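(* There is a constant $C_1>1$ and a sequence $\{\Delta_n\}_{n=1,\dots,\infty}$ of unknotted closed $C^\infty$-curves embedded in $\mathbb{R}^3$, each having length $L_n=1$ and thickness $r_n > 1/n$, with the property that for large enough $n$, any embedded disk spanning $\Delta_n$ has area $$A \ge (C_1)^{n} \ge (C_1)^{L_n/r_n} L_n^2 .$$
   Context: A closed embedded curve in $\mathbb{R}^3$ is unknotted if it is the boundary of an embedded disk in $\mathbb{R}^3$. The thickness of an embedded closed $C^2$-curve in $\mathbb{R}^3$ is the supremum of those $r>0$ such that the radius $r$ normal tubular neighborhood of the curve is embedded, i.e. such that the flat two-dimensional disks of radius $r$ centered at the points of the curve and normal to the curve at their centers are pairwise disjoint. A disk spans a closed curve if its boundary is that curve; embedded disks are understood to be piecewise-smooth embedded disks in $\mathbb{R}^3$.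
   Formalization: The thickness bound r_n > 1/n is required only for n > 2π (that is, n ≥ 7); for n ≤ 6 it is impossible, since a closed curve of length 1 has thickness at most 1/(2π) < 1/6. *)

theory Defs
  imports "HOL-Analysis.Analysis"
begin

(* Intended for open S, where "at x" and "at x within S" agree. *)
primrec Ck_on :: "nat \<Rightarrow> 'a::euclidean_space set \<Rightarrow> ('a \<Rightarrow> 'b::real_normed_vector) \<Rightarrow> bool" where
  "Ck_on 0 S f \<longleftrightarrow> continuous_on S f"
| "Ck_on (Suc k) S f \<longleftrightarrow>
     (\<forall>x\<in>S. f differentiable (at x)) \<and>
     (\<forall>v. Ck_on k S (\<lambda>x. frechet_derivative f (at x) v))"

definition smooth_on :: "'a::euclidean_space set \<Rightarrow> ('a \<Rightarrow> 'b::real_normed_vector) \<Rightarrow> bool" where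
  "smooth_on S f \<longleftrightarrow> (\<forall>k. Ck_on k S f)"

(* A closed curve is given by a 1-periodic regular parametrization on the whole real line, so that
   it closes up smoothly; the curve as a subset of space is path_image c. *)
definition smooth_closed_embedded_curve :: "(real \<Rightarrow> real^3) \<Rightarrow> bool" where
  "smooth_closed_embedded_curve c \<longleftrightarrow>
     smooth_on UNIV c \<and>
     (\<forall>t. c (t + 1) = c t) \<and>
     (\<forall>t. vector_derivative c (at t) \<noteq> 0) \<and>
     inj_on c {0..<1}"

definition curve_length :: "(real \<Rightarrow> real^3) \<Rightarrow> real" where
  "curve_length c = integral {0..1} (\<lambda>t. norm (vector_derivative c (at t)))"

definition normal_disk :: "(real \<Rightarrow> real^3) \<Rightarrow> real \<Rightarrow> real \<Rightarrow> (real^3) set" where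
  "normal_disk c r t = {x \<in> cball (c t) r. (x - c t) \<bullet> vector_derivative c (at t) = 0}"

(* For an embedded closed C^2 curve the set of admissible radii is nonempty (tubular neighbourhood
   theorem) and bounded above (two non-parallel normal planes meet), so the real supremum is the
   genuine one.  Since thickness r forces curvature at most 1/r, Fenchel's theorem gives
   2 pi r <= length; equality holds for round circles. *)
definition thickness :: "(real \<Rightarrow> real^3) \<Rightarrow> real" where
  "thickness c = Sup {r. r > 0 \<and> disjoint_family_on (normal_disk c r) {0..<1}}"

(* Every PL disk is PL homeomorphic to a square, so the square with an arbitrary triangulation
   serves as the domain of all piecewise-smooth disks. *)
abbreviation unit_square :: "(real^2) set" where
  "unit_square \<equiv> cbox 0 1"

(* On each closed simplex the map is the restriction of a smooth map, defined near the simplex,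
   whose differential is injective at every point of the simplex. *)
definition ps_embedded_disk :: "(real^2 \<Rightarrow> real^3) \<Rightarrow> bool" where
  "ps_embedded_disk f \<longleftrightarrow>
     continuous_on unit_square f \<and>
     inj_on f unit_square \<and>
     (\<exists>\<T>. triangulation \<T> \<and> \<Union>\<T> = unit_square \<and>
        (\<forall>T\<in>\<T>. \<exists>U g. open U \<and> T \<subseteq> U \<and> smooth_on U g \<and>
           (\<forall>x\<in>T. g x = f x \<and> inj (frechet_derivative g (at x)))))"

definition spans :: "(real^2 \<Rightarrow> real^3) \<Rightarrow> (real \<Rightarrow> real^3) \<Rightarrow> bool" where
  "spans f c \<longleftrightarrow> f ` frontier unit_square = path_image c"

definition unknotted :: "(real \<Rightarrow> real^3) \<Rightarrow> bool" where
  "unknotted c \<longleftrightarrow> (\<exists>f. ps_embedded_disk f \<and> spans f c)"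

(* A piecewise-smooth f need not be differentiable on the edges of the triangulation, but these
   form a null set and do not affect the integral. *)
definition disk_area :: "(real^2 \<Rightarrow> real^3) \<Rightarrow> real" where
  "disk_area f = integral unit_square
     (\<lambda>x. norm (cross3 (frechet_derivative f (at x) (axis 1 1))
                       (frechet_derivative f (at x) (axis 2 1))))"

end

theory Submission
  imports Defs "HOL-Analysis.Analysis"
begin

text \<open>The curve is a four-plat: a planar unknot with four vertical strands, into which a word of
  alternating half twists (strands 1-2, then 2-3) and, further down, its inverse are inserted.  It
  bounds the twisted image of a planar disk.  Its length is linear in the number of twists, and its
  thickness is bounded below because it is made of boundedly many local pieces up to isometry.

  Let D be any spanning disk.  A square root of a function vanishing exactly on the curve gives two
  circle-valued functions on D, one below the upper caps and one above the lower caps, whose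
  values on the boundary of D are 1 and -1 only.  In the middle slab the twists act on their
  increments by a hyperbolic matrix with eigenvalue golden^2, so a combination of the two
  closed forms is, up to an exact term, golden^(-2k) times a form with bounded coefficients.
  Interpolating between them by a height cut-off yields a 1-form on D that vanishes along the boundary
  and whose curl is at most a multiple of golden^(-2k) times the area.  Cutting D along the caps, its
  flux is a nonzero half-integer, unless D contains two disjoint paths with interlaced end points on
  its boundary.  Hence the area is at least a multiple of golden^(2k).\<close>

section \<open>Calculus of smooth maps\<close>

text \<open>Why the golden ratio: the two circle-valued functions represent classes on the double
  cover of the plane branched at the four strands, and a pair of opposite half twists lifts to this
  cover and acts on the classes by the matrix with rows (2, 1) and (1, 1). The coefficients of the
  form are bounded in space, where the strands are braided, while its boundary values are visible in
  straightened coordinates, where the rim is planar; the passage between the two supplies the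
  exponential factor. The obstacle is that D is arbitrary: its intersection with a horizontal level
  may be anything. So the flux is taken through whatever part of D hangs on one chosen cap. This
  fails only if that part reaches the other cap at the same end, and the plane topology of D
  excludes such a failure at both ends at once. As a map of the whole square D is only Lipschitz, so
  forms become functions of pairs of nearby points, the Stokes formula becomes cancellation over a
  grid, and the area enters by dominated convergence. Rescaling to length 1 costs a factor quadratic
  in n, which half of the exponent absorbs.\<close>

lemma frechet_derivative_cong_open:
  assumes "open S" "x \<in> S" "!!y. y \<in> S ==> f y = g y"
  shows "frechet_derivative f (at x) = frechet_derivative g (at x)"
proof -
  have "(f has_derivative D) (at x) \<longleftrightarrow> (g has_derivative D) (at x)" for D
    using assms by (metis has_derivative_transform_within_open)
  thus ?thesis by (simp add: frechet_derivative_def)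
qed

lemma differentiable_cong_open:
  assumes "open S" "x \<in> S" "!!y. y \<in> S ==> f y = g y" "f differentiable (at x)"
  shows "g differentiable (at x)"
  using assms by (metis differentiable_def has_derivative_transform_within_open)

lemma Ck_on_cong:
  assumes "open S" "!!x. x \<in> S ==> f x = g x" "Ck_on k S f"
  shows "Ck_on k S g"
  using assms(2,3)
proof (induction k arbitrary: f g)
  case 0
  thus ?case using continuous_on_cong[of S S f g] by simp
next
  case (Suc k)
  have "Ck_on k S (%x. frechet_derivative g (at x) v)" for v
    by (rule Suc.IH[of "%x. frechet_derivative f (at x) v"])
      (use Suc.prems frechet_derivative_cong_open[OF assms(1) _ Suc.prems(1)] in auto)
  moreover have "g differentiable (at x)" if "x \<in> S" for x
    using differentiable_cong_open[OF assms(1) that Suc.prems(1)] Suc.prems(2) that by auto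
  ultimately show ?case by simp
qed

lemma Ck_on_Suc_D: "Ck_on (Suc k) S f ==> Ck_on k S f"
proof (induction k arbitrary: f)
  case 0
  thus ?case
    by (auto intro!: continuous_at_imp_continuous_on differentiable_imp_continuous_within)
next
  case (Suc k)
  thus ?case by (metis Ck_on.simps(2))
qed

lemma Ck_on_const: "Ck_on k S (%x. c)"
proof (induction k arbitrary: c)
  case (Suc k)
  have "frechet_derivative (%x. c) (at x) v = 0" for x v
    by (simp add: frechet_derivative_const)
  thus ?case using Suc by simp
qed simp

lemma Ck_on_bounded_linear:
  assumes "bounded_linear l" "open S" "Ck_on k S f"
  shows "Ck_on k S (%x. l (f x))"
  using assms(3)
proof (induction k arbitrary: f)
  case 0
  thus ?case using assms(1) by (auto intro: bounded_linear.continuous_on)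
next
  case (Suc k)
  have der: "((%x. l (f x)) has_derivative (%v. l (frechet_derivative f (at x) v))) (at x)"
    if "x \<in> S" for x
    using Suc.prems that assms(1)
    by (auto intro: bounded_linear.has_derivative simp: frechet_derivative_works)
  have "Ck_on k S (%x. frechet_derivative (%x. l (f x)) (at x) v)" for v
    by (rule Ck_on_cong[OF assms(2) _ Suc.IH[of "%x. frechet_derivative f (at x) v"]])
      (use frechet_derivative_at[OF der] Suc.prems in \<open>auto dest: fun_cong\<close>)
  thus ?case using der by (auto simp: differentiable_def)
qed

lemma Ck_on_add:
  assumes "open S" "Ck_on k S f" "Ck_on k S g"
  shows "Ck_on k S (%x. f x + g x)"
  using assms(2,3)
proof (induction k arbitrary: f g)
  case 0
  thus ?case by (auto intro: continuous_intros)
next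
  case (Suc k)
  have der: "((%x. f x + g x) has_derivative
      (%v. frechet_derivative f (at x) v + frechet_derivative g (at x) v)) (at x)" if "x \<in> S" for x
    using Suc.prems that by (auto intro!: has_derivative_add simp: frechet_derivative_works)
  have "Ck_on k S (%x. frechet_derivative (%x. f x + g x) (at x) v)" for v
    by (rule Ck_on_cong[OF assms(1) _ Suc.IH[of "%x. frechet_derivative f (at x) v"
          "%x. frechet_derivative g (at x) v"]])
      (use frechet_derivative_at[OF der] Suc.prems in \<open>auto dest: fun_cong\<close>)
  thus ?case using der by (auto simp: differentiable_def)
qed

lemma Ck_on_scaleR:
  fixes f :: "'a::euclidean_space => real"
  assumes "open S" "Ck_on k S f" "Ck_on k S g"
  shows "Ck_on k S (%x. f x *\<^sub>R g x)"
  using assms(2,3)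
proof (induction k arbitrary: f g)
  case 0
  thus ?case by (auto intro: continuous_intros)
next
  case (Suc k)
  have der: "((%x. f x *\<^sub>R g x) has_derivative
      (%v. f x *\<^sub>R frechet_derivative g (at x) v + frechet_derivative f (at x) v *\<^sub>R g x)) (at x)"
    if "x \<in> S" for x
    using Suc.prems that by (auto intro!: has_derivative_scaleR simp: frechet_derivative_works)
  have "Ck_on k S (%x. frechet_derivative (%x. f x *\<^sub>R g x) (at x) v)" for v
    by (rule Ck_on_cong[OF assms(1) _ Ck_on_add[OF assms(1)
          Suc.IH[of f "%x. frechet_derivative g (at x) v"]
          Suc.IH[of "%x. frechet_derivative f (at x) v" g]]])
      (use frechet_derivative_at[OF der] Suc.prems Suc.prems[THEN Ck_on_Suc_D] in
        \<open>auto dest: fun_cong\<close>)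
  thus ?case using der by (auto simp: differentiable_def)
qed

text \<open>A function of one variable is carried together with the whole tower of its derivatives.
  The chain rule is then an induction on the order with the level of the tower kept arbitrary:
  differentiating \<open>G n\<close> after f only shifts n by one.\<close>

definition smooth_fun :: "real set => (real => real) => bool" where
  "smooth_fun T g \<longleftrightarrow>
     (\<exists>G::nat => real => real. G 0 = g & (\<forall>n. \<forall>x\<in>T. (G n has_real_derivative G (Suc n) x) (at x)))"

lemma Ck_on_compose_real:
  assumes g: "smooth_fun T g" and S: "open S" and f: "Ck_on k S f" "f ` S \<subseteq> T"
  shows "Ck_on k S (%x. g (f x))"
proof -
  obtain G :: "nat => real => real" where G: "G 0 = g"
    "!!n x. x \<in> T ==> (G n has_real_derivative G (Suc n) x) (at x)"
    using g unfolding smooth_fun_def by blast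
  have "Ck_on k S (%x. G n (f x))" for n
    using f(1)
  proof (induction k arbitrary: n)
    case 0
    have "continuous_on T (G n)"
      using G(2) by (meson DERIV_isCont continuous_at_imp_continuous_on)
    thus ?case using 0 f(2) by (auto intro: continuous_on_compose2)
  next
    case (Suc k)
    have der: "((%x. G n (f x)) has_derivative
        (%v. G (Suc n) (f x) *\<^sub>R frechet_derivative f (at x) v)) (at x)" if "x \<in> S" for x
    proof -
      have "(f has_derivative frechet_derivative f (at x)) (at x)"
        using Suc.prems that by (auto simp: frechet_derivative_works)
      moreover have "(G n has_derivative (*) (G (Suc n) (f x))) (at (f x))"
        using G(2)[of "f x" n] f(2) that by (auto simp: has_field_derivative_def)
      ultimately show ?thesis
        using has_derivative_compose[of f _ x UNIV "G n"] by auto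
    qed
    have "Ck_on k S (%x. frechet_derivative (%x. G n (f x)) (at x) v)" for v
      by (rule Ck_on_cong[OF S _ Ck_on_scaleR[OF S Suc.IH[of "Suc n"],
            of "%x. frechet_derivative f (at x) v"]])
        (use frechet_derivative_at[OF der] Suc.prems Suc.prems[THEN Ck_on_Suc_D] in
          \<open>auto dest: fun_cong\<close>)
    thus ?case using der by (auto simp: differentiable_def)
  qed
  from this[of 0] G(1) show ?thesis by simp
qed

lemma smooth_on_const: "smooth_on S (%x. c)"
  by (simp add: smooth_on_def Ck_on_const)

lemma smooth_on_cong:
  "open S ==> (!!x. x \<in> S ==> f x = g x) ==> smooth_on S f ==> smooth_on S g"
  by (auto simp: smooth_on_def intro: Ck_on_cong)

lemma smooth_on_linear_compose:
  "bounded_linear l ==> open S ==> smooth_on S f ==> smooth_on S (%x. l (f x))"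
  by (auto simp: smooth_on_def intro: Ck_on_bounded_linear)

lemma smooth_on_add:
  "open S ==> smooth_on S f ==> smooth_on S g ==> smooth_on S (%x. f x + g x)"
  by (auto simp: smooth_on_def intro: Ck_on_add)

lemma smooth_on_scaleR:
  fixes f :: "'a::euclidean_space => real"
  shows "open S ==> smooth_on S f ==> smooth_on S g ==> smooth_on S (%x. f x *\<^sub>R g x)"
  by (auto simp: smooth_on_def intro: Ck_on_scaleR)

lemma smooth_on_mult:
  fixes f :: "'a::euclidean_space => real"
  shows "open S ==> smooth_on S f ==> smooth_on S g ==> smooth_on S (%x. f x * g x)"
  using smooth_on_scaleR[of S f g] by simp

lemma smooth_on_uminus: "open S ==> smooth_on S f ==> smooth_on S (%x. - f x)"
  using smooth_on_linear_compose[OF bounded_linear_minus[OF bounded_linear_ident]] by blast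

lemma smooth_on_diff:
  "open S ==> smooth_on S f ==> smooth_on S g ==> smooth_on S (%x. f x - g x)"
  using smooth_on_add[OF _ _ smooth_on_uminus, of S f g] by simp

lemma smooth_on_power:
  fixes f :: "'a::euclidean_space => real"
  shows "open S ==> smooth_on S f ==> smooth_on S (%x. f x ^ n)"
  by (induction n) (auto intro: smooth_on_const smooth_on_mult)

lemma smooth_on_compose_real:
  "smooth_fun T g ==> open S ==> smooth_on S f ==> f ` S \<subseteq> T ==> smooth_on S (%x. g (f x))"
  by (auto simp: smooth_on_def intro: Ck_on_compose_real)

lemma smooth_on_ident: "smooth_on S (%x. x)"
  unfolding smooth_on_def
proof
  fix k
  show "Ck_on k S (%x. x)"
  proof (cases k)
    case (Suc m)
    have "frechet_derivative (%x::'a. x) (at x) v = v" for x v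
      using frechet_derivative_at[OF has_derivative_ident] by metis
    thus ?thesis using Suc by (simp add: Ck_on_const)
  qed simp
qed

lemma smooth_on_linear: "bounded_linear l ==> open S ==> smooth_on S l"
  using smooth_on_linear_compose[OF _ _ smooth_on_ident] by blast

lemma smooth_on_vec_nth:
  fixes f :: "'a::euclidean_space => real^'n"
  shows "open S ==> smooth_on S f ==> smooth_on S (%x. f x $ i)"
  by (rule smooth_on_linear_compose[OF bounded_linear_vec_nth])

lemma smooth_on_sum:
  "finite I ==> open S ==> (!!i. i \<in> I ==> smooth_on S (f i)) ==> smooth_on S (%x. \<Sum>i\<in>I. f i x)"
  by (induction I rule: finite_induct) (auto intro: smooth_on_const smooth_on_add)

lemma smooth_on_vector_components:
  fixes f :: "'a::euclidean_space => real^'n"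
  assumes "open S" "!!i. smooth_on S (%x. f x $ i)"
  shows "smooth_on S f"
proof -
  have "smooth_on S (%x. \<Sum>i\<in>UNIV. (f x $ i) *\<^sub>R axis i (1::real))"
    using assms by (intro smooth_on_sum smooth_on_scaleR smooth_on_const) auto
  moreover have "(\<Sum>i\<in>UNIV. (f x $ i) *\<^sub>R axis i (1::real)) = f x" for x
    using basis_expansion[of "f x"] by (simp add: scalar_mult_eq_scaleR)
  ultimately show ?thesis by simp
qed

lemma smooth_on_vector_3:
  assumes "open S" "smooth_on S f" "smooth_on S g" "smooth_on S h"
  shows "smooth_on S (%x. vector [f x, g x, h x] :: real^3)"
proof (rule smooth_on_vector_components[OF assms(1)])
  fix i :: 3
  show "smooth_on S (%x. (vector [f x, g x, h x] :: real^3) $ i)"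
    using exhaust_3[of i] assms by auto
qed

lemma smooth_on_differentiable: "smooth_on S f ==> x \<in> S ==> f differentiable (at x)"
  unfolding smooth_on_def by (metis Ck_on.simps(2))

lemma smooth_on_frechet: "smooth_on S f ==> smooth_on S (%x. frechet_derivative f (at x) v)"
  unfolding smooth_on_def by (metis Ck_on.simps(2))

lemma smooth_on_continuous: "smooth_on S f ==> continuous_on S f"
  unfolding smooth_on_def by (metis Ck_on.simps(1))

lemma smooth_on_has_vector_derivative:
  assumes "smooth_on UNIV (f :: real => 'b::real_normed_vector)"
  shows "(f has_vector_derivative vector_derivative f (at t)) (at t)"
  using smooth_on_differentiable[OF assms] by (simp add: vector_derivative_works)

lemma smooth_on_vector_derivative:
  assumes "smooth_on UNIV (f :: real => 'b::real_normed_vector)"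
  shows "smooth_on UNIV (%t. vector_derivative f (at t))"
proof -
  have "frechet_derivative f (at t) 1 = vector_derivative f (at t)" for t
    using frechet_derivative_at[of f _ t] smooth_on_has_vector_derivative[OF assms, of t]
    by (metis has_vector_derivative_def scaleR_one)
  thus ?thesis using smooth_on_frechet[OF assms, of 1] by simp
qed

lemma smooth_on_imp_smooth_fun:
  assumes "smooth_on UNIV g"
  shows "smooth_fun UNIV g"
proof -
  define G where "G n = ((%f t. vector_derivative f (at t)) ^^ n) g" for n
  have sm: "smooth_on UNIV (G n)" for n
    by (induction n) (auto simp: G_def assms intro: smooth_on_vector_derivative)
  have "(G n has_real_derivative G (Suc n) x) (at x)" for n x
    using smooth_on_has_vector_derivative[OF sm[of n], of x]
    by (simp add: G_def has_real_derivative_iff_has_vector_derivative)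
  moreover have "G 0 = g" by (simp add: G_def)
  ultimately show ?thesis unfolding smooth_fun_def by blast
qed

lemma smooth_fun_cos: "smooth_fun UNIV cos" and smooth_fun_sin: "smooth_fun UNIV sin"
proof -
  define G where "G n x = cos (x + real n * (pi/2))" for n x
  have c: "cos (x + real (Suc n) * (pi/2)) = - sin (x + real n * (pi/2))" for x n
  proof -
    have "x + real (Suc n) * (pi/2) = (x + real n * (pi/2)) + pi/2" by (simp add: field_simps)
    thus ?thesis by (simp only: cos_add cos_pi_half sin_pi_half)
  qed
  have "(G n has_real_derivative G (Suc n) x) (at x)" for n x
    unfolding G_def c by (auto intro!: derivative_eq_intros)
  moreover have "G 0 = cos" by (auto simp: G_def)
  ultimately show "smooth_fun UNIV cos" unfolding smooth_fun_def by metis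
  define H where "H n x = sin (x + real n * (pi/2))" for n x
  have s: "sin (x + real (Suc n) * (pi/2)) = cos (x + real n * (pi/2))" for x n
  proof -
    have "x + real (Suc n) * (pi/2) = (x + real n * (pi/2)) + pi/2" by (simp add: field_simps)
    thus ?thesis by (simp only: sin_add cos_pi_half sin_pi_half)
  qed
  have "(H n has_real_derivative H (Suc n) x) (at x)" for n x
    unfolding H_def s by (auto intro!: derivative_eq_intros)
  moreover have "H 0 = sin" by (auto simp: H_def)
  ultimately show "smooth_fun UNIV sin" unfolding smooth_fun_def by metis
qed

lemma smooth_fun_powr: "smooth_fun {0<..} (%x. x powr a)"
proof -
  define G where "G n x = (\<Prod>i<n. a - real i) * x powr (a - real n)" for n x
  have "(G n has_real_derivative G (Suc n) x) (at x)" if "x > 0" for n x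
    using DERIV_cmult[OF has_real_derivative_powr[OF that, of "a - real n"], of "\<Prod>i<n. a - real i"]
    unfolding G_def[abs_def] by (simp add: mult.assoc diff_diff_eq add.commute)
  moreover have "G 0 = (%x. x powr a)" by (auto simp: G_def)
  ultimately show ?thesis unfolding smooth_fun_def by (metis greaterThan_iff)
qed

lemma smooth_on_sqrt:
  assumes "open S" "smooth_on S f" "!!x. x \<in> S ==> f x > 0"
  shows "smooth_on S (%x. sqrt (f x))"
  by (rule smooth_on_cong[OF assms(1) _ smooth_on_compose_real[OF smooth_fun_powr[of "1/2"]
          assms(1,2)]]) (use assms(3) in \<open>auto simp: powr_half_sqrt less_imp_le\<close>)

lemma smooth_on_inverse:
  assumes "open S" "smooth_on S f" "!!x. x \<in> S ==> f x > (0::real)"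
  shows "smooth_on S (%x. inverse (f x))"
  by (rule smooth_on_cong[OF assms(1) _ smooth_on_compose_real[OF smooth_fun_powr[of "-1"]
          assms(1,2)]]) (use assms(3) in \<open>auto simp: powr_minus less_imp_le\<close>)

lemma smooth_on_divide:
  assumes "open S" "smooth_on S f" "smooth_on S g" "!!x. x \<in> S ==> g x > (0::real)"
  shows "smooth_on S (%x. f x / g x)"
  using smooth_on_mult[OF assms(1,2) smooth_on_inverse[OF assms(1,3,4)]]
  by (simp add: divide_inverse)

section \<open>A smooth step function\<close>

definition flat :: "real => real" where
  "flat x = (if x <= 0 then 0 else exp (- 1 / x))"

lemma poly_times_exp_minus_tendsto:
  "((%x::real. poly p x * exp (- x)) \<longlongrightarrow> 0) at_top"
proof -
  have "((%x. \<Sum>i\<le>degree p. coeff p i * (x ^ i / exp x)) \<longlongrightarrow> (\<Sum>i\<le>degree p. coeff p i * 0)) at_top"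
    by (intro tendsto_sum tendsto_mult tendsto_const tendsto_power_div_exp_0)
  moreover have "(\<Sum>i\<le>degree p. coeff p i * (x ^ i / exp x)) = poly p x * exp (- x)" for x :: real
    by (simp add: poly_altdef sum_distrib_right exp_minus divide_inverse mult.assoc)
  ultimately show ?thesis by simp
qed

lemma smooth_fun_flat: "smooth_fun UNIV flat"
proof -
  \<comment> \<open>For x > 0, differentiating q(1/x) exp(-1/x) replaces the polynomial q by t^2 (q
    - q'); this is the recursion that follows.\<close>
  define p where "p = rec_nat (1::real poly) (%n q. [:0,0,1:] * (q - pderiv q))"
  have p0: "p 0 = 1" and pS: "p (Suc n) = [:0,0,1:] * (p n - pderiv (p n))" for n
    by (auto simp: p_def)
  define G where "G n x = (if x <= 0 then 0 else poly (p n) (1/x) * exp (- 1 / x))" for n x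
  have "G 0 = flat" by (auto simp: G_def flat_def p0)
  moreover have "(G n has_real_derivative G (Suc n) x) (at x)" for n x
  proof (cases x "0::real" rule: linorder_cases)
    case less
    have "((%x. 0) has_real_derivative 0) (at x)" by simp
    hence "(G n has_real_derivative 0) (at x)"
      by (rule has_field_derivative_transform_within_open[of _ _ _ "{..<0}"]) (use less in \<open>auto simp: G_def\<close>)
    thus ?thesis using less by (simp add: G_def)
  next
    case greater
    have "((%x. poly (p n) (1/x) * exp (- 1 / x)) has_real_derivative G (Suc n) x) (at x)"
      using greater
      by (auto intro!: derivative_eq_intros DERIV_chain'[of "%x. 1/x" _ _ _ "poly (p n)"] poly_DERIV
          simp: G_def pS power2_eq_square field_simps)
    thus ?thesis
      by (rule has_field_derivative_transform_within_open[of _ _ _ "{0<..}"])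
        (use greater in \<open>auto simp: G_def\<close>)
  next
    case equal
    have R: "((%y. (G n y - G n 0) / (y - 0)) \<longlongrightarrow> 0) (at_right 0)"
    proof -
      have "filterlim (%y::real. 1 / y) at_top (at_right 0)"
        using filterlim_inverse_at_top_right by (simp add: inverse_eq_divide)
      from filterlim_compose[OF poly_times_exp_minus_tendsto[of "[:0,1:] * p n"] this]
      have "((%y. (1/y) * poly (p n) (1/y) * exp (- 1/y)) \<longlongrightarrow> 0) (at_right 0)" by simp
      moreover have "\<forall>\<^sub>F y in at_right 0. (1/y) * poly (p n) (1/y) * exp (- 1/y) =
          (G n y - G n 0) / (y - 0)"
        by (auto simp: eventually_at_right_field G_def intro: exI[of _ 1])
      ultimately show ?thesis by (rule Lim_transform_eventually)
    qed
    have L: "((%y. (G n y - G n 0) / (y - 0)) \<longlongrightarrow> 0) (at_left 0)"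
      by (rule Lim_transform_eventually[OF tendsto_const])
        (auto simp: eventually_at_left_field G_def intro: exI[of _ "-1"])
    have "G (Suc n) 0 = 0" by (simp add: G_def)
    thus ?thesis
      using equal filterlim_split_at[OF L R] by (simp add: has_field_derivative_iff)
  qed
  ultimately show ?thesis unfolding smooth_fun_def by blast
qed

lemma flat_pos: "x > 0 ==> flat x > 0" and flat_nonneg: "flat x >= 0"
  by (auto simp: flat_def)

lemma flat_denom_pos: "flat x + flat (1 - x) > 0"
  using flat_pos[of x] flat_pos[of "1-x"] flat_nonneg[of x] flat_nonneg[of "1-x"] by linarith

definition st :: "real => real" where
  "st x = flat x / (flat x + flat (1 - x))"

lemma smooth_st: "smooth_on UNIV st"
proof -
  have f: "smooth_on UNIV (%x. flat (g x))" if "smooth_on UNIV g" for g :: "real => real"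
    using smooth_on_compose_real[OF smooth_fun_flat _ that] by auto
  show ?thesis unfolding st_def[abs_def]
    by (intro smooth_on_divide smooth_on_add f smooth_on_diff smooth_on_const smooth_on_ident
        flat_denom_pos open_UNIV)
qed

lemma smooth_fun_st: "smooth_fun UNIV st"
  by (rule smooth_on_imp_smooth_fun[OF smooth_st])

lemma smooth_on_st: "open S ==> smooth_on S f ==> smooth_on S (%x. st (f x))"
  by (rule smooth_on_compose_real[OF smooth_fun_st]) auto

lemma smooth_on_cos: "open S ==> smooth_on S f ==> smooth_on S (%x. cos (f x :: real))"
  and smooth_on_sin: "open S ==> smooth_on S f ==> smooth_on S (%x. sin (f x :: real))"
  by (auto intro!: smooth_on_compose_real[OF smooth_fun_cos] smooth_on_compose_real[OF smooth_fun_sin])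

lemmas smooth_intros = smooth_on_const smooth_on_ident smooth_on_add smooth_on_diff smooth_on_uminus
  smooth_on_mult smooth_on_scaleR smooth_on_power smooth_on_st smooth_on_cos smooth_on_sin
  smooth_on_vector_3 smooth_on_vec_nth

lemma st_0: "x <= 0 ==> st x = 0" and st_1: "x >= 1 ==> st x = 1"
  using flat_pos[of "x"] by (auto simp: st_def flat_def)

lemma st_sym: "st (1 - x) = 1 - st x"
  using flat_denom_pos[of x] by (simp add: st_def field_simps)

definition st' :: "real => real" where "st' x = vector_derivative st (at x)"
definition st'' :: "real => real" where "st'' x = vector_derivative st' (at x)"

lemma smooth_st': "smooth_on UNIV st'"
  unfolding st'_def[abs_def] by (rule smooth_on_vector_derivative[OF smooth_st])

lemma st_deriv: "(st has_real_derivative st' x) (at x)"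
  using smooth_on_has_vector_derivative[OF smooth_st]
  by (simp add: st'_def has_real_derivative_iff_has_vector_derivative)

lemma st'_deriv: "(st' has_real_derivative st'' x) (at x)"
  using smooth_on_has_vector_derivative[OF smooth_st']
  by (simp add: st''_def has_real_derivative_iff_has_vector_derivative)

text \<open>Strictness matters at the crest of the planar band, where \<open>X\<close> vanishes and
  only its derivative keeps the bend an immersion.\<close>

lemma st'_pos:
  assumes "0 < x" "x < 1"
  shows "st' x > 0"
proof -
  have "((%x. exp (- 1 / x) / (exp (- 1 / x) + exp (- 1 / (1 - x)))) has_real_derivative
     ((exp (- 1 / x) / x^2) * (exp (- 1 / x) + exp (- 1 / (1 - x)))
      - exp (- 1 / x) * (exp (- 1 / x) / x^2 - exp (- 1 / (1 - x)) / (1 - x)^2))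
      / (exp (- 1 / x) + exp (- 1 / (1 - x)))^2) (at x)" (is "(?f has_real_derivative ?d) _")
  proof -
    have "exp (- 1 / x) + exp (- 1 / (1 - x)) ~= 0"
      by (metis add_pos_pos exp_gt_zero less_irrefl)
    thus ?thesis using assms
      by (auto intro!: derivative_eq_intros simp: power2_eq_square)
  qed
  hence "(st has_real_derivative ?d) (at x)"
    by (rule has_field_derivative_transform_within_open[of _ _ _ "{0<..<1}"])
      (use assms in \<open>auto simp: st_def flat_def\<close>)
  hence "st' x = ?d" using st_deriv DERIV_unique by blast
  also have "?d = (exp (- 1 / x) * exp (- 1 / (1 - x)) * (1 / x^2 + 1 / (1 - x)^2))
      / (exp (- 1 / x) + exp (- 1 / (1 - x)))^2"
    by (simp add: algebra_simps)
  also have "\<dots> > 0"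
  proof (intro divide_pos_pos mult_pos_pos add_pos_pos zero_less_power)
  qed (use assms in auto)
  finally show ?thesis .
qed

lemma st'_outside: assumes "x <= 0 | x >= 1" shows "st' x = 0"
proof -
  have 1: "st' x = 0" if "x < 0 | x > 1" for x
  proof -
    have "((%_. if x < 0 then 0 else 1) has_real_derivative 0) (at x)" by simp
    hence "(st has_real_derivative 0) (at x)"
      by (rule has_field_derivative_transform_within_open[of _ _ _ "if x < 0 then {..<0} else {1<..}"])
        (use that in \<open>auto simp: st_0 st_1\<close>)
    thus ?thesis using st_deriv DERIV_unique by blast
  qed
  have cont: "isCont st' y" for y using st'_deriv DERIV_isCont by blast
  have "(st' \<longlongrightarrow> st' 0) (at_left 0)" "(st' \<longlongrightarrow> st' 1) (at_right 1)"
    using cont by (auto simp: isCont_def intro: tendsto_within_subset)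
  moreover have "(st' \<longlongrightarrow> 0) (at_left 0)" "(st' \<longlongrightarrow> 0) (at_right 1)"
    by (rule Lim_transform_eventually[OF tendsto_const],
        auto simp: eventually_at_left_field eventually_at_right_field 1 intro: exI[of _ "-1"] exI[of _ 2])+
  ultimately have "st' 0 = 0" "st' 1 = 0"
    using tendsto_unique trivial_limit_at_left_real trivial_limit_at_right_real by blast+
  thus ?thesis using 1 assms by (metis less_eq_real_def)
qed

lemma st'_nonneg: "st' x >= 0"
  using st'_pos[of x] st'_outside[of x] by fastforce

lemma st_mono: "x <= y ==> st x <= st y"
  using DERIV_nonneg_imp_nondecreasing[of x y st] st_deriv st'_nonneg by blast

lemma st_range: "0 <= st x" "st x <= 1"
  using st_mono[of "min x 0" x] st_mono[of x "max x 1"] st_0[of "min x 0"] st_1[of "max x 1"] by auto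

lemma st_strict: "0 <= x ==> x < y ==> y <= 1 ==> st x < st y"
  by (rule DERIV_pos_imp_increasing_open[of x y st])
    (use st_deriv st'_pos in \<open>force intro: DERIV_isCont continuous_at_imp_continuous_on\<close>)+

lemma st_bounds:
  obtains M where "M >= 1" "!!x. \<bar>st' x\<bar> <= M" "!!x. \<bar>st'' x\<bar> <= M"
proof -
  have c: "continuous_on {0..1} st'" "continuous_on {0..1} st''"
    using smooth_on_continuous[OF smooth_st'] smooth_on_continuous[OF smooth_on_vector_derivative[OF smooth_st']]
    by (auto simp: st''_def[abs_def] intro: continuous_on_subset)
  hence "bounded (st' ` {0..1})" "bounded (st'' ` {0..1})"
    by (auto intro: compact_imp_bounded compact_continuous_image)
  then obtain a b where ab: "!!x. x \<in> {0..1} ==> \<bar>st' x\<bar> <= a" "!!x. x \<in> {0..1} ==> \<bar>st'' x\<bar> <= b"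
    unfolding bounded_iff by (metis imageI real_norm_def)
  have "st'' x = 0" if "x < 0 | x > 1" for x
  proof -
    have "((%_. 0) has_real_derivative 0) (at x)" by simp
    hence "(st' has_real_derivative 0) (at x)"
      by (rule has_field_derivative_transform_within_open[of _ _ _ "if x < 0 then {..<0} else {1<..}"])
        (use that in \<open>auto simp: st'_outside\<close>)
    thus ?thesis using st'_deriv DERIV_unique by blast
  qed
  hence "\<bar>st' x\<bar> <= max 1 (max a b)" "\<bar>st'' x\<bar> <= max 1 (max a b)" for x
    using ab[of x] st'_outside[of x] by (cases "x \<in> {0..1}"; force)+
  thus ?thesis using that by (metis max.cobounded1)
qed

text \<open>A smooth odd stand-in for the sign function. Being exactly constant outside (-1, 1), it
  leaves the strands straight and merely translates the caps when it is used to bend the band and to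
  stretch heights.\<close>

definition X :: "real => real" where "X u = 2 * st ((u + 1) / 2) - 1"

lemma X_odd: "X (- u) = - X u"
  using st_sym[of "(u+1)/2"] by (simp add: X_def field_simps)

lemma X_0 [simp]: "X 0 = 0" using X_odd[of 0] by simp

lemma X_ge: "u >= 1 ==> X u = 1" and X_le: "u <= - 1 ==> X u = - 1"
  by (auto simp: X_def st_0 st_1)

lemma X_mono: "u <= v ==> X u <= X v"
  by (auto simp: X_def intro: st_mono)

lemma X_strict: "- 1 <= u ==> u < v ==> v <= 1 ==> X u < X v"
  by (auto simp: X_def intro: st_strict)

lemma X_range: "- 1 <= X u" "X u <= 1"
  using st_range[of "(u+1)/2"] by (auto simp: X_def)

lemma X_pos: "u > 0 ==> X u > 0"
  using X_strict[of 0 "min u 1"] X_mono[of "min u 1" u] by auto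

lemma X_neg: "u < 0 ==> X u < 0" using X_pos[of "-u"] by (simp add: X_odd)

lemma X_deriv: "(X has_real_derivative st' ((u + 1) / 2)) (at u)"
  unfolding X_def[abs_def]
  by (rule derivative_eq_intros DERIV_chain2[OF st_deriv] refl | simp)+

lemma smooth_on_X: "open S ==> smooth_on S f ==> smooth_on S (%x. X (f x))"
  unfolding X_def divide_inverse
  by (intro smooth_intros) auto

lemma continuous_X: "continuous_on UNIV X"
  using X_deriv by (meson DERIV_isCont continuous_at_imp_continuous_on)

section \<open>Discrete Stokes formula on a grid\<close>

type_synonym gpt = "nat \<times> nat"

fun cedges :: "gpt => (gpt \<times> gpt) set" where
  "cedges (i, j) = {((i, j), (Suc i, j)), ((Suc i, j), (Suc i, Suc j)),
                    ((Suc i, Suc j), (i, Suc j)), ((i, Suc j), (i, j))}"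

lemma finite_cedges [simp]: "finite (cedges c)" by (cases c) simp

lemma cedges_disjoint: "c ~= c' ==> cedges c Int cedges c' = {}"
  by (cases c; cases c') auto

text \<open>Edges are oriented pairs and each cell lists its four edges counterclockwise, so an edge
  shared by two cells appears once in each direction.\<close>

definition bdry :: "gpt set => (gpt \<times> gpt) set" where
  "bdry W = {e \<in> \<Union>(cedges ` W). prod.swap e \<notin> \<Union>(cedges ` W)}"

lemma sum_cells_eq_sum_bdry:
  fixes Om :: "gpt \<times> gpt => real"
  assumes W: "finite W" and anti: "!!e. e \<in> \<Union>(cedges ` W) ==> Om (prod.swap e) = - Om e"
  shows "(\<Sum>c\<in>W. \<Sum>e\<in>cedges c. Om e) = (\<Sum>e\<in>bdry W. Om e)"
proof -
  define U where "U = \<Union>(cedges ` W)"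
  define I where "I = {e \<in> U. prod.swap e \<in> U}"
  have fU: "finite U" using W by (auto simp: U_def)
  have "(\<Sum>c\<in>W. \<Sum>e\<in>cedges c. Om e) = sum Om U"
    unfolding U_def using W cedges_disjoint by (intro sum.UNION_disjoint[symmetric]) auto
  also have "U = I \<union> bdry W" by (auto simp: I_def bdry_def U_def)
  also have "sum Om (I \<union> bdry W) = sum Om I + sum Om (bdry W)"
    by (intro sum.union_disjoint finite_subset[OF _ fU]) (auto simp: I_def bdry_def U_def)
  also have "sum Om I = 0"
  proof -
    have "sum Om I = sum (%e. Om (prod.swap e)) I"
      by (rule sum.reindex_bij_witness[of _ prod.swap prod.swap]) (auto simp: I_def)
    also have "\<dots> = - sum Om I"
      by (auto simp: I_def anti[folded U_def] sum_negf intro: sum.cong)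
    finally show ?thesis by simp
  qed
  finally show ?thesis by simp
qed

definition grid :: "nat => gpt set" where "grid n = {..<n} \<times> {..<n}"

lemma finite_grid [simp]: "finite (grid n)" by (simp add: grid_def)

lemma bdry_grid:
  "e \<in> bdry (grid n) \<longleftrightarrow> (\<exists>i<n. e = ((i, 0), (Suc i, 0)) | e = ((n, i), (n, Suc i)) \<or>
     e = ((Suc i, n), (i, n)) | e = ((0, Suc i), (0, i)))"
  (is "?L \<longleftrightarrow> ?R")
proof
  assume ?L
  then obtain c where c: "c \<in> grid n" "e \<in> cedges c"
    and no: "!!c'. c' \<in> grid n ==> prod.swap e \<notin> cedges c'"
    by (auto simp: bdry_def)
  obtain i j where [simp]: "c = (i, j)" by fastforce
  have ij: "i < n" "j < n" using c by (auto simp: grid_def)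
  consider "e = ((i, j), (Suc i, j))" | "e = ((Suc i, j), (Suc i, Suc j))"
    | "e = ((Suc i, Suc j), (i, Suc j))" | "e = ((i, Suc j), (i, j))"
    using c by auto
  thus ?R
  proof cases
    case 1
    hence "j = 0" using no[of "(i, j - 1)"] ij by (cases j) (auto simp: grid_def)
    thus ?thesis using 1 ij by auto
  next
    case 2
    hence "Suc i = n" using no[of "(Suc i, j)"] ij by (cases "Suc i < n") (auto simp: grid_def)
    thus ?thesis using 2 ij by auto
  next
    case 3
    hence "Suc j = n" using no[of "(i, Suc j)"] ij by (cases "Suc j < n") (auto simp: grid_def)
    thus ?thesis using 3 ij by auto
  next
    case 4
    hence "i = 0" using no[of "(i - 1, j)"] ij by (cases i) (auto simp: grid_def)
    thus ?thesis using 4 ij by auto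
  qed
next
  assume ?R
  then obtain i where i: "i < n" and "e = ((i, 0), (Suc i, 0)) | e = ((n, i), (n, Suc i)) \<or>
     e = ((Suc i, n), (i, n)) | e = ((0, Suc i), (0, i))" by blast
  moreover have "n > 0" using i by simp
  hence "(i, 0) \<in> grid n" "(n - 1, i) \<in> grid n" "(i, n - 1) \<in> grid n" "(0, i) \<in> grid n"
    "Suc (n - 1) = n" using i by (auto simp: grid_def)
  ultimately have "\<exists>c\<in>grid n. e \<in> cedges c"
    by (metis cedges.simps insertI1 insertI2)
  moreover have "prod.swap e \<notin> cedges c" if "c \<in> grid n" for c
    using that calculation i \<open>e = _ | _\<close> by (cases c) (auto simp: grid_def)
  ultimately show ?L by (auto simp: bdry_def)
qed

text \<open>Outside B the form is \<open>a\<close> times the increment of \<open>nu\<close> up to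
  integers; on B it vanishes, although \<open>nu\<close> still jumps by one half at the single edge
  \<open>e0\<close>. The increments of \<open>nu\<close> cancel along the cycle
  \<open>bdry W\<close>, so those outside B add up to plus or minus one half, and the total is
  \<open>a\<close> times a number at distance at least one half from 0.\<close>

lemma half_integer_flux:
  fixes Om :: "gpt \<times> gpt => real" and nu :: "gpt => real"
  assumes W: "finite W" and anti: "!!e. e \<in> \<Union>(cedges ` W) ==> Om (prod.swap e) = - Om e"
    and int: "!!e. e \<in> bdry W - B ==> \<exists>k::int. Om e = a * (nu (snd e) - nu (fst e) + k)"
    and bd: "!!e. e \<in> bdry W Int B ==> Om e = 0"
    and jump: "e0 \<in> bdry W Int B" "\<bar>nu (snd e0) - nu (fst e0)\<bar> = 1/2"
    and uniq: "!!e. e \<in> bdry W Int B ==> nu (snd e) ~= nu (fst e) ==> e = e0"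
  shows "\<bar>a\<bar> / 2 <= (\<Sum>c\<in>W. \<bar>\<Sum>e\<in>cedges c. Om e\<bar>)"
proof -
  define dn where "dn e = nu (snd e) - nu (fst e)" for e :: "gpt \<times> gpt"
  have fin: "finite (bdry W)" using W by (auto simp: bdry_def)
  from int obtain k :: "gpt \<times> gpt => int"
    where k: "!!e. e \<in> bdry W - B ==> Om e = a * (dn e + k e)"
    unfolding dn_def by metis
  have "(\<Sum>e\<in>bdry W. dn e) = (\<Sum>c\<in>W. \<Sum>e\<in>cedges c. dn e)"
    by (rule sum_cells_eq_sum_bdry[symmetric, OF W]) (auto simp: dn_def)
  also have "\<dots> = 0"
  proof (rule sum.neutral, rule)
    fix c show "(\<Sum>e\<in>cedges c. dn e) = 0" by (cases c) (simp add: dn_def)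
  qed
  finally have z: "(\<Sum>e\<in>bdry W. dn e) = 0" by simp
  have spl: "(\<Sum>e\<in>bdry W. F e) = (\<Sum>e\<in>bdry W - B. F e) + (\<Sum>e\<in>bdry W Int B. F e)" for F :: "_ => real"
    using sum.Int_Diff[OF fin, of F B] by simp
  have "(\<Sum>e\<in>bdry W Int B. dn e) = (\<Sum>e\<in>{e0}. dn e)"
  proof (rule sum.mono_neutral_right)
    show "\<forall>i\<in>bdry W Int B - {e0}. dn i = 0" unfolding dn_def using uniq by fastforce
  qed (use fin jump(1) in auto)
  hence d0: "(\<Sum>e\<in>bdry W - B. dn e) = - dn e0" using z spl[of dn] by simp
  have "(\<Sum>e\<in>bdry W. Om e) = (\<Sum>e\<in>bdry W - B. a * (dn e + k e))"
    unfolding spl[of Om] using bd k by simp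
  also have "\<dots> = a * ((\<Sum>e\<in>bdry W - B. dn e) + of_int (\<Sum>e\<in>bdry W - B. k e))"
    by (simp add: sum_distrib_left sum.distrib distrib_left)
  finally have "(\<Sum>e\<in>bdry W. Om e) = a * (of_int (\<Sum>e\<in>bdry W - B. k e) - dn e0)"
    using d0 by simp
  hence "(\<Sum>c\<in>W. \<Sum>e\<in>cedges c. Om e) = a * (of_int (\<Sum>e\<in>bdry W - B. k e) - dn e0)"
    by (subst sum_cells_eq_sum_bdry[OF W]) (use anti in blast)+
  moreover have "\<bar>of_int m - dn e0\<bar> >= 1/2" for m :: int
  proof -
    have "dn e0 = 1/2 | dn e0 = - 1/2" using jump(2) by (auto simp: dn_def abs_if split: if_splits)
    moreover have "real_of_int m <= 0 | real_of_int m >= 1" by (cases "m <= 0") auto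
    moreover have "real_of_int m <= -1 | real_of_int m >= 0"
    proof (cases "m >= 0")
      case False
      hence "real_of_int m <= real_of_int (- 1)" by (simp only: of_int_le_iff)
      thus ?thesis by simp
    qed auto
    ultimately show ?thesis by linarith
  qed
  ultimately have "\<bar>\<Sum>c\<in>W. \<Sum>e\<in>cedges c. Om e\<bar> >= \<bar>a\<bar> * (1/2)"
    by (metis abs_ge_zero abs_mult mult_left_mono)
  also have "\<bar>\<Sum>c\<in>W. \<Sum>e\<in>cedges c. Om e\<bar> <= (\<Sum>c\<in>W. \<bar>\<Sum>e\<in>cedges c. Om e\<bar>)" by (rule sum_abs)
  finally show ?thesis by simp
qed

text \<open>The increment of a circle-valued function, measured in full turns. The principal
  argument gives it a value for every pair; it behaves like a cochain for nearby points.\<close>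

definition inc :: "('a => complex) => 'a => 'a => real" where
  "inc e v v' = Arg (e v' / e v) / (2 * pi)"

lemma inc_mod:
  fixes s s' :: real
  assumes "e v = exp (2 * pi * \<i> * of_real s)" "e v' = exp (2 * pi * \<i> * of_real s')"
  shows "\<exists>k::int. inc e v v' = s' - s + k"
proof -
  have "e v' / e v = exp (\<i> * of_real (2 * pi * (s' - s)))"
    by (simp add: assms exp_diff[symmetric] algebra_simps)
  moreover have "e v' / e v ~= 0" by (simp add: assms)
  ultimately have "exp (\<i> * of_real (Arg (e v' / e v))) = exp (\<i> * of_real (2 * pi * (s' - s)))"
    using Arg_eq[of "e v' / e v"] by (simp add: norm_divide assms)
  then obtain k :: int where "\<i> * complex_of_real (Arg (e v' / e v)) =
      \<i> * of_real (2 * pi * (s' - s)) + of_real (2 * of_int k * pi) * \<i>"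
    unfolding exp_eq by (auto simp: mult_ac)
  hence "\<i> * complex_of_real (Arg (e v' / e v)) = \<i> * of_real (2 * pi * (s' - s) + 2 * of_int k * pi)"
    by (simp add: algebra_simps)
  hence "Arg (e v' / e v) = 2 * pi * (s' - s) + 2 * of_int k * pi"
    by (metis mult_left_cancel complex_i_not_zero of_real_eq_iff)
  hence "inc e v v' = s' - s + k" by (simp add: inc_def field_simps)
  thus ?thesis by blast
qed

section \<open>Vertices, cells and boundary edges of the square grid\<close>

definition vtx :: "nat => gpt => real^2" where
  "vtx n p = vector [real (fst p) / real n, real (snd p) / real n]"

lemma vtx_nth [simp]: "vtx n p $ 1 = real (fst p) / real n" "vtx n p $ 2 = real (snd p) / real n"
  by (auto simp: vtx_def)

lemma mem_unit_square: "q \<in> unit_square \<longleftrightarrow> 0 <= q$1 & q$1 <= 1 & 0 <= q$2 & q$2 <= 1"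
  by (auto simp: mem_box_cart forall_2)

lemma mem_frontier_square:
  "q \<in> frontier unit_square \<longleftrightarrow> q \<in> unit_square & (q$1 = 0 | q$1 = 1 | q$2 = 0 | q$2 = 1)"
  unfolding frontier_cbox by (auto simp: mem_box_cart forall_2)

definition celbox :: "nat => gpt => (real^2) set" where
  "celbox n c = cbox (vtx n c) (vtx n (Suc (fst c), Suc (snd c)))"

lemma celbox_subset: "c \<in> grid n ==> celbox n c \<subseteq> unit_square"
proof
  fix q assume c: "c \<in> grid n" and q: "q \<in> celbox n c"
  have n: "real n > 0" "real (Suc (fst c)) / n <= 1" "real (Suc (snd c)) / n <= 1"
    using c by (auto simp: grid_def)
  have "0 <= real (fst c) / n" "0 <= real (snd c) / n" by auto
  moreover have "real (fst c) / n <= q$1" "q$1 <= real (Suc (fst c)) / n"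
    "real (snd c) / n <= q$2" "q$2 <= real (Suc (snd c)) / n"
    using q by (auto simp: celbox_def mem_box_cart forall_2)
  ultimately show "q \<in> unit_square" unfolding mem_unit_square using n by (intro conjI) linarith+
qed

lemma celbox_dist:
  assumes "x \<in> celbox n c" "y \<in> celbox n c" "n > 0"
  shows "dist x y <= 2 / n"
proof -
  have "dist x y <= (\<Sum>i\<in>UNIV. \<bar>(x - y) $ i\<bar>)" unfolding dist_norm by (rule norm_le_l1_cart)
  also have "\<dots> = \<bar>x$1 - y$1\<bar> + \<bar>x$2 - y$2\<bar>" by (simp add: sum_2)
  also have "\<dots> <= 1/n + 1/n"
    using assms by (intro add_mono) (auto simp: celbox_def mem_box_cart forall_2 field_simps abs_if)
  finally show ?thesis by simp
qed

lemma cedges_celbox: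
  assumes "e \<in> cedges c" "n > 0"
  shows "vtx n (fst e) \<in> celbox n c" "vtx n (snd e) \<in> celbox n c"
  using assms by (cases c; auto simp: celbox_def mem_box_cart forall_2 divide_right_mono)+

lemma cedges_grid_vertex:
  "e \<in> cedges c ==> c \<in> grid n ==> n > 0 ==> vtx n (fst e) \<in> unit_square & vtx n (snd e) \<in> unit_square"
  using cedges_celbox celbox_subset by blast

lemma closed_segment_horizontal:
  fixes a b q :: "real^2"
  assumes "a$2 = b$2"
  shows "q \<in> closed_segment a b \<longleftrightarrow> q$2 = a$2 & q$1 \<in> closed_segment (a$1) (b$1)"
  using assms by (auto simp: in_segment vec_eq_iff forall_2 algebra_simps)

lemma closed_segment_vertical:
  fixes a b q :: "real^2"
  assumes "a$1 = b$1"
  shows "q \<in> closed_segment a b \<longleftrightarrow> q$1 = a$1 & q$2 \<in> closed_segment (a$2) (b$2)"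
  using assms by (auto simp: in_segment vec_eq_iff forall_2 algebra_simps)

lemma bdry_segment_frontier:
  assumes "e \<in> bdry (grid n)" "n > 0"
  shows "closed_segment (vtx n (fst e)) (vtx n (snd e)) \<subseteq> frontier unit_square"
proof -
  obtain c where c: "c \<in> grid n" "e \<in> cedges c" using assms by (auto simp: bdry_def)
  have "closed_segment (vtx n (fst e)) (vtx n (snd e)) \<subseteq> unit_square"
    using cedges_grid_vertex[OF c(2,1) assms(2)] by (meson convex_box(1) convex_contains_segment)
  moreover have "q$1 = 0 | q$1 = 1 | q$2 = 0 | q$2 = 1"
    if "q \<in> closed_segment (vtx n (fst e)) (vtx n (snd e))" for q
    using assms that unfolding bdry_grid
    by (auto simp: closed_segment_horizontal closed_segment_vertical)
  ultimately show ?thesis unfolding mem_frontier_square by (auto simp: subset_iff mem_frontier_square)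
qed

lemma nat_floor_grid:
  assumes "0 <= x" "x <= 1" "n > 0"
  obtains i where "i < n" "real i / n <= x" "x <= real (Suc i) / n"
proof (cases "x = 1")
  case True
  show ?thesis by (rule that[of "n - 1"]) (use assms(3) True in simp_all)
next
  case False
  let ?i = "nat \<lfloor>real n * x\<rfloor>"
  have lt: "real n * x < real n" using False assms by (cases "x < 1") auto
  have "0 <= \<lfloor>real n * x\<rfloor>" using assms by simp
  hence eq: "real ?i = real_of_int \<lfloor>real n * x\<rfloor>" by simp
  have i: "real ?i <= real n * x" "real n * x <= real (Suc ?i)"
    unfolding of_nat_Suc eq by linarith+
  hence "real ?i < real n" using lt by linarith
  hence "?i < n" by (simp only: of_nat_less_iff)
  moreover have "real ?i / n <= x" "x <= real (Suc ?i) / n"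
    using i assms(3) by (simp_all only: pos_divide_le_eq pos_le_divide_eq of_nat_0_less_iff mult.commute[of x])
  ultimately show ?thesis by (rule that)
qed

lemma frontier_covered:
  assumes q: "q \<in> frontier unit_square" and n: "n > 0"
  obtains e where "e \<in> bdry (grid n)" "q \<in> closed_segment (vtx n (fst e)) (vtx n (snd e))"
proof -
  have sq: "0 <= q$1" "q$1 <= 1" "0 <= q$2" "q$2 <= 1" using q unfolding mem_frontier_square mem_unit_square by auto
  obtain i where i: "i < n" "real i / n <= q$1" "q$1 <= real (Suc i) / n"
    using nat_floor_grid[OF sq(1,2) n] by blast
  obtain j where j: "j < n" "real j / n <= q$2" "q$2 <= real (Suc j) / n"
    using nat_floor_grid[OF sq(3,4) n] by blast
  have le: "real k / n <= real (Suc k) / n" for k by (simp add: divide_right_mono)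
  consider "q$2 = 0" | "q$1 = 1" | "q$2 = 1" | "q$1 = 0"
    using q unfolding mem_frontier_square by auto
  thus ?thesis
  proof cases
    case 1
    thus ?thesis using i le[of i] n
      by (intro that[of "((i, 0), (Suc i, 0))"])
        (auto simp: bdry_grid closed_segment_horizontal closed_segment_eq_real_ivl)
  next
    case 2
    thus ?thesis using j le[of j] n
      by (intro that[of "((n, j), (n, Suc j))"])
        (auto simp: bdry_grid closed_segment_vertical closed_segment_eq_real_ivl)
  next
    case 3
    thus ?thesis using i le[of i] n
      by (intro that[of "((Suc i, n), (i, n))"])
        (auto simp: bdry_grid closed_segment_horizontal closed_segment_eq_real_ivl)
  next
    case 4
    thus ?thesis using j le[of j] n
      by (intro that[of "((0, Suc j), (0, j))"])
        (auto simp: bdry_grid closed_segment_vertical closed_segment_eq_real_ivl)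
  qed
qed

lemma grid_cell_unique:
  assumes n: "(n::nat) > 0" and "real i / n <= x" "x <= real (Suc i) / n" "real k / n <= x" "x <= real (Suc k) / n"
    and nv: "!!m. m <= n ==> x ~= real m / n" and "i < n" "k < n"
  shows "i = k"
proof -
  have "x ~= real i / n" "x ~= real k / n"
    by (rule nv, use assms(7,8) in linarith)+
  hence "real i / n < real (Suc k) / n" "real k / n < real (Suc i) / n"
    using assms(2-5) by (metis dual_order.strict_trans1 order_le_less)+
  hence "real i < real (Suc k)" "real k < real (Suc i)"
    using n by (metis divide_right_mono not_less of_nat_0_le_iff)+
  thus ?thesis by linarith
qed

lemma bdry_edge_unique:
  assumes n: "n > 0" and e: "e \<in> bdry (grid n)" "q \<in> closed_segment (vtx n (fst e)) (vtx n (snd e))"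
    and e': "e' \<in> bdry (grid n)" "q \<in> closed_segment (vtx n (fst e')) (vtx n (snd e'))"
    and nv: "!!p. fst p <= n ==> snd p <= n ==> q ~= vtx n p"
  shows "e = e'"
proof -
  have form: "\<exists>i<n. (e = ((i, 0), (Suc i, 0)) & q$2 = 0 & real i / n <= q$1 & q$1 <= real (Suc i) / n) \<or>
     (e = ((n, i), (n, Suc i)) & q$1 = 1 & real i / n <= q$2 & q$2 <= real (Suc i) / n) \<or>
     (e = ((Suc i, n), (i, n)) & q$2 = 1 & real i / n <= q$1 & q$1 <= real (Suc i) / n) \<or>
     (e = ((0, Suc i), (0, i)) & q$1 = 0 & real i / n <= q$2 & q$2 <= real (Suc i) / n)"
    if "e \<in> bdry (grid n)" "q \<in> closed_segment (vtx n (fst e)) (vtx n (snd e))" for e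
  proof -
    have le: "real k / n <= (1 + real k) / n" "\<not> (1 + real k) / n <= real k / n" for k
      using n by (auto simp: divide_right_mono divide_le_cancel)
    from that(1) obtain i where i: "i < n" and
      "e = ((i, 0), (Suc i, 0)) | e = ((n, i), (n, Suc i)) | e = ((Suc i, n), (i, n)) | e = ((0, Suc i), (0, i))"
      unfolding bdry_grid by blast
    then consider "e = ((i, 0), (Suc i, 0))" | "e = ((n, i), (n, Suc i))" | "e = ((Suc i, n), (i, n))"
      | "e = ((0, Suc i), (0, i))" by blast
    thus ?thesis
    proof cases
      case 1
      show ?thesis using that(2) i n unfolding 1
        by (intro exI[of _ i]) (simp add: closed_segment_horizontal closed_segment_eq_real_ivl le)
    next
      case 2
      show ?thesis using that(2) i n unfolding 2
        by (intro exI[of _ i]) (simp add: closed_segment_vertical closed_segment_eq_real_ivl le)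
    next
      case 3
      show ?thesis using that(2) i n unfolding 3
        by (intro exI[of _ i]) (simp add: closed_segment_horizontal closed_segment_eq_real_ivl le)
    next
      case 4
      show ?thesis using that(2) i n unfolding 4
        by (intro exI[of _ i]) (simp add: closed_segment_vertical closed_segment_eq_real_ivl le)
    qed
  qed
  have nvq: "\<not> (q$1 = real a / n & q$2 = real b / n)" if "a <= n" "b <= n" for a b
    using nv[of "(a, b)"] that by (simp add: vec_eq_iff forall_2)
  have c1: "q$2 = 0 ==> m <= n ==> q$1 ~= real m / n" "q$2 = 1 ==> m <= n ==> q$1 ~= real m / n"
    "q$1 = 0 ==> m <= n ==> q$2 ~= real m / n" "q$1 = 1 ==> m <= n ==> q$2 ~= real m / n" for m
    subgoal using nvq[of m 0] by simp
    subgoal using nvq[of m n] n by simp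
    subgoal using nvq[of 0 m] by simp
    subgoal using nvq[of n m] n by simp
    done
  have corner: "\<not> ((q$1 = 0 | q$1 = 1) & (q$2 = 0 | q$2 = 1))"
    using nvq[of 0 0, simplified] nvq[of 0 n, simplified] nvq[of n 0, simplified] nvq[of n n, simplified] n
    by simp blast
  obtain i where i: "i < n" and fi: "(e = ((i, 0), (Suc i, 0)) & q$2 = 0 & real i / n <= q$1 & q$1 <= real (Suc i) / n) \<or>
     (e = ((n, i), (n, Suc i)) & q$1 = 1 & real i / n <= q$2 & q$2 <= real (Suc i) / n) \<or>
     (e = ((Suc i, n), (i, n)) & q$2 = 1 & real i / n <= q$1 & q$1 <= real (Suc i) / n) \<or>
     (e = ((0, Suc i), (0, i)) & q$1 = 0 & real i / n <= q$2 & q$2 <= real (Suc i) / n)"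
    using form[OF e] by blast
  obtain k where k: "k < n" and fk: "(e' = ((k, 0), (Suc k, 0)) & q$2 = 0 & real k / n <= q$1 & q$1 <= real (Suc k) / n) \<or>
     (e' = ((n, k), (n, Suc k)) & q$1 = 1 & real k / n <= q$2 & q$2 <= real (Suc k) / n) \<or>
     (e' = ((Suc k, n), (k, n)) & q$2 = 1 & real k / n <= q$1 & q$1 <= real (Suc k) / n) \<or>
     (e' = ((0, Suc k), (0, k)) & q$1 = 0 & real k / n <= q$2 & q$2 <= real (Suc k) / n)"
    using form[OF e'] by blast
  have u: "real i / n <= x ==> x <= real (Suc i) / n ==> real k / n <= x ==> x <= real (Suc k) / n ==>
      (!!m. m <= n ==> x ~= real m / n) ==> i = k" for x
    using grid_cell_unique[OF n] i k by blast
  from fi show ?thesis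
  proof (elim disjE conjE)
    assume a: "e = ((i, 0), (Suc i, 0))" "q$2 = 0" "real i / n <= q$1" "q$1 <= real (Suc i) / n"
    hence "e' = ((k, 0), (Suc k, 0)) & real k / n <= q$1 & q$1 <= real (Suc k) / n"
      using fk corner by (elim disjE) simp_all
    hence "i = k & e' = ((k, 0), (Suc k, 0))" using u[OF a(3,4)] c1(1)[OF a(2)] by blast
    thus ?thesis using a by simp
  next
    assume a: "e = ((n, i), (n, Suc i))" "q$1 = 1" "real i / n <= q$2" "q$2 <= real (Suc i) / n"
    hence "e' = ((n, k), (n, Suc k)) & real k / n <= q$2 & q$2 <= real (Suc k) / n"
      using fk corner by (elim disjE) simp_all
    hence "i = k & e' = ((n, k), (n, Suc k))" using u[OF a(3,4)] c1(4)[OF a(2)] by blast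
    thus ?thesis using a by simp
  next
    assume a: "e = ((Suc i, n), (i, n))" "q$2 = 1" "real i / n <= q$1" "q$1 <= real (Suc i) / n"
    hence "e' = ((Suc k, n), (k, n)) & real k / n <= q$1 & q$1 <= real (Suc k) / n"
      using fk corner by (elim disjE) simp_all
    hence "i = k & e' = ((Suc k, n), (k, n))" using u[OF a(3,4)] c1(2)[OF a(2)] by blast
    thus ?thesis using a by simp
  next
    assume a: "e = ((0, Suc i), (0, i))" "q$1 = 0" "real i / n <= q$2" "q$2 <= real (Suc i) / n"
    hence "e' = ((0, Suc k), (0, k)) & real k / n <= q$2 & q$2 <= real (Suc k) / n"
      using fk corner by (elim disjE) simp_all
    hence "i = k & e' = ((0, Suc k), (0, k))" using u[OF a(3,4)] c1(3)[OF a(2)] by blast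
    thus ?thesis using a by simp
  qed
qed

lemma inf_positive_compact:
  fixes f :: "'a::topological_space => real"
  assumes "compact K" "continuous_on K f" "!!x. x \<in> K ==> f x > 0"
  obtains m where "m > 0" "!!x. x \<in> K ==> m <= f x"
proof (cases "K = {}")
  case True
  thus ?thesis using that[of 1] by auto
next
  case False
  thus ?thesis using continuous_attains_inf[OF assms(1) False assms(2)] assms(3) that by metis
qed

lemma compact_frontier_square: "compact (frontier unit_square)"
  by (simp add: compact_frontier)

lemma frontier_square_subset: "frontier unit_square \<subseteq> unit_square"
  using mem_frontier_square by blast

section \<open>Area as a limit of sums over grid cells\<close>

lemma smooth_on_lipschitz_compact:
  fixes g :: "'a::euclidean_space => 'b::real_normed_vector"
  assumes "smooth_on U g" "compact T" "convex T" "T \<subseteq> U"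
  obtains L where "L-lipschitz_on T g"
proof -
  have "\<exists>B. \<forall>x\<in>T. norm (frechet_derivative g (at x) i) <= B" for i
  proof -
    have "continuous_on T (%x. frechet_derivative g (at x) i)"
      using smooth_on_continuous[OF smooth_on_frechet[OF assms(1)]] assms(4) continuous_on_subset by blast
    hence "bounded ((%x. frechet_derivative g (at x) i) ` T)"
      by (intro compact_imp_bounded compact_continuous_image assms(2))
    thus ?thesis by (auto simp: bounded_iff)
  qed
  then obtain B where B: "!!i x. x \<in> T ==> norm (frechet_derivative g (at x) i) <= B i" by metis
  define L where "L = (\<Sum>i\<in>Basis. \<bar>B i\<bar>)"
  have der: "(g has_derivative frechet_derivative g (at x)) (at x)" if "x \<in> T" for x
    using smooth_on_differentiable[OF assms(1), of x] that assms(4) by (auto simp: frechet_derivative_works)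
  have "onorm (frechet_derivative g (at x)) <= L" if x: "x \<in> T" for x
  proof (rule onorm_le)
    fix v :: 'a
    interpret bounded_linear "frechet_derivative g (at x)" using der[OF x] has_derivative_bounded_linear by blast
    have "frechet_derivative g (at x) v = (\<Sum>i\<in>Basis. (v \<bullet> i) *\<^sub>R frechet_derivative g (at x) i)"
      using euclidean_representation[of v] by (metis (no_types, lifting) scaleR sum sum.cong)
    also have "norm \<dots> <= (\<Sum>i\<in>Basis. norm v * \<bar>B i\<bar>)"
    proof (rule sum_norm_le)
      fix i :: 'a assume i: "i \<in> Basis"
      have "\<bar>v \<bullet> i\<bar> * norm (frechet_derivative g (at x) i) <= norm v * \<bar>B i\<bar>"
        using Basis_le_norm[OF i, of v] B[OF x, of i] by (intro mult_mono) auto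
      thus "norm ((v \<bullet> i) *\<^sub>R frechet_derivative g (at x) i) <= norm v * \<bar>B i\<bar>" by simp
    qed
    also have "\<dots> = L * norm v" by (simp add: L_def sum_distrib_left mult.commute)
    finally show "norm (frechet_derivative g (at x) v) <= L * norm v" .
  qed
  moreover have "0 <= L" by (simp add: L_def sum_nonneg)
  ultimately have "L-lipschitz_on T g"
    by (intro bounded_derivative_imp_lipschitz[OF has_derivative_at_withinI[OF der] assms(3)]) auto
  thus ?thesis using that by blast
qed

text \<open>The pieces are glued along the segment from x to y, which stays in the convex union:
  their preimages form a finite closed cover of the interval [0, 1], where the one-dimensional
  gluing lemma applies.\<close>

lemma lipschitz_on_finite_closed_cover:
  fixes f :: "'a::euclidean_space => 'b::metric_space"
  assumes "finite C" "!!T. T \<in> C ==> closed T" "!!T. T \<in> C ==> L-lipschitz_on T f" "convex (\<Union>C)" "L >= 0"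
  shows "L-lipschitz_on (\<Union>C) f"
proof (rule lipschitz_onI)
  fix x y assume xy: "x \<in> \<Union>C" "y \<in> \<Union>C"
  define p where "p s = x + s *\<^sub>R (y - x)" for s :: real
  have pd: "dist (p s) (p t) = dist s t * dist x y" for s t
  proof -
    have "p s - p t = (s - t) *\<^sub>R (y - x)" by (simp add: p_def algebra_simps)
    thus ?thesis by (simp add: dist_norm norm_minus_commute)
  qed
  have "(L * dist x y)-lipschitz_on {0..1} (%s. f (p s))"
  proof (rule lipschitz_on_closed_Union[of C "L * dist x y" "%T. p -` T"])
    fix T assume T: "T \<in> C"
    show "(L * dist x y)-lipschitz_on (p -` T) (%s. f (p s))"
    proof (rule lipschitz_onI)
      fix s t assume "s \<in> p -` T" "t \<in> p -` T"
      thus "dist (f (p s)) (f (p t)) <= L * dist x y * dist s t"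
        using lipschitz_onD[OF assms(3)[OF T], of "p s" "p t"] by (simp add: pd mult_ac)
    qed (use assms(5) in simp)
    show "closed (p -` T)"
      by (rule continuous_closed_vimage[OF assms(2)[OF T]])
        (unfold p_def[abs_def], intro continuous_intros)
  next
    show "{0..1} \<subseteq> (\<Union>T\<in>C. p -` T)"
    proof
      fix s :: real assume "s \<in> {0..1}"
      hence "p s \<in> \<Union>C" using convexD_alt[OF assms(4) xy, of s] by (simp add: p_def algebra_simps)
      thus "s \<in> (\<Union>T\<in>C. p -` T)" by auto
    qed
  qed (use assms in auto)
  from lipschitz_onD[OF this, of 0 1] show "dist (f x) (f y) <= L * dist x y"
    by (simp add: p_def)
qed (rule assms(5))

text \<open>The form in which piecewise smoothness enters the area estimate. Differentiability may
  fail on the edges of the triangulation and on the frontier of the square; both are frontiers of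
  convex sets and therefore negligible.\<close>

lemma ps_embedded_disk_regular:
  assumes "ps_embedded_disk f"
  obtains L N where "L-lipschitz_on unit_square f" "negligible N"
    "!!q. q \<in> unit_square - N ==> q \<in> interior unit_square & f differentiable (at q)"
proof -
  obtain \<T> where T: "triangulation \<T>" "\<Union>\<T> = unit_square"
    and g: "!!T. T \<in> \<T> ==> \<exists>U g. open U & T \<subseteq> U & smooth_on U g & (\<forall>x\<in>T. g x = f x & inj (frechet_derivative g (at x)))"
    using assms unfolding ps_embedded_disk_def by blast
  have fin: "finite \<T>" and cc: "!!T. T \<in> \<T> ==> convex T & compact T & closed T"
    using T(1) unfolding triangulation_def by (auto intro: convex_simplex compact_simplex closed_simplex)
  have "\<exists>L. L-lipschitz_on T f" if tT: "T \<in> \<T>" for T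
  proof -
    obtain U g where U: "T \<subseteq> U" "smooth_on U g" "!!x. x \<in> T ==> g x = f x" using g[OF tT] by blast
    obtain L where "L-lipschitz_on T g" using smooth_on_lipschitz_compact[OF U(2) _ _ U(1)] cc[OF tT] by blast
    thus ?thesis using U(3) by (metis lipschitz_on_transform)
  qed
  then obtain LT where LT: "!!T. T \<in> \<T> ==> (LT T)-lipschitz_on T f" by metis
  define L where "L = (\<Sum>T\<in>\<T>. \<bar>LT T\<bar>)"
  have "L-lipschitz_on T f" if tT: "T \<in> \<T>" for T
  proof -
    have "LT T <= L" using member_le_sum[OF tT _ fin, of "%T. \<bar>LT T\<bar>"] by (simp add: L_def)
    thus ?thesis using LT[OF tT] lipschitz_on_le by blast
  qed
  moreover have "0 <= L" by (simp add: L_def sum_nonneg)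
  ultimately have "L-lipschitz_on (\<Union>\<T>) f"
    using fin cc T(2) by (intro lipschitz_on_finite_closed_cover) (auto simp: convex_box)
  moreover define N where "N = (\<Union>T\<in>\<T>. frontier T) \<union> frontier unit_square"
  have "negligible N" unfolding N_def using fin cc
    by (intro negligible_Un negligible_Union) (auto intro!: negligible_convex_frontier simp: convex_box)
  moreover have "q \<in> interior unit_square & f differentiable (at q)" if q: "q \<in> unit_square - N" for q
  proof
    show "q \<in> interior unit_square" using q by (auto simp: N_def frontier_def)
    obtain T where tT: "T \<in> \<T>" "q \<in> T" using q T(2) by blast
    hence qi: "q \<in> interior T" using q cc[OF tT(1)] by (auto simp: N_def frontier_def)
    obtain U g where U: "T \<subseteq> U" "smooth_on U g" "!!x. x \<in> T ==> g x = f x" using g[OF tT(1)] by blast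
    have "g differentiable (at q)" using smooth_on_differentiable[OF U(2)] U(1) tT by blast
    thus "f differentiable (at q)"
      using differentiable_cong_open[of "interior T" q g f] qi U(3) interior_subset by blast
  qed
  ultimately show ?thesis using that T(2) by metis
qed

section \<open>Difference quotients over the cell that contains a point\<close>

definition cel :: "nat => real^2 => gpt" where
  "cel n q = (nat \<lfloor>real n * q$1\<rfloor>, nat \<lfloor>real n * q$2\<rfloor>)"

definition corner :: "nat => real^2 => gpt => real^2" where
  "corner n q k = vtx n (fst (cel n q) + fst k, snd (cel n q) + snd k)"

lemma nat_floor_bounds:
  fixes x :: real assumes "0 <= x"
  shows "real (nat \<lfloor>x\<rfloor>) <= x" "x < real (nat \<lfloor>x\<rfloor>) + 1"
proof -
  have "0 <= \<lfloor>x\<rfloor>" using assms by simp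
  hence eq: "real (nat \<lfloor>x\<rfloor>) = real_of_int \<lfloor>x\<rfloor>" by simp
  show "real (nat \<lfloor>x\<rfloor>) <= x" "x < real (nat \<lfloor>x\<rfloor>) + 1" unfolding eq by linarith+
qed

lemma interior_square: "q \<in> interior unit_square \<longleftrightarrow> 0 < q$1 & q$1 < 1 & 0 < q$2 & q$2 < 1"
  unfolding interior_cbox mem_box_cart forall_2 by simp

lemma cel_grid:
  assumes "q \<in> interior unit_square" "n > 0"
  shows "cel n q \<in> grid n" "q \<in> celbox n (cel n q)"
proof -
  have q: "0 < q$1" "q$1 < 1" "0 < q$2" "q$2 < 1" using assms(1) unfolding interior_square by auto
  have m: "0 <= real n * q$1" "0 <= real n * q$2" "real n * q$1 < real n" "real n * q$2 < real n"
    using q assms(2) by auto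
  note b = nat_floor_bounds[OF m(1)] nat_floor_bounds[OF m(2)]
  have div1: "a / m <= x" if "a <= m * x" "m > 0" for a m x :: real using that by (simp add: field_simps)
  have div2: "x <= a / m" if "m * x < a" "m > 0" for a m x :: real using that by (simp add: field_simps)
  have "real (nat \<lfloor>real n * q$1\<rfloor>) < real n" "real (nat \<lfloor>real n * q$2\<rfloor>) < real n" using b m by linarith+
  thus "cel n q \<in> grid n" unfolding cel_def grid_def of_nat_less_iff by simp
  have "real (nat \<lfloor>real n * q$1\<rfloor>) / n <= q$1" "q$1 <= (1 + real (nat \<lfloor>real n * q$1\<rfloor>)) / n"
     "real (nat \<lfloor>real n * q$2\<rfloor>) / n <= q$2" "q$2 <= (1 + real (nat \<lfloor>real n * q$2\<rfloor>)) / n"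
    using div1[OF b(1)] div1[OF b(3)] div2[OF b(2)] div2[OF b(4)] assms(2)
    by (simp_all only: of_nat_0_less_iff add.commute[of 1])
  thus "q \<in> celbox n (cel n q)" by (simp add: celbox_def mem_box_cart forall_2 cel_def)
qed

lemma corner_celbox:
  assumes "fst k <= 1" "snd k <= 1" "n > 0"
  shows "corner n q k \<in> celbox n (cel n q)"
  using assms by (simp add: celbox_def corner_def mem_box_cart forall_2 divide_right_mono)

lemma corner_dist:
  assumes "q \<in> interior unit_square" "fst k <= 1" "snd k <= 1" "n > 0"
  shows "dist (corner n q k) q <= 2 / n"
  using celbox_dist[OF corner_celbox[OF assms(2-4)] cel_grid(2)[OF assms(1,4)] assms(4)] .

text \<open>The point q is anywhere in the shrinking cell, not at a corner. Both corners stay within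
  2 / n of q and n times their difference is a fixed vector, so differentiability at q alone yields
  the limit.\<close>

lemma corner_diff_quotient:
  fixes \<phi> :: "real^2 => 'b::real_normed_vector"
  assumes d: "(\<phi> has_derivative \<phi>') (at q)" and q: "q \<in> interior unit_square"
    and kk: "fst k <= 1" "snd k <= 1" "fst k' <= 1" "snd k' <= 1"
  shows "(%n. real n *\<^sub>R (\<phi> (corner n q k') - \<phi> (corner n q k))) \<longlonglongrightarrow>
      \<phi>' (vector [real (fst k') - real (fst k), real (snd k') - real (snd k)])"
proof (rule LIMSEQ_I)
  fix r :: real assume r: "r > 0"
  let ?u = "vector [real (fst k') - real (fst k), real (snd k') - real (snd k)] :: real^2"
  \<comment> \<open>Each of the two remainders is at most r/5 times 2/n; after multiplication by n
    they add up to 4r/5, which is below r.\<close>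
  have "r / 5 > 0" using r by simp
  then obtain e where e: "e > 0" "!!y. norm (y - q) < e ==> norm (\<phi> y - \<phi> q - \<phi>' (y - q)) <= r / 5 * norm (y - q)"
    using d unfolding has_derivative_at_alt by blast
  obtain N :: nat where N: "real N > 2 / e" using reals_Archimedean2 by blast
  have "norm (real n *\<^sub>R (\<phi> (corner n q k') - \<phi> (corner n q k)) - \<phi>' ?u) < r" if n: "n >= N" for n
  proof -
    have "2 / e > 0" using e by simp
    hence n0: "n > 0" and "real n > 2 / e" using N n by linarith+
    hence ne: "2 / real n < e" using e(1) by (simp add: field_simps)
    interpret bounded_linear \<phi>' using d has_derivative_bounded_linear by blast
    let ?a = "corner n q k" and ?b = "corner n q k'"
    have da: "norm (?a - q) <= 2 / n" "norm (?b - q) <= 2 / n"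
      using corner_dist[OF q kk(1,2) n0] corner_dist[OF q kk(3,4) n0] by (simp_all add: dist_norm)
    have Ra: "norm (\<phi> ?a - \<phi> q - \<phi>' (?a - q)) <= r / 5 * (2 / n)" "norm (\<phi> ?b - \<phi> q - \<phi>' (?b - q)) <= r / 5 * (2 / n)"
      using e(2)[of ?a] e(2)[of ?b] da ne r
      by (smt (verit) divide_nonneg_pos mult_left_mono)+
    have u: "real n *\<^sub>R (?b - ?a) = ?u"
      using n0 by (simp add: vec_eq_iff forall_2 corner_def field_simps)
    have "\<phi>' ?u = real n *\<^sub>R (\<phi>' (?b - q) - \<phi>' (?a - q))"
      unfolding u[symmetric] scaleR by (simp add: diff[symmetric])
    hence "real n *\<^sub>R (\<phi> ?b - \<phi> ?a) - \<phi>' ?u =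
        real n *\<^sub>R ((\<phi> ?b - \<phi> q - \<phi>' (?b - q)) - (\<phi> ?a - \<phi> q - \<phi>' (?a - q)))"
      by (simp add: algebra_simps)
    hence "norm (real n *\<^sub>R (\<phi> ?b - \<phi> ?a) - \<phi>' ?u) <= real n * (r / 5 * (2 / n) + r / 5 * (2 / n))"
      using norm_triangle_ineq4[of "\<phi> ?b - \<phi> q - \<phi>' (?b - q)" "\<phi> ?a - \<phi> q - \<phi>' (?a - q)"] Ra
      by (simp only: norm_scaleR abs_of_nat) (intro mult_left_mono, auto)
    also have "\<dots> < r" using n0 r by simp
    finally show ?thesis .
  qed
  thus "\<exists>no. \<forall>n\<ge>no. norm (real n *\<^sub>R (\<phi> (corner n q k') - \<phi> (corner n q k)) - \<phi>' ?u) < r" by blast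
qed

lemma negligible_coordinate: "negligible {q :: real^2. q$k = c}"
  by (simp add: cart_eq_inner_axis negligible_standard_hyperplane)

text \<open>Each cell has area 1 / n^2, so a sum over cells becomes the integral of a step function,
  to which convergence theorems apply. The exceptional set \<open>Z\<close> consists of the grid
  lines.\<close>

lemma has_integral_step:
  fixes F :: "gpt => real"
  assumes n: "n > 0"
  shows "((%q. (real n)^2 * F (cel n q)) has_integral (\<Sum>c\<in>grid n. F c)) unit_square"
proof -
  have cell: "((%q. if q \<in> celbox n c then (real n)^2 * F c else 0) has_integral F c) unit_square"
    if c: "c \<in> grid n" for c
  proof -
    have ne: "celbox n c ~= {}" using cedges_celbox[OF _ n, of "((fst c, snd c), (Suc (fst c), snd c))" c]
      by (cases c) auto
    have "((%q. (real n)^2 * F c) has_integral measure lborel (celbox n c) *\<^sub>R ((real n)^2 * F c)) (celbox n c)"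
      unfolding celbox_def by (rule has_integral_const)
    moreover have "measure lborel (celbox n c) = 1 / (real n)^2"
      using ne unfolding celbox_def
      by (subst content_cbox_cart) (auto simp: prod_2 UNIV_2 power2_eq_square diff_divide_distrib[symmetric])
    ultimately have "((%q. (real n)^2 * F c) has_integral F c) (celbox n c)" using n by simp
    thus ?thesis
      using has_integral_restrict[OF celbox_subset[OF c], of "%q. (real n)^2 * F c" "F c"] by simp
  qed
  define Z where "Z = (\<Union>k\<le>n. {q :: real^2. q$1 = real k / n} \<union> {q. q$2 = real k / n})"
  have "negligible Z" unfolding Z_def by (intro negligible_Union) (auto simp: negligible_coordinate)
  thus ?thesis
  proof (rule has_integral_spike[OF _ _ has_integral_sum[OF finite_grid cell]])
    fix q assume q: "q \<in> unit_square - Z"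
    have nz: "q$1 ~= real k / n" "q$2 ~= real k / n" if "k <= n" for k using q that by (auto simp: Z_def)
    have "0 <= q$1" "q$1 <= 1" "0 <= q$2" "q$2 <= 1" using q unfolding Diff_iff mem_unit_square by auto
    moreover have "q$1 ~= 0" "q$1 ~= 1" "q$2 ~= 0" "q$2 ~= 1" using nz[of 0] nz[of n] n by simp_all
    ultimately have "q \<in> interior unit_square" unfolding interior_square by linarith
    note cg = cel_grid[OF this n]
    have "q \<in> celbox n c \<longleftrightarrow> c = cel n q" if c: "c \<in> grid n" for c
    proof
      assume "q \<in> celbox n c"
      hence "real (fst c) / n <= q$1" "q$1 <= real (Suc (fst c)) / n" "real (snd c) / n <= q$2" "q$2 <= real (Suc (snd c)) / n"
        by (auto simp: celbox_def mem_box_cart forall_2)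
      moreover have "real (fst (cel n q)) / n <= q$1" "q$1 <= real (Suc (fst (cel n q))) / n"
        "real (snd (cel n q)) / n <= q$2" "q$2 <= real (Suc (snd (cel n q))) / n"
        using cg(2) by (auto simp: celbox_def mem_box_cart forall_2)
      moreover have "fst c < n" "snd c < n" "fst (cel n q) < n" "snd (cel n q) < n"
        using c cg(1) by (auto simp: grid_def)
      ultimately have "fst c = fst (cel n q)" "snd c = snd (cel n q)"
        using grid_cell_unique[OF n, of "fst c" "q$1" "fst (cel n q)"]
          grid_cell_unique[OF n, of "snd c" "q$2" "snd (cel n q)"] nz by blast+
      thus "c = cel n q" by (rule prod_eqI)
    qed (use cg in auto)
    hence "(\<Sum>c\<in>grid n. if q \<in> celbox n c then (real n)^2 * F c else 0) =
        (\<Sum>c\<in>grid n. if c = cel n q then (real n)^2 * F c else 0)" by (intro sum.cong) auto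
    also have "\<dots> = (real n)^2 * F (cel n q)" using cg(1) by simp
    finally show "(real n)^2 * F (cel n q) = (\<Sum>c\<in>grid n. if q \<in> celbox n c then (real n)^2 * F c else 0)" by simp
  qed
qed

definition jac :: "(real^2 => real^3) => real^2 => real" where
  "jac f x = norm (cross3 (frechet_derivative f (at x) (axis 1 1)) (frechet_derivative f (at x) (axis 2 1)))"

lemma norm_cross3_le: "norm (cross3 x y) <= norm x * norm y"
proof (rule power2_le_imp_le)
  have "(norm (cross3 x y))^2 + (x \<bullet> y)^2 = (norm x * norm y)^2" by (rule norm_cross_dot)
  thus "(norm (cross3 x y))^2 <= (norm x * norm y)^2" using zero_le_power2[of "x \<bullet> y"] by linarith
qed simp

lemma vector_axis: "vector [1, 0] = (axis 1 1 :: real^2)" "vector [0, 1] = (axis 2 1 :: real^2)"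
  by (auto simp: vec_eq_iff forall_2 axis_def)

text \<open>The integral of a non-integrable function would have the default value 0, so
  integrability has to be secured. The Jacobian is the pointwise limit of step functions built from
  corner differences, and the Lipschitz constant dominates them all by (2 L)^2.\<close>

lemma jac_integrable:
  assumes L: "L-lipschitz_on unit_square f" and N: "negligible N"
    and reg: "!!q. q \<in> unit_square - N ==> q \<in> interior unit_square & f differentiable (at q)"
  shows "jac f integrable_on unit_square"
proof -
  define F where "F n c = norm (cross3 (f (vtx n (Suc (fst c), snd c)) - f (vtx n c))
      (f (vtx n (fst c, Suc (snd c))) - f (vtx n c)))" for n c
  define d where "d n q = (if q \<in> N then 0 else (real (Suc n))^2 * F (Suc n) (cel (Suc n) q))" for n q
  have L0: "L >= 0" using L lipschitz_on_nonneg by blast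
  have int: "d n integrable_on unit_square" for n
    by (rule integrable_spike[OF has_integral_integrable[OF has_integral_step] N]) (auto simp: d_def)
  have bound: "norm (d n q) <= (2 * L)^2" if q: "q \<in> unit_square" for n q
  proof (cases "q \<in> N")
    case False
    let ?m = "Suc n" and ?c = "cel (Suc n) q"
    have qi: "q \<in> interior unit_square" using reg q False by blast
    have cg: "?c \<in> grid ?m" using cel_grid(1)[OF qi] by simp
    have v: "vtx ?m (fst ?c + i, snd ?c + j) \<in> celbox ?m ?c" if "i <= 1" "j <= 1" for i j
      using corner_celbox[of "(i, j)" ?m q] that by (simp add: corner_def)
    have fl: "norm (f (vtx ?m (fst ?c + i, snd ?c + j)) - f (vtx ?m ?c)) <= L * (2 / ?m)" if "i <= 1" "j <= 1" for i j
    proof -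
      have v1: "vtx ?m (fst ?c + i, snd ?c + j) \<in> celbox ?m ?c" "vtx ?m ?c \<in> celbox ?m ?c"
        using v[OF that] v[of 0 0] by auto
      have "dist (f (vtx ?m (fst ?c + i, snd ?c + j))) (f (vtx ?m ?c)) <= L * dist (vtx ?m (fst ?c + i, snd ?c + j)) (vtx ?m ?c)"
        using v1 celbox_subset[OF cg] by (intro lipschitz_onD[OF L]) blast+
      also have "\<dots> <= L * (2 / ?m)" using celbox_dist[OF v1] L0 by (intro mult_left_mono) auto
      finally show ?thesis by (simp add: dist_norm)
    qed
    have "F ?m ?c <= (L * (2 / ?m)) * (L * (2 / ?m))"
      unfolding F_def using fl[of 1 0] fl[of 0 1] L0
      by (intro order_trans[OF norm_cross3_le] mult_mono) auto
    hence "(real ?m)^2 * F ?m ?c <= (real ?m)^2 * ((L * (2 / ?m)) * (L * (2 / ?m)))"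
      by (intro mult_left_mono) auto
    also have "\<dots> = (2 * L)^2" by (simp add: power2_eq_square del: of_nat_Suc)
    finally show ?thesis using False by (simp add: d_def F_def del: of_nat_Suc)
  qed (simp add: d_def)
  have conv: "(%n. d n q) \<longlonglongrightarrow> (if q \<in> N then 0 else jac f q)" if q: "q \<in> unit_square" for q
  proof (cases "q \<in> N")
    case False
    have qi: "q \<in> interior unit_square" and df: "(f has_derivative frechet_derivative f (at q)) (at q)"
      using reg q False by (auto simp: frechet_derivative_works)
    have "(%n. norm (cross3 (real n *\<^sub>R (f (corner n q (1, 0)) - f (corner n q (0, 0))))
        (real n *\<^sub>R (f (corner n q (0, 1)) - f (corner n q (0, 0)))))) \<longlonglongrightarrow> jac f q"
      unfolding jac_def
      using corner_diff_quotient[OF df qi, of "(0,0)" "(1,0)"] corner_diff_quotient[OF df qi, of "(0,0)" "(0,1)"]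
      by (intro tendsto_norm bounded_bilinear.tendsto[OF bilinear_conv_bounded_bilinear[THEN iffD1, OF bilinear_cross]])
        (simp_all add: vector_axis)
    hence "(%n. norm (cross3 (real (Suc n) *\<^sub>R (f (corner (Suc n) q (1, 0)) - f (corner (Suc n) q (0, 0))))
        (real (Suc n) *\<^sub>R (f (corner (Suc n) q (0, 1)) - f (corner (Suc n) q (0, 0)))))) \<longlonglongrightarrow> jac f q"
      by (rule LIMSEQ_Suc)
    moreover have "norm (cross3 (real m *\<^sub>R (f (corner m q (1, 0)) - f (corner m q (0, 0))))
        (real m *\<^sub>R (f (corner m q (0, 1)) - f (corner m q (0, 0))))) = (real m)^2 * F m (cel m q)" for m
      by (simp add: F_def corner_def cross_mult_left cross_mult_right power2_eq_square)
    ultimately have "(%n. (real (Suc n))^2 * F (Suc n) (cel (Suc n) q)) \<longlonglongrightarrow> jac f q"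
      by (simp only:)
    thus ?thesis using False by (simp add: d_def del: of_nat_Suc)
  qed (simp add: d_def)
  have "(%q. if q \<in> N then 0 else jac f q) integrable_on unit_square"
    by (rule dominated_convergence(1)[OF int integrable_const bound conv])
  thus ?thesis by (rule integrable_spike[OF _ N]) auto
qed

text \<open>The cell terms are only bounded from above in the limit. Dominated convergence is
  therefore applied to the positive part of their excess over C times the Jacobian, which tends to 0
  pointwise.\<close>

lemma cell_sums_le_area:
  assumes L: "L-lipschitz_on unit_square f" and N: "negligible N"
    and reg: "!!q. q \<in> unit_square - N ==> q \<in> interior unit_square & f differentiable (at q)"
    and C: "C >= 0" and F0: "!!n c. F n c >= (0::real)"
    and bd: "!!n c. n >= n0 ==> c \<in> grid n ==> (real n)^2 * F n c <= B"
    and pt: "!!q e. q \<in> unit_square - N ==> e > 0 ==>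
        \<forall>\<^sub>F n in sequentially. (real n)^2 * F n (cel n q) <= C * jac f q + e"
    and eps: "eps > 0"
  shows "\<forall>\<^sub>F n in sequentially. (\<Sum>c\<in>grid n. F n c) <= C * integral unit_square (jac f) + eps"
proof -
  note J = jac_integrable[OF L N reg]
  have J0: "jac f q >= 0" for q by (simp add: jac_def)
  \<comment> \<open>The shift makes every index at least n0 and positive, so that the uniform bound
    and the integral formula hold for all terms of the sequence.\<close>
  define m where "m n = n + n0 + 1" for n
  define d where "d n q = (real (m n))^2 * F (m n) (cel (m n) q)" for n q
  define k where "k n q = (if q \<in> N then 0 else max (d n q - C * jac f q) 0)" for n q
  have dint: "(d n has_integral (\<Sum>c\<in>grid (m n). F (m n) c)) unit_square" for n
    unfolding d_def by (rule has_integral_step) (simp add: m_def)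
  have dn: "d n q >= 0" for n q using F0 by (simp add: d_def)
  have "(%q. max (d n q - C * jac f q) 0) absolutely_integrable_on unit_square" for n
  proof (rule absolutely_integrable_max_1)
    have "d n absolutely_integrable_on unit_square"
      using dint dn by (intro nonnegative_absolutely_integrable_1) auto
    moreover have "(%q. C * jac f q) absolutely_integrable_on unit_square"
      using J J0 C by (intro nonnegative_absolutely_integrable_1 integrable_on_mult_right) auto
    ultimately show "(%q. d n q - C * jac f q) absolutely_integrable_on unit_square" by (rule set_integral_diff(1))
    show "(%q. 0) absolutely_integrable_on unit_square" by simp
  qed
  hence kint: "k n integrable_on unit_square" for n
    by (intro integrable_spike[OF set_lebesgue_integral_eq_integral(1) N]) (auto simp: k_def)
  have kb: "norm (k n q) <= \<bar>B\<bar>" if q: "q \<in> unit_square" for n q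
  proof (cases "q \<in> N")
    case False
    hence "q \<in> interior unit_square" using reg q by blast
    hence "d n q <= B" unfolding d_def using bd[of "m n"] cel_grid(1)[of q "m n"] by (simp add: m_def)
    hence "d n q - C * jac f q <= B" using C J0[of q] by (smt (verit) mult_nonneg_nonneg)
    thus ?thesis by (auto simp: k_def)
  qed (simp add: k_def)
  have kc: "(%n. k n q) \<longlonglongrightarrow> 0" if q: "q \<in> unit_square" for q
  proof (cases "q \<in> N")
    case False
    show ?thesis
    proof (rule LIMSEQ_I)
      fix r :: real assume r: "r > 0"
      have "\<forall>\<^sub>F n in sequentially. (real n)^2 * F n (cel n q) <= C * jac f q + r / 2"
        using pt[of q "r/2"] q False r by auto
      then obtain M where M: "!!n. n >= M ==> (real n)^2 * F n (cel n q) <= C * jac f q + r / 2"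
        unfolding eventually_sequentially by blast
      have "norm (k n q - 0) < r" if "n >= M" for n
        using M[of "m n"] that r False by (auto simp: k_def d_def m_def)
      thus "\<exists>no. \<forall>n\<ge>no. norm (k n q - 0) < r" by blast
    qed
  qed (simp add: k_def)
  have "(%n. integral unit_square (k n)) \<longlonglongrightarrow> integral unit_square (%q. 0 :: real)"
    by (rule dominated_convergence(2)[OF kint integrable_const kb kc])
  hence "\<forall>\<^sub>F n in sequentially. integral unit_square (k n) < eps"
    using eps by (simp add: order_tendstoD)
  then obtain M where M: "!!n. n >= M ==> integral unit_square (k n) < eps"
    unfolding eventually_sequentially by blast
  have le: "(\<Sum>c\<in>grid (m n). F (m n) c) <= C * integral unit_square (jac f) + integral unit_square (k n)" for n
  proof -
    have "(\<Sum>c\<in>grid (m n). F (m n) c) = integral unit_square (d n)" using integral_unique[OF dint[of n]] by simp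
    also have "\<dots> = integral unit_square (%q. if q \<in> N then 0 else d n q)"
      by (rule integral_spike[OF N]) auto
    also have "\<dots> <= integral unit_square (%q. C * jac f q + k n q)"
    proof (rule integral_le)
      show "(%q. if q \<in> N then 0 else d n q) integrable_on unit_square"
        by (rule integrable_spike[OF has_integral_integrable[OF dint] N]) auto
      show "(%q. C * jac f q + k n q) integrable_on unit_square"
        by (intro integrable_add integrable_on_mult_right J kint)
      show "(if q \<in> N then 0 else d n q) <= C * jac f q + k n q" for q
        using C J0[of q] by (auto simp: k_def)
    qed
    also have "\<dots> = C * integral unit_square (jac f) + integral unit_square (k n)"
      by (subst integral_add) (auto intro: integrable_on_mult_right J kint)
    finally show ?thesis .
  qed
  have "(\<Sum>c\<in>grid n. F n c) <= C * integral unit_square (jac f) + eps" if "n >= M + n0 + 1" for n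
  proof -
    have "n = m (n - n0 - 1)" "n - n0 - 1 >= M" using that by (auto simp: m_def)
    thus ?thesis using le[of "n - n0 - 1"] M[of "n - n0 - 1"] by simp
  qed
  thus ?thesis unfolding eventually_sequentially by blast
qed

lemma disk_area_jac: "disk_area f = integral unit_square (jac f)"
  by (simp add: disk_area_def jac_def[abs_def])

lemma compact_Collect_closed:
  fixes S :: "'a::t2_space set"
  assumes "compact S" "closed {x \<in> S. P x}"
  shows "compact {x \<in> S. P x}"
proof -
  have "{x \<in> S. P x} = S Int {x \<in> S. P x}" by auto
  thus ?thesis using compact_Int_closed[OF assms] by simp
qed

text \<open>Above height zA the frontier contains the crests of two caps, where g is -i and i.
  Starting at the crest with Im g < 0, cells are collected by crossing edges that are not low at
  both ends. Either the collection arrives at the arc with Im g > 0, which gives the path, or its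
  boundary consists of low edges, where the form is \<open>a\<close> times increments of
  \<open>e1\<close>, and of frontier edges on which the sign change of Re g is met exactly once.
  Then the flux is an odd multiple of half of \<open>a\<close>.\<close>

theorem grid_dichotomy:
  fixes h :: "real^2 => real" and g e1 :: "real^2 => complex" and Om :: "real^2 => real^2 => real"
  assumes h: "continuous_on unit_square h"
    and g: "continuous_on (frontier unit_square) g" "inj_on g (frontier unit_square)"
      "g ` frontier unit_square = sphere 0 1"
    and e1: "!!q. q \<in> unit_square ==> h q <= zA ==> cmod (e1 q) = 1"
    and bd: "!!q. q \<in> frontier unit_square ==> h q <= zA ==>
        Re (g q) ~= 0 & e1 q = (if Re (g q) < 0 then 1 else - 1)"
    and d: "d > 0"
    and anti: "!!v v'. v \<in> unit_square ==> v' \<in> unit_square ==> dist v v' < d ==> Om v' v = - Om v v'"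
    and fr0: "!!v v'. v \<in> frontier unit_square ==> v' \<in> frontier unit_square ==> dist v v' < d ==> Om v v' = 0"
    and low: "!!v v'. v \<in> unit_square ==> v' \<in> unit_square ==> dist v v' < d ==> h v <= zA ==> h v' <= zA ==>
        Om v v' = a * inc e1 v v'"
    and eps: "eps > 0"
  shows "(\<exists>p\<in>frontier unit_square. \<exists>p'\<in>frontier unit_square. h p > zA & Im (g p) < 0 &
            h p' > zA & Im (g p') > 0 & path_component {q \<in> unit_square. h q > zA - eps} p p') \<or>
         (\<exists>N. \<forall>n\<ge>N. \<bar>a\<bar> / 2 <= (\<Sum>c\<in>grid n. \<bar>\<Sum>e\<in>cedges c. Om (vtx n (fst e)) (vtx n (snd e))\<bar>))"
proof (rule disjCI)
  let ?fr = "frontier (unit_square :: (real^2) set)"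
  assume nopath: "\<not> (\<exists>N. \<forall>n\<ge>N. \<bar>a\<bar> / 2 <= (\<Sum>c\<in>grid n. \<bar>\<Sum>e\<in>cedges c. Om (vtx n (fst e)) (vtx n (snd e))\<bar>))"
  show "\<exists>p\<in>?fr. \<exists>p'\<in>?fr. h p > zA & Im (g p) < 0 &
            h p' > zA & Im (g p') > 0 & path_component {q \<in> unit_square. h q > zA - eps} p p'"
  proof (rule ccontr)
    assume no: "\<not> ?thesis"
    have hfr: "continuous_on ?fr h" using h frontier_square_subset continuous_on_subset by blast
    have cRe: "continuous_on ?fr (%q. Re (g q))" using g(1) by (intro continuous_intros)
    have K: "compact {q \<in> ?fr. Re (g q) = 0}"
      by (intro compact_Collect_closed compact_frontier_square
          continuous_closed_preimage_constant[OF cRe] compact_imp_closed)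
    \<comment> \<open>Frontier points with Re g = 0 lie above zA, by compactness with a margin m;
      \<open>eta\<close> is then chosen so that points with small Re g keep half of this
      margin.\<close>
    obtain m where m: "m > 0" "!!q. q \<in> ?fr ==> Re (g q) = 0 ==> m <= h q - zA"
    proof (rule inf_positive_compact[OF K])
      show "continuous_on {q \<in> ?fr. Re (g q) = 0} (%q. h q - zA)"
        by (intro continuous_intros continuous_on_subset[OF hfr]) auto
      show "0 < h q - zA" if "q \<in> {q \<in> ?fr. Re (g q) = 0}" for q using bd[of q] that by force
    qed auto
    have K2: "compact {q \<in> ?fr. h q <= zA + m/2}"
      by (intro compact_Collect_closed compact_frontier_square
          continuous_on_closed_Collect_le[OF hfr continuous_on_const] compact_imp_closed)
    obtain eta0 where eta0: "eta0 > 0" "!!q. q \<in> ?fr ==> h q <= zA + m/2 ==> eta0 <= \<bar>Re (g q)\<bar>"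
    proof (rule inf_positive_compact[OF K2])
      show "continuous_on {q \<in> ?fr. h q <= zA + m/2} (%q. \<bar>Re (g q)\<bar>)"
        by (intro continuous_intros continuous_on_subset[OF cRe]) (use continuous_on_subset[OF cRe] in auto)
      show "0 < \<bar>Re (g q)\<bar>" if "q \<in> {q \<in> ?fr. h q <= zA + m/2}" for q
        using m(1) m(2)[of q] that by fastforce
    qed auto
    define eta where "eta = min eta0 (1/2)"
    have eta: "eta > 0" "eta <= 1/2" "!!q. q \<in> ?fr ==> \<bar>Re (g q)\<bar> < eta ==> h q > zA + m/2"
      using eta0 by (auto simp: eta_def) (smt (verit))
    have "uniformly_continuous_on unit_square h"
      by (rule compact_uniformly_continuous[OF h compact_cbox])
    moreover have "min eps (m/2) > 0" using eps m(1) by simp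
    ultimately obtain dh where dh: "dh > 0"
      "!!x y. x \<in> unit_square ==> y \<in> unit_square ==> dist x y < dh ==> dist (h x) (h y) < min eps (m/2)"
      unfolding uniformly_continuous_on_def by metis
    have "uniformly_continuous_on ?fr g"
      by (rule compact_uniformly_continuous[OF g(1) compact_frontier_square])
    then obtain dg where dg: "dg > 0"
      "!!x y. x \<in> ?fr ==> y \<in> ?fr ==> dist x y < dg ==> dist (g x) (g y) < 1/4"
      unfolding uniformly_continuous_on_def by (metis zero_less_divide_1_iff zero_less_numeral)
    define dd where "dd = min d (min dh dg)"
    have dd: "dd > 0" using d dh dg by (simp add: dd_def)
    obtain N :: nat where N: "real N > 2 / dd" using reals_Archimedean2 by blast
    have "\<bar>a\<bar> / 2 <= (\<Sum>c\<in>grid n. \<bar>\<Sum>e\<in>cedges c. Om (vtx n (fst e)) (vtx n (snd e))\<bar>)" if nN: "n >= N" for n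
    proof -
      have "2 / dd > 0" using dd by simp
      hence n: "n > 0" and "real n > 2 / dd" using N nN by linarith+
      hence mesh: "2 / real n < dd" using dd by (simp add: field_simps)
      have close: "dist x y < d" "dist x y < dh" "dist x y < dg"
        if "x \<in> celbox n c" "y \<in> celbox n c" for x y c
        using celbox_dist[OF that n] mesh by (auto simp: dd_def)
      define V where "V = vtx n"
      \<comment> \<open>The level t avoids the values of Re g at all grid vertices, so the point
        where the lift jumps is interior to one boundary edge.\<close>
      have "infinite ({-eta<..<eta} - (%p. Re (g (V p))) ` ({..n} \<times> {..n}))"
        using eta(1) by (intro Diff_infinite_finite) auto
      then obtain t where tin: "t \<in> {-eta<..<eta} - (%p. Re (g (V p))) ` ({..n} \<times> {..n})"
        using infinite_imp_nonempty by blast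
      have t3: "Re (g (V p)) ~= t" if "fst p <= n" "snd p <= n" for p
        using tin that by (cases p) force
      have t: "- eta < t" "t < eta" "!!p. fst p <= n ==> snd p <= n ==> Re (g (V p)) ~= t"
        using tin t3 by auto
      have tt: "t^2 < 1"
        using t eta(2) by (intro abs_square_less_1[THEN iffD2]) auto
      have "Complex t (- sqrt (1 - t^2)) \<in> sphere 0 1" using tt by (simp add: cmod_def)
      then obtain q0 where q0: "q0 \<in> ?fr" "g q0 = Complex t (- sqrt (1 - t^2))"
        using g(3) by (metis imageE)
      have q0u: "q = q0" if "q \<in> ?fr" "Re (g q) = t" "Im (g q) < 0" for q
      proof -
        have "(Re (g q))^2 + (Im (g q))^2 = 1"
          using that(1) g(3) by (metis cmod_power2 imageI mem_sphere_0 power_one)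
        hence "Im (g q) = - sqrt (1 - t^2)"
          using that by (metis abs_of_neg add_diff_cancel_left' minus_minus real_sqrt_abs)
        hence "g q = g q0" using that q0 by (simp add: complex_eq_iff)
        thus ?thesis using g(2) that q0 by (meson inj_onD)
      qed
      define hot where "hot s c \<longleftrightarrow> (\<exists>e\<in>cedges c Int bdry (grid n). \<exists>v\<in>{V (fst e), V (snd e)}. h v > zA & s * Im (g v) > 0)"
        for s :: real and c
      \<comment> \<open>Neighbouring cells are linked unless their common edge is low at both ends.
        Hence an interior edge on the boundary of \<open>W\<close> is low, and the form on it is
        governed by \<open>e1\<close>.\<close>
      define R where "R = {(c, c'). c \<in> grid n & c' \<in> grid n & (\<exists>e\<in>cedges c. prod.swap e \<in> cedges c' &
          \<not> (h (V (fst e)) <= zA & h (V (snd e)) <= zA))}"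
      define W where "W = R\<^sup>* `` {c \<in> grid n. hot (-1) c}"
      have Wg: "W \<subseteq> grid n"
      proof
        fix c assume "c \<in> W"
        then obtain c0 where "c0 \<in> grid n" "(c0, c) \<in> R\<^sup>*" by (auto simp: W_def)
        from this(2,1) show "c \<in> grid n" by (induction) (auto simp: R_def)
      qed
      have fW: "finite W" using Wg finite_grid finite_subset by blast
      have inside: "celbox n c \<subseteq> {q \<in> unit_square. h q > zA - eps}"
        if "c \<in> grid n" "v \<in> celbox n c" "h v > zA" for c v
      proof
        fix q assume q: "q \<in> celbox n c"
        have "q \<in> unit_square" "v \<in> unit_square" using q that celbox_subset by blast+
        hence "dist (h q) (h v) < eps" using dh(2) close(2)[OF q that(2)] by fastforce
        thus "q \<in> {q \<in> unit_square. h q > zA - eps}"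
          using \<open>q \<in> unit_square\<close> that(3) by (auto simp: dist_real_def)
      qed
      have cnv: "path_component S x y" if "celbox n c \<subseteq> S" "x \<in> celbox n c" "y \<in> celbox n c" for S x y c
      proof -
        have "path_connected (celbox n c)"
          by (simp add: celbox_def convex_imp_path_connected)
        thus ?thesis using that path_component_of_subset
          by (metis path_connected_component)
      qed
      \<comment> \<open>Linked cells share a high vertex, and a cell with a high vertex is small
        enough to stay above zA - eps; a chain of links up to a cell that is hot with sign 1 would
        produce the excluded path.\<close>
      have cold: "\<not> hot 1 c" if cW: "c \<in> W" for c
      proof
        assume hc: "hot 1 c"
        obtain c0 where c0: "c0 \<in> grid n" "hot (-1) c0" "(c0, c) \<in> R\<^sup>*" using cW by (auto simp: W_def)
        obtain e p where e: "e \<in> cedges c0" "e \<in> bdry (grid n)" and p: "p \<in> {V (fst e), V (snd e)}" "h p > zA" "(-1) * Im (g p) > 0"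
          using c0(2) unfolding hot_def by blast
        have p3: "Im (g p) < 0" using p(3) by simp
        have pf: "p \<in> ?fr" using bdry_segment_frontier[OF e(2) n] p(1) by (auto simp: V_def)
        have pc: "p \<in> celbox n c0" using cedges_celbox[OF e(1) n] p(1) by (auto simp: V_def)
        have "c \<in> grid n & (\<exists>v\<in>celbox n c. h v > zA) &
            (\<forall>y\<in>celbox n c. path_component {q \<in> unit_square. h q > zA - eps} p y)"
          using c0(3)
        proof induction
          case base
          thus ?case using c0(1) pc p(2) inside[OF c0(1) pc p(2)] cnv by blast
        next
          case (step b c)
          then obtain e where e: "e \<in> cedges b" "prod.swap e \<in> cedges c" and cg: "c \<in> grid n"
            and hi: "h (V (fst e)) > zA | h (V (snd e)) > zA" by (force simp: R_def)
          then obtain v where v: "v \<in> {V (fst e), V (snd e)}" "h v > zA" by auto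
          have vb: "v \<in> celbox n b" and vc: "v \<in> celbox n c"
            using cedges_celbox[OF e(1) n] cedges_celbox[OF e(2) n] v(1) by (auto simp: V_def)
          have "path_component {q \<in> unit_square. h q > zA - eps} p v" using step.IH vb by blast
          moreover have "path_component {q \<in> unit_square. h q > zA - eps} v y" if "y \<in> celbox n c" for y
            using cnv[OF inside[OF cg vc v(2)] vc that] .
          ultimately show ?case using cg vc v(2) path_component_trans by blast
        qed
        moreover obtain e' p' where e': "e' \<in> cedges c" "e' \<in> bdry (grid n)"
          and p': "p' \<in> {V (fst e'), V (snd e')}" "h p' > zA" "1 * Im (g p') > 0"
          using hc unfolding hot_def by blast
        moreover have "Im (g p') > 0" using p'(3) by simp
        moreover have "p' \<in> ?fr" using bdry_segment_frontier[OF e'(2) n] p'(1) by (auto simp: V_def)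
        moreover have "p' \<in> celbox n c" using cedges_celbox[OF e'(1) n] p'(1) by (auto simp: V_def)
        ultimately show False using no pf p(2) p3 by blast
      qed
      \<comment> \<open>A lift of \<open>e1\<close> at low vertices that is prescribed on the whole
        frontier by comparing Re g with t. The two rules agree at low frontier vertices, where |Re
        g| >= eta > |t|.\<close>
      define nu where "nu p = (if V p \<in> ?fr then (if Re (g (V p)) > t then 1/2 else 0)
          else Arg (e1 (V p)) / (2 * pi))" for p
      have e1nu: "e1 (V p) = exp (2 * pi * \<i> * of_real (nu p))" if "V p \<in> unit_square" "h (V p) <= zA" for p
      proof (cases "V p \<in> ?fr")
        case True
        have b: "Re (g (V p)) ~= 0" "e1 (V p) = (if Re (g (V p)) < 0 then 1 else - 1)"
          using bd[OF True that(2)] by auto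
        have "\<bar>Re (g (V p))\<bar> >= eta" using eta(3)[OF True] that(2) m(1) by force
        hence "nu p = (if Re (g (V p)) < 0 then 0 else 1/2)" using True t b by (auto simp: nu_def)
        thus ?thesis using b by (auto simp: mult.commute)
      next
        case False
        hence "2 * pi * \<i> * of_real (nu p) = \<i> * of_real (Arg (e1 (V p)))"
          by (simp add: nu_def)
        moreover have "e1 (V p) ~= 0" using e1[OF that] by auto
        hence "e1 (V p) = exp (\<i> * of_real (Arg (e1 (V p))))"
          using Arg_eq[of "e1 (V p)"] e1[OF that] by simp
        ultimately show ?thesis by (metis (no_types))
      qed
      have edge_d: "dist (V (fst e)) (V (snd e)) < d" "V (fst e) \<in> unit_square" "V (snd e) \<in> unit_square"
        if "e \<in> cedges c" "c \<in> grid n" for e c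
        using cedges_celbox[OF that(1) n] close cedges_grid_vertex[OF that n] by (auto simp: V_def)
      have jumpq: "\<exists>q\<in>closed_segment (V (fst e)) (V (snd e)). Re (g q) = t &
            (\<forall>v\<in>closed_segment (V (fst e)) (V (snd e)). v \<in> ?fr & h v > zA & Im (g v) * Im (g q) > 0)"
        if e: "e \<in> bdry (grid n)" and q: "q \<in> closed_segment (V (fst e)) (V (snd e))" "Re (g q) = t" for e q
      proof (intro bexI[OF _ q(1)] conjI q(2) ballI)
        let ?s = "closed_segment (V (fst e)) (V (snd e))"
        obtain c where c: "c \<in> grid n" "e \<in> cedges c" using e by (auto simp: bdry_def)
        have sc: "?s \<subseteq> celbox n c" using cedges_celbox[OF c(2) n]
          by (simp add: V_def celbox_def closed_segment_subset)
        have sf: "?s \<subseteq> ?fr" using bdry_segment_frontier[OF e n] by (simp add: V_def)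
        fix v assume v: "v \<in> ?s"
        show vf: "v \<in> ?fr" using v sf by blast
        have qf: "q \<in> ?fr" using q sf by blast
        have "h q > zA + m/2" using eta(3)[OF qf] q(2) t by auto
        moreover have "dist (h q) (h v) < min eps (m/2)"
          using dh(2)[of q v] close(2)[of q c v] q v sc frontier_square_subset vf qf by blast
        ultimately show "h v > zA" unfolding dist_real_def by linarith
        have "dist (g q) (g v) < 1/4" using dg(2)[OF qf vf] close(3)[of q c v] q v sc by blast
        hence "\<bar>Im (g q) - Im (g v)\<bar> < 1/4"
          using abs_Im_le_cmod[of "g q - g v"] by (simp add: dist_norm)
        moreover have "\<bar>Im (g q)\<bar> > 1/2"
        proof -
          have "(Re (g q))^2 + (Im (g q))^2 = 1"
            using qf g(3) by (metis cmod_power2 imageI mem_sphere_0 power_one)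
          moreover have "t^2 <= (1/2)^2" using t eta(2) by (intro power2_le_iff_abs_le[THEN iffD2]) auto
          ultimately have "(1/2)^2 < (Im (g q))^2" using q(2) by (simp add: power2_eq_square)
          thus ?thesis using power2_less_imp_less[of "1/2" "\<bar>Im (g q)\<bar>"] by simp
        qed
        ultimately show "Im (g v) * Im (g q) > 0"
          by (auto simp: zero_less_mult_iff abs_if split: if_splits)
      qed
      obtain e0 where e0: "e0 \<in> bdry (grid n)" "q0 \<in> closed_segment (V (fst e0)) (V (snd e0))"
        using frontier_covered[OF q0(1) n] unfolding V_def by blast
      have q0t: "Re (g q0) = t" "Im (g q0) < 0" using q0(2) tt by auto
      have q0v: "q0 ~= V p" if "fst p <= n" "snd p <= n" for p using t(3)[OF that] q0t by auto
      have s0: "v \<in> ?fr & h v > zA & Im (g v) < 0" if "v \<in> closed_segment (V (fst e0)) (V (snd e0))" for v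
      proof -
        obtain q where q: "q \<in> closed_segment (V (fst e0)) (V (snd e0))" "Re (g q) = t"
          "\<forall>v\<in>closed_segment (V (fst e0)) (V (snd e0)). v \<in> ?fr & h v > zA & Im (g v) * Im (g q) > 0"
          using jumpq[OF e0 q0t(1)] by blast
        hence "Im (g q) < 0" using e0(2) q0t(2) by (metis mult_less_cancel_right2 not_less_iff_gr_or_eq zero_less_mult_iff)
        thus ?thesis using q(3) that by (metis zero_less_mult_iff not_less_iff_gr_or_eq)
      qed
      have e0B: "e0 \<in> bdry W Int bdry (grid n)"
      proof -
        obtain c where c: "c \<in> grid n" "e0 \<in> cedges c" using e0(1) by (auto simp: bdry_def)
        have "hot (-1) c" unfolding hot_def using c(2) e0(1) s0[of "V (fst e0)"] by (auto intro!: bexI[of _ e0])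
        hence "c \<in> W" using c(1) by (auto simp: W_def)
        thus ?thesis using e0(1) c(2) Wg by (auto simp: bdry_def)
      qed
      have jump: "\<bar>nu (snd e0) - nu (fst e0)\<bar> = 1/2"
      proof -
        define f where "f s = Re (g (linepath (V (fst e0)) (V (snd e0)) s))" for s
        have im: "linepath (V (fst e0)) (V (snd e0)) ` {0..1} = closed_segment (V (fst e0)) (V (snd e0))"
          using path_image_linepath by (auto simp: path_image_def)
        have ne: "V (fst e0) ~= V (snd e0)"
          using e0(1) n unfolding bdry_grid V_def by (auto simp: vec_eq_iff forall_2 divide_simps)
        have "continuous_on {0..1} f" unfolding f_def
          by (rule continuous_on_compose2[OF cRe]) (use im s0 in \<open>auto intro!: continuous_intros\<close>)
        \<comment> \<open>Along \<open>e0\<close> the imaginary part of g is negative, so on the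
          unit circle Re g determines g; the continuous function f is injective, hence monotone, and
          crosses t once.\<close>
        moreover have "inj_on f {0..1}"
        proof (rule inj_onI)
          fix s s' assume s: "s \<in> {0..1::real}" "s' \<in> {0..1}" "f s = f s'"
          let ?x = "linepath (V (fst e0)) (V (snd e0)) s" and ?y = "linepath (V (fst e0)) (V (snd e0)) s'"
          have xy: "?x \<in> ?fr" "Im (g ?x) < 0" "?y \<in> ?fr" "Im (g ?y) < 0" using s0 s im by blast+
          have "(Re (g ?x))^2 + (Im (g ?x))^2 = 1" "(Re (g ?y))^2 + (Im (g ?y))^2 = 1"
            using xy g(3) by (metis cmod_power2 imageI mem_sphere_0 power_one)+
          hence "(Im (g ?x))^2 = (Im (g ?y))^2" using s(3) by (simp add: f_def)
          hence "g ?x = g ?y" using s(3) xy by (auto simp: f_def complex_eq_iff power2_eq_iff)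
          hence "?x = ?y" using g(2) xy by (meson inj_onD)
          moreover have "?x - ?y = (s - s') *\<^sub>R (V (snd e0) - V (fst e0))"
            by (simp add: linepath_def algebra_simps)
          ultimately show "s = s'" using ne by simp
        qed
        moreover obtain s where s: "s \<in> {0..1}" "q0 = linepath (V (fst e0)) (V (snd e0)) s"
          using e0(2) im by (metis imageE)
        moreover have fl: "fst (fst e0) <= n" "snd (fst e0) <= n" "fst (snd e0) <= n" "snd (snd e0) <= n"
          using e0(1) unfolding bdry_grid by auto
        moreover have "s ~= 0" "s ~= 1" using q0v[OF fl(1,2)] q0v[OF fl(3,4)] s by (auto simp: linepath_def)
        ultimately have "(f 0 < f s & f s < f 1) | (f 1 < f s & f s < f 0)"
          by (intro continuous_inj_imp_mono) auto
        moreover have "f s = t" using s q0t by (simp add: f_def)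
        moreover have "f 0 = Re (g (V (fst e0)))" "f 1 = Re (g (V (snd e0)))"
          by (simp_all add: f_def linepath_def)
        moreover have "V (fst e0) \<in> ?fr" "V (snd e0) \<in> ?fr" using s0 by auto
        ultimately show ?thesis by (auto simp: nu_def)
      qed
      have uniq: "e = e0" if e: "e \<in> bdry W Int bdry (grid n)" "nu (snd e) ~= nu (fst e)" for e
      proof -
        have sf: "closed_segment (V (fst e)) (V (snd e)) \<subseteq> ?fr" using bdry_segment_frontier[of e n] e n by (simp add: V_def)
        have "V (fst e) \<in> ?fr" "V (snd e) \<in> ?fr" using sf by auto
        hence "(Re (g (V (fst e))) <= t & t <= Re (g (V (snd e)))) | (Re (g (V (snd e))) <= t & t <= Re (g (V (fst e))))"
          using e(2) by (auto simp: nu_def split: if_splits)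
        moreover have "connected ((%q. Re (g q)) ` closed_segment (V (fst e)) (V (snd e)))"
          using sf by (intro connected_continuous_image continuous_on_subset[OF cRe]) auto
        ultimately have "t \<in> (%q. Re (g q)) ` closed_segment (V (fst e)) (V (snd e))"
          by (meson connected_contains_Icc atLeastAtMost_iff ends_in_segment imageI subsetD)
        then obtain q where q: "q \<in> closed_segment (V (fst e)) (V (snd e))" "Re (g q) = t" by auto
        obtain q' where q': "q' \<in> closed_segment (V (fst e)) (V (snd e))" "Re (g q') = t"
          "\<forall>v\<in>closed_segment (V (fst e)) (V (snd e)). v \<in> ?fr & h v > zA & Im (g v) * Im (g q') > 0"
          using jumpq[OF _ q] e by blast
        obtain c where c: "c \<in> W" "e \<in> cedges c" using e by (auto simp: bdry_def)
        have "Im (g q') < 0"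
        proof (rule ccontr)
          assume "\<not> Im (g q') < 0"
          hence "Im (g (V (fst e))) > 0" "h (V (fst e)) > zA"
            using q'(3) by (auto simp: zero_less_mult_iff)
          hence "hot 1 c" unfolding hot_def using c e by auto
          thus False using cold c by blast
        qed
        hence "q' = q0" using q0u q' sf by blast
        thus ?thesis
          using bdry_edge_unique[OF n _ _ e0(1) e0(2)[unfolded V_def], of e] e q'(1) q0v by (auto simp: V_def)
      qed
      have "\<bar>a\<bar> / 2 <= (\<Sum>c\<in>W. \<bar>\<Sum>e\<in>cedges c. Om (V (fst e)) (V (snd e))\<bar>)"
      proof (rule half_integer_flux[OF fW _ _ _ e0B jump uniq])
        fix e assume "e \<in> \<Union>(cedges ` W)"
        then obtain c where "c \<in> grid n" "e \<in> cedges c" using Wg by blast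
        thus "Om (V (fst (prod.swap e))) (V (snd (prod.swap e))) = - Om (V (fst e)) (V (snd e))"
          using anti edge_d by simp
      next
        fix e assume e: "e \<in> bdry W Int bdry (grid n)"
        then obtain c where "c \<in> grid n" "e \<in> cedges c" by (auto simp: bdry_def)
        moreover have "V (fst e) \<in> ?fr" "V (snd e) \<in> ?fr"
          using bdry_segment_frontier[of e n] e n by (auto simp: V_def)
        ultimately show "Om (V (fst e)) (V (snd e)) = 0" using fr0 edge_d by blast
      next
        fix e assume e: "e \<in> bdry W - bdry (grid n)"
        then obtain c where c: "c \<in> W" "e \<in> cedges c" by (auto simp: bdry_def)
        then obtain c' where c': "c' \<in> grid n" "prod.swap e \<in> cedges c'" using e Wg by (auto simp: bdry_def)
        have "c' \<notin> W" using e c' by (auto simp: bdry_def)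
        hence "(c, c') \<notin> R" using c(1) by (auto simp: W_def intro: rtrancl_into_rtrancl)
        hence lo: "h (V (fst e)) <= zA" "h (V (snd e)) <= zA" using c c' Wg by (auto simp: R_def)
        have ed: "dist (V (fst e)) (V (snd e)) < d" "V (fst e) \<in> unit_square" "V (snd e) \<in> unit_square"
          using edge_d[OF c(2)] c(1) Wg by auto
        have "Om (V (fst e)) (V (snd e)) = a * inc e1 (V (fst e)) (V (snd e))"
          using low ed lo by blast
        moreover obtain k :: int where "inc e1 (V (fst e)) (V (snd e)) = nu (snd e) - nu (fst e) + k"
          using inc_mod[of e1 "V (fst e)" "nu (fst e)" "V (snd e)" "nu (snd e)"]
            e1nu[OF ed(2) lo(1)] e1nu[OF ed(3) lo(2)] by blast
        ultimately show "\<exists>k::int. Om (V (fst e)) (V (snd e)) = a * (nu (snd e) - nu (fst e) + k)"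
          by auto
      qed
      also have "\<dots> <= (\<Sum>c\<in>grid n. \<bar>\<Sum>e\<in>cedges c. Om (V (fst e)) (V (snd e))\<bar>)"
        by (rule sum_mono2) (use Wg in auto)
      finally show ?thesis by (simp add: V_def)
    qed
    thus False using nopath by blast
  qed
qed

section \<open>Crossing paths in a square\<close>

definition ctr :: "real^2" where "ctr = vector [1/2, 1/2]"

lemma ctr_nth [simp]: "ctr $ 1 = 1/2" "ctr $ 2 = 1/2" by (auto simp: ctr_def)

text \<open>The maximum norm around the centre, scaled so that the frontier of the square is its
  unit sphere.\<close>

definition sqn :: "real^2 => real" where
  "sqn q = 2 * max \<bar>q$1 - 1/2\<bar> \<bar>q$2 - 1/2\<bar>"

definition rproj :: "real^2 => real^2" where
  "rproj q = ctr + inverse (sqn q) *\<^sub>R (q - ctr)"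

lemma sqn_pos: "q ~= ctr ==> sqn q > 0"
  by (auto simp: sqn_def vec_eq_iff forall_2 max_def)

lemma sqn_ctr [simp]: "sqn ctr = 0" by (simp add: sqn_def)

lemma sqn_le_1: "q \<in> unit_square \<longleftrightarrow> sqn q <= 1"
  unfolding mem_unit_square sqn_def max_def by (auto simp: abs_if split: if_splits)

lemma sqn_eq_1: "q \<in> frontier unit_square \<longleftrightarrow> sqn q = 1"
  unfolding mem_frontier_square mem_unit_square sqn_def max_def by (auto simp: abs_if)

lemma sqn_scale:
  assumes "c >= 0"
  shows "sqn (ctr + c *\<^sub>R v) = c * sqn (ctr + v)"
proof -
  have "\<bar>c * a\<bar> = c * \<bar>a\<bar>" for a :: real using assms by (simp add: abs_mult)
  moreover have "c * max a b = max (c * a) (c * b)" for a b :: real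
    using assms by (simp add: max_mult_distrib_left)
  ultimately show ?thesis by (simp add: sqn_def)
qed

lemma rproj_frontier: "q ~= ctr ==> rproj q \<in> frontier unit_square"
  unfolding sqn_eq_1 rproj_def using sqn_pos[of q] sqn_scale[of "inverse (sqn q)" "q - ctr"] by simp

lemma rproj_eq: "q = ctr + sqn q *\<^sub>R (rproj q - ctr)"
  using sqn_pos[of q] by (cases "q = ctr") (auto simp: rproj_def)

lemma rproj_frontier_id: "q \<in> frontier unit_square ==> rproj q = q"
  by (simp add: sqn_eq_1 rproj_def)

lemma continuous_sqn: "continuous_on S sqn"
  unfolding sqn_def by (intro continuous_intros)

text \<open>The cone over g, as in the Alexander trick: H preserves the radius, and on each radius
  injectivity reduces to that of g on the frontier.\<close>

lemma radial_extension:
  fixes g :: "real^2 => complex"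
  assumes g: "continuous_on (frontier unit_square) g" "inj_on g (frontier unit_square)"
      "g ` frontier unit_square \<subseteq> sphere 0 1"
  obtains H where "continuous_on unit_square H" "inj_on H unit_square"
    "H ` unit_square \<subseteq> cball 0 1" "!!q. q \<in> frontier unit_square ==> H q = g q"
proof -
  define H where "H q = (if q = ctr then 0 else of_real (sqn q) * g (rproj q))" for q
  have ng: "cmod (g (rproj q)) = 1" if "q ~= ctr" for q
    using g(3) rproj_frontier[OF that] by (metis imageI mem_sphere_0 subsetD)
  have nH: "cmod (H q) = sqn q" for q
    using ng[of q] sqn_pos[of q] by (auto simp: H_def norm_mult)
  have "continuous (at q within unit_square) H" for q
  proof (cases "q = ctr")
    case True
    have "(sqn \<longlongrightarrow> sqn ctr) (at ctr within unit_square)"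
      using continuous_sqn[of UNIV] by (metis continuous_on_def continuous_within_subset UNIV_I subset_UNIV tendsto_within_subset)
    hence "((%x. cmod (H x)) \<longlongrightarrow> 0) (at ctr within unit_square)" by (simp add: nH)
    hence "(H \<longlongrightarrow> 0) (at ctr within unit_square)" by (rule tendsto_norm_zero_cancel)
    thus ?thesis using True by (simp add: continuous_within H_def)
  next
    case False
    have c: "continuous_on (- {ctr}) (%q. of_real (sqn q) * g (rproj q))"
    proof (intro continuous_on_mult continuous_on_of_real continuous_sqn)
      show "continuous_on (- {ctr}) (%q. g (rproj q))"
      proof (rule continuous_on_compose2[OF g(1)])
        show "continuous_on (- {ctr}) rproj" unfolding rproj_def
          by (intro continuous_intros continuous_sqn) (use sqn_pos in force)
      qed (use rproj_frontier in auto)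
    qed
    have "continuous_on (- {ctr}) H"
      by (rule continuous_on_eq[OF c]) (auto simp: H_def)
    hence "continuous (at q) H"
      using False by (simp add: continuous_on_eq_continuous_at open_Compl)
    thus ?thesis by (rule continuous_at_imp_continuous_within)
  qed
  hence "continuous_on unit_square H" by (simp add: continuous_on_eq_continuous_within)
  moreover have "inj_on H unit_square"
  proof (rule inj_onI)
    fix p q assume e: "H p = H q"
    hence s: "sqn p = sqn q" using nH by metis
    show "p = q"
    proof (cases "p = ctr | q = ctr")
      case True
      hence "sqn p = 0" "sqn q = 0" using s by auto
      thus ?thesis using sqn_pos by (metis less_irrefl)
    next
      case False
      hence "g (rproj p) = g (rproj q)" using e s sqn_pos[of p] by (simp add: H_def)
      hence "rproj p = rproj q" using g(2) rproj_frontier False by (meson inj_onD)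
      thus ?thesis using rproj_eq[of p] rproj_eq[of q] s by simp
    qed
  qed
  moreover have "H ` unit_square \<subseteq> cball 0 1" using nH sqn_le_1 by auto
  moreover have "H q = g q" if "q \<in> frontier unit_square" for q
    using that rproj_frontier_id[OF that] by (auto simp: H_def sqn_eq_1)
  ultimately show ?thesis using that by blast
qed

definition c2v :: "complex => real^2" where "c2v w = vector [Re w, Im w]"

lemma c2v_nth [simp]: "c2v w $ 1 = Re w" "c2v w $ 2 = Im w" by (auto simp: c2v_def)

lemma c2v_eq_iff [simp]: "c2v w = c2v z \<longleftrightarrow> w = z"
  by (auto simp: vec_eq_iff forall_2 complex_eq_iff)

lemma continuous_on_c2v: "continuous_on S c2v"
proof -
  have "bounded_linear c2v"
    unfolding linear_conv_bounded_linear[symmetric] by (rule linearI) (auto simp: vec_eq_iff forall_2)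
  thus ?thesis by (rule linear_continuous_on)
qed

text \<open>Extending one path horizontally and the other one vertically out of the disc brings the
  end points onto the sides of a box; the ordering of the end points on the circle keeps the
  extensions disjoint.\<close>

lemma disc_paths_cross:
  fixes p r :: "real => complex"
  assumes p: "path p" "path_image p \<subseteq> cball 0 1" "cmod (pathstart p) = 1" "cmod (pathfinish p) = 1"
      "Im (pathstart p) < 0" "Im (pathfinish p) > 0"
    and r: "path r" "path_image r \<subseteq> cball 0 1" "cmod (pathstart r) = 1" "cmod (pathfinish r) = 1"
      "Re (pathstart r) < 0" "Re (pathfinish r) > 0"
    and ord: "!!a b. a \<in> {pathstart p, pathfinish p} ==> b \<in> {pathstart r, pathfinish r} ==>
       Im a * Im b > 0 ==> Re a * Re b >= 0 ==> \<bar>Re a\<bar> < \<bar>Re b\<bar>"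
  shows "path_image p Int path_image r ~= {}"
proof -
  define P where "P = linepath (Complex (Re (pathstart p)) (-2)) (pathstart p) +++ (p +++
      linepath (pathfinish p) (Complex (Re (pathfinish p)) 2))"
  define R where "R = linepath (Complex (-2) (Im (pathstart r))) (pathstart r) +++ (r +++
      linepath (pathfinish r) (Complex 2 (Im (pathfinish r))))"
  define a where "a = (vector [-2, -2] :: real^2)"
  define b where "b = (vector [2, 2] :: real^2)"
  have bd: "\<bar>Re z\<bar> <= 1" "\<bar>Im z\<bar> <= 1" if "cmod z <= 1" for z
    using that abs_Re_le_cmod[of z] abs_Im_le_cmod[of z] by linarith+
  have cr: "\<bar>x\<bar> <= 2 & \<bar>y\<bar> <= 2 ==> c2v (Complex x y) \<in> cbox a b" for x y
    by (auto simp: mem_box_cart forall_2 a_def b_def)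
  have inbox: "c2v z \<in> cbox a b" if "\<bar>Re z\<bar> <= 2" "\<bar>Im z\<bar> <= 2" for z
    using cr[of "Re z" "Im z"] that by simp
  have vert: "Re z = Re w & Im z \<in> closed_segment (Im w) y" if "z \<in> closed_segment w (Complex (Re w) y)" for z w y
    using that by (auto simp: in_segment) (simp add: algebra_simps)
  have horiz: "Im z = Im w & Re z \<in> closed_segment (Re w) x" if "z \<in> closed_segment w (Complex x (Im w))" for z w x
    using that by (auto simp: in_segment) (simp add: algebra_simps)
  have pp: "path P" "path R" using p(1) r(1) by (auto simp: P_def R_def)
  have PI: "path_image P = closed_segment (pathstart p) (Complex (Re (pathstart p)) (-2)) \<union> path_image p \<union>
      closed_segment (pathfinish p) (Complex (Re (pathfinish p)) 2)"
    using p(1) by (auto simp: P_def path_image_join closed_segment_commute)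
  have RI: "path_image R = closed_segment (pathstart r) (Complex (-2) (Im (pathstart r))) \<union> path_image r \<union>
      closed_segment (pathfinish r) (Complex 2 (Im (pathfinish r)))"
    using r(1) by (auto simp: R_def path_image_join closed_segment_commute)
  have p1: "cmod z <= 1" if "z \<in> path_image p" for z using p(2) that by auto
  have r1: "cmod z <= 1" if "z \<in> path_image r" for z using r(2) that by auto
  have PB: "\<bar>Re z\<bar> <= 2 & \<bar>Im z\<bar> <= 2" if zin: "z \<in> path_image P" for z
  proof -
    consider "z \<in> path_image p" | "z \<in> closed_segment (pathstart p) (Complex (Re (pathstart p)) (-2))"
      | "z \<in> closed_segment (pathfinish p) (Complex (Re (pathfinish p)) 2)" using zin unfolding PI by blast
    thus ?thesis
    proof cases
      case 1 thus ?thesis using bd[OF p1[OF 1]] by auto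
    next
      case 2 thus ?thesis using vert[OF 2] bd[of "pathstart p"] p(3) by (auto simp: closed_segment_eq_real_ivl split: if_splits)
    next
      case 3 thus ?thesis using vert[OF 3] bd[of "pathfinish p"] p(4) by (auto simp: closed_segment_eq_real_ivl split: if_splits)
    qed
  qed
  have RB: "\<bar>Re z\<bar> <= 2 & \<bar>Im z\<bar> <= 2" if zin: "z \<in> path_image R" for z
  proof -
    consider "z \<in> path_image r" | "z \<in> closed_segment (pathstart r) (Complex (-2) (Im (pathstart r)))"
      | "z \<in> closed_segment (pathfinish r) (Complex 2 (Im (pathfinish r)))" using zin unfolding RI by blast
    thus ?thesis
    proof cases
      case 1 thus ?thesis using bd[OF r1[OF 1]] by auto
    next
      case 2 thus ?thesis using horiz[OF 2] bd[of "pathstart r"] r(3) by (auto simp: closed_segment_eq_real_ivl split: if_splits)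
    next
      case 3 thus ?thesis using horiz[OF 3] bd[of "pathfinish r"] r(4) by (auto simp: closed_segment_eq_real_ivl split: if_splits)
    qed
  qed
  obtain z where "z \<in> path_image (c2v \<circ> R)" "z \<in> path_image (c2v \<circ> P)"
  proof (rule fashoda[of "c2v \<circ> R" "c2v \<circ> P" a b])
    show "path (c2v \<circ> R)" "path (c2v \<circ> P)"
      using pp continuous_on_c2v by (auto intro: path_continuous_image)
    show "path_image (c2v \<circ> R) \<subseteq> cbox a b" "path_image (c2v \<circ> P) \<subseteq> cbox a b"
      using PB RB inbox by (auto simp: path_image_compose)
    show "pathstart (c2v \<circ> R) $ 1 = a $ 1" "pathfinish (c2v \<circ> R) $ 1 = b $ 1"
      "pathstart (c2v \<circ> P) $ 2 = a $ 2" "pathfinish (c2v \<circ> P) $ 2 = b $ 2"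
      by (auto simp: pathstart_compose pathfinish_compose P_def R_def a_def b_def)
  qed
  then obtain z where z: "z \<in> path_image P" "z \<in> path_image R"
    by (auto simp: path_image_compose)
  have out_v: "z = w" if "cmod z <= 1" "cmod w = 1" "Re z = Re w" "\<bar>Im w\<bar> <= \<bar>Im z\<bar>" "Im w * Im z > 0" for z w
  proof -
    have "(Re z)^2 + (Im z)^2 <= 1" "(Re w)^2 + (Im w)^2 = 1"
      using that(1,2) by (metis cmod_power2 norm_ge_zero power_le_one, metis cmod_power2 power_one)
    hence "(Im z)^2 <= (Im w)^2" using that(3) by simp
    hence "\<bar>Im z\<bar> <= \<bar>Im w\<bar>" by (simp add: abs_le_square_iff)
    hence "\<bar>Im z\<bar> = \<bar>Im w\<bar>" using that by simp
    thus ?thesis using that(3,5) by (auto simp: complex_eq_iff abs_if zero_less_mult_iff split: if_splits)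
  qed
  have out_h: "z = w" if "cmod z <= 1" "cmod w = 1" "Im z = Im w" "\<bar>Re w\<bar> <= \<bar>Re z\<bar>" "Re w * Re z > 0" for z w
  proof -
    have "(Re z)^2 + (Im z)^2 <= 1" "(Re w)^2 + (Im w)^2 = 1"
      using that(1,2) by (metis cmod_power2 norm_ge_zero power_le_one, metis cmod_power2 power_one)
    hence "(Re z)^2 <= (Re w)^2" using that(3) by simp
    hence "\<bar>Re z\<bar> <= \<bar>Re w\<bar>" by (simp add: abs_le_square_iff)
    hence "\<bar>Re z\<bar> = \<bar>Re w\<bar>" using that by simp
    thus ?thesis using that(3,5) by (auto simp: complex_eq_iff abs_if zero_less_mult_iff split: if_splits)
  qed
  have zP: "z \<in> path_image p | (\<exists>w\<in>{pathstart p, pathfinish p}. Re z = Re w & Im w * Im z > 0 & \<bar>Im w\<bar> <= \<bar>Im z\<bar>)"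
  proof -
    have "Re z = Re (pathstart p) & Im (pathstart p) * Im z > 0 & \<bar>Im (pathstart p)\<bar> <= \<bar>Im z\<bar>"
      if "z \<in> closed_segment (pathstart p) (Complex (Re (pathstart p)) (-2))"
      using vert[OF that] p(5) bd[of "pathstart p"] p(3)
      by (auto simp: closed_segment_eq_real_ivl zero_less_mult_iff split: if_splits)
    moreover have "Re z = Re (pathfinish p) & Im (pathfinish p) * Im z > 0 & \<bar>Im (pathfinish p)\<bar> <= \<bar>Im z\<bar>"
      if "z \<in> closed_segment (pathfinish p) (Complex (Re (pathfinish p)) 2)"
      using vert[OF that] p(6) bd[of "pathfinish p"] p(4)
      by (auto simp: closed_segment_eq_real_ivl zero_less_mult_iff split: if_splits)
    ultimately show ?thesis using z(1) unfolding PI by blast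
  qed
  have zR: "z \<in> path_image r | (\<exists>w\<in>{pathstart r, pathfinish r}. Im z = Im w & Re w * Re z > 0 & \<bar>Re w\<bar> <= \<bar>Re z\<bar>)"
  proof -
    have "Im z = Im (pathstart r) & Re (pathstart r) * Re z > 0 & \<bar>Re (pathstart r)\<bar> <= \<bar>Re z\<bar>"
      if "z \<in> closed_segment (pathstart r) (Complex (-2) (Im (pathstart r)))"
      using horiz[OF that] r(5) bd[of "pathstart r"] r(3)
      by (auto simp: closed_segment_eq_real_ivl zero_less_mult_iff split: if_splits)
    moreover have "Im z = Im (pathfinish r) & Re (pathfinish r) * Re z > 0 & \<bar>Re (pathfinish r)\<bar> <= \<bar>Re z\<bar>"
      if "z \<in> closed_segment (pathfinish r) (Complex 2 (Im (pathfinish r)))"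
      using horiz[OF that] r(6) bd[of "pathfinish r"] r(4)
      by (auto simp: closed_segment_eq_real_ivl zero_less_mult_iff split: if_splits)
    ultimately show ?thesis using z(2) unfolding RI by blast
  qed
  show ?thesis
  proof (cases "z \<in> path_image p")
    case True
    show ?thesis
    proof (cases "z \<in> path_image r")
      case False
      then obtain w where w: "w \<in> {pathstart r, pathfinish r}" "Im z = Im w" "Re w * Re z > 0" "\<bar>Re w\<bar> <= \<bar>Re z\<bar>"
        using zR by blast
      have "z = w" by (rule out_h[OF p1[OF True] _ w(2,4,3)]) (use w(1) r(3,4) in auto)
      hence "z \<in> path_image r" using w(1) by auto
      thus ?thesis using False by blast
    qed (use True in blast)
  next
    case False
    then obtain w where w: "w \<in> {pathstart p, pathfinish p}" "Re z = Re w" "Im w * Im z > 0" "\<bar>Im w\<bar> <= \<bar>Im z\<bar>"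
      using zP by blast
    have nw: "cmod w = 1" using w(1) p(3,4) by auto
    show ?thesis
    proof (cases "z \<in> path_image r")
      case True
      have "z = w" by (rule out_v[OF r1[OF True] nw w(2,4,3)])
      hence "z \<in> path_image p" using w(1) by auto
      thus ?thesis using False by blast
    next
      case F2: False
      then obtain v where v: "v \<in> {pathstart r, pathfinish r}" "Im z = Im v" "Re v * Re z > 0" "\<bar>Re v\<bar> <= \<bar>Re z\<bar>"
        using zR by blast
      \<comment> \<open>The last possibility is that two added segments cross each other at z. Then
        Re z = Re w and Im z = Im v with signs that make \<open>ord\<close> applicable, against |Re
        v| <= |Re z|.\<close>
      have "\<bar>Re w\<bar> < \<bar>Re v\<bar>"
        by (rule ord[OF w(1) v(1)]) (use w v in \<open>auto simp: mult.commute less_imp_le\<close>)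
      thus ?thesis using w(2) v(4) by simp
    qed
  qed
qed

lemma square_paths_cross:
  fixes g :: "real^2 => complex" and h :: "real^2 => real"
  assumes g: "continuous_on (frontier unit_square) g" "inj_on g (frontier unit_square)"
      "g ` frontier unit_square \<subseteq> sphere 0 1"
    and p: "p \<in> frontier unit_square" "p' \<in> frontier unit_square" "Im (g p) < 0" "Im (g p') > 0"
      "path_component A p p'" "A \<subseteq> unit_square"
    and r: "r \<in> frontier unit_square" "r' \<in> frontier unit_square" "Re (g r) < 0" "Re (g r') > 0"
      "path_component B r r'" "B \<subseteq> unit_square"
    and disj: "A Int B = {}"
    and ord: "!!a b. a \<in> {p, p'} ==> b \<in> {r, r'} ==> Im (g a) * Im (g b) > 0 ==>
        Re (g a) * Re (g b) >= 0 ==> \<bar>Re (g a)\<bar> < \<bar>Re (g b)\<bar>"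
  shows False
proof -
  obtain H where H: "continuous_on unit_square H" "inj_on H unit_square"
    "H ` unit_square \<subseteq> cball 0 1" "!!q. q \<in> frontier unit_square ==> H q = g q"
    using radial_extension[OF g] by blast
  obtain P where P: "path P" "path_image P \<subseteq> A" "pathstart P = p" "pathfinish P = p'"
    using p(5) unfolding path_component_def by blast
  obtain R where R: "path R" "path_image R \<subseteq> B" "pathstart R = r" "pathfinish R = r'"
    using r(5) unfolding path_component_def by blast
  have nz: "cmod (g q) = 1" if "q \<in> frontier unit_square" for q using g(3) that by auto
  have "path_image (H \<circ> P) Int path_image (H \<circ> R) ~= {}"
  proof (rule disc_paths_cross)
    show "path (H \<circ> P)" "path (H \<circ> R)"
      using P(1,2) R(1,2) p(6) r(6) by (auto intro!: path_continuous_image continuous_on_subset[OF H(1)])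
    show "path_image (H \<circ> P) \<subseteq> cball 0 1" "path_image (H \<circ> R) \<subseteq> cball 0 1"
      using P(2) R(2) p(6) r(6) H(3) unfolding path_image_compose by blast+
    show "\<bar>Re a\<bar> < \<bar>Re b\<bar>" if ab: "a \<in> {pathstart (H \<circ> P), pathfinish (H \<circ> P)}"
      "b \<in> {pathstart (H \<circ> R), pathfinish (H \<circ> R)}" "Im a * Im b > 0" "Re a * Re b >= 0" for a b
    proof -
      obtain x y where "x \<in> {p, p'}" "y \<in> {r, r'}" "a = g x" "b = g y"
        using ab(1,2) P(3,4) R(3,4) H(4) p(1,2) r(1,2)
        by (auto simp: pathstart_compose pathfinish_compose)
      thus ?thesis using ord ab(3,4) by blast
    qed
  qed (use P(3,4) R(3,4) H(4) p r nz in \<open>auto simp: pathstart_compose pathfinish_compose\<close>)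
  then obtain x y where xy: "x \<in> path_image P" "y \<in> path_image R" "H x = H y"
    unfolding path_image_compose by auto
  hence "x = y" using H(2) P(2) R(2) p(6) r(6) by (meson inj_onD subsetD)
  thus False using xy P(2) R(2) disj by blast
qed

section \<open>Increments of circle-valued functions up to exact terms\<close>

text \<open>Relative discrete cohomology: two functions of nearby pairs that differ by the
  coboundary of a continuous E vanishing on Z. With the frontier of the square as Z, correcting by E
  does not disturb boundary values.\<close>

definition coh :: "'a::metric_space set => 'a set => ('a => 'a => real) => ('a => 'a => real) => bool" where
  "coh S Z c c' \<longleftrightarrow> (\<exists>E. continuous_on S E & (\<forall>q\<in>S\<inter>Z. E q = 0) &
     (\<exists>d>0. \<forall>q\<in>S. \<forall>q'\<in>S. dist q q' < d --> c q q' = c' q q' + E q' - E q))"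

lemma coh_trans:
  assumes "coh S Z a b" "coh S Z b c"
  shows "coh S Z a c"
proof -
  obtain E d where E: "continuous_on S E" "\<forall>q\<in>S\<inter>Z. E q = 0" "d > 0"
    "\<forall>q\<in>S. \<forall>q'\<in>S. dist q q' < d --> a q q' = b q q' + E q' - E q" using assms(1) unfolding coh_def by blast
  obtain E' d' where E': "continuous_on S E'" "\<forall>q\<in>S\<inter>Z. E' q = 0" "d' > 0"
    "\<forall>q\<in>S. \<forall>q'\<in>S. dist q q' < d' --> b q q' = c q q' + E' q' - E' q" using assms(2) unfolding coh_def by blast
  have "a q q' = c q q' + (E q' + E' q') - (E q + E' q)" if "q \<in> S" "q' \<in> S" "dist q q' < min d d'" for q q'
    using E(4) E'(4) that by simp
  thus ?thesis unfolding coh_def using E E'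
    by (intro exI[of _ "%q. E q + E' q"] conjI exI[of _ "min d d'"]) (auto intro: continuous_intros)
qed

lemma coh_linear:
  assumes "coh S Z a a'" "coh S Z b b'"
  shows "coh S Z (%q q'. x * a q q' + y * b q q') (%q q'. x * a' q q' + y * b' q q')"
proof -
  obtain E d where E: "continuous_on S E" "\<forall>q\<in>S\<inter>Z. E q = 0" "d > 0"
    "\<forall>q\<in>S. \<forall>q'\<in>S. dist q q' < d --> a q q' = a' q q' + E q' - E q" using assms(1) unfolding coh_def by blast
  obtain E' d' where E': "continuous_on S E'" "\<forall>q\<in>S\<inter>Z. E' q = 0" "d' > 0"
    "\<forall>q\<in>S. \<forall>q'\<in>S. dist q q' < d' --> b q q' = b' q q' + E' q' - E' q" using assms(2) unfolding coh_def by blast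
  have "x * a q q' + y * b q q' = x * a' q q' + y * b' q q' + (x * E q' + y * E' q') - (x * E q + y * E' q)"
    if "q \<in> S" "q' \<in> S" "dist q q' < min d d'" for q q'
  proof -
    have 1: "a q q' = a' q q' + E q' - E q" "b q q' = b' q q' + E' q' - E' q" using E(4) E'(4) that by auto
    show ?thesis unfolding 1 by (simp add: algebra_simps)
  qed
  moreover have "continuous_on S (%q. x * E q + y * E' q)" using E(1) E'(1) by (intro continuous_intros)
  ultimately show ?thesis unfolding coh_def using E(2,3) E'(2,3)
    by (intro exI[of _ "%q. x * E q + y * E' q"] conjI exI[of _ "min d d'"]) auto
qed

lemma coh_refl: "coh S Z c c"
  unfolding coh_def by (intro exI[of _ "%_. 0"] conjI exI[of _ 1]) auto

lemma coh_cong: "coh S Z a b ==> (!!q q'. q \<in> S ==> q' \<in> S ==> a q q' = a' q q') ==>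
    (!!q q'. q \<in> S ==> q' \<in> S ==> b q q' = b' q q') ==> coh S Z a' b'"
  unfolding coh_def by (metis (no_types, lifting))

lemma coh_sym:
  assumes "coh S Z a b"
  shows "coh S Z b a"
proof -
  obtain E d where E: "continuous_on S E" "\<forall>q\<in>S\<inter>Z. E q = 0" "d > 0"
    "\<forall>q\<in>S. \<forall>q'\<in>S. dist q q' < d --> a q q' = b q q' + E q' - E q" using assms(1) unfolding coh_def by blast
  hence "\<forall>q\<in>S. \<forall>q'\<in>S. dist q q' < d --> b q q' = a q q' + (- E q') - (- E q)" by simp
  thus ?thesis unfolding coh_def using E
    by (intro exI[of _ "%q. - E q"] conjI exI[of _ d]) (auto intro: continuous_intros)
qed

section \<open>Small increments of circle-valued functions\<close>

definition ucirc :: "'a::metric_space set => ('a => complex) => bool" where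
  "ucirc S e \<longleftrightarrow> continuous_on S e & (\<forall>q\<in>S. cmod (e q) = 1)"

text \<open>The bound pi / 4 leaves room to add two increments, or to reverse one, within the
  principal branch.\<close>

lemma small_Arg: "\<exists>d>0. \<forall>z. cmod (z - 1) < d --> \<bar>Arg z\<bar> < pi / 4"
proof -
  have "isCont Arg 1" by (rule continuous_at_Arg) (auto simp: complex_nonpos_Reals_iff)
  hence "\<forall>e>0. \<exists>d>0. \<forall>z. dist z 1 < d --> dist (Arg z) (Arg 1) < e"
    by (simp only: continuous_at_eps_delta)
  then obtain d where "d > 0" "\<forall>z. dist z 1 < d --> dist (Arg z) (Arg 1) < pi / 4"
    using pi_gt_zero by (metis divide_pos_pos zero_less_numeral)
  thus ?thesis by (intro exI[of _ d]) (simp add: dist_norm)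
qed

lemma inc_small:
  assumes "compact S" "ucirc S e"
  shows "\<exists>d>0. \<forall>q\<in>S. \<forall>q'\<in>S. dist q q' < d --> \<bar>Arg (e q' / e q)\<bar> < pi / 4"
proof -
  obtain d0 where d0: "d0 > 0" "\<forall>z. cmod (z - 1) < d0 --> \<bar>Arg z\<bar> < pi / 4" using small_Arg by blast
  have "uniformly_continuous_on S e"
    using assms compact_uniformly_continuous unfolding ucirc_def by blast
  then obtain d where d: "d > 0" "\<forall>q\<in>S. \<forall>q'\<in>S. dist q' q < d --> dist (e q') (e q) < d0"
    unfolding uniformly_continuous_on_def using d0(1) by blast
  have "\<bar>Arg (e q' / e q)\<bar> < pi / 4" if "q \<in> S" "q' \<in> S" "dist q q' < d" for q q'
  proof -
    have n: "cmod (e q) = 1" using assms(2) that by (auto simp: ucirc_def)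
    hence "e q ~= 0" by auto
    hence "e q' / e q - 1 = (e q' - e q) / e q" by (simp add: field_simps)
    hence "cmod (e q' / e q - 1) = dist (e q') (e q)" using n by (simp add: norm_divide dist_norm)
    thus ?thesis using d0(2) d(2) that by (simp add: dist_commute)
  qed
  thus ?thesis using d(1) by blast
qed

lemma inc_swap_small:
  assumes "\<bar>Arg (e q' / e q)\<bar> < pi / 4" "cmod (e q) = 1" "cmod (e q') = 1"
  shows "inc e q' q = - inc e q q'"
proof -
  have nz: "e q ~= 0" "e q' ~= 0" using assms(2,3) by auto
  have "e q / e q' = inverse (e q' / e q)" using nz by (simp add: field_simps)
  moreover have "Arg (inverse (e q' / e q)) = - Arg (e q' / e q)"
  proof (cases "e q' / e q \<in> \<real>")
    case True
    then obtain x where x: "e q' / e q = of_real x" by (auto elim: Reals_cases)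
    have "Arg (e q' / e q) = 0" using assms(1) pi_gt_zero unfolding x Arg_of_real by (auto split: if_splits)
    thus ?thesis using True unfolding Arg_inverse by simp
  next
    case False
    thus ?thesis unfolding Arg_inverse by simp
  qed
  ultimately show ?thesis by (simp add: inc_def)
qed

lemma inc_add_small:
  assumes "\<bar>Arg (e q' / e q)\<bar> < pi / 4" "\<bar>Arg (e q'' / e q')\<bar> < pi / 4"
     "cmod (e q) = 1" "cmod (e q') = 1" "cmod (e q'') = 1"
  shows "inc e q q'' = inc e q q' + inc e q' q''"
proof -
  have nz: "e q ~= 0" "e q' ~= 0" "e q'' ~= 0" using assms(3-5) by auto
  hence "e q'' / e q = (e q' / e q) * (e q'' / e q')" by (simp add: field_simps)
  moreover have "Arg ((e q' / e q) * (e q'' / e q')) = Arg (e q' / e q) + Arg (e q'' / e q')"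
    using assms(1,2) nz by (intro Arg_times) (auto simp: abs_less_iff)
  ultimately show ?thesis by (simp add: inc_def add_divide_distrib)
qed

lemma coh_mult:
  assumes S: "compact S" and u: "ucirc S u" and v: "ucirc S v"
    and e: "!!q. q \<in> S ==> e q = c * u q * v q" and c: "c ~= 0"
  shows "coh S Z (inc e) (%q q'. inc u q q' + inc v q q')"
proof -
  obtain d where d: "d > 0" "\<forall>q\<in>S. \<forall>q'\<in>S. dist q q' < d --> \<bar>Arg (u q' / u q)\<bar> < pi / 4" using inc_small[OF S u] by blast
  obtain d' where d': "d' > 0" "\<forall>q\<in>S. \<forall>q'\<in>S. dist q q' < d' --> \<bar>Arg (v q' / v q)\<bar> < pi / 4" using inc_small[OF S v] by blast
  have "inc e q q' = inc u q q' + inc v q q'" if q: "q \<in> S" "q' \<in> S" "dist q q' < min d d'" for q q'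
  proof -
    have nz: "u q ~= 0" "u q' ~= 0" "v q ~= 0" "v q' ~= 0" using u v q by (auto simp: ucirc_def)
    have "e q' / e q = (u q' / u q) * (v q' / v q)" using e q nz c by (simp add: field_simps)
    moreover have "Arg ((u q' / u q) * (v q' / v q)) = Arg (u q' / u q) + Arg (v q' / v q)"
    proof (rule Arg_times)
      have "\<bar>Arg (u q' / u q)\<bar> < pi / 4" "\<bar>Arg (v q' / v q)\<bar> < pi / 4" using d d' q by auto
      thus "Arg (u q' / u q) + Arg (v q' / v q) \<in> {-pi<..pi}" by (auto simp: abs_less_iff)
    qed (use nz in auto)
    ultimately show ?thesis by (simp add: inc_def add_divide_distrib)
  qed
  thus ?thesis unfolding coh_def using d(1) d'(1)
    by (intro exI[of _ "%_. 0"] conjI exI[of _ "min d d'"]) auto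
qed

text \<open>Values of E at nearby points differ by less than a quarter, so the principal argument of
  the quotient of the factors is 2 pi times the exact difference of E.\<close>

lemma coh_exp:
  assumes S: "compact S" and u: "ucirc S u" and E: "continuous_on S E" "\<forall>q\<in>S\<inter>Z. E q = 0"
    and e: "!!q. q \<in> S ==> e q = u q * cis (2 * pi * E q)"
  shows "coh S Z (inc e) (inc u)"
proof -
  have v: "ucirc S (%q. cis (2 * pi * E q))" using E(1) by (auto simp: ucirc_def intro!: continuous_intros)
  have 1: "coh S Z (inc e) (%q q'. inc u q q' + inc (%q. cis (2 * pi * E q)) q q')"
    by (rule coh_mult[OF S u v, of e 1]) (simp_all add: e)
  have "uniformly_continuous_on S E" using compact_uniformly_continuous[OF E(1) S] .
  then obtain d where d: "d > 0" "\<forall>q\<in>S. \<forall>q'\<in>S. dist q' q < d --> dist (E q') (E q) < 1/4"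
    unfolding uniformly_continuous_on_def by (metis zero_less_divide_1_iff zero_less_numeral)
  have "inc (%q. cis (2 * pi * E q)) q q' = E q' - E q" if q: "q \<in> S" "q' \<in> S" "dist q q' < d" for q q'
  proof -
    have a: "\<bar>E q' - E q\<bar> < 1/4" using d(2) q by (simp add: dist_commute dist_real_def)
    have "cis (2 * pi * E q') / cis (2 * pi * E q) = cis (2 * pi * (E q' - E q))"
      by (simp add: cis_divide algebra_simps)
    moreover have "Arg (cis (2 * pi * (E q' - E q))) = 2 * pi * (E q' - E q)"
    proof (rule Arg_cis)
      have "\<bar>2 * pi * (E q' - E q)\<bar> < 2 * pi * (1/4)" using a by (simp add: abs_mult)
      thus "2 * pi * (E q' - E q) \<in> {- pi<..pi}" unfolding greaterThanAtMost_iff using pi_gt_zero by linarith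
    qed
    ultimately show ?thesis by (simp add: inc_def)
  qed
  hence "coh S Z (%q q'. inc u q q' + inc (%q. cis (2 * pi * E q)) q q') (inc u)"
    unfolding coh_def using E d(1) by (intro exI[of _ E] conjI exI[of _ d]) auto
  thus ?thesis using 1 coh_trans by blast
qed

section \<open>The double cover of the plane branched at four points\<close>

text \<open>It vanishes at the strand positions -3, -1, 1, 3 and is negative between -3 and -1 and
  between 1 and 3. A square root of \<open>phi0\<close> thus lives on the double cover branched at
  these four points. The piecewise linear shape, in place of a quartic polynomial, makes the half
  twists act on \<open>phi0\<close> by exact conjugation.\<close>

definition gx :: "real => real" where "gx x = \<bar>\<bar>x\<bar> - 2\<bar> - 1"

definition phi0 :: "complex => complex" where "phi0 w = Complex (gx (Re w)) (Im w)"

lemma phi0_sel [simp]: "Re (phi0 w) = gx (Re w)" "Im (phi0 w) = Im w" by (auto simp: phi0_def)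

lemma continuous_phi0: "continuous_on S phi0"
proof -
  have eq: "phi0 = (%w. of_real (gx (Re w)) + \<i> * of_real (Im w))" by (auto simp: phi0_def complex_eq_iff)
  show ?thesis unfolding eq gx_def by (intro continuous_intros)
qed

text \<open>For nonzero s this is a point of the circle at angle 2 pi t, taken with the sign of s:
  changing the sheet reverses the rotation. Continuity across s = 0 forces t to be 0 or 1/2 there,
  where the sine vanishes; this is the hypothesis of \<open>ucirc_ee\<close>.\<close>

definition ee :: "real => real => complex" where
  "ee s t = Complex (cos (2 * pi * t)) (sgn s * sin (2 * pi * t))"

lemma ee_nz: "s ~= 0 ==> ee s t = cis (2 * pi * (sgn s * t))"
  by (cases "s > 0") (auto simp: ee_def complex_eq_iff sgn_if)

lemma ee_0 [simp]: "ee s 0 = 1" by (simp add: ee_def complex_eq_iff)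
lemma ee_half [simp]: "ee s (1/2) = - 1" by (simp add: ee_def complex_eq_iff)
lemma ee_flip: "ee (- s) (1/2 - t) = - ee s t"
proof -
  have "2 * pi * (1/2 - t) = pi - 2 * pi * t" by (simp add: algebra_simps)
  thus ?thesis by (simp add: ee_def complex_eq_iff)
qed

lemma continuous_on_sgn_mult:
  fixes a s :: "'a::metric_space => real"
  assumes a: "continuous_on S a" and s: "continuous_on S s" and z: "!!q. q \<in> S ==> a q = 0 ==> s q = 0"
  shows "continuous_on S (%q. sgn (a q) * s q)"
  unfolding continuous_on_def
proof
  fix q assume q: "q \<in> S"
  have at: "(a \<longlongrightarrow> a q) (at q within S)" and st: "(s \<longlongrightarrow> s q) (at q within S)"
    using a s q by (auto simp: continuous_on_def)
  show "((%q. sgn (a q) * s q) \<longlongrightarrow> sgn (a q) * s q) (at q within S)"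
  proof (cases "a q = 0")
    case True
    hence "(s \<longlongrightarrow> 0) (at q within S)" using st z[OF q] by simp
    hence "((%q. \<bar>s q\<bar>) \<longlongrightarrow> 0) (at q within S)" by (rule tendsto_rabs_zero)
    moreover have "\<forall>\<^sub>F x in at q within S. norm (sgn (a x) * s x) <= \<bar>s x\<bar>"
      by (auto simp: abs_mult sgn_if)
    ultimately have "((%q. sgn (a q) * s q) \<longlongrightarrow> 0) (at q within S)"
      by (rule Lim_null_comparison[rotated])
    thus ?thesis using True by simp
  next
    case False
    thus ?thesis using at st by (intro tendsto_mult tendsto_sgn) auto
  qed
qed

lemma ucirc_ee:
  assumes "continuous_on S a" "continuous_on S t" "!!q. q \<in> S ==> a q = 0 ==> t q = 0 | t q = 1/2"
  shows "ucirc S (%q. ee (a q) (t q))"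
  unfolding ucirc_def
proof
  have z: "sin (2 * pi * t q) = 0" if "q \<in> S" "a q = 0" for q
  proof -
    have "2 * pi * t q = 0 | 2 * pi * t q = pi" using assms(3)[OF that] by auto
    thus ?thesis by (elim disjE) (simp_all only: sin_zero sin_pi)
  qed
  have c1: "continuous_on S (%q. sgn (a q) * sin (2 * pi * t q))"
    using assms(1,2) z by (intro continuous_on_sgn_mult) (auto intro!: continuous_intros)
  have c2: "continuous_on S (%q. cos (2 * pi * t q))" using assms(2) by (intro continuous_intros)
  have eq: "(%q. ee (a q) (t q)) = (%q. of_real (cos (2 * pi * t q)) + \<i> * of_real (sgn (a q) * sin (2 * pi * t q)))"
    by (auto simp: ee_def complex_eq_iff)
  show "continuous_on S (%q. ee (a q) (t q))" unfolding eq
    by (rule continuous_on_add[OF continuous_on_of_real[OF c2]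
          continuous_on_mult[OF continuous_on_const continuous_on_of_real[OF c1]]])
  show "\<forall>q\<in>S. cmod (ee (a q) (t q)) = 1"
  proof
    fix q assume q: "q \<in> S"
    show "cmod (ee (a q) (t q)) = 1"
    proof (cases "a q = 0")
      case True
      show ?thesis using assms(3)[OF q True]
        by (elim disjE) (simp_all only: ee_0 ee_half norm_one norm_minus_cancel)
    qed (simp add: ee_nz)
  qed
qed

definition sheet :: "'a::metric_space set => ('a => complex) => ('a => complex) => bool" where
  "sheet S w s \<longleftrightarrow> continuous_on S w & continuous_on S s & (\<forall>q\<in>S. (s q)^2 = phi0 (w q))"

lemma sheet_Re_0: "s^2 = phi0 w ==> Re s = 0 ==> Im w = 0 & gx (Re w) <= 0"
  and sheet_Im_0: "s^2 = phi0 w ==> Im s = 0 ==> Im w = 0 & gx (Re w) >= 0"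
  using zero_le_power2[of "Re s"] zero_le_power2[of "Im s"]
  by (auto simp: complex_eq_iff power2_eq_square simp del: zero_le_square)

text \<open>The real part of a root of \<open>phi0 w\<close> vanishes only over the two segments
  joining -3 to -1 and 1 to 3, the imaginary part (for \<open>adm2\<close>) only over the rest of
  the real line. A profile is prescribed on these cuts alone, with values 0 and 1/2, so that
  \<open>ee\<close> is continuous; elsewhere it is free.\<close>

definition adm1 :: "(complex => real) => bool" where
  "adm1 ch \<longleftrightarrow> continuous_on UNIV ch &
     (\<forall>w. Im w = 0 & gx (Re w) <= 0 --> ch w = (if Re w < 0 then 0 else 1/2))"

definition adm2 :: "(complex => real) => bool" where
  "adm2 ch \<longleftrightarrow> continuous_on UNIV ch &
     (\<forall>w. Im w = 0 & gx (Re w) >= 0 --> ch w = (if \<bar>Re w\<bar> <= 1 then 1/2 else 0))"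

lemma ucirc_e1:
  assumes "sheet S w s" "adm1 ch"
  shows "ucirc S (%q. ee (Re (s q)) (ch (w q)))"
proof (rule ucirc_ee)
  show "continuous_on S (%q. Re (s q))" using assms(1) by (auto simp: sheet_def intro!: continuous_intros)
  show "continuous_on S (%q. ch (w q))"
    using assms by (auto simp: sheet_def adm1_def intro: continuous_on_compose2)
  show "ch (w q) = 0 | ch (w q) = 1/2" if "q \<in> S" "Re (s q) = 0" for q
    using sheet_Re_0[of "s q" "w q"] assms that by (auto simp: sheet_def adm1_def)
qed

lemma ucirc_e2:
  assumes "sheet S w s" "adm2 ch"
  shows "ucirc S (%q. ee (Im (s q)) (ch (w q)))"
proof (rule ucirc_ee)
  show "continuous_on S (%q. Im (s q))" using assms(1) by (auto simp: sheet_def intro!: continuous_intros)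
  show "continuous_on S (%q. ch (w q))"
    using assms by (auto simp: sheet_def adm2_def intro: continuous_on_compose2)
  show "ch (w q) = 0 | ch (w q) = 1/2" if "q \<in> S" "Im (s q) = 0" for q
    using sheet_Im_0[of "s q" "w q"] assms that by (auto simp: sheet_def adm2_def)
qed

text \<open>Two profiles agree where the sheet coordinate a vanishes, so their difference times the
  sign of a is continuous. It is the exact term, and it is zero on Z because a is.\<close>

lemma coh_change:
  assumes S: "compact S" and a: "continuous_on S a" and t: "continuous_on S t" "continuous_on S t'"
    and z: "!!q. q \<in> S ==> a q = 0 ==> t q = t' q & (t q = 0 | t q = 1/2)"
    and Z: "!!q. q \<in> S Int Z ==> a q = 0"
  shows "coh S Z (inc (%q. ee (a q) (t q))) (inc (%q. ee (a q) (t' q)))"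
proof (rule coh_exp[OF S ucirc_ee[OF a t(2)], of "%q. sgn (a q) * (t q - t' q)"])
  show "continuous_on S (%q. sgn (a q) * (t q - t' q))"
    by (rule continuous_on_sgn_mult[OF a continuous_on_diff[OF t]]) (use z in force)
  fix q assume q: "q \<in> S"
  show "t' q = 0 | t' q = 1/2" if "a q = 0" using z[OF q that] by auto
  show "ee (a q) (t q) = ee (a q) (t' q) * cis (2 * pi * (sgn (a q) * (t q - t' q)))"
  proof (cases "a q = 0")
    case True
    thus ?thesis using z[OF q] by simp
  qed (simp add: ee_nz cis_mult algebra_simps)
qed (use Z in simp)

lemma coh_change1:
  assumes "compact S" "sheet S w s" "adm1 ch" "adm1 ch'" "!!q. q \<in> S Int Z ==> s q = 0"
  shows "coh S Z (inc (%q. ee (Re (s q)) (ch (w q)))) (inc (%q. ee (Re (s q)) (ch' (w q))))"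
proof (rule coh_change[OF assms(1)])
  show "continuous_on S (%q. Re (s q))" using assms(2) by (auto simp: sheet_def intro!: continuous_intros)
  show "continuous_on S (%q. ch (w q))" "continuous_on S (%q. ch' (w q))"
    using assms by (auto simp: sheet_def adm1_def intro: continuous_on_compose2)
  show "ch (w q) = ch' (w q) & (ch (w q) = 0 | ch (w q) = 1/2)" if "q \<in> S" "Re (s q) = 0" for q
    using sheet_Re_0[of "s q" "w q"] assms(2-4) that by (auto simp: sheet_def adm1_def)
  show "Re (s q) = 0" if "q \<in> S Int Z" for q using assms(5)[OF that] by simp
qed

lemma coh_change2:
  assumes "compact S" "sheet S w s" "adm2 ch" "adm2 ch'" "!!q. q \<in> S Int Z ==> s q = 0"
  shows "coh S Z (inc (%q. ee (Im (s q)) (ch (w q)))) (inc (%q. ee (Im (s q)) (ch' (w q))))"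
proof (rule coh_change[OF assms(1)])
  show "continuous_on S (%q. Im (s q))" using assms(2) by (auto simp: sheet_def intro!: continuous_intros)
  show "continuous_on S (%q. ch (w q))" "continuous_on S (%q. ch' (w q))"
    using assms by (auto simp: sheet_def adm2_def intro: continuous_on_compose2)
  show "ch (w q) = ch' (w q) & (ch (w q) = 0 | ch (w q) = 1/2)" if "q \<in> S" "Im (s q) = 0" for q
    using sheet_Im_0[of "s q" "w q"] assms(2-4) that by (auto simp: sheet_def adm2_def)
  show "Im (s q) = 0" if "q \<in> S Int Z" for q using assms(5)[OF that] by simp
qed

section \<open>Half twists\<close>

text \<open>The argument is a squared radius. Within squared radius 2 of a twist centre lie the two
  strands at distance 1, and this disc turns rigidly; all other strands are at distance at least 3,
  outside squared radius 3, and stay fixed.\<close>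

definition eta :: "real => real" where "eta r = st (3 - r)"

lemma eta_in: "r <= 2 ==> eta r = 1" and eta_out: "r >= 3 ==> eta r = 0"
  by (auto simp: eta_def st_0 st_1)

lemma continuous_st: "continuous_on UNIV st"
  using st_deriv by (meson DERIV_isCont continuous_at_imp_continuous_on)

lemma continuous_on_eta: "continuous_on S f ==> continuous_on S (%x. eta (f x))"
  unfolding eta_def by (rule continuous_on_compose2[OF continuous_st]) (auto intro: continuous_intros)

definition tw :: "complex => real => real => complex => complex" where
  "tw c e th w = c + cis (e * pi * th * eta ((cmod (w - c))^2)) * (w - c)"

lemma tw_minus: "tw c e th w - c = cis (e * pi * th * eta ((cmod (w - c))^2)) * (w - c)"
  by (simp add: tw_def)

lemma tw_norm: "cmod (tw c e th w - c) = cmod (w - c)"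
  by (simp add: tw_minus norm_mult)

lemma tw_inverse: "tw c (- e) th (tw c e th w) = w"
proof -
  have "tw c (- e) th (tw c e th w) = c + cis (- e * pi * th * eta ((cmod (w - c))^2)) * (tw c e th w - c)"
    unfolding tw_def[of c "-e"] tw_norm ..
  also have "\<dots> = w" unfolding tw_minus by (simp add: mult.assoc[symmetric] cis_mult)
  finally show ?thesis .
qed

lemma continuous_on_tw:
  assumes "continuous_on S w" "continuous_on S th"
  shows "continuous_on S (%q. tw c e (th q) (w q))"
  unfolding tw_def using assms by (intro continuous_intros continuous_on_eta)

text \<open>The letters r and a stand for radial and angular. \<open>chi1r\<close> and
  \<open>chi2r\<close> are unchanged by the twists about -2 and 0, respectively;
  \<open>chi2a\<close> and \<open>chi1a\<close> follow the angle about -2 and 0. The maximum with 1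
  keeps the quotients continuous at the centres. All four are admissible, so exchanging profiles
  costs only an exact term.\<close>

definition chi1r :: "complex => real" where "chi1r w = (1 - eta ((cmod (w + 2))^2)) / 2"
definition chi2r :: "complex => real" where "chi2r w = eta ((cmod w)^2) / 2"
definition chi1a :: "complex => real" where
  "chi1a w = 1/2 - arccos (Re w / max (cmod w) 1) / (2 * pi)"
definition chi2a :: "complex => real" where
  "chi2a w = 1/2 - arccos ((2 - \<bar>Re w\<bar>) / max (cmod (Complex (2 - \<bar>Re w\<bar>) (Im w))) 1) / (2 * pi)"

lemma cmod_real: "Im w = 0 ==> cmod w = \<bar>Re w\<bar>" by (simp add: cmod_eq_Re)

lemma gx_le_0: "gx x <= 0 \<longleftrightarrow> 1 <= \<bar>x\<bar> & \<bar>x\<bar> <= 3" and gx_ge_0: "gx x >= 0 \<longleftrightarrow> \<bar>x\<bar> <= 1 | \<bar>x\<bar> >= 3"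
  by (auto simp: gx_def)

lemma adm1_chi1r: "adm1 chi1r"
  unfolding adm1_def
proof (intro conjI allI impI)
  show "continuous_on UNIV chi1r" unfolding chi1r_def by (intro continuous_intros continuous_on_eta) auto
  fix w assume w: "Im w = 0 & gx (Re w) <= 0"
  hence m: "cmod (w + 2) = \<bar>Re w + 2\<bar>" using cmod_real[of "w + 2"] by simp
  show "chi1r w = (if Re w < 0 then 0 else 1/2)"
  proof (cases "Re w < 0")
    case True
    hence "\<bar>Re w + 2\<bar> <= 1" using w by (auto simp: gx_le_0)
    hence "(cmod (w + 2))^2 <= 1" unfolding m power2_abs by (simp add: abs_square_le_1)
    thus ?thesis using True by (simp add: chi1r_def eta_in)
  next
    case False
    hence "3 <= \<bar>Re w + 2\<bar>" using w by (auto simp: gx_le_0)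
    hence "3^2 <= (cmod (w + 2))^2" unfolding m by (intro power_mono) auto
    thus ?thesis using False by (simp add: chi1r_def eta_out)
  qed
qed

lemma adm2_chi2r: "adm2 chi2r"
  unfolding adm2_def
proof (intro conjI allI impI)
  show "continuous_on UNIV chi2r" unfolding chi2r_def by (intro continuous_intros continuous_on_eta) auto
  fix w assume w: "Im w = 0 & gx (Re w) >= 0"
  hence m: "cmod w = \<bar>Re w\<bar>" using cmod_real by simp
  show "chi2r w = (if \<bar>Re w\<bar> <= 1 then 1/2 else 0)"
  proof (cases "\<bar>Re w\<bar> <= 1")
    case True
    hence "(cmod w)^2 <= 1" unfolding m power2_abs by (simp add: abs_square_le_1)
    thus ?thesis using True by (simp add: chi2r_def eta_in)
  next
    case False
    hence "3 <= \<bar>Re w\<bar>" using w by (auto simp: gx_ge_0)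
    hence "3^2 <= (cmod w)^2" unfolding m by (intro power_mono) auto
    thus ?thesis using False by (simp add: chi2r_def eta_out)
  qed
qed

lemma ratio_bound: "\<bar>x\<bar> <= n ==> - 1 <= x / max n 1" "\<bar>x\<bar> <= n ==> x / max n 1 <= (1::real)"
  by (auto simp: field_simps max_def)

lemma adm1_chi1a: "adm1 chi1a"
  unfolding adm1_def
proof (intro conjI allI impI)
  have b: "- 1 <= Re w / max (cmod w) 1" "Re w / max (cmod w) 1 <= 1" for w
    using ratio_bound[OF abs_Re_le_cmod] by auto
  show "continuous_on UNIV chi1a" unfolding chi1a_def
    by (intro continuous_intros continuous_on_arccos) (use b in \<open>auto simp: max_def\<close>)
  fix w assume w: "Im w = 0 & gx (Re w) <= 0"
  hence m: "cmod w = \<bar>Re w\<bar>" "1 <= \<bar>Re w\<bar>" using cmod_real gx_le_0 by auto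
  hence "Re w / max (cmod w) 1 = (if Re w < 0 then - 1 else 1)" by (auto simp: max_def)
  thus "chi1a w = (if Re w < 0 then 0 else 1/2)" by (auto simp: chi1a_def)
qed

lemma adm2_chi2a: "adm2 chi2a"
  unfolding adm2_def
proof (intro conjI allI impI)
  have b: "- 1 <= (2 - \<bar>Re w\<bar>) / max (cmod (Complex (2 - \<bar>Re w\<bar>) (Im w))) 1"
    "(2 - \<bar>Re w\<bar>) / max (cmod (Complex (2 - \<bar>Re w\<bar>) (Im w))) 1 <= 1" for w
    using ratio_bound[of "2 - \<bar>Re w\<bar>"] abs_Re_le_cmod[of "Complex (2 - \<bar>Re w\<bar>) (Im w)"] by auto
  have "(%w. Complex (2 - \<bar>Re w\<bar>) (Im w)) = (%w. of_real (2 - \<bar>Re w\<bar>) + \<i> * of_real (Im w))"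
    by (auto simp: complex_eq_iff)
  hence c: "continuous_on UNIV (%w. Complex (2 - \<bar>Re w\<bar>) (Im w))" by (auto intro!: continuous_intros)
  show "continuous_on UNIV chi2a" unfolding chi2a_def
    by (intro continuous_intros continuous_on_arccos c) (use b in \<open>auto simp: max_def\<close>)
  fix w assume w: "Im w = 0 & gx (Re w) >= 0"
  hence m: "cmod (Complex (2 - \<bar>Re w\<bar>) (Im w)) = \<bar>2 - \<bar>Re w\<bar>\<bar>" "1 <= \<bar>2 - \<bar>Re w\<bar>\<bar>"
    using cmod_real[of "Complex (2 - \<bar>Re w\<bar>) (Im w)"] gx_ge_0 by auto
  hence "(2 - \<bar>Re w\<bar>) / max (cmod (Complex (2 - \<bar>Re w\<bar>) (Im w))) 1 = (if \<bar>Re w\<bar> <= 1 then 1 else - 1)"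
    using w by (auto simp: max_def gx_ge_0 divide_simps)
  thus "chi2a w = (if \<bar>Re w\<bar> <= 1 then 1/2 else 0)" by (auto simp: chi2a_def)
qed

text \<open>An angular profile gives back the unit vector u up to sign and conjugation; a rotation
  of u thus becomes a multiplication of values.\<close>

lemma ee_arccos:
  assumes "cmod u = 1" "sgn s = k * sgn (Im u)"
  shows "ee s (1/2 - arccos (Re u) / (2 * pi)) = Complex (- Re u) (k * Im u)"
proof -
  have b: "\<bar>Re u\<bar> <= 1" using assms(1) abs_Re_le_cmod[of u] by simp
  have eq: "2 * pi * (1/2 - arccos (Re u) / (2 * pi)) = pi - arccos (Re u)" by (simp add: field_simps)
  have "(Re u)^2 + (Im u)^2 = 1" using assms(1) by (metis cmod_power2 power_one)
  hence "1 - (Re u)^2 = (Im u)^2" by simp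
  hence "sin (arccos (Re u)) = \<bar>Im u\<bar>"
    using sin_arccos_abs[OF b] by simp
  moreover have "cos (arccos (Re u)) = Re u" using b by (rule cos_arccos_abs)
  moreover have "sgn s * \<bar>Im u\<bar> = k * Im u"
    unfolding assms(2) mult.assoc sgn_mult_abs ..
  ultimately show ?thesis unfolding ee_def eq by simp
qed

lemma csqrt_sgn_Re:
  assumes "Re s ~= 0"
  shows "of_real (sgn (Re s)) * csqrt (s^2) = s"
proof (cases "Re s > 0")
  case True
  thus ?thesis using csqrt_square[of s] by simp
next
  case False
  hence "Re (- s) > 0" using assms by simp
  hence "csqrt ((- s)^2) = - s" using csqrt_square[of "- s"] by simp
  thus ?thesis using False assms by (simp add: sgn_if)
qed

lemma csqrt_sgn_Im:
  assumes "Im s ~= 0"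
  shows "of_real (sgn (Im s)) * (\<i> * csqrt (- (s^2))) = s"
proof -
  have r: "Re (- \<i> * s) = Im s" by simp
  have "of_real (sgn (Re (- \<i> * s))) * csqrt ((- \<i> * s)^2) = - \<i> * s"
    by (rule csqrt_sgn_Re) (use assms r in simp)
  moreover have "(- \<i> * s)^2 = - (s^2)" by (simp add: power_mult_distrib)
  ultimately have "of_real (sgn (Im s)) * csqrt (- (s^2)) = - \<i> * s" using r by simp
  hence "\<i> * (of_real (sgn (Im s)) * csqrt (- (s^2))) = s" by simp
  thus ?thesis by (simp add: mult.left_commute)
qed

lemma sgn_of_product: "2 * a * b = (y::real) ==> a ~= 0 ==> sgn b = sgn a * sgn y"
  by (auto simp: sgn_if zero_less_mult_iff mult_less_0_iff)

lemma square_Im: "s^2 = phi0 w ==> 2 * Re s * Im s = Im w"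
  by (auto simp: complex_eq_iff power2_eq_square algebra_simps)

text \<open>The annulus where the twist about -2 slows down misses the cut, so the real part of the
  root has locally constant sign there; \<open>collar2\<close> does the same for the twist about 0
  and the imaginary part.\<close>

lemma collar1:
  assumes "Im w = 0" "gx (Re w) <= 0"
  shows "\<not> (2 <= (cmod (w + 2))^2 & (cmod (w + 2))^2 <= 3)"
proof -
  have m: "(cmod (w + 2))^2 = \<bar>Re w + 2\<bar>^2" using cmod_real[of "w + 2"] assms by simp
  have "\<bar>Re w + 2\<bar> <= 1 | 3 <= \<bar>Re w + 2\<bar>" using assms by (auto simp: gx_le_0)
  thus ?thesis
  proof
    assume "\<bar>Re w + 2\<bar> <= 1"
    hence "\<bar>Re w + 2\<bar>^2 <= 1^2" by (intro power_mono) auto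
    thus ?thesis using m by simp
  next
    assume "3 <= \<bar>Re w + 2\<bar>"
    hence "3^2 <= \<bar>Re w + 2\<bar>^2" by (intro power_mono) auto
    thus ?thesis using m by simp
  qed
qed

lemma collar2:
  assumes "Im w = 0" "gx (Re w) >= 0"
  shows "\<not> (2 <= (cmod w)^2 & (cmod w)^2 <= 3)"
proof -
  have m: "(cmod w)^2 = \<bar>Re w\<bar>^2" using cmod_real[of w] assms by simp
  have "\<bar>Re w\<bar> <= 1 | 3 <= \<bar>Re w\<bar>" using assms by (auto simp: gx_ge_0)
  thus ?thesis
  proof
    assume "\<bar>Re w\<bar> <= 1"
    hence "\<bar>Re w\<bar>^2 <= 1^2" by (intro power_mono) auto
    thus ?thesis using m by simp
  next
    assume "3 <= \<bar>Re w\<bar>"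
    hence "3^2 <= \<bar>Re w\<bar>^2" by (intro power_mono) auto
    thus ?thesis using m by simp
  qed
qed

lemma tw1_in: "(cmod (w + 2))^2 <= 2 ==> tw (-2) 1 1 w = - 4 - w"
  by (simp add: tw_def eta_in)

lemma tw_out1: "(cmod (w + 2))^2 >= 3 ==> tw (-2) e th w = w"
  by (simp add: tw_def eta_out)

lemma tw2_in: "(cmod w)^2 <= 2 ==> tw 0 (-1) 1 w = - w"
  by (simp add: tw_def eta_in complex_eq_iff)

lemma tw_out2: "(cmod w)^2 >= 3 ==> tw 0 e th w = w"
  by (simp add: tw_def eta_out)

lemma disc1_Re:
  assumes "(cmod (w + 2))^2 <= 3"
  shows "- 4 < Re w" "Re w < 0"
proof -
  have "(Re (w + 2))^2 <= (cmod (w + 2))^2" by (metis abs_Re_le_cmod abs_ge_zero power2_abs power_mono)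
  hence "(Re w + 2)^2 < 2^2" using assms by simp
  hence "\<bar>Re w + 2\<bar> < 2" using power2_less_imp_less[of "\<bar>Re w + 2\<bar>" 2] by simp
  thus "- 4 < Re w" "Re w < 0" by auto
qed

lemma phi0_reflect1: "(cmod (w + 2))^2 <= 3 ==> phi0 (- 4 - w) = cnj (phi0 w)"
  using disc1_Re[of w] by (auto simp: complex_eq_iff gx_def)

lemma phi0_reflect2: "phi0 (- w) = cnj (phi0 w)"
  by (auto simp: complex_eq_iff gx_def)

lemma chi2a_disc:
  assumes "(cmod (w + 2))^2 <= 3"
  shows "chi2a w = 1/2 - arccos (Re (w + 2) / max (cmod (w + 2)) 1) / (2 * pi)"
proof -
  have "2 - \<bar>Re w\<bar> = Re (w + 2)" using disc1_Re[OF assms] by simp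
  moreover have "Complex (2 - \<bar>Re w\<bar>) (Im w) = w + 2" using disc1_Re[OF assms] by (simp add: complex_eq_iff)
  ultimately show ?thesis unfolding chi2a_def by (simp add: add.commute)
qed

lemma arccos_ratio_minus:
  assumes "\<bar>x\<bar> <= n"
  shows "1/2 - arccos (- x / max n 1) / (2 * pi) = 1/2 - (1/2 - arccos (x / max n 1) / (2 * pi))"
  using ratio_bound[OF assms] arccos_minus[of "x / max n 1"] by (simp add: field_simps)

lemma unit_part:
  assumes "2 <= (cmod z)^2"
  shows "cmod (z / of_real (cmod z)) = 1" "max (cmod z) 1 = cmod z" "cmod z > 0"
    "Re z / cmod z = Re (z / of_real (cmod z))" "sgn (Im (z / of_real (cmod z))) = sgn (Im z)"
proof -
  show p: "cmod z > 0" using assms by (cases "z = 0") auto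
  have "1 <= cmod z"
  proof (rule ccontr)
    assume "\<not> 1 <= cmod z"
    hence "(cmod z)^2 <= 1^2" by (intro power_mono) auto
    thus False using assms by simp
  qed
  thus "max (cmod z) 1 = cmod z" by simp
  show "cmod (z / of_real (cmod z)) = 1" using p by (simp add: norm_divide)
  show "Re z / cmod z = Re (z / of_real (cmod z))" "sgn (Im (z / of_real (cmod z))) = sgn (Im z)"
    using p by (auto simp: sgn_if zero_less_divide_iff)
qed

text \<open>The half twist about -2 is lifted to the double cover. Inside, w goes to -4 - w, which
  conjugates \<open>phi0\<close>, and among the two roots \<open>cnj s\<close> keeps the real part,
  so the first function is unchanged. In the annulus the root is determined by the sign of its real
  part; outside nothing moves. The value of the first function encodes the local turning angle,
  hence the second function is multiplied by it. The factor -1 reconciles the inside, where the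
  first function is 1, with the outside, where it is -1.\<close>

lemma twist1:
  assumes S: "sheet S w s"
  obtains s' where "sheet S (%q. tw (-2) 1 1 (w q)) s'" "!!q. q \<in> S ==> s q = 0 ==> s' q = 0"
    "!!q. q \<in> S ==> ee (Re (s' q)) (chi1r (tw (-2) 1 1 (w q))) = ee (Re (s q)) (chi1r (w q))"
    "!!q. q \<in> S ==> ee (Im (s' q)) (chi2a (tw (-2) 1 1 (w q))) =
        - 1 * ee (Re (s q)) (chi1r (w q)) * ee (Im (s q)) (chi2a (w q))"
proof -
  define r where "r q = (cmod (w q + 2))^2" for q
  define w' where "w' q = tw (-2) 1 1 (w q)" for q
  define m where "m q = of_real (sgn (Re (s q))) * csqrt (phi0 (w' q))" for q
  define s' where "s' q = (if r q <= 2 then cnj (s q) else if r q <= 3 then m q else s q)" for q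
  have cw: "continuous_on S w" and cs: "continuous_on S s" and sq: "!!q. q \<in> S ==> (s q)^2 = phi0 (w q)"
    using S by (auto simp: sheet_def)
  have cw': "continuous_on S w'" unfolding w'_def by (intro continuous_on_tw cw continuous_on_const)
  have cr: "continuous_on S r" unfolding r_def using cw by (intro continuous_intros)
  have r': "(cmod (w' q + 2))^2 = r q" for q
    using tw_norm[of "-2" 1 1 "w q"] by (simp add: w'_def r_def)
  have A: "Re (s q) ~= 0" if "q \<in> S" "2 <= r q" "r q <= 3" for q
    using sheet_Re_0[OF sq[OF that(1)]] collar1[of "w q"] that(2,3) unfolding r_def by blast
  have nonneg: "phi0 (w' q) \<notin> \<real>\<^sub>\<le>\<^sub>0" if "2 <= r q" "r q <= 3" for q
    using collar1[of "w' q"] that unfolding r' complex_nonpos_Reals_iff by auto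
  have m2: "cnj (s q) = m q" if q: "q \<in> S" "r q = 2" for q
  proof -
    have "w' q = - 4 - w q" using tw1_in[of "w q"] q by (simp add: w'_def r_def)
    hence "phi0 (w' q) = (cnj (s q))^2"
      using phi0_reflect1[of "w q"] q unfolding complex_cnj_power[symmetric] sq[OF q(1)] by (simp add: r_def)
    thus ?thesis using csqrt_sgn_Re[of "cnj (s q)"] A[OF q(1)] q(2) by (simp add: m_def)
  qed
  have m3: "m q = s q" if q: "q \<in> S" "r q = 3" for q
  proof -
    have "w' q = w q" using tw_out1[of "w q"] q by (simp add: w'_def r_def)
    thus ?thesis using csqrt_sgn_Re[of "s q"] A[OF q(1)] q sq[OF q(1)] by (simp add: m_def)
  qed
  have cm: "continuous_on {q \<in> {q \<in> S. 2 <= r q}. r q <= 3} m"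
  proof -
    have "continuous_on {q \<in> {q \<in> S. 2 <= r q}. r q <= 3} (%q. csqrt (phi0 (w' q)))"
    proof (rule continuous_on_compose2[of "- \<real>\<^sub>\<le>\<^sub>0" csqrt])
      show "continuous_on (- \<real>\<^sub>\<le>\<^sub>0) csqrt"
        by (intro continuous_at_imp_continuous_on ballI continuous_at_csqrt) auto
      show "continuous_on {q \<in> {q \<in> S. 2 <= r q}. r q <= 3} (%q. phi0 (w' q))"
        by (rule continuous_on_compose2[OF continuous_phi0[of UNIV]]) (auto intro: continuous_on_subset[OF cw'])
    qed (use nonneg in auto)
    moreover have "continuous_on {q \<in> {q \<in> S. 2 <= r q}. r q <= 3} (%q. sgn (Re (s q)) * 1)"
      by (rule continuous_on_sgn_mult) (use A in \<open>auto intro!: continuous_intros continuous_on_subset[OF cs]\<close>)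
    ultimately show ?thesis unfolding m_def by (intro continuous_on_mult continuous_on_of_real) auto
  qed
  have "continuous_on S s'" unfolding s'_def
  proof (rule continuous_on_cases_le[OF _ _ cr])
    show "continuous_on {q \<in> S. r q <= 2} (%q. cnj (s q))"
      by (intro continuous_on_cnj continuous_on_subset[OF cs]) auto
    show "continuous_on {q \<in> S. 2 <= r q} (%q. if r q <= 3 then m q else s q)"
    proof (rule continuous_on_cases_le[OF cm])
      show "continuous_on {q \<in> {q \<in> S. 2 <= r q}. 3 <= r q} s" by (rule continuous_on_subset[OF cs]) auto
      show "continuous_on {q \<in> S. 2 <= r q} r" by (rule continuous_on_subset[OF cr]) auto
    qed (use m3 in auto)
    show "cnj (s q) = (if r q <= 3 then m q else s q)" if "q \<in> S" "r q = 2" for q using m2 that by simp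
  qed
  moreover have sq': "(s' q)^2 = phi0 (w' q)" if q: "q \<in> S" for q
  proof -
    consider "r q <= 2" | "2 < r q" "r q <= 3" | "r q > 3" by linarith
    thus ?thesis
    proof cases
      case 1
      hence "w' q = - 4 - w q" using tw1_in[of "w q"] by (simp add: w'_def r_def)
      thus ?thesis using phi0_reflect1[of "w q"] 1 sq[OF q] by (simp add: r_def s'_def flip: complex_cnj_power)
    next
      case 2
      have "(sgn (Re (s q)))^2 = 1" using A[OF q] 2 by (simp add: sgn_if)
      hence "(complex_of_real (sgn (Re (s q))))^2 = 1" by (metis of_real_1 of_real_power)
      thus ?thesis using 2 by (simp add: s'_def m_def power_mult_distrib)
    next
      case 3
      hence "w' q = w q" using tw_out1[of "w q"] by (simp add: w'_def r_def)
      thus ?thesis using 3 sq[OF q] by (simp add: s'_def)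
    qed
  qed
  ultimately have sh: "sheet S w' s'" using cw' by (simp add: sheet_def)
  have zero: "s' q = 0" if q: "q \<in> S" "s q = 0" for q
    using A[OF q(1)] q(2) by (auto simp: s'_def)
  have chi1: "chi1r (w' q) = chi1r (w q)" for q by (simp add: chi1r_def r' r_def)
  have sgnA: "sgn (Re (s' q)) = sgn (Re (s q))" if q: "q \<in> S" "2 < r q" "r q <= 3" for q
  proof -
    have "Re (csqrt (phi0 (w' q))) ~= 0"
      using sheet_Re_0[of "csqrt (phi0 (w' q))" "w' q"] collar1[of "w' q"] q unfolding r' by auto
    hence "Re (csqrt (phi0 (w' q))) > 0" using Re_csqrt[of "phi0 (w' q)"] by simp
    thus ?thesis using A[OF q(1)] q by (simp add: s'_def m_def sgn_mult)
  qed
  have e1: "ee (Re (s' q)) (chi1r (w' q)) = ee (Re (s q)) (chi1r (w q))" if q: "q \<in> S" for q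
  proof -
    consider "r q <= 2" | "2 < r q" "r q <= 3" | "r q > 3" by linarith
    thus ?thesis
    proof cases
      case 1
      hence "chi1r (w q) = 0" by (simp add: chi1r_def r_def eta_in)
      thus ?thesis by (simp add: chi1)
    next
      case 2
      thus ?thesis using sgnA[OF q] by (simp add: chi1 ee_def)
    next
      case 3
      thus ?thesis by (simp add: chi1 s'_def)
    qed
  qed
  have e2: "ee (Im (s' q)) (chi2a (w' q)) = - 1 * ee (Re (s q)) (chi1r (w q)) * ee (Im (s q)) (chi2a (w q))"
    if q: "q \<in> S" for q
  proof -
    consider "r q <= 2" | "2 < r q" "r q <= 3" | "r q > 3" by linarith
    thus ?thesis
    proof cases
      case 1
      have w'q: "w' q = - 4 - w q" using tw1_in[of "w q"] 1 by (simp add: w'_def r_def)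
      have rr: "(cmod (w q + 2))^2 <= 3" "(cmod (w' q + 2))^2 <= 3" using 1 r'[of q] by (auto simp: r_def)
      have nn: "cmod (w' q + 2) = cmod (w q + 2)" using tw_norm[of "-2" 1 1 "w q"] by (simp add: w'_def)
      have re: "Re (w' q + 2) = - Re (w q + 2)" by (simp add: w'q)
      have "chi2a (w' q) = 1/2 - arccos (- Re (w q + 2) / max (cmod (w q + 2)) 1) / (2 * pi)"
        unfolding chi2a_disc[OF rr(2)] nn re ..
      also have "\<dots> = 1/2 - chi2a (w q)" unfolding chi2a_disc[OF rr(1)]
        by (rule arccos_ratio_minus[OF abs_Re_le_cmod])
      finally have "chi2a (w' q) = 1/2 - chi2a (w q)" .
      moreover have "chi1r (w q) = 0" using 1 by (simp add: chi1r_def r_def eta_in)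
      ultimately show ?thesis using 1 ee_flip[of "Im (s q)" "chi2a (w q)"] by (simp add: s'_def)
    next
      case 2
      define k where "k = sgn (Re (s q))"
      have kk: "k * k = 1" using A[OF q] 2 by (auto simp: k_def sgn_if)
      have val: "ee (Im t) (chi2a p) = Complex (- Re ((p + 2) / of_real (cmod (p + 2)))) (k * Im ((p + 2) / of_real (cmod (p + 2))))"
        if "t^2 = phi0 p" "sgn (Re t) = k" "2 <= (cmod (p + 2))^2" "(cmod (p + 2))^2 <= 3" for t p
      proof -
        note u = unit_part[OF that(3)]
        have "Re t ~= 0" using that(2) kk by auto
        hence "sgn (Im t) = k * sgn (Im p)" using sgn_of_product[OF square_Im[OF that(1)]] that(2) by simp
        hence "sgn (Im t) = k * sgn (Im ((p + 2) / of_real (cmod (p + 2))))" using u(5) by simp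
        from ee_arccos[OF u(1) this] show ?thesis unfolding chi2a_disc[OF that(4)] u(2) u(4) .
      qed
      define u where "u = (w q + 2) / of_real (cmod (w q + 2))"
      define th where "th = pi * eta (r q)"
      have nn: "cmod (w' q + 2) = cmod (w q + 2)" using tw_norm[of "-2" 1 1 "w q"] by (simp add: w'_def)
      have u': "(w' q + 2) / of_real (cmod (w' q + 2)) = cis th * u"
        unfolding nn using tw_minus[of "-2" 1 1 "w q"] by (simp add: w'_def u_def th_def r_def)
      have v': "ee (Im (s' q)) (chi2a (w' q)) = Complex (- Re (cis th * u)) (k * Im (cis th * u))"
        using val[OF sq'[OF q]] sgnA[OF q] 2 r'[of q] u' by (simp add: k_def)
      have v: "ee (Im (s q)) (chi2a (w q)) = Complex (- Re u) (k * Im u)"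
        using val[OF sq[OF q]] 2 by (simp add: k_def u_def r_def)
      have "2 * pi * chi1r (w q) = pi - th" by (simp add: chi1r_def th_def r_def field_simps)
      hence v1: "ee (Re (s q)) (chi1r (w q)) = Complex (- cos th) (k * sin th)"
        by (simp add: ee_def k_def)
      have kk': "k * (k * x) = x" for x using kk by (simp add: mult.assoc[symmetric])
      show ?thesis unfolding v v' v1 by (simp add: complex_eq_iff algebra_simps kk')
    next
      case 3
      hence h1: "w' q = w q" using tw_out1[of "w q"] by (simp add: w'_def r_def)
      have h2: "chi1r (w q) = 1/2" using 3 by (simp add: chi1r_def r_def eta_out)
      have h3: "s' q = s q" using 3 by (simp add: s'_def)
      show ?thesis unfolding h1 h2 h3 ee_half by simp
    qed
  qed
  show ?thesis using that[OF sh[unfolded w'_def]] zero e1 e2 unfolding w'_def by blast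
qed

text \<open>The mirror image of \<open>twist1\<close> with the roles of the two functions exchanged:
  now the imaginary part must keep its sign, which selects \<open>- cnj s\<close> inside, and in the
  annulus the root is taken of \<open>- phi0\<close> and multiplied by i, because there
  \<open>phi0\<close> can be negative but not positive real.\<close>

lemma twist2:
  assumes S: "sheet S w s"
  obtains s' where "sheet S (%q. tw 0 (-1) 1 (w q)) s'" "!!q. q \<in> S ==> s q = 0 ==> s' q = 0"
    "!!q. q \<in> S ==> ee (Im (s' q)) (chi2r (tw 0 (-1) 1 (w q))) = ee (Im (s q)) (chi2r (w q))"
    "!!q. q \<in> S ==> ee (Re (s' q)) (chi1a (tw 0 (-1) 1 (w q))) =
        1 * ee (Re (s q)) (chi1a (w q)) * ee (Im (s q)) (chi2r (w q))"
proof -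
  define r where "r q = (cmod (w q))^2" for q
  define w' where "w' q = tw 0 (-1) 1 (w q)" for q
  define m where "m q = of_real (sgn (Im (s q))) * (\<i> * csqrt (- phi0 (w' q)))" for q
  define s' where "s' q = (if r q <= 2 then - cnj (s q) else if r q <= 3 then m q else s q)" for q
  have cw: "continuous_on S w" and cs: "continuous_on S s" and sq: "!!q. q \<in> S ==> (s q)^2 = phi0 (w q)"
    using S by (auto simp: sheet_def)
  have cw': "continuous_on S w'" unfolding w'_def by (intro continuous_on_tw cw continuous_on_const)
  have cr: "continuous_on S r" unfolding r_def using cw by (intro continuous_intros)
  have r': "(cmod (w' q))^2 = r q" for q
    using tw_norm[of 0 "-1" 1 "w q"] by (simp add: w'_def r_def)
  have A: "Im (s q) ~= 0" if "q \<in> S" "2 <= r q" "r q <= 3" for q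
    using sheet_Im_0[OF sq[OF that(1)]] collar2[of "w q"] that(2,3) unfolding r_def by blast
  have nonneg: "- phi0 (w' q) \<notin> \<real>\<^sub>\<le>\<^sub>0" if "2 <= r q" "r q <= 3" for q
    using collar2[of "w' q"] that unfolding r' complex_nonpos_Reals_iff by auto
  have m2: "- cnj (s q) = m q" if q: "q \<in> S" "r q = 2" for q
  proof -
    have "w' q = - w q" using tw2_in[of "w q"] q by (simp add: w'_def r_def)
    hence "phi0 (w' q) = (- cnj (s q))^2"
      using phi0_reflect2[of "w q"] unfolding power2_minus complex_cnj_power[symmetric] sq[OF q(1)] by simp
    thus ?thesis using csqrt_sgn_Im[of "- cnj (s q)"] A[OF q(1)] q(2) by (simp add: m_def)
  qed
  have m3: "m q = s q" if q: "q \<in> S" "r q = 3" for q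
  proof -
    have "w' q = w q" using tw_out2[of "w q"] q by (simp add: w'_def r_def)
    thus ?thesis using csqrt_sgn_Im[of "s q"] A[OF q(1)] q sq[OF q(1)] by (simp add: m_def)
  qed
  have cm: "continuous_on {q \<in> {q \<in> S. 2 <= r q}. r q <= 3} m"
  proof -
    have "continuous_on {q \<in> {q \<in> S. 2 <= r q}. r q <= 3} (%q. csqrt (- phi0 (w' q)))"
    proof (rule continuous_on_compose2[of "- \<real>\<^sub>\<le>\<^sub>0" csqrt])
      show "continuous_on (- \<real>\<^sub>\<le>\<^sub>0) csqrt"
        by (intro continuous_at_imp_continuous_on ballI continuous_at_csqrt) auto
      show "continuous_on {q \<in> {q \<in> S. 2 <= r q}. r q <= 3} (%q. - phi0 (w' q))"
        by (intro continuous_on_minus, rule continuous_on_compose2[OF continuous_phi0[of UNIV]])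
          (auto intro: continuous_on_subset[OF cw'])
    qed (use nonneg in auto)
    moreover have "continuous_on {q \<in> {q \<in> S. 2 <= r q}. r q <= 3} (%q. sgn (Im (s q)) * 1)"
      by (rule continuous_on_sgn_mult) (use A in \<open>auto intro!: continuous_intros continuous_on_subset[OF cs]\<close>)
    ultimately show ?thesis unfolding m_def by (intro continuous_on_mult continuous_on_of_real continuous_on_const) auto
  qed
  have "continuous_on S s'" unfolding s'_def
  proof (rule continuous_on_cases_le[OF _ _ cr])
    show "continuous_on {q \<in> S. r q <= 2} (%q. - cnj (s q))"
      by (intro continuous_on_minus continuous_on_cnj continuous_on_subset[OF cs]) auto
    show "continuous_on {q \<in> S. 2 <= r q} (%q. if r q <= 3 then m q else s q)"
    proof (rule continuous_on_cases_le[OF cm])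
      show "continuous_on {q \<in> {q \<in> S. 2 <= r q}. 3 <= r q} s" by (rule continuous_on_subset[OF cs]) auto
      show "continuous_on {q \<in> S. 2 <= r q} r" by (rule continuous_on_subset[OF cr]) auto
    qed (use m3 in auto)
    show "- cnj (s q) = (if r q <= 3 then m q else s q)" if "q \<in> S" "r q = 2" for q using m2 that by simp
  qed
  moreover have sq': "(s' q)^2 = phi0 (w' q)" if q: "q \<in> S" for q
  proof -
    consider "r q <= 2" | "2 < r q" "r q <= 3" | "r q > 3" by linarith
    thus ?thesis
    proof cases
      case 1
      hence "w' q = - w q" using tw2_in[of "w q"] by (simp add: w'_def r_def)
      thus ?thesis using phi0_reflect2[of "w q"] 1 sq[OF q] by (simp add: r_def s'_def flip: complex_cnj_power)
    next
      case 2
      have "(sgn (Im (s q)))^2 = 1" using A[OF q] 2 by (simp add: sgn_if)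
      hence "(complex_of_real (sgn (Im (s q))))^2 = 1" by (metis of_real_1 of_real_power)
      thus ?thesis using 2 by (simp add: s'_def m_def power_mult_distrib)
    next
      case 3
      hence "w' q = w q" using tw_out2[of "w q"] by (simp add: w'_def r_def)
      thus ?thesis using 3 sq[OF q] by (simp add: s'_def)
    qed
  qed
  ultimately have sh: "sheet S w' s'" using cw' by (simp add: sheet_def)
  have zero: "s' q = 0" if q: "q \<in> S" "s q = 0" for q
    using A[OF q(1)] q(2) by (auto simp: s'_def)
  have chi2: "chi2r (w' q) = chi2r (w q)" for q by (simp add: chi2r_def r' r_def)
  have sgnA: "sgn (Im (s' q)) = sgn (Im (s q))" if q: "q \<in> S" "2 < r q" "r q <= 3" for q
  proof -
    have c: "(\<i> * csqrt (- phi0 (w' q)))^2 = phi0 (w' q)" by (simp add: power_mult_distrib)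
    have "Im (\<i> * csqrt (- phi0 (w' q))) ~= 0"
    proof
      assume "Im (\<i> * csqrt (- phi0 (w' q))) = 0"
      from sheet_Im_0[OF c this] have "\<not> (2 <= (cmod (w' q))^2 & (cmod (w' q))^2 <= 3)" using collar2 by blast
      thus False using q unfolding r' by simp
    qed
    hence "Re (csqrt (- phi0 (w' q))) > 0" using Re_csqrt[of "- phi0 (w' q)"] by simp
    thus ?thesis using A[OF q(1)] q by (simp add: s'_def m_def sgn_mult)
  qed
  have e1: "ee (Im (s' q)) (chi2r (w' q)) = ee (Im (s q)) (chi2r (w q))" if q: "q \<in> S" for q
  proof -
    consider "r q <= 2" | "2 < r q" "r q <= 3" | "r q > 3" by linarith
    thus ?thesis
    proof cases
      case 1
      thus ?thesis by (simp add: chi2 s'_def)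
    next
      case 2
      thus ?thesis using sgnA[OF q] by (simp add: chi2 ee_def)
    next
      case 3
      thus ?thesis by (simp add: chi2 s'_def)
    qed
  qed
  have e2: "ee (Re (s' q)) (chi1a (w' q)) = 1 * ee (Re (s q)) (chi1a (w q)) * ee (Im (s q)) (chi2r (w q))"
    if q: "q \<in> S" for q
  proof -
    consider "r q <= 2" | "2 < r q" "r q <= 3" | "r q > 3" by linarith
    thus ?thesis
    proof cases
      case 1
      have w'q: "w' q = - w q" using tw2_in[of "w q"] 1 by (simp add: w'_def r_def)
      have "chi1a (w' q) = 1/2 - chi1a (w q)" unfolding chi1a_def w'q
        using arccos_ratio_minus[OF abs_Re_le_cmod[of "w q"]] by simp
      moreover have h2: "chi2r (w q) = 1/2" using 1 by (simp add: chi2r_def r_def eta_in)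
      ultimately show ?thesis using 1 ee_flip[of "Re (s q)" "chi1a (w q)"]
        unfolding h2 ee_half by (simp add: s'_def)
    next
      case 2
      define k where "k = sgn (Im (s q))"
      have kk: "k * k = 1" using A[OF q] 2 by (auto simp: k_def sgn_if)
      have val: "ee (Re t) (chi1a p) = Complex (- Re (p / of_real (cmod p))) (k * Im (p / of_real (cmod p)))"
        if "t^2 = phi0 p" "sgn (Im t) = k" "2 <= (cmod p)^2" for t p
      proof -
        note u = unit_part[OF that(3)]
        have "Im t ~= 0" using that(2) kk by auto
        hence "sgn (Re t) = k * sgn (Im p)"
          using sgn_of_product[of "Im t" "Re t" "Im p"] square_Im[OF that(1)] that(2) by (simp add: mult.commute)
        hence "sgn (Re t) = k * sgn (Im (p / of_real (cmod p)))" using u(5) by simp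
        from ee_arccos[OF u(1) this] show ?thesis unfolding chi1a_def u(2) u(4) .
      qed
      define u where "u = w q / of_real (cmod (w q))"
      define th where "th = pi * eta (r q)"
      have nn: "cmod (w' q) = cmod (w q)" using tw_norm[of 0 "-1" 1 "w q"] by (simp add: w'_def)
      have u': "w' q / of_real (cmod (w' q)) = cis (- th) * u"
        unfolding nn using tw_minus[of 0 "-1" 1 "w q"] by (simp add: w'_def u_def th_def r_def)
      have v': "ee (Re (s' q)) (chi1a (w' q)) = Complex (- Re (cis (- th) * u)) (k * Im (cis (- th) * u))"
        using val[OF sq'[OF q]] sgnA[OF q] 2 r'[of q] u' by (simp add: k_def)
      have v: "ee (Re (s q)) (chi1a (w q)) = Complex (- Re u) (k * Im u)"
        using val[OF sq[OF q]] 2 by (simp add: k_def u_def r_def)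
      have "2 * pi * chi2r (w q) = th" by (simp add: chi2r_def th_def r_def)
      hence v1: "ee (Im (s q)) (chi2r (w q)) = Complex (cos th) (k * sin th)"
        by (simp add: ee_def k_def)
      have kk': "k * (k * x) = x" for x using kk by (simp add: mult.assoc[symmetric])
      show ?thesis unfolding v v' v1 by (simp add: complex_eq_iff algebra_simps kk')
    next
      case 3
      hence "w' q = w q" using tw_out2[of "w q"] by (simp add: w'_def r_def)
      moreover have "chi2r (w q) = 0" using 3 by (simp add: chi2r_def r_def eta_out)
      moreover have "s' q = s q" using 3 by (simp add: s'_def)
      ultimately show ?thesis by simp
    qed
  qed
  show ?thesis using that[OF sh[unfolded w'_def]] zero e1 e2 unfolding w'_def by blast
qed

declare coh_trans [trans]

definition golden :: real where "golden = (1 + sqrt 5) / 2"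

lemma golden_sq: "golden * golden = golden + 1"
  by (simp add: golden_def field_simps)

lemma golden_gt_1: "golden > 1" by (simp add: golden_def)

definition pairtwist :: "complex => complex" where
  "pairtwist w = tw 0 (-1) 1 (tw (-2) 1 1 w)"

definition wform :: "('a => complex) => ('a => complex) => 'a => 'a => real" where
  "wform w s q q' = golden * inc (%q. ee (Re (s q)) (chi1r (w q))) q q' +
     inc (%q. ee (Im (s q)) (chi2r (w q))) q q'"

text \<open>On the increments of the two circle-valued functions a pair of half twists acts by the
  matrix with rows (2, 1) and (1, 1); the weights (golden, 1) form a left eigenvector.\<close>

lemma pairtwist_wform:
  assumes C: "compact S" and S: "sheet S w s" and Z: "!!q. q \<in> S Int Z ==> s q = 0"
  obtains s' where "sheet S (%q. pairtwist (w q)) s'" "!!q. q \<in> S Int Z ==> s' q = 0"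
    "coh S Z (wform (%q. pairtwist (w q)) s') (%q q'. golden^2 * wform w s q q')"
proof -
  obtain s1 where s1: "sheet S (%q. tw (-2) 1 1 (w q)) s1" "!!q. q \<in> S ==> s q = 0 ==> s1 q = 0"
    "!!q. q \<in> S ==> ee (Re (s1 q)) (chi1r (tw (-2) 1 1 (w q))) = ee (Re (s q)) (chi1r (w q))"
    "!!q. q \<in> S ==> ee (Im (s1 q)) (chi2a (tw (-2) 1 1 (w q))) =
        - 1 * ee (Re (s q)) (chi1r (w q)) * ee (Im (s q)) (chi2a (w q))"
    using twist1[OF S] by blast
  define w1 where "w1 q = tw (-2) 1 1 (w q)" for q
  note s1 = s1[folded w1_def]
  obtain s2 where s2: "sheet S (%q. tw 0 (-1) 1 (w1 q)) s2" "!!q. q \<in> S ==> s1 q = 0 ==> s2 q = 0"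
    "!!q. q \<in> S ==> ee (Im (s2 q)) (chi2r (tw 0 (-1) 1 (w1 q))) = ee (Im (s1 q)) (chi2r (w1 q))"
    "!!q. q \<in> S ==> ee (Re (s2 q)) (chi1a (tw 0 (-1) 1 (w1 q))) =
        1 * ee (Re (s1 q)) (chi1a (w1 q)) * ee (Im (s1 q)) (chi2r (w1 q))"
    using twist2[OF s1(1)] by blast
  define w2 where "w2 q = tw 0 (-1) 1 (w1 q)" for q
  note s2 = s2[folded w2_def]
  have Z1: "!!q. q \<in> S Int Z ==> s1 q = 0" and Z2: "!!q. q \<in> S Int Z ==> s2 q = 0"
    using Z s1(2) s2(2) by auto
  let ?d1 = "inc (%q. ee (Re (s q)) (chi1r (w q)))" and ?d2 = "inc (%q. ee (Im (s q)) (chi2r (w q)))"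
  let ?f1 = "inc (%q. ee (Re (s1 q)) (chi1r (w1 q)))" and ?f2 = "inc (%q. ee (Im (s1 q)) (chi2r (w1 q)))"
  let ?g1 = "inc (%q. ee (Re (s2 q)) (chi1r (w2 q)))" and ?g2 = "inc (%q. ee (Im (s2 q)) (chi2r (w2 q)))"
  have lin: "coh S Z (%q q'. a q q' + b q q') (%q q'. a' q q' + b' q q')" if "coh S Z a a'" "coh S Z b b'" for a b a' b'
    using coh_linear[OF that, of 1 1] by simp
  have f1: "coh S Z ?f1 ?d1" by (rule coh_cong[OF coh_refl[of S Z ?f1]]) (use s1(3) in \<open>auto simp: inc_def\<close>)
  have f2: "coh S Z ?f2 (%q q'. ?d1 q q' + ?d2 q q')"
  proof -
    have "coh S Z ?f2 (inc (%q. ee (Im (s1 q)) (chi2a (w1 q))))"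
      by (rule coh_change2[OF C s1(1) adm2_chi2r adm2_chi2a Z1])
    also have "coh S Z (inc (%q. ee (Im (s1 q)) (chi2a (w1 q)))) (%q q'. ?d1 q q' + inc (%q. ee (Im (s q)) (chi2a (w q))) q q')"
      by (rule coh_mult[OF C ucirc_e1[OF S adm1_chi1r] ucirc_e2[OF S adm2_chi2a] s1(4)]) auto
    also have "coh S Z (%q q'. ?d1 q q' + inc (%q. ee (Im (s q)) (chi2a (w q))) q q') (%q q'. ?d1 q q' + ?d2 q q')"
      by (rule lin[OF coh_refl coh_change2[OF C S adm2_chi2a adm2_chi2r Z]])
    finally show ?thesis .
  qed
  have g2: "coh S Z ?g2 (%q q'. ?d1 q q' + ?d2 q q')"
  proof -
    have "coh S Z ?g2 ?f2" by (rule coh_cong[OF coh_refl[of S Z ?g2]]) (use s2(3) in \<open>auto simp: inc_def\<close>)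
    thus ?thesis using f2 coh_trans by blast
  qed
  have g1: "coh S Z ?g1 (%q q'. ?d1 q q' + (?d1 q q' + ?d2 q q'))"
  proof -
    have "coh S Z ?g1 (inc (%q. ee (Re (s2 q)) (chi1a (w2 q))))"
      by (rule coh_change1[OF C s2(1) adm1_chi1r adm1_chi1a Z2])
    also have "coh S Z (inc (%q. ee (Re (s2 q)) (chi1a (w2 q)))) (%q q'. inc (%q. ee (Re (s1 q)) (chi1a (w1 q))) q q' + ?f2 q q')"
      by (rule coh_mult[OF C ucirc_e1[OF s1(1) adm1_chi1a] ucirc_e2[OF s1(1) adm2_chi2r] s2(4)]) auto
    also have "coh S Z (%q q'. inc (%q. ee (Re (s1 q)) (chi1a (w1 q))) q q' + ?f2 q q') (%q q'. ?d1 q q' + (?d1 q q' + ?d2 q q'))"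
      by (rule lin[OF coh_trans[OF coh_change1[OF C s1(1) adm1_chi1a adm1_chi1r Z1] f1] f2])
    finally show ?thesis .
  qed
  have "coh S Z (%q q'. golden * ?g1 q q' + 1 * ?g2 q q')
      (%q q'. golden * (?d1 q q' + (?d1 q q' + ?d2 q q')) + 1 * (?d1 q q' + ?d2 q q'))"
    by (rule coh_linear[OF g1 g2])
  hence "coh S Z (wform w2 s2) (%q q'. golden^2 * wform w s q q')"
  proof (rule coh_cong)
    fix q q'
    \<comment> \<open>The left eigenvector equation for the eigenvalue golden^2, which rests on
      golden^2 = golden + 1.\<close>
    have "golden^2 * (golden * x + y) = golden * (x + (x + y)) + 1 * (x + y)" for x y
    proof -
      have "golden^2 * (golden * x + y) = (golden * golden) * golden * x + golden * golden * y"
        by (simp add: power2_eq_square algebra_simps)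
      also have "\<dots> = (golden * golden) * x + golden * x + golden * y + y"
        unfolding golden_sq by (simp add: algebra_simps golden_sq)
      also have "\<dots> = golden * (x + (x + y)) + 1 * (x + y)" unfolding golden_sq by (simp add: algebra_simps)
      finally show ?thesis .
    qed
    thus "golden * (?d1 q q' + (?d1 q q' + ?d2 q q')) + 1 * (?d1 q q' + ?d2 q q') = golden^2 * wform w s q q'"
      by (simp add: wform_def)
  qed (simp add: wform_def)
  moreover have "w2 = (%q. pairtwist (w q))" by (auto simp: w2_def w1_def pairtwist_def)
  ultimately show ?thesis using that[of s2] s2(1) Z2 by simp
qed

lemma pairtwist_iterate:
  assumes C: "compact S" and S: "sheet S w s" and Z: "!!q. q \<in> S Int Z ==> s q = 0"
  shows "\<exists>s'. sheet S (%q. (pairtwist ^^ k) (w q)) s' & (\<forall>q\<in>S\<inter>Z. s' q = 0) &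
    coh S Z (wform (%q. (pairtwist ^^ k) (w q)) s') (%q q'. (golden^2) ^ k * wform w s q q')"
proof (induction k)
  case 0
  show ?case using S Z coh_refl by (intro exI[of _ s]) auto
next
  case (Suc k)
  then obtain s1 where s1: "sheet S (%q. (pairtwist ^^ k) (w q)) s1" "\<forall>q\<in>S\<inter>Z. s1 q = 0"
    "coh S Z (wform (%q. (pairtwist ^^ k) (w q)) s1) (%q q'. (golden^2) ^ k * wform w s q q')" by blast
  obtain s2 where s2: "sheet S (%q. pairtwist ((pairtwist ^^ k) (w q))) s2" "!!q. q \<in> S Int Z ==> s2 q = 0"
    "coh S Z (wform (%q. pairtwist ((pairtwist ^^ k) (w q))) s2) (%q q'. golden^2 * wform (%q. (pairtwist ^^ k) (w q)) s1 q q')"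
    using pairtwist_wform[OF C s1(1), of Z] s1(2) by blast
  have "coh S Z (%q q'. golden^2 * wform (%q. (pairtwist ^^ k) (w q)) s1 q q' + 0 * 0)
      (%q q'. golden^2 * ((golden^2) ^ k * wform w s q q') + 0 * 0)"
    by (rule coh_linear[OF s1(3) coh_refl])
  hence "coh S Z (wform (%q. pairtwist ((pairtwist ^^ k) (w q))) s2) (%q q'. (golden^2) ^ Suc k * wform w s q q')"
    using coh_trans[OF s2(3)] by (simp add: mult.assoc)
  thus ?case using s2 by auto
qed

section \<open>The area estimate\<close>

text \<open>Away from the transition annulus the circle-valued function is locally constant, and on the
  annulus its sign is locally constant; so increments are increments of a real function.\<close>

lemma inc_local:
  fixes a r :: "'a::metric_space => real"
  assumes C: "compact S" and a: "continuous_on S a" and r: "continuous_on S r"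
    and T: "continuous_on UNIV T" "!!x. x <= 2 ==> T x = t0" "!!x. x >= 3 ==> T x = (t1::real)"
    and t01: "t0 = 0 | t0 = 1/2" "t1 = 0 | t1 = 1/2"
    and nz: "!!q. q \<in> S ==> 2 <= r q ==> r q <= 3 ==> a q ~= 0"
  shows "\<exists>d>0. \<forall>q. \<exists>s\<in>{-1, 1::real}. \<forall>v\<in>S Int ball q d. \<forall>v'\<in>S Int ball q d.
    inc (%q. ee (a q) (T (r q))) v v' = s * (T (r v') - T (r v))"
proof -
  let ?K = "{q \<in> S. 2 <= r q & r q <= 3}"
  have "closed {q \<in> S. r q \<in> {2..3}}"
    using continuous_closed_preimage[OF r compact_imp_closed[OF C], of "{2..3}"]
    by (simp add: vimage_def Int_def)
  hence "compact ?K" by (intro compact_Collect_closed[OF C]) simp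
  then obtain m where m: "m > 0" "!!q. q \<in> ?K ==> m <= \<bar>a q\<bar>"
  proof (rule inf_positive_compact)
    show "continuous_on ?K (%q. \<bar>a q\<bar>)" by (intro continuous_intros continuous_on_subset[OF a]) auto
    show "0 < \<bar>a q\<bar>" if "q \<in> ?K" for q using nz that by auto
  qed auto
  have tc: "continuous_on S (%q. T (r q))" by (rule continuous_on_compose2[OF T(1) r]) auto
  have unif: "\<exists>d>0. \<forall>x\<in>S. \<forall>y\<in>S. dist x y < d --> dist (F x) (F y) < e" if "continuous_on S F" "e > 0" for F :: "'a => real" and e
    using compact_uniformly_continuous[OF that(1) C] that(2) unfolding uniformly_continuous_on_def
    by (metis dist_commute)
  obtain d1 where d1: "d1 > 0" "\<forall>x\<in>S. \<forall>y\<in>S. dist x y < d1 --> dist (a x) (a y) < m" using unif[OF a m(1)] by blast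
  obtain d2 where d2: "d2 > 0" "\<forall>x\<in>S. \<forall>y\<in>S. dist x y < d2 --> dist (r x) (r y) < 1" using unif[OF r, of 1] by auto
  obtain d3 where d3: "d3 > 0" "\<forall>x\<in>S. \<forall>y\<in>S. dist x y < d3 --> dist (T (r x)) (T (r y)) < 1/4"
    using unif[OF tc, of "1/4"] by auto
  define d where "d = min d1 (min d2 d3) / 2"
  have d: "d > 0" using d1(1) d2(1) d3(1) by (simp add: d_def)
  have close: "dist v v' < d1" "dist v v' < d2" "dist v v' < d3" if "v \<in> ball q d" "v' \<in> ball q d" for q v v'
    using that dist_triangle2[of v v' q] by (auto simp: d_def dist_commute)
  have "\<exists>s\<in>{-1, 1::real}. \<forall>v\<in>S Int ball q d. \<forall>v'\<in>S Int ball q d.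
    inc (%q. ee (a q) (T (r q))) v v' = s * (T (r v') - T (r v))" for q
  proof (cases "\<exists>p\<in>?K. p \<in> ball q d")
    case True
    then obtain p where p: "p \<in> S" "p \<in> ?K" "p \<in> ball q d" by auto
    have sg: "sgn (a v) = sgn (a p) & a v ~= 0" if v: "v \<in> S" "v \<in> ball q d" for v
    proof -
      have "\<bar>a v - a p\<bar> < m" using d1(2) close(1)[OF v(2) p(3)] v(1) p(1) by (simp add: dist_real_def)
      moreover have "m <= \<bar>a p\<bar>" using m(2) p(2) by blast
      ultimately have "a v > 0 & a p > 0 | a v < 0 & a p < 0" by linarith
      thus ?thesis by auto
    qed
    have ap: "a p ~= 0" using sg[OF p(1,3)] by simp
    have "inc (%q. ee (a q) (T (r q))) v v' = sgn (a p) * (T (r v') - T (r v))"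
      if v: "v \<in> S Int ball q d" "v' \<in> S Int ball q d" for v v'
    proof -
      have b: "\<bar>T (r v') - T (r v)\<bar> < 1/4"
        using d3(2) close(3)[of v q v'] v by (auto simp: dist_real_def abs_minus_commute)
      have e: "ee (a x) (T (r x)) = cis (2 * pi * (sgn (a p) * T (r x)))" if "x \<in> S Int ball q d" for x
        using sg[of x] that by (simp add: ee_nz)
      have "ee (a v') (T (r v')) / ee (a v) (T (r v)) = cis (2 * pi * (sgn (a p) * (T (r v') - T (r v))))"
        unfolding e[OF v(1)] e[OF v(2)] by (simp add: cis_divide algebra_simps)
      moreover have "Arg (cis (2 * pi * (sgn (a p) * (T (r v') - T (r v))))) = 2 * pi * (sgn (a p) * (T (r v') - T (r v)))"
      proof (rule Arg_cis)
        have "\<bar>2 * pi * (sgn (a p) * (T (r v') - T (r v)))\<bar> < 2 * pi * (1/4)"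
          using b ap by (simp add: abs_mult abs_sgn_eq)
        thus "2 * pi * (sgn (a p) * (T (r v') - T (r v))) \<in> {-pi<..pi}"
          unfolding greaterThanAtMost_iff using pi_gt_zero by linarith
      qed
      ultimately show ?thesis by (simp add: inc_def)
    qed
    moreover have "sgn (a p) \<in> {-1, 1}" using ap by (simp add: sgn_if)
    ultimately show ?thesis by blast
  next
    case False
    have "inc (%q. ee (a q) (T (r q))) v v' = 1 * (T (r v') - T (r v))"
      if v: "v \<in> S Int ball q d" "v' \<in> S Int ball q d" for v v'
    proof -
      have out: "r v < 2 | r v > 3" "r v' < 2 | r v' > 3" using False v by force+
      have "\<bar>r v - r v'\<bar> < 1" using d2(2) close(2)[of v q v'] v by (auto simp: dist_real_def)
      hence "(r v <= 2 & r v' <= 2) | (r v >= 3 & r v' >= 3)" using out by linarith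
      hence "\<exists>t. (t = 0 | t = 1/2) & T (r v) = t & T (r v') = t" using T(2,3) t01 by metis
      then obtain t where t: "t = 0 | t = 1/2" "T (r v) = t" "T (r v') = t" by blast
      have "ee (a v') t / ee (a v) t = 1" using t(1) by (elim disjE) (simp_all only: ee_0 ee_half, simp_all)
      thus ?thesis using t(2,3) by (simp add: inc_def)
    qed
    thus ?thesis by blast
  qed
  thus ?thesis using d by blast
qed

lemma inc_const:
  assumes "e v = e v'" "cmod (e v) = 1"
  shows "inc e v v' = 0"
proof -
  have "e v ~= 0" using assms(2) by auto
  thus ?thesis using assms(1) by (simp add: inc_def)
qed

text \<open>With the signs s and t of the two sheet coordinates frozen, this is a local primitive of
  \<open>wform\<close> in terms of the spatial coordinates: golden s \<open>chi1r\<close> + t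
  \<open>chi2r\<close>, written out.\<close>

definition psi :: "real => real => real^3 => real" where
  "psi s t p = golden * s * ((1 - st (3 - ((p$1 + 2)^2 + (p$2)^2))) / 2) + t * (st (3 - ((p$1)^2 + (p$2)^2)) / 2)"

lemma chi_coords:
  "chi1r (Complex x y) = (1 - st (3 - ((x + 2)^2 + y^2))) / 2"
  "chi2r (Complex x y) = st (3 - (x^2 + y^2)) / 2"
  by (simp_all add: chi1r_def chi2r_def eta_def cmod_power2)

lemma st_compose_deriv:
  assumes "(\<phi> has_derivative \<phi>') (at q)"
  shows "((%q. st (\<phi> q)) has_derivative (%v. st' (\<phi> q) * \<phi>' v)) (at q)"
  using has_derivative_compose[OF assms, of st "(*) (st' (\<phi> q))"] st_deriv[of "\<phi> q"]
  by (simp add: has_field_derivative_def)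

lemma psi_deriv:
  fixes f :: "real^2 => real^3"
  assumes f: "(f has_derivative f') (at q)"
  defines "a1 \<equiv> st' (3 - ((f q$1 + 2)^2 + (f q$2)^2))" and "a2 \<equiv> st' (3 - ((f q$1)^2 + (f q$2)^2))"
  shows "((%q. psi s t (f q)) has_derivative
     (%v. (golden * s * a1 * (f q$1 + 2) - t * a2 * f q$1) * (f' v$1) +
          (golden * s * a1 * f q$2 - t * a2 * f q$2) * (f' v$2))) (at q)"
proof -
  have c: "((%q. f q$i) has_derivative (%v. f' v$i)) (at q)" for i
    by (rule bounded_linear.has_derivative[OF bounded_linear_vec_nth f])
  have 1: "((%q. 3 - ((f q$1 + 2)^2 + (f q$2)^2)) has_derivative
      (%v. - (2 * (f q$1 + 2) * f' v$1 + 2 * f q$2 * f' v$2))) (at q)"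
    by (auto intro!: derivative_eq_intros c simp: algebra_simps)
  have 2: "((%q. 3 - ((f q$1)^2 + (f q$2)^2)) has_derivative
      (%v. - (2 * f q$1 * f' v$1 + 2 * f q$2 * f' v$2))) (at q)"
    by (auto intro!: derivative_eq_intros c simp: algebra_simps)
  have 3: "((%q. golden * s * ((1 - st (3 - ((f q$1 + 2)^2 + (f q$2)^2))) / 2)) has_derivative
      (%v. golden * s * (a1 * ((f q$1 + 2) * f' v$1 + f q$2 * f' v$2)))) (at q)"
    unfolding a1_def
    by (rule has_derivative_eq_rhs, rule has_derivative_mult_right, rule has_derivative_divide',
        rule has_derivative_diff[OF has_derivative_const st_compose_deriv[OF 1]],
        rule has_derivative_const, simp)
      (simp add: fun_eq_iff field_simps)
  have 4: "((%q. t * (st (3 - ((f q$1)^2 + (f q$2)^2)) / 2)) has_derivative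
      (%v. - t * (a2 * (f q$1 * f' v$1 + f q$2 * f' v$2)))) (at q)"
    unfolding a2_def
    by (rule has_derivative_eq_rhs, rule has_derivative_mult_right, rule has_derivative_divide',
        rule st_compose_deriv[OF 2], rule has_derivative_const, simp)
      (simp add: fun_eq_iff field_simps)
  show ?thesis unfolding psi_def
    by (rule has_derivative_eq_rhs[OF has_derivative_add[OF 3 4]]) (simp add: fun_eq_iff algebra_simps)
qed

lemma st'_support: "st' (3 - r) ~= 0 ==> 2 < r & r < 3"
  using st'_outside[of "3 - r"] by force

lemma sq_lt_4: "(x::real)^2 + y^2 < 3 ==> \<bar>x\<bar> <= 2 & \<bar>y\<bar> <= 2"
proof -
  assume a: "x^2 + y^2 < 3"
  have "x^2 <= 4" "y^2 <= 4" using a zero_le_power2[of x] zero_le_power2[of y] by linarith+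
  hence "x^2 <= 2^2" "y^2 <= 2^2" by simp_all
  thus ?thesis using abs_le_square_iff[of x 2] abs_le_square_iff[of y 2] by simp
qed

text \<open>The derivative is supported where the squared radius is between 2 and 3, so the
  coordinates are bounded there. This makes the coefficients of the form bounded independently of
  where the disk wanders.\<close>

lemma st'_times_bound:
  assumes M: "!!x. \<bar>st' x\<bar> <= M"
  shows "\<bar>st' (3 - (x^2 + y^2)) * x\<bar> <= 2 * M" "\<bar>st' (3 - (x^2 + y^2)) * y\<bar> <= 2 * M"
proof -
  have M0: "M >= 0" using M[of 0] by linarith
  have "\<bar>st' (3 - (x^2 + y^2)) * x\<bar> <= M * 2 & \<bar>st' (3 - (x^2 + y^2)) * y\<bar> <= M * 2"
  proof (cases "st' (3 - (x^2 + y^2)) = 0")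
    case False
    hence "\<bar>x\<bar> <= 2" "\<bar>y\<bar> <= 2" using st'_support[of "x^2 + y^2"] sq_lt_4 by auto
    thus ?thesis unfolding abs_mult using M M0 by (auto intro!: mult_mono)
  qed (use M0 in simp)
  thus "\<bar>st' (3 - (x^2 + y^2)) * x\<bar> <= 2 * M" "\<bar>st' (3 - (x^2 + y^2)) * y\<bar> <= 2 * M" by auto
qed

text \<open>The left side evaluates the wedge product of c dz with a dx + b dy on u and v; only the
  first two components of the cross product occur in it.\<close>

lemma det_cross_bound:
  fixes u v :: "real^3"
  assumes "\<bar>c\<bar> <= C" "\<bar>a\<bar> <= A" "\<bar>b\<bar> <= A"
  shows "\<bar>(c * u$3) * (a * v$1 + b * v$2) - (c * v$3) * (a * u$1 + b * u$2)\<bar> <= C * (2 * A) * norm (cross3 u v)"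
proof -
  have "(c * u$3) * (a * v$1 + b * v$2) - (c * v$3) * (a * u$1 + b * u$2) =
      c * (a * (cross3 u v)$2 - b * (cross3 u v)$1)"
    by (simp add: cross3_def algebra_simps)
  also have "\<bar>\<dots>\<bar> <= C * (A * norm (cross3 u v) + A * norm (cross3 u v))"
    unfolding abs_mult
  proof (rule mult_mono)
    have "\<bar>a * (cross3 u v)$2 - b * (cross3 u v)$1\<bar> <= \<bar>a\<bar> * \<bar>(cross3 u v)$2\<bar> + \<bar>b\<bar> * \<bar>(cross3 u v)$1\<bar>"
      unfolding abs_mult[symmetric] by (rule abs_triangle_ineq4)
    also have "\<dots> <= A * norm (cross3 u v) + A * norm (cross3 u v)"
      using assms(2,3) component_le_norm_cart[of "cross3 u v"] by (intro add_mono mult_mono) auto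
    finally show "\<bar>a * (cross3 u v)$2 - b * (cross3 u v)$1\<bar> <= A * norm (cross3 u v) + A * norm (cross3 u v)" .
  qed (use assms in auto)
  finally show ?thesis by (simp add: algebra_simps)
qed

lemma golden_lt_2: "golden < 2"
proof -
  have "sqrt 5 < 3" by (rule real_less_lsqrt) auto
  thus ?thesis by (simp add: golden_def)
qed

text \<open>The sum of the trapezoidal increments of a form along a quadrilateral is the shoelace
  formula for its signed area.\<close>

lemma shoelace:
  fixes X U :: "nat => real"
  shows "(X 0 + X 1) / 2 * (U 1 - U 0) + (X 1 + X 2) / 2 * (U 2 - U 1) + (X 2 + X 3) / 2 * (U 3 - U 2)
     + (X 3 + X 0) / 2 * (U 0 - U 3) = ((X 2 - X 0) * (U 3 - U 1) - (X 3 - X 1) * (U 2 - U 0)) / 2"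
  by (simp add: field_simps)

text \<open>The values 1 and -1 are half a turn apart and cannot both occur at nearby points, so a
  function with these values only has zero increments. This is how the form comes to vanish along
  the rim.\<close>

lemma e_pm_close:
  fixes e :: "'a::metric_space => complex"
  assumes "compact S" "ucirc S e"
  shows "\<exists>d>0. \<forall>q\<in>S. \<forall>q'\<in>S. dist q q' < d -->
     \<bar>Arg (e q' / e q)\<bar> < pi / 4 & inc e q' q = - inc e q q' & inc e q q = 0 &
     (e q \<in> {1, -1} --> e q' \<in> {1, -1} --> inc e q q' = 0)"
proof -
  obtain d where d: "d > 0" "\<forall>q\<in>S. \<forall>q'\<in>S. dist q q' < d --> \<bar>Arg (e q' / e q)\<bar> < pi / 4"
    using inc_small[OF assms] by blast
  have n: "cmod (e q) = 1" if "q \<in> S" for q using assms(2) that by (auto simp: ucirc_def)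
  have "inc e q q' = 0" if "q \<in> S" "q' \<in> S" "dist q q' < d" "e q \<in> {1,-1}" "e q' \<in> {1,-1}" for q q'
  proof -
    have "e q' = e q"
    proof (rule ccontr)
      assume "e q' ~= e q"
      hence "e q' / e q = - 1" using that by auto
      hence "Arg (e q' / e q) = pi" using Arg_of_real[of "-1"] by simp
      thus False using d(2) that pi_gt_zero by fastforce
    qed
    thus ?thesis using inc_const[of e q q'] n[OF that(1)] by simp
  qed
  moreover have "inc e q' q = - inc e q q'" if "q \<in> S" "q' \<in> S" "dist q q' < d" for q q'
    using inc_swap_small[of e q' q] d(2) that n by blast
  moreover have "inc e q q = 0" if "q \<in> S" for q using inc_const[of e q q] n[OF that] by simp
  ultimately show ?thesis using d by blast
qed

lemma cell_edge_sum:
  "(\<Sum>e\<in>cedges (i, j). F (fst e) (snd e)) = F (i, j) (Suc i, j) + F (Suc i, j) (Suc i, Suc j) +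
     F (Suc i, Suc j) (i, Suc j) + F (i, Suc j) (i, j)"
  by (simp add: add.assoc)

lemma inc_quad:
  assumes A: "!!x y. x \<in> W ==> y \<in> W ==> \<bar>Arg (e y / e x)\<bar> < pi/4 & inc e y x = - inc e x y"
    and nn: "!!x. x \<in> W ==> cmod (e x) = 1" and W: "v0 \<in> W & v1 \<in> W & v2 \<in> W & v3 \<in> W"
  shows "inc e v0 v1 + inc e v1 v2 + inc e v2 v3 + inc e v3 v0 = 0"
proof -
  have "inc e v0 v2 = inc e v0 v1 + inc e v1 v2" by (rule inc_add_small) (use A nn W in auto)
  moreover have "inc e v2 v0 = inc e v2 v3 + inc e v3 v0" by (rule inc_add_small) (use A nn W in auto)
  moreover have "inc e v2 v0 = - inc e v0 v2" using A[of v0 v2] W by auto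
  ultimately show ?thesis by simp
qed

text \<open>The cut-off \<open>ch\<close> interpolates between the closed form on the lower part and the one on the
  upper part.  Its discrete curl is controlled by the area, because on the slab the two forms
  differ, up to an exact term, by the tiny form \<open>mu * wform\<close>.\<close>

lemma cutoff_sum_le:
  fixes f :: "real^2 => real^3" and e1 e2 :: "real^2 => complex" and b c :: real
  defines "ch \<equiv> %t. 1 - st (2 * t - c)"
  defines "S \<equiv> {q \<in> unit_square. \<bar>f q$3\<bar> <= 1}"
  assumes M: "!!x. \<bar>st' x\<bar> <= M"
    and L: "L-lipschitz_on unit_square f" and N: "negligible N"
    and reg: "!!q. q \<in> unit_square - N ==> q \<in> interior unit_square & f differentiable (at q)"
    and c: "-3/2 <= c" "c <= 1/2"
    and sh: "sheet S (%q. Complex (f q$1) (f q$2)) sg"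
    and u1: "ucirc {q \<in> unit_square. f q$3 <= 1} e1" and u2: "ucirc {q \<in> unit_square. - 1 <= f q$3} e2"
    and E: "continuous_on S E" "!!q. q \<in> S ==> q \<in> frontier unit_square ==> E q = 0"
    and dE: "dE > 0" "!!q q'. q \<in> S ==> q' \<in> S ==> dist q q' < dE ==>
        golden * inc e1 q q' + inc e2 q q' = mu * wform (%q. Complex (f q$1) (f q$2)) sg q q' + E q' - E q"
    and mu: "mu >= 0"
    and b1: "!!q. q \<in> frontier unit_square ==> f q$3 <= 1 ==> e1 q \<in> {1, -1}"
    and b2: "!!q. q \<in> frontier unit_square ==> - 1 <= f q$3 ==> e2 q \<in> {1, -1}"
  obtains Om d where "d > 0"
    "!!v v'. v \<in> unit_square ==> v' \<in> unit_square ==> dist v v' < d ==> Om v' v = - Om v v'"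
    "!!v v'. v \<in> frontier unit_square ==> v' \<in> frontier unit_square ==> dist v v' < d ==> Om v v' = 0"
    "!!v v'. v \<in> unit_square ==> v' \<in> unit_square ==> dist v v' < d ==> f v$3 <= c/2 ==> f v'$3 <= c/2 ==>
        Om v v' = golden * inc e1 v v'"
    "!!v v'. v \<in> unit_square ==> v' \<in> unit_square ==> dist v v' < d ==> f v$3 >= c/2 + 1/2 ==> f v'$3 >= c/2 + 1/2 ==>
        Om v v' = - 1 * inc e2 v v'"
    "!!eps. eps > 0 ==> \<forall>\<^sub>F n in sequentially.
        (\<Sum>c\<in>grid n. \<bar>\<Sum>e\<in>cedges c. Om (vtx n (fst e)) (vtx n (snd e))\<bar>) <= 24 * M^2 * mu * disk_area f + eps"
proof -
  let ?Q = "unit_square :: (real^2) set" and ?fr = "frontier unit_square :: (real^2) set"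
  let ?Q1 = "{q \<in> ?Q. f q$3 <= 1}" and ?Q2 = "{q \<in> ?Q. - 1 <= f q$3}"
  let ?w = "%q. Complex (f q$1) (f q$2)"
  define h where "h q = f q$3" for q
  define m where "m v v' = (ch (h v) + ch (h v')) / 2" for v v'
  \<comment> \<open>The discrete version of ch golden d(e1) - (1 - ch) d(e2) + E d(ch), with
    trapezoidal means. The last term turns the exact discrepancy E into the coboundary of ch E, so
    that it drops out of the curl.\<close>
  define Om where "Om v v' = m v v' * (golden * inc e1 v v') - (1 - m v v') * inc e2 v v' +
      (ch (h v') - ch (h v)) * (E v + E v') / 2" for v v'
  have M0: "M >= 0" using M[of 0] by linarith
  have L0: "L >= 0" using L lipschitz_on_nonneg by blast
  have cf: "continuous_on ?Q f" using L lipschitz_on_continuous_on by blast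
  have ch1: "continuous_on ?Q h" unfolding h_def using cf by (intro continuous_intros)
  have cS: "compact S" unfolding S_def
    by (intro compact_Collect_closed continuous_on_closed_Collect_le)
      (use ch1 in \<open>auto simp: h_def intro!: continuous_intros compact_imp_closed\<close>)
  have cQ1: "compact ?Q1" and cQ2: "compact ?Q2"
    by (intro compact_Collect_closed continuous_on_closed_Collect_le;
        use ch1 in \<open>auto simp: h_def intro!: continuous_intros compact_imp_closed\<close>)+
  \<comment> \<open>The transition takes place at heights from c/2 to c/2 + 1/2, that is within
    [-3/4, 3/4]. Cells whose heights vary by less than 1/4 and which meet it are therefore contained
    in the slab \<open>S\<close>.\<close>
  have chlow: "ch t = 1" if "t <= c/2" for t using that by (simp add: ch_def st_0)
  have chhigh: "ch t = 0" if "t >= c/2 + 1/2" for t using that by (simp add: ch_def st_1)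
  obtain d1 where d1: "d1 > 0" "\<forall>q\<in>?Q1. \<forall>q'\<in>?Q1. dist q q' < d1 -->
     \<bar>Arg (e1 q' / e1 q)\<bar> < pi / 4 & inc e1 q' q = - inc e1 q q' & inc e1 q q = 0 &
     (e1 q \<in> {1, -1} --> e1 q' \<in> {1, -1} --> inc e1 q q' = 0)" using e_pm_close[OF cQ1 u1] by blast
  obtain d2 where d2: "d2 > 0" "\<forall>q\<in>?Q2. \<forall>q'\<in>?Q2. dist q q' < d2 -->
     \<bar>Arg (e2 q' / e2 q)\<bar> < pi / 4 & inc e2 q' q = - inc e2 q q' & inc e2 q q = 0 &
     (e2 q \<in> {1, -1} --> e2 q' \<in> {1, -1} --> inc e2 q q' = 0)" using e_pm_close[OF cQ2 u2] by blast
  have "uniformly_continuous_on ?Q h" by (rule compact_uniformly_continuous[OF ch1 compact_cbox])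
  then obtain d3 where d3: "d3 > 0" "!!x y. x \<in> ?Q ==> y \<in> ?Q ==> dist x y < d3 ==> dist (h x) (h y) < 1/4"
    unfolding uniformly_continuous_on_def by (metis zero_less_divide_1_iff zero_less_numeral)
  have cfS: "continuous_on S f" by (rule continuous_on_subset[OF cf]) (auto simp: S_def)
  define s1 where "s1 q = ee (Re (sg q)) (chi1r (?w q))" for q
  define s2 where "s2 q = ee (Im (sg q)) (chi2r (?w q))" for q
  have cw: "continuous_on S ?w" and csg: "continuous_on S sg" and sq: "!!q. q \<in> S ==> (sg q)^2 = phi0 (?w q)"
    using sh by (auto simp: sheet_def)
  have "\<exists>d>0. \<forall>q. \<exists>s\<in>{-1, 1::real}. \<forall>v\<in>S Int ball q d. \<forall>v'\<in>S Int ball q d.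
    inc (%q. ee (Re (sg q)) ((%r. (1 - eta r) / 2) ((cmod (?w q + 2))^2))) v v' =
      s * ((%r. (1 - eta r) / 2) ((cmod (?w v' + 2))^2) - (%r. (1 - eta r) / 2) ((cmod (?w v + 2))^2))"
  proof (rule inc_local[OF cS, where T = "%r. (1 - eta r) / 2" and ?t0.0 = 0 and ?t1.0 = "1/2"
        and a = "%q. Re (sg q)" and r = "%q. (cmod (?w q + 2))^2"])
    show "continuous_on S (%q. Re (sg q))" using csg by (intro continuous_intros)
    show "continuous_on S (%q. (cmod (?w q + 2))^2)" using cfS by (intro continuous_intros)
    show "continuous_on UNIV (%r. (1 - eta r) / 2)" by (intro continuous_intros continuous_on_eta) auto
    show "(1 - eta r) / 2 = 0" if "r <= 2" for r using that by (simp add: eta_in)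
    show "(1 - eta r) / 2 = 1/2" if "r >= 3" for r using that by (simp add: eta_out)
    show "Re (sg q) ~= 0" if "q \<in> S" "2 <= (cmod (?w q + 2))^2" "(cmod (?w q + 2))^2 <= 3" for q
      using sheet_Re_0[OF sq[OF that(1)]] collar1[of "?w q"] that(2,3) by blast
  qed auto
  then obtain d4 where d4: "d4 > 0" "!!q. \<exists>s\<in>{-1, 1::real}. \<forall>v\<in>S Int ball q d4. \<forall>v'\<in>S Int ball q d4.
      inc s1 v v' = s * (chi1r (?w v') - chi1r (?w v))"
    unfolding s1_def chi1r_def by blast
  have "\<exists>d>0. \<forall>q. \<exists>s\<in>{-1, 1::real}. \<forall>v\<in>S Int ball q d. \<forall>v'\<in>S Int ball q d.
    inc (%q. ee (Im (sg q)) ((%r. eta r / 2) ((cmod (?w q))^2))) v v' =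
      s * ((%r. eta r / 2) ((cmod (?w v'))^2) - (%r. eta r / 2) ((cmod (?w v))^2))"
  proof (rule inc_local[OF cS, where T = "%r. eta r / 2" and ?t0.0 = "1/2" and ?t1.0 = 0
        and a = "%q. Im (sg q)" and r = "%q. (cmod (?w q))^2"])
    show "continuous_on S (%q. Im (sg q))" using csg by (intro continuous_intros)
    show "continuous_on S (%q. (cmod (?w q))^2)" using cfS by (intro continuous_intros)
    show "continuous_on UNIV (%r. eta r / 2)" by (intro continuous_intros continuous_on_eta) auto
    show "eta r / 2 = 1/2" if "r <= 2" for r using that by (simp add: eta_in)
    show "eta r / 2 = 0" if "r >= 3" for r using that by (simp add: eta_out)
    show "Im (sg q) ~= 0" if "q \<in> S" "2 <= (cmod (?w q))^2" "(cmod (?w q))^2 <= 3" for q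
      using sheet_Im_0[OF sq[OF that(1)]] collar2[of "?w q"] that(2,3) by blast
  qed auto
  then obtain d5 where d5: "d5 > 0" "!!q. \<exists>s\<in>{-1, 1::real}. \<forall>v\<in>S Int ball q d5. \<forall>v'\<in>S Int ball q d5.
      inc s2 v v' = s * (chi2r (?w v') - chi2r (?w v))"
    unfolding s2_def chi2r_def by blast
  define d where "d = Min {d1, d2, d3, d4, d5, dE}"
  have d: "d > 0" "d <= d1" "d <= d2" "d <= d3" "d <= d4" "d <= d5" "d <= dE"
    using d1(1) d2(1) d3(1) d4(1) d5(1) dE(1) by (auto simp: d_def)
  have hd: "\<bar>h v - h v'\<bar> < 1/4" if "v \<in> ?Q" "v' \<in> ?Q" "dist v v' < d" for v v'
    using d3(2)[OF that(1,2)] that(3) d by (simp add: dist_real_def)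
  have m0: "f v$3 <= 1 & f v'$3 <= 1" if "v \<in> ?Q" "v' \<in> ?Q" "dist v v' < d" "m v v' ~= 0" for v v'
  proof -
    have "h v < c/2 + 1/2 | h v' < c/2 + 1/2"
    proof (rule ccontr)
      assume "\<not> ?thesis"
      hence "ch (h v) = 0" "ch (h v') = 0" using chhigh by auto
      thus False using that(4) by (simp add: m_def)
    qed
    thus ?thesis using hd[OF that(1-3)] c unfolding h_def by linarith
  qed
  have m1: "- 1 <= f v$3 & - 1 <= f v'$3" if "v \<in> ?Q" "v' \<in> ?Q" "dist v v' < d" "m v v' ~= 1" for v v'
  proof -
    have "h v > c/2 | h v' > c/2"
    proof (rule ccontr)
      assume "\<not> ?thesis"
      hence "ch (h v) = 1" "ch (h v') = 1" using chlow by auto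
      thus False using that(4) by (simp add: m_def)
    qed
    thus ?thesis using hd[OF that(1-3)] c unfolding h_def by linarith
  qed
  have S01: "v \<in> S & v' \<in> S" if "v \<in> ?Q" "v' \<in> ?Q" "dist v v' < d" "ch (h v) ~= ch (h v')" for v v'
  proof -
    have "\<not> (h v <= c/2 & h v' <= c/2)" "\<not> (h v >= c/2 + 1/2 & h v' >= c/2 + 1/2)"
      using that(4) chlow[of "h v"] chlow[of "h v'"] chhigh[of "h v"] chhigh[of "h v'"] by metis+
    hence "\<bar>h v\<bar> <= 1" "\<bar>h v'\<bar> <= 1" using hd[OF that(1-3)] c by linarith+
    thus ?thesis using that by (auto simp: S_def h_def)
  qed
  have msym: "m v' v = m v v'" for v v' by (simp add: m_def add.commute)
  have anti: "Om v' v = - Om v v'" if v: "v \<in> ?Q" "v' \<in> ?Q" "dist v v' < d" for v v'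
  proof -
    have "m v v' * (golden * inc e1 v' v) = - (m v v' * (golden * inc e1 v v'))"
      using d1(2) m0[OF v] v d by (cases "m v v' = 0") force+
    moreover have "(1 - m v v') * inc e2 v' v = - ((1 - m v v') * inc e2 v v')"
      using d2(2) m1[OF v] v d by (cases "m v v' = 1") force+
    ultimately show ?thesis by (simp add: Om_def msym algebra_simps) (simp add: field_simps)
  qed
  have fr0: "Om v v' = 0" if v: "v \<in> ?fr" "v' \<in> ?fr" "dist v v' < d" for v v'
  proof -
    have vQ: "v \<in> ?Q" "v' \<in> ?Q" using v frontier_square_subset by auto
    have z1: "m v v' * (golden * inc e1 v v') = 0"
    proof (cases "m v v' = 0")
      case False
      hence lo: "f v$3 <= 1" "f v'$3 <= 1" using m0[OF vQ v(3)] by auto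
      hence "inc e1 v v' = 0" using d1(2) b1[OF v(1) lo(1)] b1[OF v(2) lo(2)] vQ v(3) d by force
      thus ?thesis by simp
    qed simp
    have z2: "(1 - m v v') * inc e2 v v' = 0"
    proof (cases "m v v' = 1")
      case False
      hence lo: "- 1 <= f v$3" "- 1 <= f v'$3" using m1[OF vQ v(3)] by auto
      hence "inc e2 v v' = 0" using d2(2) b2[OF v(1) lo(1)] b2[OF v(2) lo(2)] vQ v(3) d by force
      thus ?thesis by simp
    qed simp
    have z3: "(ch (h v') - ch (h v)) * (E v + E v') = 0"
      using S01[OF vQ v(3)] E(2)[of v] E(2)[of v'] v by (cases "ch (h v) = ch (h v')") auto
    show ?thesis unfolding Om_def z1 z2 z3 by simp
  qed
  have low: "Om v v' = golden * inc e1 v v'" if "f v$3 <= c/2" "f v'$3 <= c/2" for v v'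
    using that by (simp add: Om_def m_def chlow h_def)
  have high: "Om v v' = - 1 * inc e2 v v'" if "f v$3 >= c/2 + 1/2" "f v'$3 >= c/2 + 1/2" for v v'
    using that by (simp add: Om_def m_def chhigh h_def)
  define F where "F n cc = \<bar>\<Sum>e\<in>cedges cc. Om (vtx n (fst e)) (vtx n (snd e))\<bar>" for n cc
  have closed1: "inc e1 v0 v1 + inc e1 v1 v2 + inc e1 v2 v3 + inc e1 v3 v0 = 0"
    if v: "{v0, v1, v2, v3} \<subseteq> ?Q1" "!!x y. x \<in> {v0,v1,v2,v3} ==> y \<in> {v0,v1,v2,v3} ==> dist x y < d" for v0 v1 v2 v3
  proof (rule inc_quad[of "{v0,v1,v2,v3}"])
    show "\<bar>Arg (e1 y / e1 x)\<bar> < pi/4 & inc e1 y x = - inc e1 x y" if "x \<in> {v0,v1,v2,v3}" "y \<in> {v0,v1,v2,v3}" for x y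
      using d1(2) v(2)[OF that] v(1) that d(2) by (meson less_le_trans subsetD)
    show "cmod (e1 x) = 1" if "x \<in> {v0,v1,v2,v3}" for x using u1 v(1) that unfolding ucirc_def by blast
  qed simp
  have closed2: "inc e2 v0 v1 + inc e2 v1 v2 + inc e2 v2 v3 + inc e2 v3 v0 = 0"
    if v: "{v0, v1, v2, v3} \<subseteq> ?Q2" "!!x y. x \<in> {v0,v1,v2,v3} ==> y \<in> {v0,v1,v2,v3} ==> dist x y < d" for v0 v1 v2 v3
  proof (rule inc_quad[of "{v0,v1,v2,v3}"])
    show "\<bar>Arg (e2 y / e2 x)\<bar> < pi/4 & inc e2 y x = - inc e2 x y" if "x \<in> {v0,v1,v2,v3}" "y \<in> {v0,v1,v2,v3}" for x y
      using d2(2) v(2)[OF that] v(1) that d(3) by (meson less_le_trans subsetD)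
    show "cmod (e2 x) = 1" if "x \<in> {v0,v1,v2,v3}" for x using u2 v(1) that unfolding ucirc_def by blast
  qed simp
  have curl: "Om v0 v1 + Om v1 v2 + Om v2 v3 + Om v3 v0 =
      mu * (((ch (h v2) - ch (h v0)) * (psi s t (f v3) - psi s t (f v1)) -
             (ch (h v3) - ch (h v1)) * (psi s t (f v2) - psi s t (f v0))) / 2)"
    if vS: "{v0, v1, v2, v3} \<subseteq> S" and vd: "!!x y. x \<in> {v0,v1,v2,v3} ==> y \<in> {v0,v1,v2,v3} ==> dist x y < d"
      and ps: "!!x y. x \<in> {v0,v1,v2,v3} ==> y \<in> {v0,v1,v2,v3} ==>
         wform ?w sg x y = psi s t (f y) - psi s t (f x)" for v0 v1 v2 v3 s t
  proof -
    \<comment> \<open>Substituting the relation between \<open>e1\<close>, \<open>e2\<close> and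
      \<open>wform\<close>, and using that the product rule for trapezoidal means is exact, leaves a
      coboundary, a closed term and mu times the mean of ch against the increment of the
      primitive.\<close>
    have om: "Om x y = (ch (h y) * E y - ch (h x) * E x) - inc e2 x y +
        mu * ((ch (h x) + ch (h y)) / 2 * (psi s t (f y) - psi s t (f x)))"
      if xy: "x \<in> {v0,v1,v2,v3}" "y \<in> {v0,v1,v2,v3}" for x y
    proof -
      have "golden * inc e1 x y + inc e2 x y = mu * wform ?w sg x y + E y - E x"
        using dE(2) vS xy vd[OF xy] d(7) by (meson less_le_trans subsetD)
      hence g1: "golden * inc e1 x y = mu * (psi s t (f y) - psi s t (f x)) + E y - E x - inc e2 x y"
        using ps[OF xy] by simp
      show ?thesis unfolding Om_def g1 m_def by (simp add: field_simps)
    qed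
    have z: "inc e2 v0 v1 + inc e2 v1 v2 + inc e2 v2 v3 + inc e2 v3 v0 = 0"
      by (rule closed2) (use vS vd in \<open>auto simp: S_def\<close>)
    have o: "Om v0 v1 = (ch (h v1) * E v1 - ch (h v0) * E v0) - inc e2 v0 v1 + mu * ((ch (h v0) + ch (h v1)) / 2 * (psi s t (f v1) - psi s t (f v0)))"
      "Om v1 v2 = (ch (h v2) * E v2 - ch (h v1) * E v1) - inc e2 v1 v2 + mu * ((ch (h v1) + ch (h v2)) / 2 * (psi s t (f v2) - psi s t (f v1)))"
      "Om v2 v3 = (ch (h v3) * E v3 - ch (h v2) * E v2) - inc e2 v2 v3 + mu * ((ch (h v2) + ch (h v3)) / 2 * (psi s t (f v3) - psi s t (f v2)))"
      "Om v3 v0 = (ch (h v0) * E v0 - ch (h v3) * E v3) - inc e2 v3 v0 + mu * ((ch (h v3) + ch (h v0)) / 2 * (psi s t (f v0) - psi s t (f v3)))"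
      by (rule om; simp)+
    have "Om v0 v1 + Om v1 v2 + Om v2 v3 + Om v3 v0 = mu * ((ch (h v0) + ch (h v1)) / 2 * (psi s t (f v1) - psi s t (f v0)) +
       (ch (h v1) + ch (h v2)) / 2 * (psi s t (f v2) - psi s t (f v1)) + (ch (h v2) + ch (h v3)) / 2 * (psi s t (f v3) - psi s t (f v2)) +
       (ch (h v3) + ch (h v0)) / 2 * (psi s t (f v0) - psi s t (f v3)))"
      unfolding o distrib_left using z by linarith
    also have "(ch (h v0) + ch (h v1)) / 2 * (psi s t (f v1) - psi s t (f v0)) +
       (ch (h v1) + ch (h v2)) / 2 * (psi s t (f v2) - psi s t (f v1)) + (ch (h v2) + ch (h v3)) / 2 * (psi s t (f v3) - psi s t (f v2)) +
       (ch (h v3) + ch (h v0)) / 2 * (psi s t (f v0) - psi s t (f v3)) =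
       ((ch (h v2) - ch (h v0)) * (psi s t (f v3) - psi s t (f v1)) - (ch (h v3) - ch (h v1)) * (psi s t (f v2) - psi s t (f v0))) / 2"
      by (simp add: field_simps)
    finally show ?thesis .
  qed
  \<comment> \<open>On a ball of radius d both signs are constant wherever they matter, so a single
    primitive serves all pairs of points in it.\<close>
  have loc: "\<exists>s\<in>{-1,1}. \<exists>t\<in>{-1,1}. \<forall>x\<in>S Int ball q d. \<forall>y\<in>S Int ball q d. wform ?w sg x y = psi s t (f y) - psi s t (f x)" for q
  proof -
    obtain s where s: "s \<in> {-1,1}" "\<forall>v\<in>S Int ball q d4. \<forall>v'\<in>S Int ball q d4. inc s1 v v' = s * (chi1r (?w v') - chi1r (?w v))"
      using d4(2)[of q] by blast
    obtain t where t: "t \<in> {-1,1}" "\<forall>v\<in>S Int ball q d5. \<forall>v'\<in>S Int ball q d5. inc s2 v v' = t * (chi2r (?w v') - chi2r (?w v))"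
      using d5(2)[of q] by blast
    have "wform ?w sg x y = psi s t (f y) - psi s t (f x)" if "x \<in> S Int ball q d" "y \<in> S Int ball q d" for x y
    proof -
      have i: "inc s1 x y = s * (chi1r (?w y) - chi1r (?w x))" "inc s2 x y = t * (chi2r (?w y) - chi2r (?w x))"
        using s(2) t(2) that d by auto
      have w: "wform ?w sg x y = golden * inc s1 x y + inc s2 x y" by (simp add: wform_def s1_def[abs_def] s2_def[abs_def])
      have pe: "psi s t (f z) = golden * s * chi1r (?w z) + t * chi2r (?w z)" for z
        unfolding psi_def chi_coords ..
      show ?thesis unfolding w i pe by (simp add: algebra_simps)
    qed
    thus ?thesis using s(1) t(1) by blast
  qed
  have Feq: "F n (i, j) = \<bar>Om (vtx n (i, j)) (vtx n (Suc i, j)) + Om (vtx n (Suc i, j)) (vtx n (Suc i, Suc j)) +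
     Om (vtx n (Suc i, Suc j)) (vtx n (i, Suc j)) + Om (vtx n (i, Suc j)) (vtx n (i, j))\<bar>" for n i j
    unfolding F_def cell_edge_sum[of "%a b. Om (vtx n a) (vtx n b)"] ..
  define n0 where "n0 = nat \<lceil>2 / d\<rceil> + 1"
  have n0: "2 / real n < d" "n > 0" if "n >= n0" for n
  proof -
    have "real n >= real n0" using that by simp
    moreover have "real n0 > 2 / d" unfolding n0_def by linarith
    ultimately have "real n > 2 / d" by linarith
    moreover have "2 / d > 0" using d(1) by simp
    ultimately have n1: "real n > 0" by linarith
    thus "n > 0" by simp
    have "2 < d * real n" using \<open>real n > 2 / d\<close> d(1) by (simp add: pos_divide_less_eq mult.commute)
    thus "2 / real n < d" using n1 by (simp add: pos_divide_less_eq)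
  qed
  have cellv: "vtx n (i, j) \<in> celbox n (i, j)" "vtx n (Suc i, j) \<in> celbox n (i, j)"
     "vtx n (Suc i, Suc j) \<in> celbox n (i, j)" "vtx n (i, Suc j) \<in> celbox n (i, j)" if "n > 0" for n i j
    using that by (simp_all add: celbox_def mem_box_cart forall_2 divide_right_mono)
  let ?vs = "%n i j. {vtx n (i, j), vtx n (Suc i, j), vtx n (Suc i, Suc j), vtx n (i, Suc j)}"
  have vsc: "?vs n i j \<subseteq> celbox n (i, j)" if "n > 0" for n i j using cellv[OF that] by blast
  have vsd: "dist x y < d" if n: "n >= n0" and xy: "x \<in> celbox n cc" "y \<in> celbox n cc" for x y n cc
    using celbox_dist[OF xy n0(2)[OF n]] n0(1)[OF n] by linarith
  \<comment> \<open>Off the transition the form is a multiple of the increment of one circle-valued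
    function, whose sum around a small cell is zero.\<close>
  have Fzero: "F n (i, j) = 0"
    if n: "n >= n0" and g: "(i, j) \<in> grid n" and al: "(\<forall>x\<in>?vs n i j. h x <= c/2) | (\<forall>x\<in>?vs n i j. h x >= c/2 + 1/2)" for n i j
  proof -
    have Q: "?vs n i j \<subseteq> ?Q" using vsc[OF n0(2)[OF n]] celbox_subset[OF g] by blast
    have dd: "dist x y < d" if "x \<in> ?vs n i j" "y \<in> ?vs n i j" for x y
      using vsd[OF n] vsc[OF n0(2)[OF n]] that by blast
    from al show ?thesis
    proof
      assume lo: "\<forall>x\<in>?vs n i j. h x <= c/2"
      have "inc e1 (vtx n (i, j)) (vtx n (Suc i, j)) + inc e1 (vtx n (Suc i, j)) (vtx n (Suc i, Suc j)) +
          inc e1 (vtx n (Suc i, Suc j)) (vtx n (i, Suc j)) + inc e1 (vtx n (i, Suc j)) (vtx n (i, j)) = 0"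
      proof (rule closed1[OF _ dd])
        show "?vs n i j \<subseteq> ?Q1" using Q lo c by (fastforce simp: h_def)
      qed
      thus ?thesis unfolding Feq using low lo by (simp add: h_def distrib_left[symmetric])
    next
      assume hi: "\<forall>x\<in>?vs n i j. h x >= c/2 + 1/2"
      have "inc e2 (vtx n (i, j)) (vtx n (Suc i, j)) + inc e2 (vtx n (Suc i, j)) (vtx n (Suc i, Suc j)) +
          inc e2 (vtx n (Suc i, Suc j)) (vtx n (i, Suc j)) + inc e2 (vtx n (i, Suc j)) (vtx n (i, j)) = 0"
      proof (rule closed2[OF _ dd])
        show "?vs n i j \<subseteq> ?Q2" using Q hi c by (fastforce simp: h_def)
      qed
      thus ?thesis unfolding Feq using high hi by (simp add: h_def)
    qed
  qed
  have inS: "celbox n (i, j) \<subseteq> S"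
    if n: "n >= n0" and g: "(i, j) \<in> grid n" and al: "\<not> ((\<forall>x\<in>?vs n i j. h x <= c/2) | (\<forall>x\<in>?vs n i j. h x >= c/2 + 1/2))" for n i j
  proof
    fix x assume x: "x \<in> celbox n (i, j)"
    have "\<not> (\<forall>x\<in>?vs n i j. h x <= c/2)" "\<not> (\<forall>x\<in>?vs n i j. h x >= c/2 + 1/2)" using al by blast+
    then obtain y z where yz': "y \<in> ?vs n i j" "\<not> h y <= c/2" "z \<in> ?vs n i j" "\<not> h z >= c/2 + 1/2" by blast
    hence yz: "y \<in> ?vs n i j" "h y > c/2" "z \<in> ?vs n i j" "h z < c/2 + 1/2" by (simp_all only: not_le)
    have yzc: "y \<in> celbox n (i, j)" "z \<in> celbox n (i, j)" using yz vsc[OF n0(2)[OF n]] by blast+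
    have Q: "x \<in> ?Q" "y \<in> ?Q" "z \<in> ?Q" using x yzc celbox_subset[OF g] by blast+
    have "\<bar>h x - h y\<bar> < 1/4" "\<bar>h x - h z\<bar> < 1/4"
      using hd[OF Q(1,2) vsd[OF n x yzc(1)]] hd[OF Q(1,3) vsd[OF n x yzc(2)]] .
    hence "\<bar>h x\<bar> <= 1" using yz c by linarith
    thus "x \<in> S" using Q by (simp add: S_def h_def)
  qed
  have Fcurl: "F n (i, j) = \<bar>mu * (((ch (h (vtx n (Suc i, Suc j))) - ch (h (vtx n (i, j)))) * (psi s t (f (vtx n (i, Suc j))) - psi s t (f (vtx n (Suc i, j)))) -
             (ch (h (vtx n (i, Suc j))) - ch (h (vtx n (Suc i, j)))) * (psi s t (f (vtx n (Suc i, Suc j))) - psi s t (f (vtx n (i, j))))) / 2)\<bar>"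
    if n: "n >= n0" and g: "(i, j) \<in> grid n" and sub: "celbox n (i, j) \<subseteq> S" and ba: "celbox n (i, j) \<subseteq> ball q d"
      and st: "\<forall>x\<in>S Int ball q d. \<forall>y\<in>S Int ball q d. wform ?w sg x y = psi s t (f y) - psi s t (f x)" for n i j q s t
    unfolding Feq
  proof (subst curl[where s = s and t = t])
    note vc = vsc[OF n0(2)[OF n], of i j]
    show "?vs n i j \<subseteq> S" using vc sub by blast
    show "dist x y < d" if "x \<in> ?vs n i j" "y \<in> ?vs n i j" for x y using vsd[OF n] vc that by blast
    show "wform ?w sg x y = psi s t (f y) - psi s t (f x)" if "x \<in> ?vs n i j" "y \<in> ?vs n i j" for x y
      using st vc sub ba that by blast
  qed simp
  have stL: "\<bar>st x - st y\<bar> <= M * \<bar>x - y\<bar>" for x y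
    using field_differentiable_bound[of UNIV st st' M x y] st_deriv M by (auto simp: has_field_derivative_at_within)
  have stA: "dist (st x) (st y) <= M * dist x y" for x y using stL by (simp add: dist_real_def)
  have chL: "\<bar>ch x - ch y\<bar> <= 2 * M * \<bar>x - y\<bar>" for x y
  proof -
    have "(2 * x - c) - (2 * y - c) = 2 * (x - y)" by simp
    hence "\<bar>(2 * x - c) - (2 * y - c)\<bar> = 2 * \<bar>x - y\<bar>" by (simp only: abs_mult abs_numeral)
    thus ?thesis using stL[of "2 * x - c" "2 * y - c"] unfolding ch_def by (simp add: abs_minus_commute)
  qed
  obtain R where R: "!!q. q \<in> ?Q ==> norm (f q) <= R" 
    using compact_imp_bounded[OF compact_continuous_image[OF cf compact_cbox]] unfolding bounded_iff by auto
  have "(0::real^2) \<in> ?Q" unfolding mem_unit_square by simp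
  hence R0: "R >= 0" using R[of 0] norm_ge_zero[of "f 0"] by linarith
  have sqL: "\<bar>a^2 - b^2\<bar> <= (A + A) * \<bar>a - b\<bar>" if "\<bar>a\<bar> <= A" "\<bar>b\<bar> <= A" for a b A :: real
  proof -
    have "a^2 - b^2 = (a + b) * (a - b)" by (simp add: power2_eq_square algebra_simps)
    moreover have "\<bar>a + b\<bar> <= A + A" using that by linarith
    ultimately show ?thesis by (simp add: abs_mult mult_right_mono)
  qed
  define P where "P = 12 * M * (R + 2)"
  have P0: "P >= 0" using M0 R0 by (simp add: P_def)
  have psiL: "\<bar>psi s t (f x) - psi s t (f y)\<bar> <= P * norm (f x - f y)" if st: "s \<in> {-1,1}" "t \<in> {-1,1}" and x: "x \<in> ?Q" "y \<in> ?Q" for s t x y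
  proof -
    have c1: "\<bar>f x$i\<bar> <= R" "\<bar>f y$i\<bar> <= R" "\<bar>f x$i - f y$i\<bar> <= norm (f x - f y)" for i
      using R[OF x(1)] R[OF x(2)] component_le_norm_cart[of "f x" i] component_le_norm_cart[of "f y" i]
        component_le_norm_cart[of "f x - f y" i] by auto
    have k: "\<bar>st (3 - ((f x$1 + a)^2 + (f x$2)^2)) - st (3 - ((f y$1 + a)^2 + (f y$2)^2))\<bar> <= M * (4 * (R + 2) * norm (f x - f y))"
      if "a = 0 | a = 2" for a
    proof -
      have ab: "\<bar>f x$1 + a\<bar> <= R + 2" "\<bar>f y$1 + a\<bar> <= R + 2" using that c1(1)[of 1] c1(2)[of 1] by auto
      have "\<bar>(f x$1 + a)^2 - (f y$1 + a)^2\<bar> <= ((R + 2) + (R + 2)) * norm (f x - f y)"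
        using order_trans[OF sqL[OF ab, unfolded add_diff_cancel_right] mult_left_mono[OF c1(3)[of 1]]] R0 by simp
      moreover have "\<bar>(f x$2)^2 - (f y$2)^2\<bar> <= ((R + 2) + (R + 2)) * norm (f x - f y)"
        using order_trans[OF sqL[of "f x$2" "R + 2" "f y$2"] mult_left_mono[OF c1(3)[of 2]]] c1(1)[of 2] c1(2)[of 2] R0 by simp
      ultimately have "\<bar>(3 - ((f x$1 + a)^2 + (f x$2)^2)) - (3 - ((f y$1 + a)^2 + (f y$2)^2))\<bar> <= 4 * (R + 2) * norm (f x - f y)"
        by (simp add: algebra_simps abs_if split: if_splits)
      thus ?thesis using order_trans[OF stL mult_left_mono[OF _ M0]] by blast
    qed
    define A where "A = st (3 - ((f x$1 + 2)^2 + (f x$2)^2)) - st (3 - ((f y$1 + 2)^2 + (f y$2)^2))"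
    define B where "B = st (3 - ((f x$1)^2 + (f x$2)^2)) - st (3 - ((f y$1)^2 + (f y$2)^2))"
    have AB: "\<bar>A\<bar> <= M * (4 * (R + 2) * norm (f x - f y))" "\<bar>B\<bar> <= M * (4 * (R + 2) * norm (f x - f y))"
      using k[of 2] k[of 0] by (auto simp: A_def B_def)
    have "psi s t (f x) - psi s t (f y) = - (golden * s * A) / 2 + t * B / 2"
      by (simp add: psi_def A_def B_def field_simps)
    moreover have "\<bar>golden * s * A\<bar> <= 2 * \<bar>A\<bar>"
      using st golden_gt_1 golden_lt_2 by (auto simp: abs_mult intro!: mult_right_mono)
    moreover have "\<bar>t * B\<bar> = \<bar>B\<bar>" using st by auto
    ultimately have "\<bar>psi s t (f x) - psi s t (f y)\<bar> <= \<bar>A\<bar> + \<bar>B\<bar> / 2" by linarith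
    also have "\<dots> <= P * norm (f x - f y)" using AB by (simp add: P_def algebra_simps)
    finally show ?thesis .
  qed
  have fL: "norm (f x - f y) <= L * (2 / n)" if n: "n >= n0" and g: "cc \<in> grid n" and x: "x \<in> celbox n cc" "y \<in> celbox n cc" for x y n cc
  proof -
    have "dist (f x) (f y) <= L * dist x y" by (rule lipschitz_onD[OF L]) (use x celbox_subset[OF g] in blast)+
    also have "\<dots> <= L * (2 / n)" using celbox_dist[OF x n0(2)[OF n]] L0 by (intro mult_left_mono)
    finally show ?thesis by (simp add: dist_norm)
  qed
  \<comment> \<open>A crude bound that depends on f. It serves to dominate the cell terms; the
    constant of the estimate comes from the pointwise limit in \<open>pt\<close>.\<close>
  have bd: "(real n)^2 * F n cc <= mu * (2 * M * (2 * L) * (P * (2 * L)))" if n: "n >= n0" and g: "cc \<in> grid n" for n cc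
  proof -
    obtain i j where [simp]: "cc = (i, j)" by fastforce
    have n1: "n > 0" using n0(2)[OF n] .
    show ?thesis
    proof (cases "(\<forall>x\<in>?vs n i j. h x <= c/2) | (\<forall>x\<in>?vs n i j. h x >= c/2 + 1/2)")
      case True
      hence "F n cc = 0" using Fzero[OF n] g by simp
      thus ?thesis using mu M0 L0 P0 by simp
    next
      case False
      hence sub: "celbox n (i, j) \<subseteq> S" using inS[OF n] g by simp
      have ba: "celbox n (i, j) \<subseteq> ball (vtx n (i, j)) d" using vsd[OF n cellv(1)[OF n1]] by auto
      obtain s t where st: "s \<in> {-1,1}" "t \<in> {-1,1}"
        "\<forall>x\<in>S Int ball (vtx n (i, j)) d. \<forall>y\<in>S Int ball (vtx n (i, j)) d. wform ?w sg x y = psi s t (f y) - psi s t (f x)"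
        using loc[of "vtx n (i, j)"] by blast
      have gg: "(i, j) \<in> grid n" using g by simp
      have chb: "\<bar>ch (h x) - ch (h y)\<bar> <= 2 * M * (2 * L) / n" if x: "x \<in> celbox n (i, j)" "y \<in> celbox n (i, j)" for x y
      proof -
        have "\<bar>h x - h y\<bar> <= L * (2 / n)" using component_le_norm_cart[of "f x - f y" 3] fL[OF n gg x] by (simp add: h_def)
        hence "2 * M * \<bar>h x - h y\<bar> <= 2 * M * (L * (2 / n))" using M0 by (intro mult_left_mono) auto
        thus ?thesis using chL[of "h x" "h y"] by (simp add: algebra_simps)
      qed
      have psb: "\<bar>psi s t (f x) - psi s t (f y)\<bar> <= P * (2 * L) / n" if x: "x \<in> celbox n (i, j)" "y \<in> celbox n (i, j)" for x y
      proof -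
        have "P * norm (f x - f y) <= P * (L * (2 / n))" using fL[OF n gg x] P0 by (intro mult_left_mono)
        hence "P * norm (f x - f y) <= P * (2 * L) / n" by (simp add: mult_ac)
        moreover have "\<bar>psi s t (f x) - psi s t (f y)\<bar> <= P * norm (f x - f y)"
          by (rule psiL[OF st(1,2)]) (use celbox_subset[OF gg] x in blast)+
        ultimately show ?thesis by linarith
      qed
      have prod: "\<bar>a * b\<bar> <= (2 * M * (2 * L) / n) * (P * (2 * L) / n)" if "\<bar>a\<bar> <= 2 * M * (2 * L) / n" "\<bar>b\<bar> <= P * (2 * L) / n" for a b
        unfolding abs_mult using that M0 L0 by (intro mult_mono) auto
      note cv = cellv[OF n1, of i j]
      define a1 where "a1 = (ch (h (vtx n (Suc i, Suc j))) - ch (h (vtx n (i, j)))) * (psi s t (f (vtx n (i, Suc j))) - psi s t (f (vtx n (Suc i, j))))"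
      define a2 where "a2 = (ch (h (vtx n (i, Suc j))) - ch (h (vtx n (Suc i, j)))) * (psi s t (f (vtx n (Suc i, Suc j))) - psi s t (f (vtx n (i, j))))"
      define K where "K = (2 * M * (2 * L) / n) * (P * (2 * L) / n)"
      have "\<bar>a1\<bar> <= K" "\<bar>a2\<bar> <= K"
        unfolding a1_def a2_def K_def by (rule prod[OF chb psb]; rule cv)+
      hence "\<bar>a1 - a2\<bar> <= 2 * K" using abs_triangle_ineq4[of a1 a2] by linarith
      hence "\<bar>(a1 - a2) / 2\<bar> <= K" by simp
      moreover have "F n cc = mu * \<bar>(a1 - a2) / 2\<bar>"
        using Fcurl[OF n gg sub ba st(3)] mu unfolding a1_def[symmetric] a2_def[symmetric]
        by (simp add: abs_mult)
      ultimately have "F n cc <= mu * K" using mu by (simp only: mult_left_mono)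
      hence "(real n)^2 * F n cc <= (real n)^2 * (mu * K)" by (intro mult_left_mono) auto
      also have "\<dots> = mu * (2 * M * (2 * L) * (P * (2 * L)))" using n1 by (simp add: K_def power2_eq_square)
      finally show ?thesis .
    qed
  qed
  have pt: "\<forall>\<^sub>F n in sequentially. (real n)^2 * F n (cel n q) <= 24 * M^2 * mu * jac f q + e"
    if q: "q \<in> ?Q - N" and e: "e > 0" for q e
  proof -
    have qi: "q \<in> interior ?Q" and df: "(f has_derivative frechet_derivative f (at q)) (at q)"
      using reg[OF q] by (auto simp: frechet_derivative_works)
    have qQ: "q \<in> ?Q" using q by blast
    have J0: "jac f q >= 0" by (simp add: jac_def)
    have vsq: "?vs n (fst (cel n q)) (snd (cel n q)) \<subseteq> celbox n (cel n q)" if "n > 0" for n using vsc[OF that] by (metis prod.collapse)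
    have clq: "dist x q < r" if "x \<in> celbox n (cel n q)" "n > 0" "2 / real n < r" for x n r
      using celbox_dist[OF that(1) cel_grid(2)[OF qi that(2)] that(2)] that(3) by linarith
    have evn: "\<forall>\<^sub>F n in sequentially. n >= n0 & 2 / real n < r" if "r > 0" for r
    proof -
      have "(%n. 2 * inverse (real n)) \<longlonglongrightarrow> 2 * 0" by (intro tendsto_mult tendsto_const lim_inverse_n)
      hence "\<forall>\<^sub>F n in sequentially. 2 * inverse (real n) < r" using that by (intro order_tendstoD(2)[of _ "2*0"]) auto
      thus ?thesis using eventually_ge_at_top[of n0] by eventually_elim (simp add: divide_inverse)
    qed
    have hq: "\<bar>h x - h q\<bar> < r" if "x \<in> celbox n (cel n q)" "n > 0" "2 / real n < dr"
        "!!y. y \<in> ?Q ==> dist y q < dr ==> dist (h y) (h q) < r" for x n r dr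
      using clq[OF that(1-3)] that(4)[of x] celbox_subset[OF cel_grid(1)[OF qi that(2)]] that(1) by (auto simp: dist_real_def)
    have hcont: "\<exists>dr>0. \<forall>y\<in>?Q. dist y q < dr --> dist (h y) (h q) < r" if "r > 0" for r
      using ch1 qQ that unfolding continuous_on_iff by blast
    have far: ?thesis if out: "h q < c/2 | h q > c/2 + 1/2"
    proof -
      define r where "r = (if h q < c/2 then c/2 - h q else h q - (c/2 + 1/2))"
      have r: "r > 0" using out by (auto simp: r_def)
      obtain dr where dr: "dr > 0" "\<forall>y\<in>?Q. dist y q < dr --> dist (h y) (h q) < r" using hcont[OF r] by blast
      have "\<forall>\<^sub>F n in sequentially. n >= n0 & 2 / real n < dr" by (rule evn[OF dr(1)])
      thus ?thesis
      proof eventually_elim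
        case (elim n)
        hence n1: "n > 0" using n0(2) by blast
        have "\<bar>h x - h q\<bar> < r" if "x \<in> ?vs n (fst (cel n q)) (snd (cel n q))" for x
          using hq[of x n dr r] vsq[OF n1] that elim n1 dr(2) by blast
        hence "(\<forall>x\<in>?vs n (fst (cel n q)) (snd (cel n q)). h x <= c/2) | (\<forall>x\<in>?vs n (fst (cel n q)) (snd (cel n q)). h x >= c/2 + 1/2)"
          unfolding r_def by (smt (verit))
        moreover have "(fst (cel n q), snd (cel n q)) \<in> grid n" using cel_grid(1)[OF qi n1] by simp
        ultimately have "F n (cel n q) = 0" using Fzero[of n "fst (cel n q)" "snd (cel n q)"] elim by simp
        thus ?case using e J0 mu by simp
      qed
    qed
    have near: ?thesis if mid: "c/2 <= h q" "h q <= c/2 + 1/2"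
    proof -
      obtain s t where st: "s \<in> {-1,1}" "t \<in> {-1,1}"
        "\<forall>x\<in>S Int ball q d. \<forall>y\<in>S Int ball q d. wform ?w sg x y = psi s t (f y) - psi s t (f x)"
        using loc[of q] by blast
      define D where "D = frechet_derivative f (at q)"
      define kc where "kc = - 2 * st' (2 * h q - c)"
      define ka where "ka = golden * s * st' (3 - ((f q$1 + 2)^2 + (f q$2)^2)) * (f q$1 + 2) - t * st' (3 - ((f q$1)^2 + (f q$2)^2)) * f q$1"
      define kb where "kb = golden * s * st' (3 - ((f q$1 + 2)^2 + (f q$2)^2)) * f q$2 - t * st' (3 - ((f q$1)^2 + (f q$2)^2)) * f q$2"
      have dX: "((%x. ch (h x)) has_derivative (%v. kc * (D v$3))) (at q)"
      proof -
        have "((%x. f x$3) has_derivative (%v. D v$3)) (at q)"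
          unfolding D_def by (rule bounded_linear.has_derivative[OF bounded_linear_vec_nth df])
        hence "((%x. 2 * h x - c) has_derivative (%v. 2 * (D v$3))) (at q)"
          unfolding h_def by (auto intro!: derivative_eq_intros)
        hence "((%x. 1 - st (2 * h x - c)) has_derivative (%v. 0 - st' (2 * h q - c) * (2 * (D v$3)))) (at q)"
          by (intro has_derivative_diff has_derivative_const st_compose_deriv)
        thus ?thesis by (simp add: ch_def kc_def algebra_simps)
      qed
      have dP: "((%x. psi s t (f x)) has_derivative (%v. ka * (D v$1) + kb * (D v$2))) (at q)"
        using psi_deriv[OF df, of s t] by (simp add: ka_def kb_def D_def)
      \<comment> \<open>The shoelace expression uses the two diagonals of the cell, whose scaled
        limits are D(1,1) and D(-1,1); passing to the two axis directions turns half of the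
        determinant into the whole one.\<close>
      define ll where "ll = mu * (((kc * (D (vector [1, 1])$3)) * (ka * (D (vector [-1, 1])$1) + kb * (D (vector [-1, 1])$2)) -
          (kc * (D (vector [-1, 1])$3)) * (ka * (D (vector [1, 1])$1) + kb * (D (vector [1, 1])$2))) / 2)"
      have lin: "linear D" unfolding D_def using df has_derivative_linear by blast
      have v11: "D (vector [1, 1]) = D (axis 1 1) + D (axis 2 1)" "D (vector [-1, 1]) = D (axis 2 1) - D (axis 1 1)"
        by (simp_all add: linear_add[OF lin, symmetric] linear_diff[OF lin, symmetric])
          (rule arg_cong[of _ _ D], simp add: vec_eq_iff forall_2 axis_def)+
      have "ll = mu * ((kc * D (axis 1 1)$3) * (ka * D (axis 2 1)$1 + kb * D (axis 2 1)$2) -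
          (kc * D (axis 2 1)$3) * (ka * D (axis 1 1)$1 + kb * D (axis 1 1)$2))"
        unfolding ll_def v11 by (simp add: algebra_simps) (simp add: field_simps)
      \<comment> \<open>The height factor is at most 2 M. Since golden < 2, each planar coefficient
        is at most 2 (2 M) + 2 M = 6 M. With the factor 2 of \<open>det_cross_bound\<close> this is
        24 M^2.\<close>
      moreover have "\<bar>(kc * D (axis 1 1)$3) * (ka * D (axis 2 1)$1 + kb * D (axis 2 1)$2) -
          (kc * D (axis 2 1)$3) * (ka * D (axis 1 1)$1 + kb * D (axis 1 1)$2)\<bar> <= (2 * M) * (2 * (6 * M)) * norm (cross3 (D (axis 1 1)) (D (axis 2 1)))"
      proof (rule det_cross_bound)
        show "\<bar>kc\<bar> <= 2 * M" using M[of "2 * h q - c"] by (simp add: kc_def abs_mult)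
        have tri: "\<bar>golden * s * x - t * y\<bar> <= 6 * M" if "\<bar>x\<bar> <= 2 * M" "\<bar>y\<bar> <= 2 * M" for x y
        proof -
          have "\<bar>golden * s * x\<bar> <= 2 * \<bar>x\<bar>" using st(1) golden_gt_1 golden_lt_2 by (auto simp: abs_mult intro!: mult_right_mono)
          moreover have "\<bar>t * y\<bar> = \<bar>y\<bar>" using st(2) by auto
          ultimately show ?thesis using that by linarith
        qed
        show "\<bar>ka\<bar> <= 6 * M" unfolding ka_def mult.assoc
          using tri[OF st'_times_bound(1)[OF M, of "f q$1 + 2" "f q$2"] st'_times_bound(1)[OF M, of "f q$1" "f q$2"]] by (simp add: mult.assoc)
        show "\<bar>kb\<bar> <= 6 * M" unfolding kb_def mult.assoc
          using tri[OF st'_times_bound(2)[OF M, of "f q$1 + 2" "f q$2"] st'_times_bound(2)[OF M, of "f q$1" "f q$2"]] by (simp add: mult.assoc)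
      qed
      ultimately have "\<bar>ll\<bar> <= mu * ((2 * M) * (2 * (6 * M)) * jac f q)"
        using mu by (simp add: abs_mult jac_def D_def mult_left_mono)
      hence llb: "\<bar>ll\<bar> <= 24 * M^2 * mu * jac f q" by (simp add: power2_eq_square algebra_simps)
      let ?c = "%n a b. corner n q (a, b)"
      have lX1: "(%n. real n *\<^sub>R (ch (h (?c n 1 1)) - ch (h (?c n 0 0)))) \<longlonglongrightarrow> kc * (D (vector [1, 1])$3)"
        using corner_diff_quotient[OF dX qi, of "(0,0)" "(1,1)"] by simp
      have lX2: "(%n. real n *\<^sub>R (ch (h (?c n 0 1)) - ch (h (?c n 1 0)))) \<longlonglongrightarrow> kc * (D (vector [-1, 1])$3)"
        using corner_diff_quotient[OF dX qi, of "(1,0)" "(0,1)"] by simp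
      have lP1: "(%n. real n *\<^sub>R (psi s t (f (?c n 1 1)) - psi s t (f (?c n 0 0)))) \<longlonglongrightarrow> ka * (D (vector [1, 1])$1) + kb * (D (vector [1, 1])$2)"
        using corner_diff_quotient[OF dP qi, of "(0,0)" "(1,1)"] by simp
      have lP2: "(%n. real n *\<^sub>R (psi s t (f (?c n 0 1)) - psi s t (f (?c n 1 0)))) \<longlonglongrightarrow> ka * (D (vector [-1, 1])$1) + kb * (D (vector [-1, 1])$2)"
        using corner_diff_quotient[OF dP qi, of "(1,0)" "(0,1)"] by simp
      have "(%n. \<bar>mu * (((real n *\<^sub>R (ch (h (?c n 1 1)) - ch (h (?c n 0 0)))) * (real n *\<^sub>R (psi s t (f (?c n 0 1)) - psi s t (f (?c n 1 0)))) -
          (real n *\<^sub>R (ch (h (?c n 0 1)) - ch (h (?c n 1 0)))) * (real n *\<^sub>R (psi s t (f (?c n 1 1)) - psi s t (f (?c n 0 0))))) / 2)\<bar>) \<longlonglongrightarrow> \<bar>ll\<bar>"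
        unfolding ll_def by (intro tendsto_rabs tendsto_mult tendsto_const tendsto_divide tendsto_diff lX1 lX2 lP1 lP2) simp
      hence "\<forall>\<^sub>F n in sequentially. \<bar>mu * (((real n *\<^sub>R (ch (h (?c n 1 1)) - ch (h (?c n 0 0)))) * (real n *\<^sub>R (psi s t (f (?c n 0 1)) - psi s t (f (?c n 1 0)))) -
          (real n *\<^sub>R (ch (h (?c n 0 1)) - ch (h (?c n 1 0)))) * (real n *\<^sub>R (psi s t (f (?c n 1 1)) - psi s t (f (?c n 0 0))))) / 2)\<bar> < \<bar>ll\<bar> + e"
        using e by (intro order_tendstoD(2)) auto
      moreover have "\<forall>\<^sub>F n in sequentially. n >= n0 & 2 / real n < d" by (rule evn[OF d(1)])
      ultimately show ?thesis
      proof eventually_elim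
        case (elim n)
        hence n1: "n > 0" using n0(2) by blast
        have cb: "celbox n (cel n q) \<subseteq> ball q d" using clq[of _ n d] n1 elim by (auto simp: dist_commute)
        have cS': "celbox n (cel n q) \<subseteq> S"
        proof
          fix x assume x: "x \<in> celbox n (cel n q)"
          have xQ: "x \<in> ?Q" using x celbox_subset[OF cel_grid(1)[OF qi n1]] by blast
          have "\<bar>h x - h q\<bar> < 1/4" by (rule hd[OF xQ qQ]) (use clq[OF x n1] elim in blast)
          hence "\<bar>h x\<bar> <= 1" using mid c by linarith
          thus "x \<in> S" using xQ by (simp add: S_def h_def)
        qed
        have "F n (cel n q) = \<bar>mu * (((ch (h (?c n 1 1)) - ch (h (?c n 0 0))) * (psi s t (f (?c n 0 1)) - psi s t (f (?c n 1 0))) -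
          (ch (h (?c n 0 1)) - ch (h (?c n 1 0))) * (psi s t (f (?c n 1 1)) - psi s t (f (?c n 0 0)))) / 2)\<bar>"
          using Fcurl[of n "fst (cel n q)" "snd (cel n q)" q s t] elim cel_grid(1)[OF qi n1] cS' cb st(3) by (simp add: corner_def)
        hence "(real n)^2 * F n (cel n q) = \<bar>mu * (((real n *\<^sub>R (ch (h (?c n 1 1)) - ch (h (?c n 0 0)))) * (real n *\<^sub>R (psi s t (f (?c n 0 1)) - psi s t (f (?c n 1 0)))) -
          (real n *\<^sub>R (ch (h (?c n 0 1)) - ch (h (?c n 1 0)))) * (real n *\<^sub>R (psi s t (f (?c n 1 1)) - psi s t (f (?c n 0 0))))) / 2)\<bar>"
          by (simp add: abs_mult power2_eq_square right_diff_distrib[symmetric] mult.assoc mult.left_commute)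
        thus ?case using elim(1) llb by linarith
      qed
    qed
    show ?thesis using far near by linarith
  qed
  have sums: "\<forall>\<^sub>F n in sequentially. (\<Sum>cc\<in>grid n. F n cc) <= 24 * M^2 * mu * disk_area f + eps" if "eps > 0" for eps
    unfolding disk_area_jac
    by (rule cell_sums_le_area[OF L N reg _ _ bd pt that]) (use mu in \<open>auto simp: F_def\<close>)
  show ?thesis
  proof (rule that[OF d(1)])
    show "Om v' v = - Om v v'" if "v \<in> ?Q" "v' \<in> ?Q" "dist v v' < d" for v v' using anti[OF that] .
    show "Om v v' = 0" if "v \<in> ?fr" "v' \<in> ?fr" "dist v v' < d" for v v' using fr0[OF that] .
    show "\<forall>\<^sub>F n in sequentially. (\<Sum>c\<in>grid n. \<bar>\<Sum>e\<in>cedges c. Om (vtx n (fst e)) (vtx n (snd e))\<bar>) <= 24 * M^2 * mu * disk_area f + eps"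
      if "eps > 0" for eps using sums[OF that] by (simp add: F_def)
  qed (use low high in auto)
qed

text \<open>The cut-off is placed twice. With the transition in [1/4, 3/4] the form is golden times
  the increment of \<open>e1\<close> below height 1/4, and the flux through a part above that height
  is tested. With the transition in [-3/4, -1/4] up and down, and the two functions, change roles.
  If both dichotomies end in a path, one path stays above 1/8 and the other below -1/8, so they are
  disjoint, while their interlaced end points force a crossing.\<close>

theorem area_lower:
  fixes f :: "real^2 => real^3" and e1 e2 g :: "real^2 => complex"
  defines "S \<equiv> {q \<in> unit_square. \<bar>f q$3\<bar> <= 1}"
  assumes M: "!!x. \<bar>st' x\<bar> <= M"
    and f: "ps_embedded_disk f"
    and sh: "sheet S (%q. Complex (f q$1) (f q$2)) sg"
    and u1: "ucirc {q \<in> unit_square. f q$3 <= 1} e1" and u2: "ucirc {q \<in> unit_square. - 1 <= f q$3} e2"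
    and coh: "coh S (frontier unit_square) (%q q'. golden * inc e1 q q' + inc e2 q q')
        (%q q'. mu * wform (%q. Complex (f q$1) (f q$2)) sg q q')"
    and mu: "mu >= 0"
    and g: "continuous_on (frontier unit_square) g" "inj_on g (frontier unit_square)"
      "g ` frontier unit_square = sphere 0 1"
    and b1: "!!q. q \<in> frontier unit_square ==> f q$3 <= 1 ==> Re (g q) ~= 0 & e1 q = (if Re (g q) < 0 then 1 else - 1)"
    and b2: "!!q. q \<in> frontier unit_square ==> - 1 <= f q$3 ==> Im (g q) ~= 0 & e2 q = (if Im (g q) > 0 then 1 else - 1)"
    and ord: "!!a b. a \<in> frontier unit_square ==> b \<in> frontier unit_square ==> f a$3 > 0 ==> f b$3 < 0 ==>
        Im (g a) * Im (g b) > 0 ==> Re (g a) * Re (g b) >= 0 ==> \<bar>Re (g a)\<bar> < \<bar>Re (g b)\<bar>"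
  shows "1/2 <= 24 * M^2 * mu * disk_area f"
proof -
  let ?Q = "unit_square :: (real^2) set" and ?fr = "frontier unit_square :: (real^2) set"
  obtain L N where LN: "L-lipschitz_on ?Q f" "negligible N"
    "!!q. q \<in> ?Q - N ==> q \<in> interior ?Q & f differentiable (at q)"
    using ps_embedded_disk_regular[OF f] by blast
  have cf: "continuous_on ?Q f" using LN(1) lipschitz_on_continuous_on by blast
  have ch: "continuous_on ?Q (%q. f q$3)" "continuous_on ?Q (%q. - (f q$3))"
    using cf by (auto intro!: continuous_intros)
  obtain E dE where E: "continuous_on S E" "\<forall>q\<in>S Int ?fr. E q = 0" "dE > 0"
    "\<forall>q\<in>S. \<forall>q'\<in>S. dist q q' < dE --> golden * inc e1 q q' + inc e2 q q' =
       mu * wform (%q. Complex (f q$1) (f q$2)) sg q q' + E q' - E q"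
    using coh unfolding coh_def by blast
  have b1': "e1 q \<in> {1, -1}" if "q \<in> ?fr" "f q$3 <= 1" for q using b1[OF that] by auto
  have b2': "e2 q \<in> {1, -1}" if "q \<in> ?fr" "- 1 <= f q$3" for q using b2[OF that] by auto
  have E2: "!!q. q \<in> {q \<in> ?Q. \<bar>f q$3\<bar> <= 1} ==> q \<in> ?fr ==> E q = 0" using E(2) unfolding S_def by blast
  have E4: "!!q q'. q \<in> {q \<in> ?Q. \<bar>f q$3\<bar> <= 1} ==> q' \<in> {q \<in> ?Q. \<bar>f q$3\<bar> <= 1} ==> dist q q' < dE ==>
        golden * inc e1 q q' + inc e2 q q' = mu * wform (%q. Complex (f q$1) (f q$2)) sg q q' + E q' - E q"
    using E(4) unfolding S_def by blast
  note cut = cutoff_sum_le[OF M LN(1) LN(2) LN(3) _ _ sh[unfolded S_def] u1 u2 E(1)[unfolded S_def] E2 E(3) E4 mu b1' b2']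
  have le: "1/2 <= 24 * M^2 * mu * disk_area f"
    if "\<exists>N. \<forall>n\<ge>N. a / 2 <= F n" "1 <= a" "!!eps. eps > 0 ==> \<forall>\<^sub>F n in sequentially. F n <= 24 * M^2 * mu * disk_area f + eps"
    for F :: "nat => real" and a
  proof (rule field_le_epsilon)
    note tt = that
    fix eps :: real assume "eps > 0"
    then obtain N1 where "\<forall>n\<ge>N1. F n <= 24 * M^2 * mu * disk_area f + eps" using tt(3) unfolding eventually_sequentially by blast
    moreover obtain N2 where "\<forall>n\<ge>N2. a / 2 <= F n" using tt(1) by blast
    ultimately have "a / 2 <= 24 * M^2 * mu * disk_area f + eps" by (meson max.cobounded1 max.cobounded2 order_trans)
    thus "1/2 <= 24 * M^2 * mu * disk_area f + eps" using that(2) by linarith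
  qed
  obtain OA dA where A: "dA > 0"
    "!!v v'. v \<in> ?Q ==> v' \<in> ?Q ==> dist v v' < dA ==> OA v' v = - OA v v'"
    "!!v v'. v \<in> ?fr ==> v' \<in> ?fr ==> dist v v' < dA ==> OA v v' = 0"
    "!!v v'. v \<in> ?Q ==> v' \<in> ?Q ==> dist v v' < dA ==> f v$3 <= (1/2)/2 ==> f v'$3 <= (1/2)/2 ==> OA v v' = golden * inc e1 v v'"
    "!!v v'. v \<in> ?Q ==> v' \<in> ?Q ==> dist v v' < dA ==> f v$3 >= (1/2)/2 + 1/2 ==> f v'$3 >= (1/2)/2 + 1/2 ==> OA v v' = - 1 * inc e2 v v'"
    "!!eps. eps > 0 ==> \<forall>\<^sub>F n in sequentially.
        (\<Sum>c\<in>grid n. \<bar>\<Sum>e\<in>cedges c. OA (vtx n (fst e)) (vtx n (snd e))\<bar>) <= 24 * M^2 * mu * disk_area f + eps"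
    by (rule cut[where c = "1/2"]) (assumption | (simp; fail) | (rule that; assumption))+
  obtain OB dB where B: "dB > 0"
    "!!v v'. v \<in> ?Q ==> v' \<in> ?Q ==> dist v v' < dB ==> OB v' v = - OB v v'"
    "!!v v'. v \<in> ?fr ==> v' \<in> ?fr ==> dist v v' < dB ==> OB v v' = 0"
    "!!v v'. v \<in> ?Q ==> v' \<in> ?Q ==> dist v v' < dB ==> f v$3 <= (-3/2)/2 ==> f v'$3 <= (-3/2)/2 ==> OB v v' = golden * inc e1 v v'"
    "!!v v'. v \<in> ?Q ==> v' \<in> ?Q ==> dist v v' < dB ==> f v$3 >= (-3/2)/2 + 1/2 ==> f v'$3 >= (-3/2)/2 + 1/2 ==> OB v v' = - 1 * inc e2 v v'"
    "!!eps. eps > 0 ==> \<forall>\<^sub>F n in sequentially.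
        (\<Sum>c\<in>grid n. \<bar>\<Sum>e\<in>cedges c. OB (vtx n (fst e)) (vtx n (snd e))\<bar>) <= 24 * M^2 * mu * disk_area f + eps"
    by (rule cut[where c = "-3/2"]) (assumption | (simp; fail) | (rule that; assumption))+
  have dA: "(\<exists>p\<in>?fr. \<exists>p'\<in>?fr. f p$3 > 1/4 & Im (g p) < 0 & f p'$3 > 1/4 & Im (g p') > 0 &
        path_component {q \<in> ?Q. f q$3 > 1/4 - 1/8} p p') \<or>
     (\<exists>N. \<forall>n\<ge>N. \<bar>golden\<bar> / 2 <= (\<Sum>c\<in>grid n. \<bar>\<Sum>e\<in>cedges c. OA (vtx n (fst e)) (vtx n (snd e))\<bar>))"
  proof (rule grid_dichotomy[OF ch(1) g _ _ A(1,2,3), where ?e1.0 = e1])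
    show "cmod (e1 q) = 1" if "q \<in> ?Q" "f q$3 <= 1/4" for q using u1 that by (auto simp: ucirc_def)
    show "Re (g q) ~= 0 & e1 q = (if Re (g q) < 0 then 1 else - 1)" if "q \<in> ?fr" "f q$3 <= 1/4" for q
      using b1[OF that(1)] that(2) by linarith
    show "OA v v' = golden * inc e1 v v'" if "v \<in> ?Q" "v' \<in> ?Q" "dist v v' < dA" "f v$3 <= 1/4" "f v'$3 <= 1/4" for v v'
      using A(4)[OF that(1-3)] that(4,5) by simp
  qed auto
  \<comment> \<open>A quarter turn of g converts the boundary values of \<open>e2\<close>, ruled by
    Im g, into the form that \<open>grid_dichotomy\<close> expects.\<close>
  have gi: "continuous_on ?fr (%q. \<i> * g q)" "inj_on (%q. \<i> * g q) ?fr" "(%q. \<i> * g q) ` ?fr = sphere 0 1"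
  proof -
    show "continuous_on ?fr (%q. \<i> * g q)" using g(1) by (intro continuous_intros)
    show "inj_on (%q. \<i> * g q) ?fr" using g(2) by (auto simp: inj_on_def)
    have "(%z. \<i> * z) ` sphere 0 1 = (sphere 0 1 :: complex set)"
    proof
      show "(%z. \<i> * z) ` sphere 0 1 \<subseteq> (sphere 0 1 :: complex set)" by (auto simp: norm_mult)
      show "(sphere 0 1 :: complex set) \<subseteq> (%z. \<i> * z) ` sphere 0 1"
      proof
        fix z :: complex assume "z \<in> sphere 0 1"
        thus "z \<in> (%z. \<i> * z) ` sphere 0 1" by (intro image_eqI[of _ _ "- \<i> * z"]) (auto simp: norm_mult)
      qed
    qed
    thus "(%q. \<i> * g q) ` ?fr = sphere 0 1" using g(3) by (metis image_image)
  qed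
  have dB: "(\<exists>p\<in>?fr. \<exists>p'\<in>?fr. - (f p$3) > 1/4 & Im (\<i> * g p) < 0 & - (f p'$3) > 1/4 & Im (\<i> * g p') > 0 &
        path_component {q \<in> ?Q. - (f q$3) > 1/4 - 1/8} p p') \<or>
     (\<exists>N. \<forall>n\<ge>N. \<bar>- 1\<bar> / 2 <= (\<Sum>c\<in>grid n. \<bar>\<Sum>e\<in>cedges c. OB (vtx n (fst e)) (vtx n (snd e))\<bar>))"
  proof (rule grid_dichotomy[OF ch(2) gi _ _ B(1,2,3), where ?e1.0 = e2])
    show "cmod (e2 q) = 1" if "q \<in> ?Q" "- (f q$3) <= 1/4" for q using u2 that by (auto simp: ucirc_def)
    show "Re (\<i> * g q) ~= 0 & e2 q = (if Re (\<i> * g q) < 0 then 1 else - 1)" if "q \<in> ?fr" "- (f q$3) <= 1/4" for q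
      using b2[OF that(1)] that(2) by auto
    show "OB v v' = - 1 * inc e2 v v'" if "v \<in> ?Q" "v' \<in> ?Q" "dist v v' < dB" "- (f v$3) <= 1/4" "- (f v'$3) <= 1/4" for v v'
      using B(5)[OF that(1-3)] that(4,5) by simp
  qed auto
  show ?thesis
  proof (cases "\<exists>N. \<forall>n\<ge>N. \<bar>golden\<bar> / 2 <= (\<Sum>c\<in>grid n. \<bar>\<Sum>e\<in>cedges c. OA (vtx n (fst e)) (vtx n (snd e))\<bar>)")
    case True
    show ?thesis by (rule le[OF True _ A(6)]) (use golden_gt_1 in simp)
  next
    case nA: False
    show ?thesis
    proof (cases "\<exists>N. \<forall>n\<ge>N. \<bar>- 1\<bar> / 2 <= (\<Sum>c\<in>grid n. \<bar>\<Sum>e\<in>cedges c. OB (vtx n (fst e)) (vtx n (snd e))\<bar>)")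
      case True
      show ?thesis by (rule le[OF True _ B(6)]) simp
    next
      case nB: False
      obtain p p' where p: "p \<in> ?fr" "p' \<in> ?fr" "f p$3 > 1/4" "Im (g p) < 0" "f p'$3 > 1/4" "Im (g p') > 0"
        "path_component {q \<in> ?Q. f q$3 > 1/4 - 1/8} p p'" using dA nA by blast
      obtain r r' where r: "r \<in> ?fr" "r' \<in> ?fr" "- (f r$3) > 1/4" "Im (\<i> * g r) < 0" "- (f r'$3) > 1/4" "Im (\<i> * g r') > 0"
        "path_component {q \<in> ?Q. - (f q$3) > 1/4 - 1/8} r r'" using dB nB by blast
      have False
      proof (rule square_paths_cross[OF g(1,2) _ p(1,2,4,6,7) _ r(1,2) _ _ r(7)])
        show "g ` ?fr \<subseteq> sphere 0 1" using g(3) by simp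
        show "{q \<in> ?Q. f q$3 > 1/4 - 1/8} Int {q \<in> ?Q. - (f q$3) > 1/4 - 1/8} = {}" by auto
        show "\<bar>Re (g a)\<bar> < \<bar>Re (g b)\<bar>" if ab: "a \<in> {p, p'}" "b \<in> {r, r'}" "Im (g a) * Im (g b) > 0" "Re (g a) * Re (g b) >= 0" for a b
        proof -
          have "a \<in> ?fr" "b \<in> ?fr" "f a$3 > 0" "f b$3 < 0" using ab(1,2) p(1,2,3,5) r(1,2,3,5) by auto
          thus ?thesis using ord ab(3,4) by blast
        qed
      qed (use r(4,6) in auto)
      thus ?thesis ..
    qed
  qed
qed

section \<open>The planar model\<close>

definition immersed :: "('a::real_normed_vector => 'b::real_normed_vector) => 'a => bool" where
  "immersed f x \<longleftrightarrow> (\<exists>D. (f has_derivative D) (at x) & inj D)"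

lemma immersed_compose:
  assumes "immersed f x" "immersed g (f x)"
  shows "immersed (%x. g (f x)) x"
proof -
  obtain D E where "(f has_derivative D) (at x)" "inj D" "(g has_derivative E) (at (f x))" "inj E"
    using assms unfolding immersed_def by blast
  hence "((%x. g (f x)) has_derivative (%h. E (D h))) (at x)" "inj (%h. E (D h))"
    using has_derivative_compose by (blast, auto simp: inj_on_def)
  thus ?thesis unfolding immersed_def by blast
qed

lemma immersed_left_inverse:
  assumes "f differentiable (at x)" "g differentiable (at (f x))" "!!y. g (f y) = y"
  shows "immersed f x"
proof -
  obtain D E where D: "(f has_derivative D) (at x)" and E: "(g has_derivative E) (at (f x))"
    using assms(1,2) unfolding differentiable_def by blast
  have "((%x. g (f x)) has_derivative (%h. E (D h))) (at x)" using has_derivative_compose[OF D E] .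
  hence "((%x. x) has_derivative (%h. E (D h))) (at x)" by (simp add: assms(3))
  hence "(%h. E (D h)) = (%h. h)" using has_derivative_unique[OF _ has_derivative_ident] by blast
  hence "inj D" by (metis injI)
  thus ?thesis using D unfolding immersed_def by blast
qed

lemma immersed_pair:
  fixes p z :: "real \<times> real => real"
  assumes p: "(p has_derivative (%h. fst h * a + snd h * b)) (at x)"
    and z: "(z has_derivative (%h. fst h * c + snd h * d)) (at x)" and det: "a * d - b * c ~= 0"
  shows "immersed (%x. (p x, z x)) x"
proof -
  have "((%x. (p x, z x)) has_derivative (%h. (fst h * a + snd h * b, fst h * c + snd h * d))) (at x)"
    by (intro derivative_intros p z)
  moreover have "inj (%h. (fst h * a + snd h * b, fst h * c + snd h * d))"
  proof (rule injI, clarsimp)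
    fix h1 h2 k1 k2 assume e: "h1 * a + h2 * b = k1 * a + k2 * b" "h1 * c + h2 * d = k1 * c + k2 * d"
    have "(h1 - k1) * (a * d - b * c) = 0" using e by algebra
    moreover have "(h2 - k2) * (a * d - b * c) = 0" using e by algebra
    ultimately show "h1 = k1 & h2 = k2" using det by simp
  qed
  ultimately show ?thesis unfolding immersed_def by blast
qed

text \<open>A cut-off that is 1 for |a| <= 1/2 and 0 for |a| >= 3/4. It keeps \<open>mf\<close>
  smooth on the whole line, while on the part |a| <= 1/2 of the unit circle \<open>b * mf a\<close>
  is exactly the sign of b, which straightens the strands.\<close>

definition kap :: "real => real" where "kap a = st (3 - 4 * a) * st (3 + 4 * a)"
definition mf :: "real => real" where "mf a = 1 / sqrt (1 - kap a * a^2)"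
text \<open>A band bent into an arch. With l = 2 + b mf(a), between 1 and 3, and u = 16 a the point
  is (l X(u), l - u X(u) + 2). For |u| >= 1 these are two vertical legs; for |u| < 1 they are joined
  at the top. The rim consists of strands at distance 1 and 3 from the axis, two upper caps near a =
  0, and one lower cap at the foot of each leg. The factor 16 puts everything with |a| >= 1/2 below
  height -2.\<close>

definition px :: "real => real => real" where "px a b = (2 + b * mf a) * X (16 * a)"
definition pz :: "real => real => real" where "pz a b = (2 + b * mf a) - 16 * a * X (16 * a) + 2"

lemma kap_1: "\<bar>a\<bar> <= 1/2 ==> kap a = 1" unfolding kap_def by (simp add: st_1)

lemma kap_den: "1 - kap a * a^2 > 0"
proof (cases "\<bar>a\<bar> >= 3/4")
  case True
  hence "kap a = 0" unfolding kap_def by (cases "a >= 0") (auto simp: st_0)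
  thus ?thesis by simp
next
  case False
  have "kap a <= 1 * 1" unfolding kap_def by (rule mult_mono) (use st_range in auto)
  moreover have "a^2 <= (3/4)^2" using False by (intro power2_le_iff_abs_le[THEN iffD2]) auto
  ultimately have "kap a * a^2 <= 1 * (3/4)^2" by (intro mult_mono) auto
  thus ?thesis by (simp add: power2_eq_square)
qed

lemma kap_le_1: "kap a <= 1" and kap_ge_0: "0 <= kap a"
proof -
  have "kap a <= 1 * 1" unfolding kap_def by (rule mult_mono) (use st_range in auto)
  thus "kap a <= 1" by simp
  show "0 <= kap a" unfolding kap_def using st_range by simp
qed

lemma mf_pos: "mf a > 0" using kap_den[of a] by (simp add: mf_def)

lemma mf_half: "\<bar>a\<bar> <= 1/2 ==> mf a = 1 / sqrt (1 - a^2)" by (simp add: mf_def kap_1)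

text \<open>As \<open>kap\<close> is at most 1, the radicand 1 - kap a^2 is at least 1 - a^2, hence
  at least b^2. So l = 2 + b mf(a) ranges over [1, 3].\<close>

lemma mf_bound:
  assumes "a^2 + b^2 <= 1"
  shows "\<bar>b * mf a\<bar> <= 1"
proof -
  have "kap a * a^2 <= 1 * a^2" by (intro mult_right_mono kap_le_1) auto
  hence "b^2 <= 1 - kap a * a^2" using assms by simp
  hence "sqrt (b^2) <= sqrt (1 - kap a * a^2)" by (rule real_sqrt_le_mono)
  hence "\<bar>b\<bar> <= sqrt (1 - kap a * a^2)" by simp
  thus ?thesis using kap_den[of a] unfolding mf_def by (simp add: abs_mult)
qed

lemma smooth_on_mf:
  assumes "open S" "smooth_on S a" shows "smooth_on S (%q. mf (a q))"
  unfolding mf_def kap_def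
proof (intro smooth_on_divide smooth_on_sqrt smooth_intros assms)
  show "1 - st (3 - 4 * a x) * st (3 + 4 * a x) * (a x)^2 > 0" for x
    using kap_den[of "a x"] by (simp add: kap_def)
  thus "sqrt (1 - st (3 - 4 * a x) * st (3 + 4 * a x) * (a x)^2) > 0" for x by simp
qed

lemma smooth_on_px: "open S ==> smooth_on S a ==> smooth_on S b ==> smooth_on S (%q. px (a q) (b q))"
  and smooth_on_pz: "open S ==> smooth_on S a ==> smooth_on S b ==> smooth_on S (%q. pz (a q) (b q))"
  unfolding px_def pz_def by (intro smooth_intros smooth_on_X smooth_on_mf; assumption)+

lemma X_abs: "\<bar>u\<bar> >= 1 ==> X u = sgn u"
  by (cases "u > 0") (auto simp: X_ge X_le)

lemma uX_nonneg: "0 <= u * X u"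
proof (cases "u >= 0")
  case True thus ?thesis using X_mono[of 0 u] by simp
next
  case False thus ?thesis using X_neg[of u] by (simp add: mult_nonpos_nonpos)
qed

lemma uX_abs: "u * X u = \<bar>u\<bar> * X \<bar>u\<bar>" by (cases "u >= 0") (auto simp: X_odd)

lemma uX_le: "\<bar>u\<bar> < 1 ==> u * X u < 1"
proof (cases "u = 0")
  case False
  assume u: "\<bar>u\<bar> < 1"
  have "\<bar>u\<bar> * X \<bar>u\<bar> <= \<bar>u\<bar> * 1" using X_range[of "\<bar>u\<bar>"] by (intro mult_left_mono) auto
  thus ?thesis using u uX_abs[of u] by simp
qed auto

lemma uX_mono: assumes "\<bar>u\<bar> < \<bar>v\<bar>" shows "u * X u < v * X v"
proof -
  have "\<bar>u\<bar> * X \<bar>u\<bar> <= \<bar>u\<bar> * X \<bar>v\<bar>" using X_mono[of "\<bar>u\<bar>" "\<bar>v\<bar>"] assms by (intro mult_left_mono) auto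
  also have "\<dots> < \<bar>v\<bar> * X \<bar>v\<bar>" using X_pos[of "\<bar>v\<bar>"] assms by (intro mult_strict_right_mono) auto
  finally show ?thesis using uX_abs by metis
qed

text \<open>If u were larger on one side, then so would be u X(u), hence l by the height equation,
  and then l X(u), against the equation for the first coordinate.\<close>

lemma bend_inj_pos:
  assumes "l >= 1" "l' >= 1" "l * X u = l' * X u'" "l - u * X u = l' - u' * X u'" "u > 0"
  shows "u = u' & l = l'"
proof -
  have "X u > 0" using X_pos assms(5) by blast
  hence "l' * X u' > 0" using assms(1,3) by (metis less_le_trans mult_pos_pos zero_less_one)
  hence "X u' > 0" using assms(2) by (simp add: zero_less_mult_iff)
  hence u': "u' > 0" using X_mono[of u' 0] by (cases "u' > 0") auto
  have no: False if "u1 < u2" "u1 > 0" "l1 >= 1" "l2 >= 1" "l1 * X u1 = l2 * X u2" "l1 - u1 * X u1 = l2 - u2 * X u2"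
    for u1 u2 l1 l2
  proof -
    have "u1 * X u1 < u2 * X u2" using uX_mono[of u1 u2] that by simp
    hence "l1 < l2" using that by simp
    hence "l1 * X u1 < l2 * X u1" using X_pos[of u1] that(2) by (intro mult_strict_right_mono) auto
    also have "\<dots> <= l2 * X u2" using X_mono[of u1 u2] that by (intro mult_left_mono) auto
    finally show False using that by simp
  qed
  have "u = u'" using no[of u u' l l'] no[of u' u l' l] assms u' by (cases u u' rule: linorder_cases) simp_all
  thus ?thesis using assms(4) by simp
qed

lemma bend_inj:
  assumes "l >= 1" "l' >= 1" "l * X u = l' * X u'" "l - u * X u = l' - u' * X u'"
  shows "u = u' & l = l'"
proof (cases u "0::real" rule: linorder_cases)
  case greater thus ?thesis using bend_inj_pos assms by blast
next
  case less
  hence "- u = - u' & l = l'" using assms by (intro bend_inj_pos) (auto simp: X_odd)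
  thus ?thesis by simp
next
  case equal
  hence "l' * X u' = 0" using assms by simp
  hence "X u' = 0" using assms(2) by simp
  hence "u' = 0" using X_pos[of u'] X_neg[of u'] by (cases u' "0::real" rule: linorder_cases) auto
  thus ?thesis using assms equal by simp
qed

lemma planar_inj:
  assumes "a^2 + b^2 <= 1" "a'^2 + b'^2 <= 1" "px a b = px a' b'" "pz a b = pz a' b'"
  shows "a = a' & b = b'"
proof -
  have "16 * a = 16 * a' & 2 + b * mf a = 2 + b' * mf a'"
    using mf_bound[OF assms(1)] mf_bound[OF assms(2)] assms(3,4)
    by (intro bend_inj) (auto simp: px_def pz_def)
  thus ?thesis using mf_pos[of a'] by auto
qed

lemma planar_immersed:
  assumes "a^2 + b^2 <= 1"
  shows "immersed (%p. (px (fst p) (snd p), pz (fst p) (snd p))) (a, b)"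
proof -
  have "smooth_on UNIV mf" using smooth_on_mf[OF open_UNIV smooth_on_ident] .
  then obtain m' where m': "(mf has_real_derivative m') (at a)"
    using smooth_on_differentiable[of UNIV mf a] by (auto simp: real_differentiable_def)
  have 1: "immersed (%p::real\<times>real. (16 * fst p, 2 + snd p * mf (fst p))) (a, b)"
  proof (rule immersed_pair)
    have f: "(fst has_derivative fst) (at (a, b))" by (rule derivative_eq_intros refl | simp)+
    have "((%p. mf (fst p)) has_derivative (%h. fst h * m')) (at (a, b))"
      using has_derivative_compose[OF f, of mf "%h. m' * h"] m' unfolding has_field_derivative_def
      by (simp add: mult.commute[of _ m'])
    thus "((%p. 2 + snd p * mf (fst p)) has_derivative (%h. fst h * (b * m') + snd h * mf a)) (at (a, b))"
      by (auto intro!: derivative_eq_intros simp: algebra_simps)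
    show "((%p. 16 * fst p) has_derivative (%h. fst h * 16 + snd h * 0)) (at (a, b))"
      by (auto intro!: derivative_eq_intros)
    show "16 * mf a - 0 * (b * m') ~= 0" using mf_pos[of a] by simp
  qed
  have 2: "immersed (%p::real\<times>real. (snd p * X (fst p), snd p - fst p * X (fst p) + 2)) (u, l)" if "l >= 1" for u l
  proof (rule immersed_pair)
    define d where "d = st' ((u + 1) / 2)"
    have f: "(fst has_derivative fst) (at (u, l))" by (rule derivative_eq_intros refl | simp)+
    have D: "((%p. X (fst p)) has_derivative (%h. fst h * d)) (at (u, l))"
      using has_derivative_compose[OF f, of X "%h. d * h"] X_deriv[of u] unfolding d_def has_field_derivative_def
      by (simp add: mult.commute[of _ "st' _"])
    show "((%p. snd p * X (fst p)) has_derivative (%h. fst h * (l * d) + snd h * X u)) (at (u, l))"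
      using D by (auto intro!: derivative_eq_intros simp: algebra_simps)
    show "((%p. snd p - fst p * X (fst p) + 2) has_derivative (%h. fst h * (- (X u + u * d)) + snd h * 1)) (at (u, l))"
      using D by (auto intro!: derivative_eq_intros simp: algebra_simps)
    have d0: "d >= 0" unfolding d_def by (rule st'_nonneg)
    \<comment> \<open>The Jacobian of the bend. At u = 0 it is positive thanks to the derivative d
      of \<open>X\<close>, elsewhere thanks to the square of \<open>X u\<close>.\<close>
    have "(l + u * X u) * d + (X u)^2 > 0"
    proof (cases "u = 0")
      case True
      hence "d > 0" unfolding d_def by (intro st'_pos) auto
      thus ?thesis using True that by simp
    next
      case False
      hence "X u ~= 0" using X_pos[of u] X_neg[of u] by (cases "u > 0") auto
      moreover have "(l + u * X u) * d >= 0" using d0 that uX_nonneg[of u] by simp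
      ultimately show ?thesis by (simp add: add_nonneg_pos)
    qed
    thus "l * d * 1 - X u * (- (X u + u * d)) ~= 0" by (simp add: algebra_simps power2_eq_square)
  qed
  have "2 + b * mf a >= 1" using mf_bound[OF assms] by linarith
  hence "immersed (%p. (snd (16 * fst p, 2 + snd p * mf (fst p)) * X (fst (16 * fst p, 2 + snd p * mf (fst p))),
      snd (16 * fst p, 2 + snd p * mf (fst p)) - fst (16 * fst p, 2 + snd p * mf (fst p)) * X (fst (16 * fst p, 2 + snd p * mf (fst p))) + 2)) (a, b)"
    using immersed_compose[OF 1, of "%p. (snd p * X (fst p), snd p - fst p * X (fst p) + 2)"] 2 by simp
  thus ?thesis by (simp add: px_def pz_def)
qed

text \<open>The bound |u| < 8 means |a| < 1/2, where \<open>mf\<close> has its exact value; there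
  the unit circle corresponds to l = 1 and l = 3.\<close>

lemma planar_of_bend:
  assumes u: "\<bar>u\<bar> < 8" and l: "1 <= l" "l <= 3"
  obtains a b where "a^2 + b^2 <= 1" "px a b = l * X u" "pz a b = l - u * X u + 2" "a^2 + b^2 = 1 \<longleftrightarrow> \<bar>l - 2\<bar> = 1"
proof
  define a b where "a = u / 16" and "b = (l - 2) * sqrt (1 - a^2)"
  have "\<bar>a\<bar> < 1/2" using u by (simp add: a_def)
  hence a2: "a^2 < 1" by (auto simp: abs_square_less_1)
  have bm: "b * mf a = l - 2" using mf_half[of a] \<open>\<bar>a\<bar> < 1/2\<close> a2 by (simp add: b_def)
  have s: "a^2 + b^2 = 1 - (1 - a^2) * (1 - (l - 2)^2)"
    using a2 by (simp add: b_def power_mult_distrib) algebra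
  have "(l - 2)^2 <= 1" using l by (auto simp: abs_square_le_1)
  thus "a^2 + b^2 <= 1" using a2 by (simp add: s)
  show "px a b = l * X u" "pz a b = l - u * X u + 2" unfolding px_def pz_def bm by (auto simp: a_def)
  show "a^2 + b^2 = 1 \<longleftrightarrow> \<bar>l - 2\<bar> = 1" using a2 \<open>\<bar>a\<bar> < 1/2\<close> by (auto simp add: s abs_square_eq_1)
qed

lemma planar_low:
  assumes "a^2 + b^2 <= 1" "pz a b <= 2"
  shows "px a b = sgn a * (2 + b * mf a)" "a ~= 0"
proof -
  have "\<bar>16 * a\<bar> >= 1"
    using uX_le[of "16 * a"] mf_bound[OF assms(1)] assms(2) unfolding pz_def by linarith
  thus "a ~= 0" "px a b = sgn a * (2 + b * mf a)" by (auto simp: px_def X_abs sgn_mult)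
qed

lemma planar_low_abs:
  assumes "a^2 + b^2 <= 1" "pz a b <= 2"
  shows "1 <= \<bar>px a b\<bar>" "\<bar>px a b\<bar> <= 3" "px a b > 0 \<longleftrightarrow> a > 0" "px a b < 0 \<longleftrightarrow> a < 0"
proof -
  have "1 <= 2 + b * mf a" "2 + b * mf a <= 3" using mf_bound[OF assms(1)] by linarith+
  thus "1 <= \<bar>px a b\<bar>" "\<bar>px a b\<bar> <= 3" "px a b > 0 \<longleftrightarrow> a > 0" "px a b < 0 \<longleftrightarrow> a < 0"
    using planar_low[OF assms] by (cases "a > 0"; simp add: sgn_if)+
qed

lemma planar_circle:
  assumes "a^2 + b^2 = 1" "pz a b >= - 2"
  shows "\<bar>a\<bar> < 1/2" "b ~= 0" "2 + b * mf a = 2 + sgn b"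
proof -
  show a: "\<bar>a\<bar> < 1/2"
  proof (rule ccontr)
    assume "\<not> \<bar>a\<bar> < 1/2"
    hence "\<bar>16 * a\<bar> >= 8" by (simp add: abs_mult)
    hence "16 * a * X (16 * a) >= 8" using X_abs[of "16 * a"] by (auto simp: sgn_if abs_if split: if_splits)
    thus False using mf_bound[of a b] assms unfolding pz_def by linarith
  qed
  hence a2: "a^2 < 1" by (auto simp: abs_square_less_1)
  thus b: "b ~= 0" using assms(1) by auto
  have "1 - a^2 = b^2" using assms(1) by simp
  hence "mf a = 1 / \<bar>b\<bar>" using mf_half[of a] a by simp
  thus "2 + b * mf a = 2 + sgn b" using b by (simp add: sgn_if)
qed

text \<open>On the upper part of the rim the height equals 4 + sgn b - u X(u) with u = 16 a, so for
  a fixed sign of b a higher point has smaller |a|. This is the ordering that the crossing argument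
  asks for.\<close>

lemma planar_circle_order:
  assumes "a^2 + b^2 = 1" "a'^2 + b'^2 = 1" "pz a b > 0" "pz a' b' < 0" "b * b' > 0"
  shows "\<bar>a\<bar> < \<bar>a'\<bar>"
proof (cases "\<bar>a'\<bar> < 1/2")
  case False thus ?thesis using planar_circle(1)[of a b] assms by linarith
next
  case True
  have c: "\<bar>a\<bar> < 1/2" "b * mf a = sgn b" using planar_circle[of a b] assms by auto
  have a2: "a'^2 < 1" using True by (auto simp: abs_square_less_1)
  have "1 - a'^2 = b'^2" using assms(2) by simp
  hence "b' * mf a' = sgn b'" using mf_half[of a'] True assms(5) by (simp add: sgn_if) 
  moreover have "sgn b' = sgn b" using assms(5) by (auto simp: sgn_if zero_less_mult_iff)
  ultimately have "16 * a * X (16 * a) < 16 * a' * X (16 * a')"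
    using assms(3,4) c(2) unfolding pz_def by linarith
  hence "\<not> \<bar>16 * a'\<bar> <= \<bar>16 * a\<bar>" using uX_mono[of "16 * a'" "16 * a"] uX_abs
    by (metis less_eq_real_def not_less_iff_gr_or_eq)
  thus ?thesis by (simp add: abs_mult)
qed

section \<open>The planar disk as a region and a function vanishing exactly on its rim\<close>

definition Xi :: "real \<times> real => real \<times> real" where "Xi p = (px (fst p) (snd p), pz (fst p) (snd p))"
definition E0 :: "(real \<times> real) set" where "E0 = Xi ` cball 0 1"

lemma norm_pair_le: "norm (a, b) <= (1::real) \<longleftrightarrow> a^2 + b^2 <= 1"
  and norm_pair_lt: "norm (a, b) < (1::real) \<longleftrightarrow> a^2 + b^2 < 1"
  and norm_pair_eq: "norm (a, b) = (1::real) \<longleftrightarrow> a^2 + b^2 = 1"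
  for a b :: real by (auto simp: norm_Pair)

lemma continuous_Xi: "continuous_on S Xi"
proof -
  have "continuous_on UNIV (%p::real\<times>real. px (fst p) (snd p))" "continuous_on UNIV (%p::real\<times>real. pz (fst p) (snd p))"
    by (intro smooth_on_continuous smooth_on_px smooth_on_pz smooth_on_linear bounded_linear_fst bounded_linear_snd open_UNIV)+
  thus ?thesis unfolding Xi_def by (intro continuous_on_subset[OF continuous_on_Pair]) auto
qed

lemma inj_Xi: "inj_on Xi (cball 0 1)"
proof (rule inj_onI, clarsimp simp: Xi_def norm_pair_le)
  fix a b a' b' assume "a^2 + b^2 <= 1" "a'^2 + b'^2 <= 1" "px a b = px a' b'" "pz a b = pz a' b'"
  thus "a = a' & b = b'" using planar_inj by blast
qed

lemma compact_E0: "compact E0"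
  unfolding E0_def by (intro compact_continuous_image continuous_Xi compact_cball)

text \<open>Invariance of domain is used for both inclusions, once for \<open>Xi\<close> and once
  for its inverse homeomorphism.\<close>

lemma interior_E0: "interior E0 = Xi ` ball 0 1"
proof
  have "open (Xi ` ball 0 1)"
    by (intro invariance_of_domain continuous_Xi open_ball inj_on_subset[OF inj_Xi]) auto
  thus "Xi ` ball 0 1 \<subseteq> interior E0" unfolding E0_def by (intro interior_maximal) auto
  obtain g where g: "homeomorphism (cball 0 1) E0 Xi g"
    using homeomorphism_compact[OF compact_cball continuous_Xi _ inj_Xi] E0_def by metis
  have "open (g ` interior E0)"
    by (intro invariance_of_domain continuous_on_subset[OF homeomorphism_cont2[OF g]] open_interior interior_subset
        inj_on_subset[OF _ interior_subset])
      (rule inj_on_inverseI[of _ Xi], rule homeomorphism_apply2[OF g])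
  moreover have "g ` interior E0 \<subseteq> cball 0 1" using homeomorphism_image2[OF g] interior_subset by blast
  ultimately have "g ` interior E0 \<subseteq> ball 0 1" using interior_maximal interior_cball by metis
  show "interior E0 \<subseteq> Xi ` ball 0 1"
  proof
    fix p assume p: "p \<in> interior E0"
    hence "g p \<in> ball 0 1" using \<open>g ` interior E0 \<subseteq> ball 0 1\<close> by blast
    moreover have "Xi (g p) = p" using homeomorphism_apply2[OF g] p interior_subset by blast
    ultimately show "p \<in> Xi ` ball 0 1" by (metis imageI)
  qed
qed

text \<open>Any function that is negative inside, zero on the rim and positive outside would give
  the square root on D; the signed distance does this at all heights. In the slab |z| <= 1 it is
  replaced by \<open>gx\<close>, so that the root becomes a sheet over \<open>phi0\<close>, on which
  the twists are understood. Both summands have the right sign where they overlap.\<close>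

definition Gs :: "real \<times> real => real" where
  "Gs p = st (2 - \<bar>snd p\<bar>) * gx (fst p) + (1 - st (2 - \<bar>snd p\<bar>)) * (infdist p E0 - infdist p (- E0))"

lemma continuous_Gs: "continuous_on UNIV Gs"
  unfolding Gs_def gx_def
  by (intro continuous_intros continuous_on_compose2[OF continuous_st]) auto

lemma Gs_slab: "\<bar>z\<bar> <= 1 ==> Gs (x, z) = gx x" by (simp add: Gs_def st_1)

lemma dist_sign:
  shows "p \<in> interior E0 ==> infdist p E0 - infdist p (- E0) < 0"
    and "p \<notin> E0 ==> infdist p E0 - infdist p (- E0) > 0"
    and "p \<in> E0 ==> p \<notin> interior E0 ==> infdist p E0 - infdist p (- E0) = 0"
proof -
  have ne: "- E0 ~= {}" using compact_E0 compact_imp_bounded not_bounded_UNIV by (metis Compl_empty_eq double_compl)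
  have ne': "E0 ~= {}" unfolding E0_def by simp
  have c: "closed E0" using compact_E0 compact_imp_closed by blast
  show "infdist p E0 - infdist p (- E0) < 0" if "p \<in> interior E0"
  proof -
    have "p \<notin> closure (- E0)" using that by (simp add: closure_complement)
    hence "infdist p (- E0) ~= 0" using in_closure_iff_infdist_zero[OF ne] by blast
    moreover have "p \<in> E0" using that interior_subset by blast
    ultimately show ?thesis using infdist_nonneg[of p "- E0"] by simp
  qed
  show "infdist p E0 - infdist p (- E0) > 0" if "p \<notin> E0"
    using that in_closed_iff_infdist_zero[OF c ne'] infdist_nonneg[of p E0] infdist_zero[of p "- E0"] by simp
  show "infdist p E0 - infdist p (- E0) = 0" if "p \<in> E0" "p \<notin> interior E0"
  proof -
    have "p \<in> closure (- E0)" using that by (simp add: closure_complement)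
    thus ?thesis using that in_closure_iff_infdist_zero[OF ne] by simp
  qed
qed

text \<open>At these heights the region consists of the two vertical legs, so membership depends on
  |x| only.\<close>

lemma slab_E0:
  assumes "\<bar>z\<bar> < 2"
  shows "(x, z) \<in> E0 \<longleftrightarrow> 1 <= \<bar>x\<bar> & \<bar>x\<bar> <= 3" "(x, z) \<in> interior E0 \<longleftrightarrow> 1 < \<bar>x\<bar> & \<bar>x\<bar> < 3"
proof -
  have A: "1 <= \<bar>x\<bar> & \<bar>x\<bar> <= 3" if "(x, z) \<in> E0"
    using that planar_low_abs assms by (auto simp: E0_def Xi_def norm_pair_le)
  have B: "\<exists>a b. a^2 + b^2 <= 1 & Xi (a, b) = (x, z) & (a^2 + b^2 = 1 \<longleftrightarrow> \<bar>x\<bar> = 1 | \<bar>x\<bar> = 3)" if r: "1 <= \<bar>x\<bar>" "\<bar>x\<bar> <= 3"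
  proof -
    define u where "u = sgn x * (\<bar>x\<bar> - z + 2)"
    have sx: "sgn x = 1 | sgn x = - 1" using that by (auto simp: sgn_if)
    have au: "\<bar>u\<bar> = \<bar>x\<bar> - z + 2" unfolding u_def using assms that sx by (auto simp: abs_mult)
    have su: "sgn u = sgn x" unfolding u_def using assms that sx by (auto simp: sgn_if)
    have "\<bar>u\<bar> < 8" "\<bar>u\<bar> >= 1" using au assms that by linarith+
    hence Xu: "X u = sgn x" using X_abs su by simp
    have uX: "u * X u = \<bar>u\<bar>" using su unfolding Xu by (metis abs_sgn su)
    obtain a b where "a^2 + b^2 <= 1" "px a b = \<bar>x\<bar> * X u" "pz a b = \<bar>x\<bar> - u * X u + 2" "a^2 + b^2 = 1 \<longleftrightarrow> \<bar>\<bar>x\<bar> - 2\<bar> = 1"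
      by (rule planar_of_bend[OF \<open>\<bar>u\<bar> < 8\<close> r])
    moreover have "\<bar>x\<bar> * X u = x" unfolding Xu by (rule abs_mult_sgn)
    moreover have "\<bar>\<bar>x\<bar> - 2\<bar> = 1 \<longleftrightarrow> \<bar>x\<bar> = 1 | \<bar>x\<bar> = 3" by linarith
    ultimately have "Xi (a, b) = (x, z)" "a^2 + b^2 <= 1" "a^2 + b^2 = 1 \<longleftrightarrow> \<bar>x\<bar> = 1 | \<bar>x\<bar> = 3"
      using au uX unfolding Xi_def by simp_all
    thus ?thesis by blast
  qed
  show "(x, z) \<in> E0 \<longleftrightarrow> 1 <= \<bar>x\<bar> & \<bar>x\<bar> <= 3"
  proof
    assume "1 <= \<bar>x\<bar> & \<bar>x\<bar> <= 3"
    then obtain a b where "a^2 + b^2 <= 1" "Xi (a, b) = (x, z)" using B by blast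
    thus "(x, z) \<in> E0" unfolding E0_def by (intro image_eqI[of _ _ "(a, b)"]) (auto simp: norm_pair_le)
  qed (rule A)
  show "(x, z) \<in> interior E0 \<longleftrightarrow> 1 < \<bar>x\<bar> & \<bar>x\<bar> < 3"
  proof
    assume i: "(x, z) \<in> interior E0"
    hence r: "1 <= \<bar>x\<bar>" "\<bar>x\<bar> <= 3" using A interior_subset by blast+
    obtain a b where ab: "a^2 + b^2 <= 1" "Xi (a, b) = (x, z)" "a^2 + b^2 = 1 \<longleftrightarrow> \<bar>x\<bar> = 1 | \<bar>x\<bar> = 3" using B[OF r] by blast
    obtain p where p: "p \<in> ball 0 1" "Xi p = (x, z)" using i unfolding interior_E0 by (metis imageE)
    have "p = (a, b)" using inj_onD[OF inj_Xi, of p "(a, b)"] p ab by (simp add: norm_pair_le)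
    hence "a^2 + b^2 ~= 1" using p(1) by (simp add: norm_pair_lt)
    thus "1 < \<bar>x\<bar> & \<bar>x\<bar> < 3" using ab(3) r by linarith
  next
    assume r: "1 < \<bar>x\<bar> & \<bar>x\<bar> < 3"
    then obtain a b where ab: "a^2 + b^2 <= 1" "Xi (a, b) = (x, z)" "a^2 + b^2 = 1 \<longleftrightarrow> \<bar>x\<bar> = 1 | \<bar>x\<bar> = 3" using B by force
    hence "(a, b) \<in> ball 0 1" using r by (auto simp: norm_pair_lt)
    thus "(x, z) \<in> interior E0" unfolding interior_E0 using ab(2) by (metis imageI)
  qed
qed

lemma Gs_sign:
  shows "p \<in> interior E0 ==> Gs p < 0" and "p \<notin> E0 ==> Gs p > 0" and "p \<in> E0 ==> p \<notin> interior E0 ==> Gs p = 0"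
proof -
  obtain x z where p: "p = (x, z)" by (cases p)
  let ?t = "st (2 - \<bar>z\<bar>)" and ?d = "infdist p E0 - infdist p (- E0)"
  have G: "Gs p = ?t * gx x + (1 - ?t) * ?d" by (simp add: Gs_def p)
  have t: "0 <= ?t" "?t <= 1" using st_range by auto
  have t0: "?t = 0" if "\<not> \<bar>z\<bar> < 2" using that by (simp add: st_0)
  show "Gs p < 0" if i: "p \<in> interior E0"
  proof (cases "\<bar>z\<bar> < 2")
    case True
    hence "gx x < 0" using slab_E0(2)[OF True, of x] i gx_ge_0[of x] p by auto
    thus ?thesis unfolding G using dist_sign(1)[OF i] t by (intro convex_bound_lt[of _ 0 _ ?t "1 - ?t"]) auto
  qed (use G t0 dist_sign(1)[OF i] in simp)
  show "Gs p > 0" if i: "p \<notin> E0"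
  proof (cases "\<bar>z\<bar> < 2")
    case True
    hence "gx x > 0" using slab_E0(1)[OF True, of x] i gx_le_0[of x] p by auto
    hence "?t * (- gx x) + (1 - ?t) * (- ?d) < 0" using dist_sign(2)[OF i] t by (intro convex_bound_lt) auto
    thus ?thesis unfolding G by (simp add: algebra_simps)
  qed (use G t0 dist_sign(2)[OF i] in simp)
  show "Gs p = 0" if i: "p \<in> E0" "p \<notin> interior E0"
  proof (cases "\<bar>z\<bar> < 2")
    case True
    hence "gx x <= 0" "gx x >= 0" using slab_E0[OF True, of x] i gx_le_0[of x] gx_ge_0[of x] p by auto
    thus ?thesis unfolding G using dist_sign(3)[OF i] by simp
  qed (use G t0 dist_sign(3)[OF i] in simp)
qed

text \<open>The maximum of x and 2 z - 5 is a coarse substitute for the band coordinate l that also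
  works at the top: on the outer upper cap z >= 4, hence 2 z - 5 >= 3, and on the inner one z <= 3,
  hence 2 z - 5 <= 1. Since l - u X(u) = z - 2 is known, the intermediate value theorem solves for
  u.\<close>

lemma cap_pos:
  assumes x: "x >= 0" and z: "z >= - 1" and l: "1 < max x (2 * z - 5)" "max x (2 * z - 5) < 3"
  obtains u l where "\<bar>u\<bar> < 8" "1 < l" "l < 3" "x = l * X u" "z = l - u * X u + 2"
proof -
  define zB where "zB = z - 2"
  have zB: "zB >= - 3" "zB < 2" "x < 3" using z l by (auto simp: zB_def)
  have "\<exists>u. 0 <= u & u <= 8 & (zB + u * X u) * X u = x"
  proof (rule IVT)
    show "(zB + 0 * X 0) * X 0 <= x" "x <= (zB + 8 * X 8) * X 8" using x zB by (auto simp: X_ge)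
    have "isCont X u" for u using continuous_X by (simp add: continuous_on_eq_continuous_at)
    thus "\<forall>u. 0 <= u & u <= 8 --> isCont (%u. (zB + u * X u) * X u) u" by (intro allI impI continuous_intros)
  qed auto
  then obtain u where u: "0 <= u" "u <= 8" "(zB + u * X u) * X u = x" by blast
  define l where "l = zB + u * X u"
  have lx: "l * X u = x" using u(3) by (simp add: l_def)
  have big: "l = x & u < 8" if "u >= 1"
  proof -
    have "X u = 1" using X_ge that by simp
    hence "l = x" "l = zB + u" using lx by (auto simp: l_def)
    thus ?thesis using zB by linarith
  qed
  have small: "l < 3" if "u < 1" using uX_le[of u] u(1) that zB by (simp add: l_def)
  have "l < 3" using big small zB by (cases "u >= 1") auto
  moreover have "1 < l"
  proof (cases "x > 1")
    case True
    have "X u >= 0" using X_mono[of 0 u] u by simp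
    hence "l > 0" using lx True by (metis less_trans mult_nonpos_nonneg not_le_imp_less not_less zero_less_one)
    hence "l * X u <= l * 1" using X_range[of u] by (intro mult_left_mono) auto
    thus ?thesis using lx True by simp
  next
    case False
    hence "zB > 1" using l(1) by (simp add: zB_def less_max_iff_disj)
    thus ?thesis using uX_nonneg[of u] by (simp add: l_def)
  qed
  moreover have "\<bar>u\<bar> < 8" using big u by (cases "u >= 1") linarith+
  moreover have "z = l - u * X u + 2" by (simp add: l_def zB_def)
  ultimately show ?thesis by (intro that[of u l] lx[symmetric])
qed

lemma cap_interior:
  assumes z: "z >= - 1" and l: "1 < max \<bar>x\<bar> (2 * z - 5)" "max \<bar>x\<bar> (2 * z - 5) < 3"
  shows "(x, z) \<in> interior E0"
proof -
  obtain u l where ul: "\<bar>u\<bar> < 8" "1 < l" "l < 3" "\<bar>x\<bar> = l * X u" "z = l - u * X u + 2"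
    by (rule cap_pos[of "\<bar>x\<bar>" z]) (use assms in simp_all)
  define v where "v = (if x >= 0 then u else - u)"
  have v: "\<bar>v\<bar> < 8" "x = l * X v" "z = l - v * X v + 2" using ul by (auto simp: v_def X_odd)
  obtain a b where ab: "a^2 + b^2 <= 1" "px a b = l * X v" "pz a b = l - v * X v + 2" "a^2 + b^2 = 1 \<longleftrightarrow> \<bar>l - 2\<bar> = 1"
    by (rule planar_of_bend[OF v(1), of l]) (use ul in simp_all)
  hence "(a, b) \<in> ball 0 1" using ul by (auto simp: norm_pair_lt)
  thus ?thesis unfolding interior_E0 by (intro image_eqI[of _ _ "(a, b)"]) (use ab v in \<open>auto simp: Xi_def\<close>)
qed

section \<open>Disks parametrised by the unit disc\<close>

text \<open>Smoothness is stated through substitution of smooth coordinate functions on the line and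
  on open plane sets, the two situations in which the map is composed: its rim, and the pieces of
  the disk over a triangulated square.\<close>

definition disk_emb :: "(real => real => real^3) => bool" where
  "disk_emb F \<longleftrightarrow>
     (\<forall>a b. smooth_on UNIV a --> smooth_on UNIV b --> smooth_on UNIV (%t::real. F (a t) (b t))) &
     (\<forall>U a b. open U --> smooth_on U a --> smooth_on U b --> smooth_on U (%q::real^2. F (a q) (b q))) &
     (\<forall>a b a' b'. a^2 + b^2 <= 1 --> a'^2 + b'^2 <= 1 --> F a b = F a' b' --> a = a' & b = b') &
     (\<forall>a b. a^2 + b^2 <= 1 --> immersed (%p. F (fst p) (snd p)) (a, b))"

definition rim :: "(real => real => real^3) => real => real^3" where
  "rim F t = F (cos (2 * pi * t)) (sin (2 * pi * t))"

lemma disk_emb_scale: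
  assumes "disk_emb F" "c ~= 0"
  shows "disk_emb (%a b. c *\<^sub>R F a b)"
proof -
  have "immersed ((*\<^sub>R) c) (x::real^3)" for x
    unfolding immersed_def using assms(2) by (intro exI[of _ "(*\<^sub>R) c"] conjI derivative_intros) (auto simp: inj_on_def)
  hence "immersed (%p. c *\<^sub>R F (fst p) (snd p)) (a, b)" if "a^2 + b^2 <= 1" for a b
    using immersed_compose[of "%p. F (fst p) (snd p)" "(a, b)" "(*\<^sub>R) c"] assms(1) that unfolding disk_emb_def by blast
  moreover have "smooth_on U (%q::real^2. c *\<^sub>R F (a q) (b q))" if "open U" "smooth_on U a" "smooth_on U b" for U a b
    using assms(1) that unfolding disk_emb_def by (intro smooth_on_scaleR smooth_on_const) blast+
  moreover have "smooth_on UNIV (%q::real. c *\<^sub>R F (a q) (b q))" if "smooth_on UNIV a" "smooth_on UNIV b" for a b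
    using assms(1) that unfolding disk_emb_def by (intro smooth_on_scaleR smooth_on_const open_UNIV) blast+
  moreover have "c *\<^sub>R F a b = c *\<^sub>R F a' b' \<longleftrightarrow> F a b = F a' b'" for a b a' b' using assms(2) by simp
  ultimately show ?thesis using assms(1) unfolding disk_emb_def by (auto simp only:)
qed

lemma circle_eq:
  assumes "cos (2 * pi * s) = cos (2 * pi * t)" "sin (2 * pi * s) = sin (2 * pi * t)" "0 <= s" "s < 1" "0 <= t" "t < 1"
  shows "s = t"
proof -
  obtain n :: int where "2 * pi * s = 2 * pi * t + 2 * pi * of_int n" using assms(1,2) sin_cos_eq_iff[of "2 * pi * s" "2 * pi * t"] by auto
  hence "2 * pi * (s - t - of_int n) = 0" by (simp add: algebra_simps)
  hence "s - t = of_int n" by simp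
  moreover hence "of_int n < (1::real)" "of_int n > (- 1::real)" using assms(3-6) by linarith+
  hence "n = 0" by linarith
  ultimately show ?thesis by simp
qed

lemma rim_derivative_nz:
  assumes "disk_emb F"
  shows "vector_derivative (rim F) (at t) ~= 0"
proof -
  let ?a = "cos (2 * pi * t)" and ?b = "sin (2 * pi * t)"
  obtain D where D: "((%p. F (fst p) (snd p)) has_derivative D) (at (?a, ?b))" "inj D"
  proof -
    have "?a^2 + ?b^2 <= 1" by simp
    hence "immersed (%p. F (fst p) (snd p)) (?a, ?b)" using assms unfolding disk_emb_def by blast
    thus ?thesis using that unfolding immersed_def by blast
  qed
  have V: "((%t. (cos (2 * pi * t), sin (2 * pi * t))) has_vector_derivative (- 2 * pi * ?b, 2 * pi * ?a)) (at t)"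
    by (intro has_vector_derivative_Pair) (auto intro!: derivative_eq_intros simp: has_real_derivative_iff_has_vector_derivative[symmetric])
  have lin: "D (h *\<^sub>R v) = h *\<^sub>R D v" for h v using D(1) has_derivative_linear linear_cmul by blast
  have "((%t. F (cos (2 * pi * t)) (sin (2 * pi * t))) has_vector_derivative D (- 2 * pi * ?b, 2 * pi * ?a)) (at t)"
    using has_derivative_compose[OF V[unfolded has_vector_derivative_def] D(1)] unfolding has_vector_derivative_def lin by simp
  hence "vector_derivative (rim F) (at t) = D (- 2 * pi * ?b, 2 * pi * ?a)"
    unfolding rim_def by (rule vector_derivative_at)
  moreover have "D (- 2 * pi * ?b, 2 * pi * ?a) ~= D 0"
  proof
    assume "D (- 2 * pi * ?b, 2 * pi * ?a) = D 0"
    hence "(- 2 * pi * ?b, 2 * pi * ?a) = 0" using D(2) by (meson injD)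
    hence "?a = 0" "?b = 0" by (auto simp: zero_prod_def)
    thus False using sin_cos_squared_add[of "2 * pi * t"] by simp
  qed
  moreover have "D 0 = 0" using D(1) has_derivative_linear linear_0 by blast
  ultimately show ?thesis by simp
qed

lemma disk_emb_curve:
  assumes "disk_emb F"
  shows "smooth_closed_embedded_curve (rim F)"
  unfolding smooth_closed_embedded_curve_def
proof (intro conjI allI)
  have "smooth_on UNIV (%t::real. cos (2 * pi * t))" "smooth_on UNIV (%t::real. sin (2 * pi * t))"
    by (intro smooth_intros open_UNIV)+
  thus "smooth_on UNIV (rim F)" using assms unfolding disk_emb_def rim_def by blast
  show "rim F (t + 1) = rim F t" for t unfolding rim_def by (simp add: distrib_left)
  show "vector_derivative (rim F) (at t) ~= 0" for t using rim_derivative_nz[OF assms] .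
  show "inj_on (rim F) {0..<1}"
  proof (rule inj_onI)
    fix s t assume "s \<in> {0..<1}" "t \<in> {0..<1::real}" "rim F s = rim F t"
    moreover hence "cos (2 * pi * s) = cos (2 * pi * t) & sin (2 * pi * s) = sin (2 * pi * t)"
    proof -
      have "(cos (2 * pi * u))^2 + (sin (2 * pi * u))^2 <= 1" for u by simp
      thus ?thesis using assms \<open>rim F s = rim F t\<close> unfolding disk_emb_def rim_def by blast
    qed
    ultimately show "s = t" using circle_eq by auto
  qed
qed

lemma rim_image: "path_image (rim F) = {F a b | a b. a^2 + b^2 = 1}"
proof
  show "path_image (rim F) \<subseteq> {F a b | a b. a^2 + b^2 = 1}"
  proof
    fix p assume "p \<in> path_image (rim F)"
    then obtain t where "p = F (cos (2 * pi * t)) (sin (2 * pi * t))" unfolding path_image_def rim_def by blast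
    thus "p \<in> {F a b | a b. a^2 + b^2 = 1}" using sin_cos_squared_add2[of "2 * pi * t"] by blast
  qed
  show "{F a b | a b. a^2 + b^2 = 1} \<subseteq> path_image (rim F)"
  proof clarify
    fix a b :: real assume "a^2 + b^2 = 1"
    then obtain t where t: "0 <= t" "t < 2 * pi" "a = cos t" "b = sin t" using sincos_total_2pi by metis
    hence "F a b = rim F (t / (2 * pi))" "t / (2 * pi) \<in> {0..1}" unfolding rim_def by (auto simp: field_simps)
    thus "F a b \<in> path_image (rim F)" unfolding path_image_def by blast
  qed
qed

text \<open>One coordinate of a homeomorphism from the square [-1, 1]^2 to the unit disc; the other
  is obtained by exchanging x and y. On each triangle between the diagonals it has a formula that
  remains smooth and immersive up to the corners and at the centre, where the radial homeomorphism
  is not differentiable.\<close>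

definition da :: "real => real => real" where "da x y = x * sqrt (1 + max 0 (x^2 - y^2)) / sqrt 2"

lemma da_sq: "(da x y)^2 = x^2 * (1 + max 0 (x^2 - y^2)) / 2"
  unfolding da_def by (simp add: power_mult_distrib power_divide)

lemma da_sgn: "sgn (da x y) = sgn x"
proof -
  have "sqrt (1 + max 0 (x^2 - y^2)) / sqrt 2 > 0" by (simp add: add_pos_nonneg)
  thus ?thesis unfolding da_def by (metis mult.right_neutral sgn_mult sgn_pos times_divide_eq_right)
qed

lemma da_norm:
  assumes "\<bar>x\<bar> <= 1" "\<bar>y\<bar> <= 1"
  shows "(da x y)^2 + (da y x)^2 <= 1" "\<bar>x\<bar> = 1 | \<bar>y\<bar> = 1 ==> (da x y)^2 + (da y x)^2 = 1"
proof -
  have *: "(da x y)^2 + (da y x)^2 <= 1 & (\<bar>x\<bar> = 1 --> (da x y)^2 + (da y x)^2 = 1)" if "\<bar>x\<bar> <= 1" "\<bar>y\<bar> <= \<bar>x\<bar>" for x y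
  proof -
    have yx: "y^2 <= x^2" using that by (simp add: abs_le_square_iff)
    have x1: "x^2 <= 1" using that by (simp add: abs_square_le_1)
    have "(da x y)^2 + (da y x)^2 = (x^2 * (1 + (x^2 - y^2)) + y^2) / 2"
      unfolding da_sq using yx by (simp add: max_def)
    also have "\<dots> = x^2 - (x^2 - y^2) * (1 - x^2) / 2" by (simp add: field_simps)
    finally have e: "(da x y)^2 + (da y x)^2 = x^2 - (x^2 - y^2) * (1 - x^2) / 2" .
    have "(x^2 - y^2) * (1 - x^2) >= 0" using yx x1 by simp
    moreover have "x^2 = 1" if "\<bar>x\<bar> = 1" using that by (simp add: abs_square_eq_1)
    ultimately show ?thesis unfolding e using x1 by auto
  qed
  show "(da x y)^2 + (da y x)^2 <= 1" using *[of x y] *[of y x] assms by linarith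
  show "(da x y)^2 + (da y x)^2 = 1" if "\<bar>x\<bar> = 1 | \<bar>y\<bar> = 1"
    using *[of x y] *[of y x] assms that by linarith
qed

text \<open>In terms of squares, the smaller coordinate is only halved while the larger one is
  halved and enlarged, so the order of the two can be read off the image; then each coordinate is
  recovered in turn, and the signs are preserved.\<close>

lemma da_inj:
  assumes "da x y = da x' y'" "da y x = da y' x'"
  shows "x = x' & y = y'"
proof -
  have sq: "p = p' & r = r'"
    if "p >= r" "r >= 0" "p' >= 0" "r' >= 0" "p * (1 + max 0 (p - r)) = p' * (1 + max 0 (p' - r'))"
       "r * (1 + max 0 (r - p)) = r' * (1 + max 0 (r' - p'))" for p r p' r' :: real
  proof (cases "p' >= r'")
    case True
    hence r: "r = r'" using that by (simp add: max_def split: if_splits)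
    hence "(p - p') * (1 + p + p' - r) = 0" using that(5) True that(1) by (simp add: max_def algebra_simps split: if_splits)
    moreover have "1 + p + p' - r > 0" using that by linarith
    ultimately show ?thesis using r by auto
  next
    case False
    hence "r = r' * (1 + (r' - p'))" "p * (1 + (p - r)) = p'" using that by (auto simp: max_def split: if_splits)
    moreover have "r' * (1 + (r' - p')) >= r' * 1" using False that by (intro mult_left_mono) auto
    moreover have "p * (1 + (p - r)) >= p * 1" by (intro mult_left_mono) (use that(1,2) in linarith)+
    ultimately show ?thesis using False that(1) by linarith
  qed
  have e: "x^2 * (1 + max 0 (x^2 - y^2)) = x'^2 * (1 + max 0 (x'^2 - y'^2))"
    "y^2 * (1 + max 0 (y^2 - x^2)) = y'^2 * (1 + max 0 (y'^2 - x'^2))"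
    using arg_cong[OF assms(1), of "%a. a^2"] arg_cong[OF assms(2), of "%a. a^2"] unfolding da_sq by auto
  have "x^2 = x'^2 & y^2 = y'^2"
  proof (cases "x^2 >= y^2")
    case True thus ?thesis using sq[OF True _ _ _ e] by simp
  next
    case False thus ?thesis using sq[of "x^2" "y^2" "y'^2" "x'^2"] e by simp
  qed
  moreover have "sgn x = sgn x'" "sgn y = sgn y'" using assms da_sgn by metis+
  ultimately show ?thesis by (metis abs_mult_sgn power2_eq_iff abs_minus_cancel)
qed

lemma da_immersed:
  assumes "1 + x^2 - y^2 > 0"
  shows "immersed (%p. (fst p * sqrt (1 + (fst p)^2 - (snd p)^2) / sqrt 2, snd p / sqrt 2)) (x, y)"
proof -
  let ?s = "sqrt (1 + x^2 - y^2)"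
  have s: "?s > 0" using assms by simp
  have A: "((%p. fst p * sqrt (1 + (fst p)^2 - (snd p)^2) / sqrt 2) has_derivative
      (%h. fst h * ((?s + x * x / ?s) / sqrt 2) + snd h * (- (x * y / ?s) / sqrt 2))) (at (x, y))"
    using assms s by (auto intro!: derivative_eq_intros simp: field_simps power2_eq_square)
  have B: "((%p. snd p / sqrt 2) has_derivative (%h. fst h * 0 + snd h * (1 / sqrt 2))) (at (x, y))"
    by (auto intro!: derivative_eq_intros simp: fun_eq_iff field_simps)
  have "?s + x * x / ?s > 0" using s by (simp add: add_pos_nonneg)
  thus ?thesis by (intro immersed_pair[OF A B]) simp
qed

definition cdirs :: "(real^2) set" where "cdirs = {vector [1, 0], vector [-1, 0], vector [0, 1], vector [0, -1]}"
definition cent :: "real^2" where "cent = vector [1/2, 1/2]"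
text \<open>The four triangles between the diagonals, c pointing to the side. They are described by
  the direction that maximises an inner product, so two of them meet in the supporting hyperplane
  where their directions tie, which shows at once that they meet in faces.\<close>

definition tri :: "real^2 => (real^2) set" where
  "tri c = {q \<in> unit_square. \<forall>c'\<in>cdirs. c' \<bullet> (q - cent) <= c \<bullet> (q - cent)}"

lemma mem_tri: "q \<in> tri c \<longleftrightarrow> q \<in> unit_square &
    \<bar>q$1 - 1/2\<bar> <= c$1 * (q$1 - 1/2) + c$2 * (q$2 - 1/2) & \<bar>q$2 - 1/2\<bar> <= c$1 * (q$1 - 1/2) + c$2 * (q$2 - 1/2)"
  unfolding tri_def cdirs_def cent_def by (simp add: inner_vec_def sum_2 abs_le_iff)

lemma vec2_eq_iff: "(x::real^2) = y \<longleftrightarrow> x$1 = y$1 & x$2 = y$2" by (simp add: vec_eq_iff forall_2)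

text \<open>With s measured along c and r across it, the four cases become one and the barycentric
  coordinates are 1 - 2 s, s + r and s - r.\<close>

lemma tri_simplex:
  assumes "c \<in> cdirs"
  shows "2 simplex (tri c)"
proof -
  define c1 c2 where "c1 = c$1" and "c2 = c$2"
  have cc: "c1 = 1 & c2 = 0 | c1 = -1 & c2 = 0 | c1 = 0 & c2 = 1 | c1 = 0 & c2 = -1"
    using assms by (auto simp: cdirs_def c1_def c2_def)
  define P R where "P = (vector [1/2 + (c1 - c2) / 2, 1/2 + (c2 + c1) / 2] :: real^2)"
    and "R = (vector [1/2 + (c1 + c2) / 2, 1/2 + (c2 - c1) / 2] :: real^2)"
  have tri: "tri c = convex hull {cent, P, R}"
  proof (rule set_eqI)
    fix q :: "real^2"
    define x y where "x = q$1 - 1/2" and "y = q$2 - 1/2"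
    have t: "q \<in> tri c \<longleftrightarrow> \<bar>x\<bar> <= c1 * x + c2 * y & \<bar>y\<bar> <= c1 * x + c2 * y & c1 * x + c2 * y <= 1/2"
      unfolding mem_tri mem_unit_square x_def y_def c1_def[symmetric] c2_def[symmetric]
      using cc by (elim disjE conjE; simp; linarith)
    have h: "q \<in> convex hull {cent, P, R} \<longleftrightarrow> (\<exists>u v w. 0 <= u & 0 <= v & 0 <= w & u + v + w = 1 &
        x = v * ((c1 - c2) / 2) + w * ((c1 + c2) / 2) & y = v * ((c2 + c1) / 2) + w * ((c2 - c1) / 2))"
    proof -
      have "q = u *\<^sub>R cent + v *\<^sub>R P + w *\<^sub>R R \<longleftrightarrow> x = v * ((c1 - c2) / 2) + w * ((c1 + c2) / 2) & y = v * ((c2 + c1) / 2) + w * ((c2 - c1) / 2)"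
        if "u + v + w = 1" for u v w
      proof -
        have u: "u = 1 - v - w" using that by simp
        show ?thesis unfolding vec2_eq_iff x_def y_def P_def R_def cent_def u by (simp add: algebra_simps)
      qed
      thus ?thesis unfolding convex_hull_3 by (simp only: mem_Collect_eq) blast
    qed
    show "q \<in> tri c \<longleftrightarrow> q \<in> convex hull {cent, P, R}"
    proof
      assume "q \<in> tri c"
      hence a: "\<bar>x\<bar> <= c1 * x + c2 * y" "\<bar>y\<bar> <= c1 * x + c2 * y" "c1 * x + c2 * y <= 1/2" using t by auto
      define s r where "s = c1 * x + c2 * y" and "r = c1 * y - c2 * x"
      have "0 <= 1 - 2 * s" using a(3) by (simp add: s_def)
      moreover have "0 <= s + r" "0 <= s - r" using cc a(1,2) unfolding s_def r_def by (elim disjE conjE; simp)+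
      moreover have "x = (s + r) * ((c1 - c2) / 2) + (s - r) * ((c1 + c2) / 2)" "y = (s + r) * ((c2 + c1) / 2) + (s - r) * ((c2 - c1) / 2)"
      proof -
        have 1: "c1 * c1 + c2 * c2 = 1" using cc by auto
        have "(s + r) * ((c1 - c2) / 2) + (s - r) * ((c1 + c2) / 2) = (c1 * c1 + c2 * c2) * x"
          "(s + r) * ((c2 + c1) / 2) + (s - r) * ((c2 - c1) / 2) = (c1 * c1 + c2 * c2) * y"
          unfolding s_def r_def by (simp_all add: field_simps)
        thus "x = (s + r) * ((c1 - c2) / 2) + (s - r) * ((c1 + c2) / 2)" "y = (s + r) * ((c2 + c1) / 2) + (s - r) * ((c2 - c1) / 2)"
          unfolding 1 by simp_all
      qed
      moreover have "1 - 2 * s + (s + r) + (s - r) = 1" by simp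
      ultimately show "q \<in> convex hull {cent, P, R}" unfolding h by blast
    next
      assume "q \<in> convex hull {cent, P, R}"
      then obtain u v w where "0 <= u" "0 <= v" "0 <= w" "u + v + w = 1"
        "x = v * ((c1 - c2) / 2) + w * ((c1 + c2) / 2)" "y = v * ((c2 + c1) / 2) + w * ((c2 - c1) / 2)" unfolding h by blast
      thus "q \<in> tri c" unfolding t using cc by (elim disjE conjE; simp; linarith)
    qed
  qed
  have d: "cent ~= P" "cent ~= R" "P ~= R" using cc unfolding vec2_eq_iff P_def R_def cent_def by auto
  have "\<not> collinear {P, cent, R}"
  proof
    assume "collinear {P, cent, R}"
    then obtain u where "cent = u *\<^sub>R P + (1 - u) *\<^sub>R R" using collinear_3_expand d(3) by metis
    thus False using cc unfolding vec2_eq_iff P_def R_def cent_def by (elim disjE conjE) (simp add: field_simps)+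
  qed
  hence "\<not> affine_dependent {cent, P, R}" using affine_dependent_imp_collinear_3 by (metis insert_commute)
  thus ?thesis unfolding simplex_def using tri d by (intro exI[of _ "{cent, P, R}"]) auto
qed

lemma tri_triangulation: "triangulation (tri ` cdirs)" "\<Union> (tri ` cdirs) = unit_square"
proof -
  show "triangulation (tri ` cdirs)"
    unfolding triangulation_def
  proof (intro conjI allI impI ballI)
    show "finite (tri ` cdirs)" by (simp add: cdirs_def)
    show "\<exists>n. n simplex T" if "T \<in> tri ` cdirs" for T using that tri_simplex by blast
    fix T T' assume "T \<in> tri ` cdirs & T' \<in> tri ` cdirs"
    then obtain c c' where c: "c \<in> cdirs" "c' \<in> cdirs" "T = tri c" "T' = tri c'" by blast
    have "T Int T' = T Int {q. (c' - c) \<bullet> q = (c' - c) \<bullet> cent}"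
    proof (intro set_eqI iffI)
      fix q assume "q \<in> T Int T'"
      hence "q \<in> T" "c' \<bullet> (q - cent) <= c \<bullet> (q - cent)" "c \<bullet> (q - cent) <= c' \<bullet> (q - cent)" using c unfolding tri_def by auto
      thus "q \<in> T Int {q. (c' - c) \<bullet> q = (c' - c) \<bullet> cent}" by (simp add: inner_diff_left inner_diff_right)
    next
      fix q assume q: "q \<in> T Int {q. (c' - c) \<bullet> q = (c' - c) \<bullet> cent}"
      hence "c' \<bullet> (q - cent) = c \<bullet> (q - cent)" by (simp add: inner_diff_left inner_diff_right)
      thus "q \<in> T Int T'" using q c unfolding tri_def by auto
    qed
    moreover have "convex T" using tri_simplex[OF c(1)] c(3) by (metis simplex_def convex_convex_hull)
    moreover have "(c' - c) \<bullet> q <= (c' - c) \<bullet> cent" if "q \<in> T" for q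
      using that c unfolding tri_def by (auto simp: inner_diff_left inner_diff_right)
    ultimately show "T Int T' face_of T" using face_of_Int_supporting_hyperplane_le by metis
  qed
  show "\<Union> (tri ` cdirs) = unit_square"
  proof
    show "\<Union> (tri ` cdirs) \<subseteq> unit_square" unfolding tri_def by auto
    show "unit_square \<subseteq> \<Union> (tri ` cdirs)"
    proof
      fix q :: "real^2" assume q: "q \<in> unit_square"
      obtain c where "c \<in> cdirs" "\<bar>q$1 - 1/2\<bar> <= c$1 * (q$1 - 1/2) + c$2 * (q$2 - 1/2)" "\<bar>q$2 - 1/2\<bar> <= c$1 * (q$1 - 1/2) + c$2 * (q$2 - 1/2)"
      proof (rule that[of "if \<bar>q$2 - 1/2\<bar> <= \<bar>q$1 - 1/2\<bar> then (if q$1 >= 1/2 then vector [1, 0] else vector [-1, 0])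
            else (if q$2 >= 1/2 then vector [0, 1] else vector [0, -1])"])
      qed (auto simp: cdirs_def)
      hence "q \<in> tri c" unfolding mem_tri using q by blast
      thus "q \<in> \<Union> (tri ` cdirs)" using \<open>c \<in> cdirs\<close> by blast
    qed
  qed
qed

lemma da_ge:
  assumes "y^2 <= x^2"
  shows "da x y = x * sqrt (1 + x^2 - y^2) / sqrt 2" "da y x = y / sqrt 2"
  using assms by (simp_all add: da_def max_absorb1 max_absorb2 add_diff_eq)

definition dmap :: "(real => real => real^3) => real^2 => real^3" where
  "dmap F q = F (da (2 * q$1 - 1) (2 * q$2 - 1)) (da (2 * q$2 - 1) (2 * q$1 - 1))"

lemma square_immersed:
  assumes "i ~= (k::2)"
  shows "immersed (%q::real^2. (2 * q$i - 1, 2 * q$k - 1)) q"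
proof -
  have "((%q::real^2. (2 * q$i - 1, 2 * q$k - 1)) has_derivative (%h. (2 * h$i, 2 * h$k))) (at q)"
    by (auto intro!: derivative_eq_intros bounded_linear_imp_has_derivative bounded_linear_vec_nth)
  moreover have "inj (%h::real^2. (2 * h$i, 2 * h$k))"
    using exhaust_2[of i] exhaust_2[of k] assms by (auto simp: inj_on_def vec2_eq_iff)
  ultimately show ?thesis unfolding immersed_def by blast
qed

lemma immersed_frechet: "immersed f x ==> inj (frechet_derivative f (at x))"
  unfolding immersed_def using frechet_derivative_at by metis

lemma disk_emb_swap:
  assumes F: "disk_emb F"
  shows "disk_emb (%a b. F b a)"
proof -
  have "((%p::real\<times>real. (snd p, fst p)) has_derivative (%h. (snd h, fst h))) (at x)" for x
    by (auto intro!: derivative_eq_intros)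
  moreover have "inj (%h::real\<times>real. (snd h, fst h))" by (auto simp: inj_on_def)
  ultimately have sw: "immersed (%p::real\<times>real. (snd p, fst p)) x" for x unfolding immersed_def by blast
  have "immersed (%p. F (snd p) (fst p)) (a, b)" if "a^2 + b^2 <= 1" for a b
  proof -
    have "immersed (%p. F (fst p) (snd p)) (b, a)" using F that unfolding disk_emb_def by (simp add: add.commute)
    thus ?thesis using immersed_compose[OF sw[of "(a, b)"], of "%p. F (fst p) (snd p)"] by simp
  qed
  moreover have "a = a' & b = b'" if "a^2 + b^2 <= 1" "a'^2 + b'^2 <= 1" "F b a = F b' a'" for a b a' b'
  proof -
    have "b^2 + a^2 <= 1" "b'^2 + a'^2 <= 1" using that by linarith+
    thus ?thesis using F that(3) unfolding disk_emb_def by blast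
  qed
  ultimately show ?thesis using F unfolding disk_emb_def by simp
qed

text \<open>Where coordinate i dominates, the maximum in \<open>da\<close> is resolved, and the
  resulting formula is smooth on the open set where the radicand is positive, a neighbourhood of the
  triangle.\<close>

lemma disk_piece:
  assumes F: "disk_emb F" and T: "T \<subseteq> unit_square" and ik: "i ~= (k::2)"
    and le: "!!q. q \<in> T ==> (2 * q$k - 1)^2 <= (2 * q$i - 1)^2"
  shows "\<exists>U g. open U & T \<subseteq> U & smooth_on U g &
    (\<forall>q\<in>T. g q = F (da (2 * q$i - 1) (2 * q$k - 1)) (da (2 * q$k - 1) (2 * q$i - 1)) & inj (frechet_derivative g (at q)))"
proof -
  define g where "g q = F ((2 * q$i - 1) * sqrt (1 + (2 * q$i - 1)^2 - (2 * q$k - 1)^2) / sqrt 2) ((2 * q$k - 1) / sqrt 2)" for q :: "real^2"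
  define U where "U = {q::real^2. 0 < 1 + (2 * q$i - 1)^2 - (2 * q$k - 1)^2}"
  have U: "open U" unfolding U_def by (intro open_Collect_less continuous_intros)
  have "smooth_on U (%q. sqrt (1 + (2 * q$i - 1)^2 - (2 * q$k - 1)^2))"
    by (intro smooth_on_sqrt smooth_intros U) (simp add: U_def)
  hence "smooth_on U (%q. (2 * q$i - 1) * sqrt (1 + (2 * q$i - 1)^2 - (2 * q$k - 1)^2) / sqrt 2)"
      "smooth_on U (%q. (2 * q$k - 1) / sqrt 2)"
    unfolding divide_inverse by (intro smooth_on_mult smooth_on_const smooth_on_diff smooth_on_vec_nth smooth_on_ident U; assumption)+
  hence "smooth_on U g" unfolding g_def using F U unfolding disk_emb_def by blast
  moreover have "T \<subseteq> U" using le unfolding U_def by force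
  moreover have "g q = F (da (2 * q$i - 1) (2 * q$k - 1)) (da (2 * q$k - 1) (2 * q$i - 1)) & inj (frechet_derivative g (at q))"
    if q: "q \<in> T" for q
  proof
    let ?x = "2 * q$i - 1" and ?y = "2 * q$k - 1"
    show "g q = F (da ?x ?y) (da ?y ?x)" unfolding g_def da_ge[OF le[OF q]] ..
    have "\<bar>2 * q$j - 1\<bar> <= 1" for j using T q exhaust_2[of j] unfolding mem_unit_square subset_iff by (auto simp: abs_le_iff)
    hence "(da ?x ?y)^2 + (da ?y ?x)^2 <= 1" using da_norm(1) by blast
    hence n: "(?x * sqrt (1 + ?x^2 - ?y^2) / sqrt 2)^2 + (?y / sqrt 2)^2 <= 1" unfolding da_ge[OF le[OF q]] .
    have "immersed (%q::real^2. ((2 * q$i - 1) * sqrt (1 + (2 * q$i - 1)^2 - (2 * q$k - 1)^2) / sqrt 2, (2 * q$k - 1) / sqrt 2)) q"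
      using immersed_compose[OF square_immersed[OF ik], OF da_immersed[of ?x ?y]] le[OF q] by simp
    from immersed_compose[OF this, of "%p. F (fst p) (snd p)"] n F have "immersed g q" unfolding disk_emb_def g_def by simp
    thus "inj (frechet_derivative g (at q))" by (rule immersed_frechet)
  qed
  ultimately show ?thesis using U by blast
qed

lemma disk_emb_unknotted:
  assumes F: "disk_emb F"
  shows "unknotted (rim F)"
  unfolding unknotted_def
proof (intro exI conjI)
  let ?Q = "unit_square :: (real^2) set"
  have x1: "\<bar>2 * q$1 - 1\<bar> <= 1 & \<bar>2 * q$2 - 1\<bar> <= 1" if "q \<in> ?Q" for q
    using that unfolding mem_unit_square forall_2 by auto
  show "spans (dmap F) (rim F)"
    unfolding spans_def rim_image
  proof
    show "dmap F ` frontier ?Q \<subseteq> {F a b |a b. a^2 + b^2 = 1}"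
    proof
      fix p assume "p \<in> dmap F ` frontier ?Q"
      then obtain q where q: "q \<in> frontier ?Q" "p = dmap F q" by blast
      have "q \<in> ?Q" using q frontier_square_subset by blast
      moreover have "\<bar>2 * q$1 - 1\<bar> = 1 | \<bar>2 * q$2 - 1\<bar> = 1" using q(1) unfolding mem_frontier_square exhaust_2 by force
      ultimately have "(da (2 * q$1 - 1) (2 * q$2 - 1))^2 + (da (2 * q$2 - 1) (2 * q$1 - 1))^2 = 1" using da_norm(2) x1 by blast
      thus "p \<in> {F a b |a b. a^2 + b^2 = 1}" unfolding q(2) dmap_def by blast
    qed
    show "{F a b |a b. a^2 + b^2 = 1} \<subseteq> dmap F ` frontier ?Q"
    proof clarify
      fix a b :: real assume ab: "a^2 + b^2 = 1"
      have key: "\<exists>x y. \<bar>x\<bar> = 1 & \<bar>y\<bar> <= 1 & a = da x y & b = da y x" if "a^2 + b^2 = 1" "b^2 <= a^2" for a b :: real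
      proof (intro exI conjI)
        have b2: "2 * b^2 <= 1" using that by linarith
        hence y2: "(b * sqrt 2)^2 <= 1" by (simp add: power_mult_distrib)
        thus "\<bar>b * sqrt 2\<bar> <= 1" by (simp add: abs_square_le_1)
        have "a ~= 0" using that by auto
        thus "\<bar>sgn a\<bar> = 1" by (simp add: sgn_if)
        have s2: "(sgn a)^2 = 1" using \<open>a ~= 0\<close> by (simp add: sgn_if)
        have "sqrt (1 + max 0 ((sgn a)^2 - (b * sqrt 2)^2)) = sqrt (2 * a^2)"
          using y2 that by (simp add: s2 power_mult_distrib max_def)
        also have "\<dots> = sqrt 2 * \<bar>a\<bar>" by (simp add: real_sqrt_mult)
        finally show "a = da (sgn a) (b * sqrt 2)" unfolding da_def by (simp add: sgn_mult_abs)
        show "b = da (b * sqrt 2) (sgn a)" unfolding da_def using y2 by (simp add: s2 max_def)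
      qed
      obtain x y where xy: "\<bar>x\<bar> <= 1" "\<bar>y\<bar> <= 1" "\<bar>x\<bar> = 1 | \<bar>y\<bar> = 1" "a = da x y" "b = da y x"
      proof (cases "b^2 <= a^2")
        case True thus ?thesis using key[OF ab True] that by (metis order_refl)
      next
        case False
        hence "\<exists>x y. \<bar>x\<bar> = 1 & \<bar>y\<bar> <= 1 & b = da x y & a = da y x" using key[of b a] ab by simp
        thus ?thesis using that by (metis order_refl)
      qed
      define q where "q = (vector [(x + 1) / 2, (y + 1) / 2] :: real^2)"
      have q12: "2 * q$1 - 1 = x" "2 * q$2 - 1 = y" by (simp_all add: q_def field_simps)
      have "q \<in> frontier ?Q" unfolding mem_frontier_square mem_unit_square using xy(1-3) q12 by linarith
      moreover have "dmap F q = F a b" unfolding dmap_def q12 xy ..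
      ultimately show "F a b \<in> dmap F ` frontier ?Q" by (metis imageI)
    qed
  qed
  show "ps_embedded_disk (dmap F)"
    unfolding ps_embedded_disk_def
  proof (intro conjI exI)
    have pieces: "\<exists>U g. open U & tri c \<subseteq> U & smooth_on U g & (\<forall>q\<in>tri c. g q = dmap F q & inj (frechet_derivative g (at q)))"
      if c: "c \<in> cdirs" for c
    proof (cases "c$2 = 0")
      case True
      hence c1: "\<bar>c$1\<bar> = 1" using c by (auto simp: cdirs_def)
      have le: "(2 * q$2 - 1)^2 <= (2 * q$1 - 1)^2" if "q \<in> tri c" for q
        using that c1 True unfolding mem_tri abs_le_square_iff[symmetric] by (auto simp: abs_if split: if_splits)
      show ?thesis unfolding dmap_def by (rule disk_piece[OF F _ _ le]) (auto simp: tri_def)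
    next
      case False
      hence c1: "\<bar>c$2\<bar> = 1" "c$1 = 0" using c by (auto simp: cdirs_def)
      have le: "(2 * q$1 - 1)^2 <= (2 * q$2 - 1)^2" if "q \<in> tri c" for q
        using that c1 unfolding mem_tri abs_le_square_iff[symmetric] by (auto simp: abs_if split: if_splits)
      show ?thesis unfolding dmap_def by (rule disk_piece[OF disk_emb_swap[OF F] _ _ le]) (auto simp: tri_def)
    qed
    thus "\<forall>T\<in>tri ` cdirs. \<exists>U g. open U & T \<subseteq> U & smooth_on U g & (\<forall>x\<in>T. g x = dmap F x & inj (frechet_derivative g (at x)))"
      by blast
    show "triangulation (tri ` cdirs)" "\<Union> (tri ` cdirs) = ?Q" by (rule tri_triangulation)+
    show "inj_on (dmap F) ?Q"
    proof (rule inj_onI)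
      fix q q' assume q: "q \<in> ?Q" "q' \<in> ?Q" "dmap F q = dmap F q'"
      hence "da (2 * q$1 - 1) (2 * q$2 - 1) = da (2 * q'$1 - 1) (2 * q'$2 - 1) & da (2 * q$2 - 1) (2 * q$1 - 1) = da (2 * q'$2 - 1) (2 * q'$1 - 1)"
        using F da_norm(1) x1 unfolding disk_emb_def dmap_def by meson
      hence "2 * q$1 - 1 = 2 * q'$1 - 1 & 2 * q$2 - 1 = 2 * q'$2 - 1" by (intro da_inj) blast+
      thus "q = q'" unfolding vec2_eq_iff by simp
    qed
    show "continuous_on ?Q (dmap F)"
    proof -
      have "continuous_on (tri c) (dmap F)" if c: "c \<in> cdirs" for c
      proof -
        obtain U g where g: "tri c \<subseteq> U" "smooth_on U g" "\<forall>q\<in>tri c. g q = dmap F q" using pieces[OF c] by blast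
        have "continuous_on (tri c) g" using smooth_on_continuous[OF g(2)] continuous_on_subset g(1) by blast
        thus ?thesis by (rule continuous_on_eq) (use g(3) in blast)
      qed
      moreover have "closed (tri c)" if "c \<in> cdirs" for c
        using tri_simplex[OF that] compact_simplex compact_imp_closed by blast
      moreover have "finite cdirs" by (simp add: cdirs_def)
      ultimately have "continuous_on (\<Union>c\<in>cdirs. tri c) (dmap F)" by (intro continuous_on_closed_Union) auto
      thus ?thesis using tri_triangulation(2) by simp
    qed
  qed
qed

section \<open>The twisted disk\<close>

definition cplx :: "real^3 => complex" where "cplx p = Complex (p$1) (p$2)"

definition twr :: "real => real => (real => real) => real^3 => real^3" where
  "twr c e h p = (let a = e * pi * h (p$3) * eta ((p$1 - c)^2 + (p$2)^2) in
     vector [c + cos a * (p$1 - c) - sin a * p$2, sin a * (p$1 - c) + cos a * p$2, p$3])"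

definition cen :: "nat => real" where "cen j = (if even j then - 2 else 0)"
definition sg :: "nat => real" where "sg j = (if even j then 1 else - 1)"
text \<open>The strength of twist j: 1 for |z| <= 2 (N - j), 0 from 2 (N - j) + 1 on. Coming from
  above, twists 0, 1, ... are switched on one after the other in disjoint height intervals; being
  even in z, they are switched off in reverse order below. So the word and its inverse appear from a
  single map of space.\<close>

definition plt :: "nat => nat => real => real" where
  "plt N j z = st (2 * (real N - real j) + 1 + z) * st (2 * (real N - real j) + 1 - z)"

primrec tws :: "nat => nat => real^3 => real^3" where
  "tws N 0 p = p"
| "tws N (Suc j) p = twr (cen j) (sg j) (plt N j) (tws N j p)"

primrec untws :: "nat => nat => real^3 => real^3" where
  "untws N 0 p = p"
| "untws N (Suc j) p = untws N j (twr (cen j) (- sg j) (plt N j) p)"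

lemma twr_3 [simp]: "twr c e h p $ 3 = p $ 3" by (simp add: twr_def Let_def)

lemma cplx_twr: "cplx (twr c e h p) = tw (of_real c) e (h (p$3)) (cplx p)"
proof -
  have "(cmod (cplx p - of_real c))^2 = (p$1 - c)^2 + (p$2)^2" by (simp add: cplx_def cmod_power2)
  thus ?thesis by (simp add: tw_def complex_eq_iff, simp add: cplx_def twr_def Let_def)
qed

lemma vec3_cplx: "p = q \<longleftrightarrow> cplx p = cplx q & p$3 = q$3"
  by (auto simp: cplx_def vec_eq_iff forall_3)

lemma twr_inverse: "twr c (- e) h (twr c e h p) = p"
  unfolding vec3_cplx cplx_twr twr_3 tw_inverse by simp

lemma tws_3 [simp]: "tws N j p $ 3 = p $ 3" by (induction j) auto
lemma untws_3 [simp]: "untws N j p $ 3 = p $ 3" by (induction j arbitrary: p) auto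

lemma untws_tws: "untws N j (tws N j p) = p" by (induction j) (auto simp: twr_inverse)

lemma tws_untws: "tws N j (untws N j p) = p"
proof (induction j arbitrary: p)
  case (Suc j)
  thus ?case using twr_inverse[of "cen j" "- sg j"] by simp
qed simp

lemma smooth_on_eta: "open S ==> smooth_on S f ==> smooth_on S (%q. eta (f q))"
  unfolding eta_def by (intro smooth_intros)

lemma smooth_on_plt: "open S ==> smooth_on S f ==> smooth_on S (%q. plt N j (f q))"
  unfolding plt_def by (intro smooth_intros; assumption)

lemma smooth_on_twr:
  assumes "open S" "smooth_on S f"
  shows "smooth_on S (%q. twr c e (plt N j) (f q))"
  unfolding twr_def Let_def by (intro smooth_intros smooth_on_eta smooth_on_plt assms)

lemma smooth_on_tws: "open S ==> smooth_on S f ==> smooth_on S (%q. tws N j (f q))"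
  by (induction j) (auto intro: smooth_on_twr)

lemma smooth_on_untws: "open S ==> smooth_on S f ==> smooth_on S (%q. untws N j (f q))"
  by (induction j arbitrary: f) (auto intro: smooth_on_twr)

lemma immersed_tws: "immersed (tws N j) p"
proof (rule immersed_left_inverse[where g = "untws N j"])
  show "tws N j differentiable at p" "untws N j differentiable at (tws N j p)"
    using smooth_on_differentiable[OF smooth_on_tws[OF open_UNIV smooth_on_ident]]
      smooth_on_differentiable[OF smooth_on_untws[OF open_UNIV smooth_on_ident]] by auto
qed (rule untws_tws)

lemma plt_1: "j < N ==> \<bar>z\<bar> <= 2 ==> plt N j z = 1"
  unfolding plt_def by (subst (1 2) st_1) (auto simp: abs_le_iff)

text \<open>For |z| <= 2 every plateau has the value 1, so the full word acts, independently of the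
  height.\<close>

lemma tws_pairtwist:
  assumes "\<bar>p$3\<bar> <= 2" "2 * k <= N"
  shows "cplx (tws N (2 * k) p) = (pairtwist ^^ k) (cplx p)"
  using assms(2)
proof (induction k)
  case (Suc k)
  have "cplx (tws N (2 * Suc k) p) = tw 0 (- 1) 1 (tw (- 2) 1 1 (cplx (tws N (2 * k) p)))"
    using Suc.prems assms(1) by (simp add: cplx_twr cen_def sg_def plt_1)
  thus ?case using Suc by (simp add: pairtwist_def)
qed simp

text \<open>Stretches the heights in [-1, 1], where the planar rim consists of vertical strands, to
  make room for the twists, and translates everything above and below.\<close>

definition sK :: "real => real => real" where "sK K z = z + K * X z"

lemma sK_expand: "K >= 0 ==> z <= z' ==> z' - z <= sK K z' - sK K z"
  unfolding sK_def using mult_left_mono[OF X_mono[of z z'], of K] by linarith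

lemma sK_inj: "K >= 0 ==> sK K z = sK K z' ==> z = z'"
  using sK_expand[of K z z'] sK_expand[of K z' z] by linarith

lemma continuous_sK: "continuous_on S (sK K)"
  unfolding sK_def by (intro continuous_intros continuous_on_subset[OF continuous_X]) auto

lemma sK_sgn: "K >= 0 ==> sK K z > 0 \<longleftrightarrow> z > 0" "K >= 0 ==> sK K z < 0 \<longleftrightarrow> z < 0"
proof -
  assume K: "K >= 0"
  have 0: "sK K 0 = 0" by (simp add: sK_def)
  have "z <= 0 ==> sK K z <= z" "z >= 0 ==> sK K z >= z" using sK_expand[OF K, of 0 z] sK_expand[OF K, of z 0] 0 by auto
  thus "sK K z > 0 \<longleftrightarrow> z > 0" "sK K z < 0 \<longleftrightarrow> z < 0" by (cases "z <= 0"; linarith)+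
qed

lemma sK_abs: assumes "K >= 0" shows "z <= max 0 (sK K z)" "min 0 (sK K z) <= z"
proof -
  have 0: "sK K 0 = 0" by (simp add: sK_def)
  have "z <= 0 ==> sK K z <= z" "z >= 0 ==> sK K z >= z" using sK_expand[OF assms, of 0 z] sK_expand[OF assms, of z 0] 0 by auto
  thus "z <= max 0 (sK K z)" "min 0 (sK K z) <= z" by (cases "z <= 0"; linarith)+
qed

text \<open>Stretching does not decrease distances, so the inverse is Lipschitz with constant
  1.\<close>

lemma sK_inverse:
  assumes "K >= 0"
  obtains g where "continuous_on UNIV g" "!!z. g (sK K z) = z" "!!y. sK K (g y) = y"
proof
  have "\<exists>z. sK K z = y" for y
  proof -
    have "\<exists>z. - \<bar>y\<bar> <= z & z <= \<bar>y\<bar> & sK K z = y"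
    proof (rule IVT')
      show "sK K (- \<bar>y\<bar>) <= y" "y <= sK K \<bar>y\<bar>" using sK_expand[OF assms, of 0 "\<bar>y\<bar>"] sK_expand[OF assms, of "- \<bar>y\<bar>" 0]
        by (auto simp: sK_def)
    qed (auto simp: continuous_sK)
    thus ?thesis by blast
  qed
  hence r: "sK K (inv (sK K) y) = y" for y by (metis surj_f_inv_f surjI)
  thus "sK K (inv (sK K) y) = y" for y .
  show "inv (sK K) (sK K z) = z" for z using sK_inj[OF assms r] .
  have "dist (inv (sK K) y) (inv (sK K) y') <= 1 * dist y y'" for y y'
    using sK_expand[OF assms, of "inv (sK K) y" "inv (sK K) y'"] sK_expand[OF assms, of "inv (sK K) y'" "inv (sK K) y"] r
    unfolding dist_real_def by (cases "inv (sK K) y <= inv (sK K) y'") simp_all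
  hence "1-lipschitz_on UNIV (inv (sK K))" by (intro lipschitz_onI) auto
  thus "continuous_on UNIV (inv (sK K))" by (rule lipschitz_on_continuous_on)
qed

definition FR :: "real => nat => real => real => real^3" where
  "FR K N a b = tws N N (vector [px a b, 0, sK K (pz a b)])"

lemma smooth_on_FR:
  assumes "open S" "smooth_on S a" "smooth_on S b"
  shows "smooth_on S (%q. FR K N (a q) (b q))"
  unfolding FR_def sK_def by (intro smooth_on_tws smooth_intros smooth_on_X smooth_on_px smooth_on_pz assms)

lemma vector3_axis: "(vector [x, y, z] :: real^3) = x *\<^sub>R axis 1 1 + y *\<^sub>R axis 2 1 + z *\<^sub>R axis 3 1"
  by (simp add: vec_eq_iff forall_3 axis_def)

lemma immersed_stretch:
  assumes "K >= 0"
  shows "immersed (%p. vector [fst p, 0, sK K (snd p)] :: real^3) (x, z)"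
proof -
  define d where "d = 1 + K * st' ((z + 1) / 2)"
  have "(sK K has_real_derivative d) (at z)"
    unfolding sK_def d_def by (auto intro!: derivative_eq_intros X_deriv)
  hence 1: "(sK K has_derivative (%h. d * h)) (at z)" by (simp add: has_field_derivative_def)
  have s: "(snd has_derivative snd) (at (x, z))" by (rule derivative_eq_intros refl | simp)+
  have "((%p. sK K (snd p)) has_derivative (%h. d * snd h)) (at (x, z))"
    using has_derivative_compose[OF s, of "sK K" "%h. d * h"] 1 by simp
  hence "((%p. vector [fst p, 0, sK K (snd p)] :: real^3) has_derivative (%h. vector [fst h, 0, d * snd h])) (at (x, z))"
    unfolding vector3_axis by (auto intro!: derivative_eq_intros)
  moreover have "d > 0" unfolding d_def using assms st'_nonneg by (simp add: add_pos_nonneg)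
  hence "inj (%h. vector [fst h, 0, d * snd h] :: real^3)"
    by (auto simp: inj_on_def vec_eq_iff forall_3)
  ultimately show ?thesis unfolding immersed_def by blast
qed

lemma FR_inj:
  assumes "K >= 0" "a^2 + b^2 <= 1" "a'^2 + b'^2 <= 1" "FR K N a b = FR K N a' b'"
  shows "a = a' & b = b'"
proof -
  have "vector [px a b, 0, sK K (pz a b)] = (vector [px a' b', 0, sK K (pz a' b')] :: real^3)"
    using arg_cong[OF assms(4), of "untws N N"] unfolding FR_def untws_tws .
  hence "px a b = px a' b'" "sK K (pz a b) = sK K (pz a' b')" by (auto simp: vec_eq_iff forall_3)
  thus ?thesis using sK_inj[OF assms(1)] planar_inj[OF assms(2,3)] by blast
qed

text \<open>Profiles that extend beyond the slab: \<open>t1\<close> of x works on the legs down to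
  the lower caps, and \<open>t2\<close> of the maximum of |x|, 2 z - 5 and |y| works over the upper
  caps. In the slab they are admissible and can be exchanged for the radial ones.\<close>

definition t1 :: "real => real" where "t1 x = max 0 (min (1/2) ((x + 1) / 4))"
definition t2 :: "real => real" where "t2 r = max 0 (min (1/2) ((3 - r) / 4))"

lemma t1_vals: "x <= - 1 ==> t1 x = 0" "x >= 1 ==> t1 x = 1/2"
  and t2_vals: "r <= 1 ==> t2 r = 1/2" "r >= 3 ==> t2 r = 0"
  unfolding t1_def t2_def by (auto simp: min_def max_def)

lemma continuous_on_t: "continuous_on S f ==> continuous_on S (%q. t1 (f q))" "continuous_on S f ==> continuous_on S (%q. t2 (f q))"
  unfolding t1_def t2_def by (intro continuous_intros; simp)+

lemma adm1_t1: "adm1 (%w. t1 (Re w))"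
  unfolding adm1_def
proof (intro conjI allI impI)
  show "continuous_on UNIV (%w. t1 (Re w))" by (intro continuous_on_t continuous_intros)
  show "t1 (Re w) = (if Re w < 0 then 0 else 1/2)" if "Im w = 0 & gx (Re w) <= 0" for w
    using that gx_le_0[of "Re w"] t1_vals[of "Re w"] by (auto simp: abs_if split: if_splits)
qed

lemma adm2_t2: "adm2 (%w. t2 (max \<bar>Re w\<bar> \<bar>Im w\<bar>))"
  unfolding adm2_def
proof (intro conjI allI impI)
  show "continuous_on UNIV (%w. t2 (max \<bar>Re w\<bar> \<bar>Im w\<bar>))" by (intro continuous_on_t continuous_intros)
  show "t2 (max \<bar>Re w\<bar> \<bar>Im w\<bar>) = (if \<bar>Re w\<bar> <= 1 then 1/2 else 0)" if "Im w = 0 & gx (Re w) >= 0" for w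
    using that gx_ge_0[of "Re w"] t2_vals[of "\<bar>Re w\<bar>"] by (auto simp: max_def)
qed

text \<open>The open square is contractible, so Phi has a continuous logarithm on it, and half of it
  gives a root. At the frontier the root tends to 0 because its modulus is the square root of that
  of Phi.\<close>

lemma continuous_square_root:
  fixes Phi :: "real^2 => complex"
  assumes c: "continuous_on unit_square Phi" and z: "!!q. q \<in> unit_square ==> Phi q = 0 \<longleftrightarrow> q \<in> frontier unit_square"
  obtains s where "continuous_on unit_square s" "!!q. q \<in> unit_square ==> (s q)^2 = Phi q"
proof -
  let ?Q = "unit_square :: (real^2) set"
  have fi: "q \<in> frontier ?Q \<longleftrightarrow> q \<notin> interior ?Q" if "q \<in> ?Q" for q
    using that by (simp only: frontier_def closure_closed[OF closed_cbox]) blast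
  have "contractible (interior ?Q)" by (intro convex_imp_contractible convex_interior convex_box)
  moreover have "continuous_on (interior ?Q) Phi" using c interior_subset continuous_on_subset by blast
  moreover have "Phi q ~= 0" if "q \<in> interior ?Q" for q using that z fi interior_subset by blast
  ultimately obtain l where l: "continuous_on (interior ?Q) l" "!!q. q \<in> interior ?Q ==> Phi q = exp (l q)"
    using continuous_logarithm_on_contractible by metis
  define s where "s q = (if q \<in> interior ?Q then exp (l q / 2) else 0)" for q
  have sq: "(s q)^2 = Phi q" if "q \<in> ?Q" for q
  proof (cases "q \<in> interior ?Q")
    case True
    thus ?thesis using l(2) by (simp only: s_def if_True exp_double[symmetric]) simp
  next
    case False
    thus ?thesis using z[OF that] fi[OF that] by (simp only: s_def if_False) simp
  qed
  have "continuous_on ?Q s"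
    unfolding continuous_on_eq_continuous_within
  proof
    fix q assume q: "q \<in> ?Q"
    show "continuous (at q within ?Q) s"
    proof (cases "q \<in> interior ?Q")
      case True
      have "continuous_on (interior ?Q) (%q. exp (l q / 2))" by (intro continuous_intros l) simp
      hence "continuous_on (interior ?Q) s" by (rule continuous_on_eq) (simp only: s_def if_True)
      hence "isCont s q" using True continuous_on_eq_continuous_at open_interior by blast
      thus ?thesis by (rule continuous_at_imp_continuous_at_within)
    next
      case False
      hence s0: "s q = 0" by (simp only: s_def if_False)
      have n: "cmod (s p) = sqrt (cmod (Phi p))" if "p \<in> ?Q" for p
        using sq[OF that] by (metis norm_power norm_ge_zero real_sqrt_unique)
      have P0: "Phi q = 0" using z[OF q] fi[OF q] False by blast
      have "((%p. sqrt (cmod (Phi p))) \<longlongrightarrow> sqrt (cmod (Phi q))) (at q within ?Q)"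
        using c q unfolding continuous_on_def by (intro tendsto_intros) blast
      hence "((%p. sqrt (cmod (Phi p))) \<longlongrightarrow> 0) (at q within ?Q)" unfolding P0 by simp
      moreover have "\<forall>\<^sub>F p in at q within ?Q. cmod (s p) = sqrt (cmod (Phi p))"
        unfolding eventually_at_filter by (rule always_eventually) (use n in blast)
      ultimately have "((%p. cmod (s p)) \<longlongrightarrow> 0) (at q within ?Q)" using tendsto_cong[of "%p. cmod (s p)" "%p. sqrt (cmod (Phi p))"] by blast
      thus ?thesis unfolding continuous_within s0 by (rule tendsto_norm_zero_cancel)
    qed
  qed
  thus thesis using that sq by blast
qed

lemma Xi_circle: "p \<in> Xi ` sphere 0 1 \<longleftrightarrow> p \<in> E0 & p \<notin> interior E0"
proof -
  have "Xi ` sphere 0 1 \<subseteq> E0" unfolding E0_def by auto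
  moreover have "p \<notin> interior E0" if "p \<in> Xi ` sphere 0 1" for p
  proof
    assume "p \<in> interior E0"
    hence "p \<in> Xi ` ball 0 1" unfolding interior_E0 .
    then obtain v w where vw: "v \<in> ball 0 1" "p = Xi v" "w \<in> sphere 0 1" "p = Xi w" using \<open>p \<in> Xi ` sphere 0 1\<close> by (elim imageE) blast
    hence "v = w" using inj_onD[OF inj_Xi, of v w] by auto
    thus False using vw by auto
  qed
  moreover have "p \<in> Xi ` sphere 0 1" if p: "p \<in> E0" "p \<notin> interior E0"
  proof -
    obtain v where v: "v \<in> cball 0 1" "p = Xi v" using p(1) unfolding E0_def by blast
    hence "v \<notin> ball 0 1" using p(2) unfolding interior_E0 by blast
    thus ?thesis using v by auto
  qed
  ultimately show ?thesis by blast
qed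

lemma square_real_sign:
  assumes "s^2 = Complex g y"
  shows "Re s = 0 ==> y = 0 & g <= 0" "Im s = 0 ==> y = 0 & g >= 0"
proof -
  have "g = (Re s)^2 - (Im s)^2" "y = 2 * Re s * Im s"
    using arg_cong[OF assms, of Re] arg_cong[OF assms, of Im] by (auto simp: power2_eq_square)
  thus "Re s = 0 ==> y = 0 & g <= 0" "Im s = 0 ==> y = 0 & g >= 0" by auto
qed

text \<open>The functions \<open>e1\<close> and \<open>e2\<close> are built in straightened
  coordinates x, y, z, in which the rim is planar, whereas bounded coefficients are available in the
  coordinates of f. In the slab the two are related by k pairs of twists, so the spatial
  \<open>wform\<close> is golden^(2k) times the straight one up to an exact term; dividing gives the
  small factor in front of the area.\<close>

theorem FR_area:
  fixes f :: "real^2 => real^3"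
  assumes M: "!!x. \<bar>st' x\<bar> <= M" and K: "K >= 0" and N: "N = 2 * k"
    and f: "ps_embedded_disk f" and sp: "spans f (rim (FR K N))"
  shows "1/2 <= 24 * M^2 * (1 / (golden^2) ^ k) * disk_area f"
proof -
  let ?Q = "unit_square :: (real^2) set" and ?fr = "frontier unit_square :: (real^2) set"
  let ?Q1 = "{q \<in> ?Q. f q $ 3 <= 1}" and ?Q2 = "{q \<in> ?Q. - 1 <= f q $ 3}"
  obtain us where us: "continuous_on UNIV us" "!!z. us (sK K z) = z" "!!y. sK K (us y) = y" using sK_inverse[OF K] by blast
  define x y z where "x q = untws N N (f q) $ 1" and "y q = untws N N (f q) $ 2" and "z q = us (f q $ 3)" for q
  have cf: "continuous_on ?Q f" and injf: "inj_on f ?Q" using f unfolding ps_embedded_disk_def by auto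
  have "continuous_on UNIV (untws N N)" by (intro smooth_on_continuous smooth_on_untws smooth_on_ident open_UNIV)
  hence cu: "continuous_on ?Q (%q. untws N N (f q))" by (rule continuous_on_compose2[OF _ cf]) simp
  have cx: "continuous_on ?Q x" and cy: "continuous_on ?Q y" and c3: "continuous_on ?Q (%q. f q $ 3)"
    unfolding x_def y_def by (intro continuous_intros cu cf)+
  have cz: "continuous_on ?Q z" unfolding z_def by (rule continuous_on_compose2[OF us(1) c3]) simp
  have szf: "sK K (z q) = f q $ 3" for q by (simp add: z_def us)
  have z_le: "z q <= 1" if "f q $ 3 <= 1" for q using sK_abs(1)[OF K, of "z q"] that unfolding szf by linarith
  have z_ge: "- 1 <= z q" if "- 1 <= f q $ 3" for q using sK_abs(2)[OF K, of "z q"] that unfolding szf by linarith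
  have unFR: "x q = px a b" "y q = 0" "z q = pz a b" if "f q = FR K N a b" for q a b
  proof -
    have "untws N N (f q) = vector [px a b, 0, sK K (pz a b)]" unfolding that FR_def untws_tws ..
    thus "x q = px a b" "y q = 0" unfolding x_def y_def by auto
    have "f q $ 3 = sK K (pz a b)" unfolding that FR_def by simp
    thus "z q = pz a b" unfolding z_def by (simp add: us)
  qed
  have toFR: "f q = FR K N a b" if "x q = px a b" "y q = 0" "z q = pz a b" for q a b
  proof -
    have "untws N N (f q) $ 3 = sK K (pz a b)" using that(3) szf[of q] by simp
    hence "untws N N (f q) = vector [px a b, 0, sK K (pz a b)]"
      using that(1,2) unfolding x_def y_def by (simp add: vec_eq_iff forall_3)
    thus ?thesis unfolding FR_def by (metis tws_untws)
  qed
  \<comment> \<open>Its zeros are the points with y = 0 and (x, z) on the rim of the planar disk,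
    that is, the frontier of the square.\<close>
  define Phi where "Phi q = Complex (Gs (x q, z q)) (y q)" for q
  have cG: "continuous_on ?Q (%q. Gs (x q, z q))"
    by (rule continuous_on_compose2[OF continuous_Gs continuous_on_Pair[OF cx cz]]) simp
  have cP: "continuous_on ?Q Phi" unfolding Phi_def Complex_eq by (intro continuous_intros cG cy)
  have fr: "q \<in> ?fr \<longleftrightarrow> (\<exists>a b. a^2 + b^2 = 1 & f q = FR K N a b)" if q: "q \<in> ?Q" for q
  proof -
    have im: "f ` ?fr = {FR K N a b | a b. a^2 + b^2 = 1}" using sp unfolding spans_def rim_image .
    have "q \<in> ?fr \<longleftrightarrow> f q \<in> f ` ?fr" using inj_on_image_mem_iff[OF injf q frontier_square_subset] by blast
    thus ?thesis unfolding im by blast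
  qed
  have Gs0: "Gs p = 0 \<longleftrightarrow> p \<in> Xi ` sphere 0 1" for p
    unfolding Xi_circle using Gs_sign[of p] interior_subset[of E0] by (metis less_irrefl)
  have P0: "Phi q = 0 \<longleftrightarrow> q \<in> ?fr" if q: "q \<in> ?Q" for q
  proof -
    have "Phi q = 0 \<longleftrightarrow> y q = 0 & (x q, z q) \<in> Xi ` sphere 0 1" unfolding Phi_def Gs0[symmetric] by (auto simp: complex_eq_iff)
    also have "\<dots> \<longleftrightarrow> (\<exists>a b. a^2 + b^2 = 1 & f q = FR K N a b)"
    proof
      assume "y q = 0 & (x q, z q) \<in> Xi ` sphere 0 1"
      then obtain a b where "norm (a, b) = 1" "(x q, z q) = Xi (a, b)" "y q = 0" by auto
      thus "\<exists>a b. a^2 + b^2 = 1 & f q = FR K N a b"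
        using toFR[of q a b] unfolding Xi_def norm_pair_eq by (intro exI[of _ a] exI[of _ b]) simp
    next
      assume "\<exists>a b. a^2 + b^2 = 1 & f q = FR K N a b"
      then obtain a b where ab: "a^2 + b^2 = 1" "f q = FR K N a b" by blast
      hence "(x q, z q) = Xi (a, b)" "y q = 0" "(a, b) \<in> sphere 0 1" using unFR[OF ab(2)] by (auto simp: Xi_def norm_pair_eq)
      thus "y q = 0 & (x q, z q) \<in> Xi ` sphere 0 1" by (metis imageI)
    qed
    finally show ?thesis unfolding fr[OF q] .
  qed
  obtain s where cs: "continuous_on ?Q s" and s2: "!!q. q \<in> ?Q ==> (s q)^2 = Phi q"
    using continuous_square_root[OF cP P0] by blast
  have Re0: "y q = 0 & (x q, z q) \<in> E0" if "q \<in> ?Q" "Re (s q) = 0" for q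
    using square_real_sign(1)[OF s2[OF that(1), unfolded Phi_def] that(2)] Gs_sign(2)[of "(x q, z q)"] by force
  have Im0: "y q = 0 & (x q, z q) \<notin> interior E0" if "q \<in> ?Q" "Im (s q) = 0" for q
    using square_real_sign(2)[OF s2[OF that(1), unfolded Phi_def] that(2)] Gs_sign(1)[of "(x q, z q)"] by force
  \<comment> \<open>Where Re s = 0 the point lies in the planar disk, and as long as z <= 1 this
    forces |x| >= 1; where Im s = 0 it lies off the interior, and for z >= -1 the maximum avoids (1,
    3). These are the conditions that make the two functions continuous below and above.\<close>
  define e1 e2 where "e1 q = ee (Re (s q)) (t1 (x q))"
    and "e2 q = ee (Im (s q)) (t2 (max (max \<bar>x q\<bar> (2 * z q - 5)) \<bar>y q\<bar>))" for q
  let ?S = "{q \<in> ?Q. \<bar>f q $ 3\<bar> <= 1}"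
  have sub1: "?Q1 \<subseteq> ?Q" and sub2: "?Q2 \<subseteq> ?Q" and sub: "?S \<subseteq> ?Q" by auto
  have u1: "ucirc ?Q1 e1"
    unfolding e1_def
  proof (rule ucirc_ee)
    show "continuous_on ?Q1 (%q. Re (s q))" "continuous_on ?Q1 (%q. t1 (x q))"
      using continuous_on_subset[OF cs sub1] continuous_on_subset[OF cx sub1] by (auto intro!: continuous_intros continuous_on_t)
    fix q assume q: "q \<in> ?Q1" "Re (s q) = 0"
    hence "(x q, z q) \<in> E0" using Re0 by blast
    then obtain v where v: "v \<in> cball 0 1" "(x q, z q) = Xi v" unfolding E0_def by blast
    obtain a b where "v = (a, b)" by (cases v)
    hence ab: "a^2 + b^2 <= 1" "x q = px a b" "z q = pz a b" using v by (auto simp: Xi_def norm_pair_le)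
    hence "1 <= \<bar>x q\<bar>" using planar_low_abs(1)[OF ab(1)] z_le[of q] q by simp
    thus "t1 (x q) = 0 | t1 (x q) = 1/2" using t1_vals[of "x q"] by linarith
  qed
  have u2: "ucirc ?Q2 e2"
    unfolding e2_def
  proof (rule ucirc_ee)
    show "continuous_on ?Q2 (%q. Im (s q))"
      "continuous_on ?Q2 (%q. t2 (max (max \<bar>x q\<bar> (2 * z q - 5)) \<bar>y q\<bar>))"
      using continuous_on_subset[OF cs sub2] continuous_on_subset[OF cx sub2] continuous_on_subset[OF cy sub2] continuous_on_subset[OF cz sub2]
      by (auto intro!: continuous_intros continuous_on_t)
    fix q assume q: "q \<in> ?Q2" "Im (s q) = 0"
    hence yq: "y q = 0" "(x q, z q) \<notin> interior E0" using Im0 by auto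
    hence "\<not> (1 < max \<bar>x q\<bar> (2 * z q - 5) & max \<bar>x q\<bar> (2 * z q - 5) < 3)" using cap_interior z_ge[of q] q by blast
    thus "t2 (max (max \<bar>x q\<bar> (2 * z q - 5)) \<bar>y q\<bar>) = 0 | t2 (max (max \<bar>x q\<bar> (2 * z q - 5)) \<bar>y q\<bar>) = 1/2"
      using t2_vals[of "max (max \<bar>x q\<bar> (2 * z q - 5)) \<bar>y q\<bar>"] yq(1) by linarith
  qed
  define w where "w q = Complex (x q) (y q)" for q
  have sw: "sheet ?S w s"
    unfolding sheet_def
  proof (intro conjI ballI)
    show "continuous_on ?S w" unfolding w_def Complex_eq
      using continuous_on_subset[OF cx sub] continuous_on_subset[OF cy sub] by (intro continuous_intros)
    show "continuous_on ?S s" using continuous_on_subset[OF cs sub] .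
    fix q assume q: "q \<in> ?S"
    hence "\<bar>z q\<bar> <= 1" using z_le[of q] z_ge[of q] by (simp add: abs_le_iff)
    thus "(s q)^2 = phi0 (w q)" using s2[of q] q Gs_slab by (simp add: Phi_def phi0_def w_def)
  qed
  have S0: "s q = 0" if "q \<in> ?S Int ?fr" for q
  proof -
    have "q \<in> ?Q" "q \<in> ?fr" using that by auto
    hence "(s q)^2 = 0" using s2 P0 by metis
    thus ?thesis by simp
  qed
  have cS: "compact ?S"
  proof -
    have "closed (?Q Int (%q. f q $ 3) -` {- 1..1})" by (rule continuous_closed_preimage[OF c3]) auto
    moreover have "?S = ?Q Int (?Q Int (%q. f q $ 3) -` {- 1..1})" by (auto simp: abs_le_iff)
    ultimately show ?thesis using compact_Int_closed[OF compact_cbox] by metis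
  qed
  obtain s' where s': "sheet ?S (%q. (pairtwist ^^ k) (w q)) s'"
    "coh ?S ?fr (wform (%q. (pairtwist ^^ k) (w q)) s') (%q q'. (golden^2) ^ k * wform w s q q')"
    using pairtwist_iterate[OF cS sw S0, where k = k] by blast
  \<comment> \<open>The full twist map carries straightened coordinates back to those of f; in the
    slab it is the iterated pair of half twists.\<close>
  have true: "(pairtwist ^^ k) (w q) = Complex (f q$1) (f q$2)" if "q \<in> ?S" for q
  proof -
    have "cplx (tws N (2 * k) (untws N N (f q))) = (pairtwist ^^ k) (cplx (untws N N (f q)))"
      using that N by (intro tws_pairtwist) auto
    thus ?thesis unfolding N[symmetric] tws_untws by (simp add: cplx_def w_def x_def y_def)
  qed
  let ?mu = "1 / (golden^2) ^ k"
  have mu: "?mu >= 0" by simp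
  have sh: "sheet ?S (%q. Complex (f q$1) (f q$2)) s'"
    unfolding sheet_def
  proof (intro conjI ballI)
    show "continuous_on ?S (%q. Complex (f q$1) (f q$2))" unfolding Complex_eq
      using continuous_on_subset[OF cf sub] by (intro continuous_intros)
    show "continuous_on ?S s'" using s'(1) by (simp add: sheet_def)
    show "(s' q)^2 = phi0 (Complex (f q$1) (f q$2))" if "q \<in> ?S" for q using s'(1) that true[OF that] by (simp add: sheet_def)
  qed
  have g0: "golden ^ (2 * k) ~= 0" using golden_gt_1 by simp
  have "coh ?S ?fr (%q q'. golden * inc e1 q q' + 1 * inc e2 q q')
      (%q q'. golden * inc (%q. ee (Re (s q)) (chi1r (w q))) q q' + 1 * inc (%q. ee (Im (s q)) (chi2r (w q))) q q')"
  proof (rule coh_linear)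
    have "coh ?S ?fr (inc (%q. ee (Re (s q)) (t1 (Re (w q))))) (inc (%q. ee (Re (s q)) (chi1r (w q))))"
      using coh_change1[OF cS sw adm1_t1 adm1_chi1r S0] .
    thus "coh ?S ?fr (inc e1) (inc (%q. ee (Re (s q)) (chi1r (w q))))"
      unfolding e1_def[abs_def] w_def by simp
    have "coh ?S ?fr (inc (%q. ee (Im (s q)) (t2 (max \<bar>Re (w q)\<bar> \<bar>Im (w q)\<bar>)))) (inc (%q. ee (Im (s q)) (chi2r (w q))))"
      using coh_change2[OF cS sw adm2_t2 adm2_chi2r S0] .
    thus "coh ?S ?fr (inc e2) (inc (%q. ee (Im (s q)) (chi2r (w q))))"
    proof (rule coh_cong)
      have e: "ee (Im (s q)) (t2 (max \<bar>Re (w q)\<bar> \<bar>Im (w q)\<bar>)) = e2 q" if "q \<in> ?S" for q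
      proof -
        have "z q <= 1" using z_le[of q] that by (simp add: abs_le_iff)
        hence "max \<bar>x q\<bar> (2 * z q - 5) = \<bar>x q\<bar>" by simp
        thus ?thesis unfolding e2_def w_def by simp
      qed
      show "inc (%q. ee (Im (s q)) (t2 (max \<bar>Re (w q)\<bar> \<bar>Im (w q)\<bar>))) q q' = inc e2 q q'" if "q \<in> ?S" "q' \<in> ?S" for q q'
        unfolding inc_def e[OF that(1)] e[OF that(2)] ..
    qed (rule refl)
  qed
  hence c1: "coh ?S ?fr (%q q'. golden * inc e1 q q' + inc e2 q q') (wform w s)"
    unfolding wform_def[abs_def] by simp
  have "coh ?S ?fr (%q q'. ?mu * ((golden^2) ^ k * wform w s q q') + 0 * (0::real))
      (%q q'. ?mu * wform (%q. (pairtwist ^^ k) (w q)) s' q q' + 0 * (0::real))"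
    by (rule coh_linear[OF coh_sym[OF s'(2)] coh_refl])
  hence c2: "coh ?S ?fr (wform w s) (%q q'. ?mu * wform (%q. Complex (f q$1) (f q$2)) s' q q')"
  proof (rule coh_cong)
    show "?mu * ((golden^2) ^ k * wform w s q q') + 0 * (0::real) = wform w s q q'" for q q' using g0 by (simp add: power_mult)
    show "?mu * wform (%q. (pairtwist ^^ k) (w q)) s' q q' + 0 * (0::real) = ?mu * wform (%q. Complex (f q$1) (f q$2)) s' q q'"
      if "q \<in> ?S" "q' \<in> ?S" for q q' unfolding wform_def inc_def true[OF that(1)] true[OF that(2)] by simp
  qed
  \<comment> \<open>The rim as an injective image of the unit circle in the complex plane; following
    f by its inverse gives the identification g, whose real and imaginary parts are the disc
    coordinates a and b.\<close>
  define fv where "fv v = FR K N (Re v) (Im v)" for v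
  have cfv: "continuous_on (sphere 0 1) fv"
    unfolding fv_def by (rule continuous_on_subset[OF smooth_on_continuous[OF smooth_on_FR[OF open_UNIV
        smooth_on_linear[OF bounded_linear_Re open_UNIV] smooth_on_linear[OF bounded_linear_Im open_UNIV]]]]) simp
  have sph: "v \<in> sphere 0 1 \<longleftrightarrow> (Re v)^2 + (Im v)^2 = 1" for v :: complex by (simp add: cmod_def)
  have ifv: "inj_on fv (sphere 0 1)"
  proof (rule inj_onI)
    fix v v' assume "v \<in> sphere 0 1" "v' \<in> sphere 0 1" "fv v = fv v'"
    thus "v = v'" using FR_inj[OF K, of "Re v" "Im v" "Re v'" "Im v'" N] unfolding sph fv_def complex_eq_iff by simp
  qed
  have imv: "fv ` sphere 0 1 = f ` ?fr"
  proof -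
    have "fv ` sphere 0 1 = {FR K N a b | a b. a^2 + b^2 = 1}"
    proof (intro set_eqI iffI)
      fix p assume "p \<in> fv ` sphere 0 1"
      then obtain v where "v \<in> sphere 0 1" "p = FR K N (Re v) (Im v)" unfolding fv_def by blast
      thus "p \<in> {FR K N a b | a b. a^2 + b^2 = 1}" unfolding sph by blast
    next
      fix p assume "p \<in> {FR K N a b | a b. a^2 + b^2 = 1}"
      then obtain a b where "a^2 + b^2 = 1" "p = FR K N a b" by blast
      thus "p \<in> fv ` sphere 0 1" unfolding fv_def by (intro image_eqI[of _ _ "Complex a b"]) (auto simp: cmod_def)
    qed
    thus ?thesis using sp unfolding spans_def rim_image by simp
  qed
  obtain h where h: "homeomorphism (sphere 0 1) (f ` ?fr) fv h"
    using homeomorphism_compact[OF compact_sphere cfv imv ifv] by blast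
  define g where "g q = h (f q)" for q
  have cg: "continuous_on ?fr g"
    unfolding g_def by (rule continuous_on_compose2[OF homeomorphism_cont2[OF h] continuous_on_subset[OF cf frontier_square_subset]]) simp
  have ig: "inj_on g ?fr"
  proof (rule inj_onI)
    fix q q' assume q: "q \<in> ?fr" "q' \<in> ?fr" "g q = g q'"
    hence "f q = f q'" using homeomorphism_apply2[OF h] unfolding g_def by (metis imageI)
    thus "q = q'" using q injf frontier_square_subset by (meson inj_onD subsetD)
  qed
  have gi: "g ` ?fr = sphere 0 1" using homeomorphism_image2[OF h] unfolding g_def by (simp add: image_image)
  have gf: "(Re (g q))^2 + (Im (g q))^2 = 1" "f q = FR K N (Re (g q)) (Im (g q))" if "q \<in> ?fr" for q
  proof -
    show "(Re (g q))^2 + (Im (g q))^2 = 1" using gi that sph by blast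
    have "fv (g q) = f q" unfolding g_def using homeomorphism_apply2[OF h] that by blast
    thus "f q = FR K N (Re (g q)) (Im (g q))" by (simp add: fv_def)
  qed
  show ?thesis
  proof (rule area_lower[OF M f sh u1 u2 coh_trans[OF c1 c2] mu cg ig gi])
    show "Re (g q) ~= 0 & e1 q = (if Re (g q) < 0 then 1 else - 1)" if q: "q \<in> ?fr" "f q $ 3 <= 1" for q
    proof -
      note G = gf[OF q(1)]
      have le: "(Re (g q))^2 + (Im (g q))^2 <= 1" "pz (Re (g q)) (Im (g q)) <= 2"
        using G(1) unFR(3)[OF G(2)] z_le[OF q(2)] by linarith+
      have n: "Re (g q) ~= 0" using planar_low(2)[OF le] .
      have xq: "x q = px (Re (g q)) (Im (g q))" using unFR(1)[OF G(2)] .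
      show ?thesis
      proof (cases "Re (g q) < 0")
        case True
        hence "x q <= - 1" using planar_low_abs(1,4)[OF le] xq by linarith
        thus ?thesis unfolding e1_def using True t1_vals by simp
      next
        case False
        hence "x q >= 1" using planar_low_abs(1,3)[OF le] xq n by linarith
        hence "t1 (x q) = 1/2" using t1_vals by blast
        thus ?thesis unfolding e1_def using False n by (simp only: ee_half if_False) simp
      qed
    qed
    show "Im (g q) ~= 0 & e2 q = (if Im (g q) > 0 then 1 else - 1)" if q: "q \<in> ?fr" "- 1 <= f q $ 3" for q
    proof -
      note G = gf[OF q(1)]
      define a b where "a = Re (g q)" and "b = Im (g q)"
      have zq: "z q = pz a b" "x q = px a b" "y q = 0" using unFR[OF G(2)] by (auto simp: a_def b_def)
      have ge: "a^2 + b^2 = 1" "pz a b >= - 2" using G(1) zq(1) z_ge[OF q(2)] by (auto simp: a_def b_def)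
      note pc = planar_circle[OF ge]
      have px: "px a b = (2 + sgn b) * X (16 * a)" and pz: "pz a b = 4 + sgn b - 16 * a * X (16 * a)"
        unfolding px_def pz_def pc(3) by simp_all
      show ?thesis
      proof (cases "b > 0")
        case True
        have "max (max \<bar>x q\<bar> (2 * z q - 5)) \<bar>y q\<bar> >= 3"
        proof (cases "\<bar>16 * a\<bar> < 1")
          case True
          hence "2 * z q - 5 >= 3" using uX_le[OF True] zq(1) pz \<open>b > 0\<close> by simp
          thus ?thesis by linarith
        next
          case False
          hence "\<bar>X (16 * a)\<bar> = 1" using X_abs[of "16 * a"] by (simp add: abs_sgn_eq)
          hence "\<bar>x q\<bar> = 3" using zq(2) px \<open>b > 0\<close> by (simp add: abs_mult)
          thus ?thesis by linarith
        qed
        thus ?thesis unfolding e2_def using True t2_vals by (simp add: b_def)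
      next
        case False
        hence sb: "sgn b = - 1" using pc(2) by simp
        \<comment> \<open>For negative b the point is on the inner strands or the inner upper cap,
          where |x| <= 1 and z <= 3.\<close>
        have "max (max \<bar>x q\<bar> (2 * z q - 5)) \<bar>y q\<bar> <= 1"
          using zq px pz sb X_range[of "16 * a"] uX_nonneg[of "16 * a"] by (simp add: abs_le_iff)
        hence "t2 (max (max \<bar>x q\<bar> (2 * z q - 5)) \<bar>y q\<bar>) = 1/2" using t2_vals by blast
        hence "e2 q = - 1" unfolding e2_def by (simp only: ee_half)
        thus ?thesis using False pc(2) by (simp add: b_def)
      qed
    qed
    show "\<bar>Re (g a)\<bar> < \<bar>Re (g b)\<bar>" if "a \<in> ?fr" "b \<in> ?fr" "f a $ 3 > 0" "f b $ 3 < 0" "Im (g a) * Im (g b) > 0" for a b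
    proof (rule planar_circle_order[OF gf(1)[OF that(1)] gf(1)[OF that(2)] _ _ that(5)])
      have "z a > 0" "z b < 0" using sK_sgn(1)[OF K, of "z a"] sK_sgn(2)[OF K, of "z b"] that(3,4) unfolding szf by blast+
      thus "pz (Re (g a)) (Im (g a)) > 0" "pz (Re (g b)) (Im (g b)) < 0"
        unfolding unFR(3)[OF gf(2)[OF that(1)]] unFR(3)[OF gf(2)[OF that(2)]] .
    qed
  qed
qed

lemma disk_emb_FR:
  assumes "K >= 0"
  shows "disk_emb (FR K N)"
  unfolding disk_emb_def
proof (intro conjI allI impI)
  show "smooth_on UNIV (%t::real. FR K N (a t) (b t))" if "smooth_on UNIV a" "smooth_on UNIV b" for a b
    using smooth_on_FR[OF open_UNIV that] .
  show "smooth_on U (%q::real^2. FR K N (a q) (b q))" if "open U" "smooth_on U a" "smooth_on U b" for U a b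
    using smooth_on_FR[OF that] .
  show "a = a'" "b = b'" if "a^2 + b^2 <= 1" "a'^2 + b'^2 <= 1" "FR K N a b = FR K N a' b'" for a b a' b'
    using FR_inj[OF assms that] by auto
  show "immersed (%p. FR K N (fst p) (snd p)) (a, b)" if "a^2 + b^2 <= 1" for a b
    using immersed_compose[OF immersed_compose[OF planar_immersed[OF that] immersed_stretch[OF assms]] immersed_tws]
    unfolding FR_def by simp
qed

section \<open>Thickness\<close>

text \<open>The radii over which \<open>thickness\<close> takes its supremum.\<close>

definition adm :: "(real => real^3) => real => bool" where
  "adm c r \<longleftrightarrow> r > 0 & disjoint_family_on (normal_disk c r) {0..<1}"

lemma admI:
  assumes "r > 0" "!!s t x. 0 <= s ==> s < t ==> t < 1 ==> norm (x - c s) <= r ==> norm (x - c t) <= r ==>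
    (x - c s) \<bullet> vector_derivative c (at s) = 0 ==> (x - c t) \<bullet> vector_derivative c (at t) = 0 ==> False"
  shows "adm c r"
  unfolding adm_def disjoint_family_on_def
proof (intro conjI ballI impI assms(1))
  have *: "normal_disk c r s Int normal_disk c r t = {}" if "0 <= s" "s < t" "t < 1" for s t
    using assms(2)[OF that] unfolding normal_disk_def by (auto simp: dist_norm norm_minus_commute)
  fix s t :: real assume "s \<in> {0..<1}" "t \<in> {0..<1}" "s ~= t"
  thus "normal_disk c r s Int normal_disk c r t = {}" using *[of s t] *[of t s] by (cases "s < t") auto
qed

lemma admD:
  assumes "adm c r" "s \<in> {0..<1}" "t \<in> {0..<1}" "s ~= t" "norm (x - c s) <= r" "norm (x - c t) <= r"
    "(x - c s) \<bullet> vector_derivative c (at s) = 0" "(x - c t) \<bullet> vector_derivative c (at t) = 0"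
  shows False
proof -
  have "normal_disk c r s Int normal_disk c r t = {}" using assms(1-4) unfolding adm_def disjoint_family_on_def by blast
  moreover have "x \<in> normal_disk c r s Int normal_disk c r t"
    using assms(5-8) unfolding normal_disk_def by (auto simp: dist_norm norm_minus_commute)
  ultimately show False by blast
qed

lemma adm_mono: "adm c r ==> 0 < r' ==> r' <= r ==> adm c r'"
proof (rule admI)
  fix s t x assume a: "adm c r" "r' <= r" and h: "0 <= s" "s < t" "t < 1" "norm (x - c s) <= r'" "norm (x - c t) <= r'"
    "(x - c s) \<bullet> vector_derivative c (at s) = 0" "(x - c t) \<bullet> vector_derivative c (at t) = 0"
  thus False by (intro admD[OF a(1), of s t x]) auto
qed

text \<open>Rolle's theorem for the height in the direction of one tangent provides a point with a
  perpendicular tangent; the two normal planes meet.\<close>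

lemma adm_bdd:
  assumes "smooth_closed_embedded_curve c"
  shows "bdd_above {r. adm c r}"
proof -
  have sm: "smooth_on UNIV c" and per: "!!t. c (t + 1) = c t" and nz: "!!t. vector_derivative c (at t) ~= 0"
    using assms unfolding smooth_closed_embedded_curve_def by auto
  define v where "v = vector_derivative c (at 0)"
  have d: "((%t. c t \<bullet> v) has_real_derivative vector_derivative c (at t) \<bullet> v) (at t)" for t
    using bounded_linear.has_vector_derivative[OF bounded_linear_inner_left smooth_on_has_vector_derivative[OF sm]]
    by (simp add: has_real_derivative_iff_has_vector_derivative)
  have "\<exists>t. 0 < t & t < 1 & ((%t. c t \<bullet> v) has_real_derivative 0) (at t)"
  proof -
    have "c 0 \<bullet> v = c 1 \<bullet> v" using per[of 0] by simp
    moreover have "continuous_on {0..1} (%t. c t \<bullet> v)"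
      by (intro continuous_at_imp_continuous_on ballI DERIV_isCont[OF d])
    moreover have "(%t. c t \<bullet> v) differentiable (at t)" for t using d real_differentiable_def by blast
    ultimately obtain t where "0 < t" "t < 1" "((%t. c t \<bullet> v) has_real_derivative 0) (at t)"
      using Rolle[of 0 1 "%t. c t \<bullet> v"] by auto
    thus ?thesis by blast
  qed
  then obtain t where t: "0 < t" "t < 1" "vector_derivative c (at t) \<bullet> v = 0" using DERIV_unique[OF d] by blast
  define w where "w = vector_derivative c (at t)"
  define x where "x = c 0 + (((c t - c 0) \<bullet> w) / (w \<bullet> w)) *\<^sub>R w"
  have ww: "w \<bullet> w ~= 0" using nz by (simp add: w_def)
  have 1: "(x - c 0) \<bullet> v = 0" unfolding x_def using t(3) by (simp add: w_def)
  have "(x - c t) \<bullet> w = (c 0 - c t) \<bullet> w + ((c t - c 0) \<bullet> w) / (w \<bullet> w) * (w \<bullet> w)"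
    unfolding x_def by (simp add: algebra_simps inner_add_left inner_diff_left)
  also have "\<dots> = 0" using ww by (simp add: inner_diff_left)
  finally have 2: "(x - c t) \<bullet> w = 0" .
  have "r <= max (norm (x - c 0)) (norm (x - c t))" if "adm c r" for r
  proof (rule ccontr)
    assume "\<not> r <= max (norm (x - c 0)) (norm (x - c t))"
    hence "norm (x - c 0) <= r" "norm (x - c t) <= r" by linarith+
    thus False using admD[OF that, of 0 t x] t(1,2) 1 2 by (simp add: v_def w_def)
  qed
  thus ?thesis unfolding bdd_above_def by blast
qed

lemma thickness_ge:
  assumes "smooth_closed_embedded_curve c" "adm c r"
  shows "r <= thickness c"
proof -
  have "thickness c = Sup {r. adm c r}" by (simp add: thickness_def adm_def)
  thus ?thesis using cSup_upper[OF _ adm_bdd[OF assms(1)], of r] assms(2) by simp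
qed

lemma vector_derivative_scale:
  fixes c :: "real => 'b::real_normed_vector"
  assumes "smooth_on UNIV c"
  shows "vector_derivative (%t. s *\<^sub>R c t) (at t) = s *\<^sub>R vector_derivative c (at t)"
  by (rule vector_derivative_at)
    (use bounded_linear.has_vector_derivative[OF bounded_linear_scaleR_right smooth_on_has_vector_derivative[OF assms]] in blast)

lemma adm_scale:
  assumes "smooth_on UNIV c" "adm c r" "s > 0"
  shows "adm (%t. s *\<^sub>R c t) (s * r)"
proof (rule admI)
  show "s * r > 0" using assms by (simp add: adm_def)
  fix a b x assume h: "0 <= a" "a < b" "b < 1" "norm (x - s *\<^sub>R c a) <= s * r" "norm (x - s *\<^sub>R c b) <= s * r"
    "(x - s *\<^sub>R c a) \<bullet> vector_derivative (%t. s *\<^sub>R c t) (at a) = 0" "(x - s *\<^sub>R c b) \<bullet> vector_derivative (%t. s *\<^sub>R c t) (at b) = 0"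
  have e: "x - s *\<^sub>R c t = s *\<^sub>R (x /\<^sub>R s - c t)" for t using assms(3) by (simp add: scaleR_diff_right)
  show False
    by (rule admD[OF assms(2), of a b "x /\<^sub>R s"])
      (use h assms(3) in \<open>simp_all add: e vector_derivative_scale[OF assms(1)]\<close>)
qed

lemma curve_length_scale:
  assumes "smooth_on UNIV c" "s > 0"
  shows "curve_length (%t. s *\<^sub>R c t) = s * curve_length c"
  unfolding curve_length_def vector_derivative_scale[OF assms(1)] using assms(2) by simp

text \<open>The function (x - c) . c' has derivative (x - c) . c'' - |c'|^2, which is negative as
  long as x stays close to the curve compared with its curvature; a decreasing function does not
  vanish twice.\<close>

lemma no_common_normal:
  fixes c c' c'' :: "real => real^3"
  assumes ab: "a < b" and d1: "!!t. t \<in> {a..b} ==> (c has_vector_derivative c' t) (at t)"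
    and d2: "!!t. t \<in> {a..b} ==> (c' has_vector_derivative c'' t) (at t)"
    and V: "!!t. t \<in> {a..b} ==> norm (c' t) <= V" and k: "!!t. t \<in> {a..b} ==> norm (c'' t) <= k"
    and m: "m > 0" "!!t. t \<in> {a..b} ==> m <= norm (c' t)" and small: "(r + V * (b - a)) * k < m^2"
    and x: "norm (x - c a) <= r" and n: "(x - c a) \<bullet> c' a = 0" "(x - c b) \<bullet> c' b = 0"
  shows False
proof -
  have V0: "V >= 0" using V[of a] ab norm_ge_zero[of "c' a"] by (meson atLeastAtMost_iff less_imp_le order_refl order_trans)
  have "(x - c b) \<bullet> c' b < (x - c a) \<bullet> c' a"
  proof (rule DERIV_neg_imp_decreasing[OF ab])
    fix t assume t: "a <= t" "t <= b"
    hence tt: "t \<in> {a..b}" by simp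
    have "((%t. x - c t) has_vector_derivative - c' t) (at t)"
      using has_vector_derivative_diff[OF has_vector_derivative_const d1[OF tt], of x] by simp
    hence D: "((%t. (x - c t) \<bullet> c' t) has_real_derivative (x - c t) \<bullet> c'' t + (- c' t) \<bullet> c' t) (at t)"
      unfolding has_real_derivative_iff_has_vector_derivative
      by (rule bounded_bilinear.has_vector_derivative[OF bounded_bilinear_inner _ d2[OF tt]])
    have "norm (c t - c a) <= V * norm (t - a)"
    proof (rule differentiable_bound[where f = c and S = "{a..b}" and f' = "%t h. h *\<^sub>R c' t"])
      show "(c has_derivative (%h. h *\<^sub>R c' u)) (at u within {a..b})" if "u \<in> {a..b}" for u
        using d1[OF that] has_derivative_at_withinI unfolding has_vector_derivative_def by blast
      show "onorm (%h. h *\<^sub>R c' u) <= V" if "u \<in> {a..b}" for u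
        by (rule onorm_le) (use mult_left_mono[OF V[OF that] abs_ge_zero] in \<open>simp add: mult.commute[of V]\<close>)
    qed (use t ab in auto)
    hence "norm (c t - c a) <= V * (b - a)" using t V0 mult_left_mono[of "t - a" "b - a" V] by simp
    moreover have "norm (x - c t) <= norm (x - c a) + norm (c t - c a)"
      using norm_triangle_ineq4[of "x - c a" "c t - c a"] by simp
    ultimately have "norm (x - c t) <= r + V * (b - a)" using x by linarith
    hence "norm (x - c t) * norm (c'' t) <= (r + V * (b - a)) * k" using k[OF tt] by (intro mult_mono) (auto intro: order_trans[OF norm_ge_zero])
    hence "(x - c t) \<bullet> c'' t < m^2" using small norm_cauchy_schwarz[of "x - c t" "c'' t"] by linarith
    moreover have "m^2 <= c' t \<bullet> c' t" using power_mono[OF m(2)[OF tt], of 2] m(1) by (simp add: power2_norm_eq_inner)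
    ultimately show "\<exists>y. ((%t. (x - c t) \<bullet> c' t) has_real_derivative y) (at t) & y < 0" using D by force
  qed
  thus False using n by simp
qed

lemma periodic_derivative:
  assumes "smooth_on UNIV c" "!!t. c (t + 1) = c t"
  shows "vector_derivative c (at (t + 1)) = vector_derivative c (at (t::real))"
proof -
  have "((%t. c (t + 1)) has_vector_derivative vector_derivative c (at (t + 1))) (at t)"
  proof -
    have "((%t. t + 1) has_vector_derivative 1) (at t)"
      by (auto simp: has_real_derivative_iff_has_vector_derivative[symmetric] intro!: derivative_eq_intros)
    thus ?thesis
      using vector_diff_chain_at[of "%t. t + 1" 1 t c] smooth_on_has_vector_derivative[OF assms(1), of "t + 1"] by (simp add: o_def)
  qed
  hence "(c has_vector_derivative vector_derivative c (at (t + 1))) (at t)" using assms(2) by simp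
  thus ?thesis by (rule vector_derivative_at[symmetric])
qed

text \<open>The tubular neighbourhood theorem by compactness: pairs of parameters close on the
  circle are handled by \<open>no_common_normal\<close>, all others form a compact set on which the
  distance of the points has a positive minimum.\<close>

lemma adm_exists:
  assumes "smooth_closed_embedded_curve c"
  obtains r where "adm c r"
proof -
  have sm: "smooth_on UNIV c" and per: "!!t. c (t + 1) = c t" and nz: "!!t. vector_derivative c (at t) ~= 0"
    and inj: "inj_on c {0..<1}" using assms unfolding smooth_closed_embedded_curve_def by auto
  define c' c'' where "c' t = vector_derivative c (at t)" and "c'' t = vector_derivative c' (at t)" for t
  have sm': "smooth_on UNIV c'" using smooth_on_vector_derivative[OF sm] unfolding c'_def[abs_def] .
  have sm'': "smooth_on UNIV c''" using smooth_on_vector_derivative[OF sm'] unfolding c''_def[abs_def] .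
  have d1: "(c has_vector_derivative c' t) (at t)" for t unfolding c'_def using smooth_on_has_vector_derivative[OF sm] .
  have d2: "(c' has_vector_derivative c'' t) (at t)" for t unfolding c''_def using smooth_on_has_vector_derivative[OF sm'] .
  have bd: "\<exists>B>0. \<forall>t\<in>{0..2}. norm (f t) <= B" if "smooth_on UNIV f" for f :: "real => real^3"
  proof -
    have "continuous_on {0..2} f" using continuous_on_subset[OF smooth_on_continuous[OF that]] by blast
    hence "bounded (f ` {0..2})" by (intro compact_imp_bounded compact_continuous_image compact_Icc)
    thus ?thesis unfolding bounded_pos by blast
  qed
  obtain V k where V: "V > 0" "\<forall>t\<in>{0..2}. norm (c' t) <= V" and k: "k > 0" "\<forall>t\<in>{0..2}. norm (c'' t) <= k"
    using bd[OF sm'] bd[OF sm''] by blast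
  have cm: "continuous_on {0..2} (%t. norm (c' t))"
    by (intro continuous_intros continuous_on_subset[OF smooth_on_continuous[OF sm']]) simp
  obtain m where m: "m > 0" "!!t. t \<in> {0..2} ==> m <= norm (c' t)"
    by (rule inf_positive_compact[OF compact_Icc cm]) (use nz in \<open>auto simp: c'_def\<close>)
  \<comment> \<open>\<open>dl\<close> and later \<open>r\<close> are chosen so that each uses at
    most one third of the available m^2.\<close>
  define dl where "dl = min (1/2) (m^2 / (3 * V * k))"
  have dl: "dl > 0" "dl <= 1/2" using V k m by (auto simp: dl_def)
  have dlk: "V * dl * k <= m^2 / 3"
  proof -
    have "V * dl * k <= V * (m^2 / (3 * V * k)) * k" using V k by (intro mult_right_mono mult_left_mono) (auto simp: dl_def)
    thus ?thesis using V k by simp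
  qed
  define F where "F = {p :: real \<times> real. fst p \<in> {0..1} & snd p \<in> {0..1} & dl <= snd p - fst p & snd p - fst p <= 1 - dl}"
  have "compact F"
  proof -
    have "F = ({0..1} \<times> {0..1}) Int ({p. dl <= snd p - fst p} Int {p. snd p - fst p <= 1 - dl})" by (auto simp: F_def)
    moreover have "closed ({p :: real \<times> real. dl <= snd p - fst p} Int {p. snd p - fst p <= 1 - dl})"
      by (intro closed_Int closed_Collect_le continuous_intros)
    moreover have "compact ({0..1::real} \<times> {0..1::real})" by (intro compact_Times compact_Icc)
    ultimately show ?thesis using compact_Int_closed by simp
  qed
  have ne: "c (fst p) ~= c (snd p)" if p: "p \<in> F" for p
  proof (cases "snd p = 1")
    case True
    hence "c (snd p) = c 0" using per[of 0] by simp
    moreover have "fst p \<in> {0..<1}" "fst p ~= 0" using p True dl by (auto simp: F_def)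
    ultimately show ?thesis using inj_onD[OF inj, of "fst p" 0] by auto
  next
    case False
    hence "fst p \<in> {0..<1}" "snd p \<in> {0..<1}" "fst p ~= snd p" using p dl by (auto simp: F_def)
    thus ?thesis using inj_onD[OF inj, of "fst p" "snd p"] by auto
  qed
  have cd: "continuous_on F (%p. norm (c (fst p) - c (snd p)))"
    by (intro continuous_intros continuous_on_compose2[OF smooth_on_continuous[OF sm]]) auto
  obtain d where d: "d > 0" "!!p. p \<in> F ==> d <= norm (c (fst p) - c (snd p))"
    by (rule inf_positive_compact[OF \<open>compact F\<close> cd]) (use ne in auto)
  define r where "r = min (d / 3) (m^2 / (3 * k))"
  have r: "r > 0" "r <= d / 3" using d m k by (auto simp: r_def)
  have rk: "r * k <= m^2 / 3"
  proof -
    have "r * k <= m^2 / (3 * k) * k" using k by (intro mult_right_mono) (auto simp: r_def)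
    thus ?thesis using k by simp
  qed
  have loc: False if "a < b" "0 <= a" "b <= 2" "b - a <= dl" "norm (x - c a) <= r" "(x - c a) \<bullet> c' a = 0" "(x - c b) \<bullet> c' b = 0" for a b x
  proof (rule no_common_normal[OF that(1) d1 d2 _ _ m(1) _ _ that(5,6,7)])
    show "norm (c' t) <= V" "norm (c'' t) <= k" "m <= norm (c' t)" if "t \<in> {a..b}" for t
      using that \<open>0 <= a\<close> \<open>b <= 2\<close> V(2) k(2) m(2) by auto
    have "V * (b - a) * k <= V * dl * k" using V k that by (intro mult_right_mono mult_left_mono) auto
    moreover have "m^2 > 0" using m(1) by simp
    ultimately show "(r + V * (b - a)) * k < m^2" unfolding distrib_right using rk dlk by linarith
  qed
  have "adm c r"
  proof (rule admI[OF r(1)])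
    fix s t x assume h: "0 <= s" "s < t" "t < 1" "norm (x - c s) <= r" "norm (x - c t) <= r"
      "(x - c s) \<bullet> vector_derivative c (at s) = 0" "(x - c t) \<bullet> vector_derivative c (at t) = 0"
    have "t - s <= dl | t - s >= 1 - dl | (s, t) \<in> F" unfolding F_def using h(1-3) by simp linarith
    then consider "t - s <= dl" | "t - s >= 1 - dl" | "(s, t) \<in> F" by blast
    thus False
    proof cases
      case 1 thus False using loc[of s t x] h by (simp add: c'_def)
    next
      case 2
      \<comment> \<open>Parameters near the two ends of [0, 1) are neighbours on the circle, so s is
        moved to s + 1; this is why the bounds were taken on [0, 2].\<close>
      thus False using loc[of t "s + 1" x] h per[of s] periodic_derivative[OF sm per, of s] by (simp add: c'_def)
    next
      case 3
      hence "d <= norm (c s - c t)" using d(2)[of "(s, t)"] by simp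
      moreover have "norm (c s - c t) <= norm (x - c t) + norm (x - c s)" using norm_triangle_ineq4[of "x - c t" "x - c s"] by simp
      ultimately show False using h(4,5) r d(1) by linarith
    qed
  qed
  thus thesis using that by blast
qed

section \<open>The four strands and their geometry, uniform in the number of twists\<close>

definition V4 :: "real set" where "V4 = {- 3, - 1, 1, 3}"
text \<open>The effect of a completed half twist about c on strand positions: c - 1 and c + 1 are
  exchanged.\<close>

definition pst :: "real => real => real" where "pst c u = (if \<bar>u - c\<bar> = 1 then 2 * c - u else u)"

primrec perm :: "nat => real => real" where
  "perm 0 v = v"
| "perm (Suc j) v = pst (cen j) (perm j v)"

lemma cen_cases: "cen j = - 2 | cen j = 0" and sg_cases: "sg j = 1 | sg j = - 1" by (auto simp: cen_def sg_def)

lemma pst_V4: "c = - 2 | c = 0 ==> u \<in> V4 ==> pst c u \<in> V4"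
  unfolding V4_def pst_def by (elim disjE insertE; simp)

lemma pst_inj: "c = - 2 | c = 0 ==> u \<in> V4 ==> u' \<in> V4 ==> pst c u = pst c u' ==> u = u'"
  unfolding V4_def pst_def by (elim disjE insertE; simp)

lemma V4_dist: "u \<in> V4 ==> u' \<in> V4 ==> u ~= u' ==> 2 <= \<bar>u - u'\<bar>"
  unfolding V4_def by (elim insertE; simp)

lemma V4_cen: "c = - 2 | c = 0 ==> u \<in> V4 ==> \<bar>u - c\<bar> = 1 | 3 <= \<bar>u - c\<bar> & \<bar>u - c\<bar> <= 5"
  unfolding V4_def by (elim disjE insertE; simp)

lemma V4_abs: "u \<in> V4 ==> \<bar>u\<bar> <= 3" unfolding V4_def by auto

lemma perm_V4: "v \<in> V4 ==> perm j v \<in> V4" by (induction j) (simp_all add: pst_V4[OF cen_cases])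

lemma perm_inj: "v \<in> V4 ==> v' \<in> V4 ==> v ~= v' ==> perm j v ~= perm j v'"
proof (induction j)
  case (Suc j)
  thus ?case using pst_inj[OF cen_cases[of j] perm_V4 perm_V4, of v v' j] by auto
qed simp

lemma eta_near: "\<bar>u - c\<bar> = 1 ==> eta ((u - c)^2) = 1"
  by (rule eta_in) (metis abs_square_eq_1 one_le_numeral)

lemma eta_far: "3 <= \<bar>u - c\<bar> ==> eta ((u - c)^2) = 0" for u c :: real
proof (rule eta_out)
  assume "3 <= \<bar>u - c\<bar>"
  hence "3^2 <= \<bar>u - c\<bar>^2" by (intro power_mono) auto
  thus "3 <= (u - c)^2" by simp
qed

lemma twr_flat: "twr c e h (vector [u, 0, z]) =
    vector [c + cos (e * pi * h z * eta ((u - c)^2)) * (u - c), sin (e * pi * h z * eta ((u - c)^2)) * (u - c), z]"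
  by (simp add: twr_def Let_def)

lemma twr_full:
  assumes "h z = 1" "u \<in> V4" "c = - 2 | c = 0" "e = 1 | e = - 1"
  shows "twr c e h (vector [u, 0, z]) = vector [pst c u, 0, z]"
proof (cases "\<bar>u - c\<bar> = 1")
  case True
  hence "eta ((u - c)^2) = 1" by (rule eta_near)
  thus ?thesis using assms(1,4) True by (auto simp: twr_flat pst_def)
next
  case False
  hence "eta ((u - c)^2) = 0" using eta_far V4_cen[OF assms(3,2)] by blast
  thus ?thesis using False by (simp add: twr_flat pst_def)
qed

lemma twr_none: "h (p$3) = 0 ==> twr c e h p = p"
  by (simp add: twr_def vec_eq_iff forall_3)

lemma plt_full: "\<bar>z\<bar> <= 2 * (real N - real j) ==> plt N j z = 1"
  unfolding plt_def by (subst (1 2) st_1) (auto simp: abs_le_iff)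

lemma plt_none: "2 * (real N - real j) + 1 <= \<bar>z\<bar> ==> plt N j z = 0"
  unfolding plt_def by (cases "z >= 0") (auto simp: st_0)

lemma tws_full:
  assumes "v \<in> V4"
  shows "\<bar>z\<bar> <= 2 * (real N - real j) + 2 ==> tws N j (vector [v, 0, z]) = vector [perm j v, 0, z]"
proof (induction j)
  case (Suc j)
  hence "plt N j z = 1" by (intro plt_full) auto
  thus ?case using Suc by (simp add: twr_full[OF _ perm_V4[OF assms] cen_cases sg_cases])
qed simp

lemma tws_tail: "\<bar>p$3\<bar> >= 2 * (real N - real j) + 1 ==> tws N (j + d) p = tws N j p"
proof (induction d)
  case (Suc d)
  hence "plt N (j + d) (p$3) = 0" by (intro plt_none) auto
  thus ?case using Suc by (simp add: twr_none)
qed simp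

definition strand :: "nat => real => real => real^3" where "strand N v z = tws N N (vector [v, 0, z])"

lemma strand_3 [simp]: "strand N v z $ 3 = z" by (simp add: strand_def)

text \<open>At these heights the twists before j are complete, those after j have not begun, and
  only twist j is in progress. So one twist at a time acts on the straight strands.\<close>

lemma strand_zone:
  assumes "v \<in> V4" "j < N" "2 * (real N - real j) - 1 <= \<bar>z\<bar>" "\<bar>z\<bar> <= 2 * (real N - real j) + 2"
  shows "strand N v z = twr (cen j) (sg j) (plt N j) (vector [perm j v, 0, z])"
proof -
  have "strand N v z = tws N (Suc j + (N - Suc j)) (vector [v, 0, z])" using assms(2) by (simp add: strand_def)
  also have "\<dots> = tws N (Suc j) (vector [v, 0, z])" using assms by (intro tws_tail) auto
  also have "\<dots> = twr (cen j) (sg j) (plt N j) (vector [perm j v, 0, z])" using tws_full[OF assms(1,4)] by simp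
  finally show ?thesis .
qed

lemma strand_inner: "v \<in> V4 ==> \<bar>z\<bar> <= 2 ==> strand N v z = vector [perm N v, 0, z]"
  unfolding strand_def by (intro tws_full) auto

lemma tws_outer: "2 * real N + 1 <= \<bar>p$3\<bar> ==> tws N N p = p"
  using tws_tail[of N 0 p N] by simp

lemma zone_cases:
  obtains "\<bar>z\<bar> < 2" | "2 * real N + 1 < \<bar>z\<bar>"
  | j where "j < N" "2 * (real N - real j) - 1 < \<bar>z\<bar>" "\<bar>z\<bar> < 2 * (real N - real j) + 2"
proof (cases "\<bar>z\<bar> < 2 | 2 * real N + 1 < \<bar>z\<bar>")
  case False
  define m where "m = nat \<lfloor>\<bar>z\<bar> / 2\<rfloor>"
  have "real_of_int \<lfloor>\<bar>z\<bar> / 2\<rfloor> <= \<bar>z\<bar> / 2" "\<bar>z\<bar> / 2 < real_of_int \<lfloor>\<bar>z\<bar> / 2\<rfloor> + 1" by linarith+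
  moreover have "real m = real_of_int \<lfloor>\<bar>z\<bar> / 2\<rfloor>" unfolding m_def by simp
  ultimately have m: "2 * real m <= \<bar>z\<bar>" "\<bar>z\<bar> < 2 * real m + 2" by linarith+
  hence "2 * real m <= 2 * real N + 1" "0 < 2 * real m" using False by linarith+
  hence mN: "m <= N" "0 < m" by linarith+
  hence "real (N - m) = real N - real m" by (simp add: of_nat_diff)
  thus ?thesis using that(3)[of "N - m"] m mN by simp
qed (use that in blast)

definition helix :: "nat => nat => real => real => real => real => real^3" where
  "helix N j c A rho z = vector [c + cos (A * plt N j z) * rho, sin (A * plt N j z) * rho, z]"

text \<open>The source of uniformity: every strand is locally a helix with angle at most pi and
  radius at most 5, the largest distance of a strand position from a twist centre, whatever N is.
  Straight parts have angle 0.\<close>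

lemma strand_local:
  assumes v: "v \<in> V4"
  obtains U c A rho j where "open U" "z \<in> U" "\<bar>A\<bar> <= pi" "\<bar>rho\<bar> <= 5" "!!z'. z' \<in> U ==> strand N v z' = helix N j c A rho z'"
proof (rule zone_cases[where z = z and N = N])
  assume z: "\<bar>z\<bar> < 2"
  show thesis
  proof (rule that[of "{z. \<bar>z\<bar> < 2}" 0 "perm N v" 0 0])
    show "open {z::real. \<bar>z\<bar> < 2}" by (intro open_Collect_less continuous_intros)
    show "strand N v z' = helix N 0 0 0 (perm N v) z'" if "z' \<in> {z. \<bar>z\<bar> < 2}" for z'
      using strand_inner[OF v, of z'] that by (simp add: helix_def)
  qed (use z V4_abs[OF perm_V4[OF v, of N]] in auto)
next
  assume z: "2 * real N + 1 < \<bar>z\<bar>"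
  show thesis
  proof (rule that[of "{z. 2 * real N + 1 < \<bar>z\<bar>}" 0 v 0 0])
    show "open {z. 2 * real N + 1 < \<bar>z\<bar>}" by (intro open_Collect_less continuous_intros)
    show "strand N v z' = helix N 0 0 0 v z'" if "z' \<in> {z. 2 * real N + 1 < \<bar>z\<bar>}" for z'
      using tws_outer[of N "vector [v, 0, z']"] that by (simp add: helix_def strand_def)
  qed (use z V4_abs[OF v] in auto)
next
  fix j assume j: "j < N" "2 * (real N - real j) - 1 < \<bar>z\<bar>" "\<bar>z\<bar> < 2 * (real N - real j) + 2"
  let ?U = "{z. 2 * (real N - real j) - 1 < \<bar>z\<bar>} Int {z. \<bar>z\<bar> < 2 * (real N - real j) + 2}"
  let ?rho = "perm j v - cen j"
  show thesis
  proof (rule that[of ?U "sg j * pi * eta (?rho^2)" ?rho j "cen j"])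
    show "open ?U" by (intro open_Int open_Collect_less continuous_intros)
    show "z \<in> ?U" using j by simp
    have r: "\<bar>?rho\<bar> = 1 | 3 <= \<bar>?rho\<bar> & \<bar>?rho\<bar> <= 5" using V4_cen[OF cen_cases perm_V4[OF v]] .
    thus "\<bar>?rho\<bar> <= 5" by linarith
    have "eta (?rho^2) = 1 | eta (?rho^2) = 0" using r eta_near eta_far by blast
    thus "\<bar>sg j * pi * eta (?rho^2)\<bar> <= pi" using sg_cases[of j] by auto
    show "strand N v z' = helix N j (cen j) (sg j * pi * eta (?rho^2)) ?rho z'" if "z' \<in> ?U" for z'
    proof -
      have "strand N v z' = twr (cen j) (sg j) (plt N j) (vector [perm j v, 0, z'])"
        using strand_zone[OF v j(1), of z'] that by simp
      moreover have "sg j * pi * plt N j z' * eta (?rho^2) = sg j * pi * eta (?rho^2) * plt N j z'" by simp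
      ultimately show ?thesis unfolding twr_flat helix_def by simp
    qed
  qed
qed

definition plt1 :: "nat => nat => real => real" where
  "plt1 N j z = (let b = 2 * (real N - real j) + 1 in st' (b + z) * st (b - z) - st (b + z) * st' (b - z))"
definition plt2 :: "nat => nat => real => real" where
  "plt2 N j z = (let b = 2 * (real N - real j) + 1 in
     st'' (b + z) * st (b - z) - 2 * st' (b + z) * st' (b - z) + st (b + z) * st'' (b - z))"

lemma plt_deriv: "(plt N j has_real_derivative plt1 N j z) (at z)"
  and plt1_deriv: "(plt1 N j has_real_derivative plt2 N j z) (at z)"
  unfolding plt_def[abs_def] plt1_def[abs_def] plt2_def Let_def
  by (auto intro!: derivative_eq_intros DERIV_chain2[OF st_deriv] DERIV_chain2[OF st'_deriv])

lemma plt_bounds: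
  assumes M: "M >= 1" "!!x. \<bar>st' x\<bar> <= M" "!!x. \<bar>st'' x\<bar> <= M"
  shows "\<bar>plt1 N j z\<bar> <= 4 * M^2" "\<bar>plt2 N j z\<bar> <= 4 * M^2"
proof -
  define b where "b = 2 * (real N - real j) + 1"
  have s: "\<bar>st x\<bar> <= 1" for x using st_range[of x] by simp
  have M2: "M <= M^2" using M(1) by (simp add: power2_eq_square mult_left_mono)
  have 1: "\<bar>st' x * st y\<bar> <= M" "\<bar>st x * st' y\<bar> <= M" "\<bar>st'' x * st y\<bar> <= M" "\<bar>st x * st'' y\<bar> <= M" for x y
    using mult_mono[OF M(2)[of x] s[of y]] mult_mono[OF s[of x] M(2)[of y]] mult_mono[OF M(3)[of x] s[of y]]
      mult_mono[OF s[of x] M(3)[of y]] M(1) by (auto simp: abs_mult)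
  have 2: "\<bar>2 * st' x * st' y\<bar> <= 2 * M^2" for x y
    using mult_mono[OF M(2)[of x] M(2)[of y]] M(1) by (auto simp: abs_mult power2_eq_square)
  have "\<bar>plt1 N j z\<bar> <= M + M" unfolding plt1_def Let_def b_def[symmetric]
    using 1(1)[of "b + z" "b - z"] 1(2)[of "b + z" "b - z"] by linarith
  thus "\<bar>plt1 N j z\<bar> <= 4 * M^2" using M2 M(1) by linarith
  have "\<bar>plt2 N j z\<bar> <= M + 2 * M^2 + M" unfolding plt2_def Let_def b_def[symmetric]
    using 1(3)[of "b + z" "b - z"] 1(4)[of "b + z" "b - z"] 2[of "b + z" "b - z"] by linarith
  thus "\<bar>plt2 N j z\<bar> <= 4 * M^2" using M2 by linarith
qed

lemma vector3_has_vector_derivative: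
  assumes "(f has_real_derivative f') (at t)" "(g has_real_derivative g') (at t)" "(h has_real_derivative h') (at t)"
  shows "((%t. vector [f t, g t, h t] :: real^3) has_vector_derivative vector [f', g', h']) (at t)"
  unfolding vector3_axis using assms
  by (auto intro!: derivative_eq_intros simp: has_real_derivative_iff_has_vector_derivative)

lemma norm_vector3_le: "norm (vector [x, y, z] :: real^3) <= \<bar>x\<bar> + \<bar>y\<bar> + \<bar>z\<bar>"
  using norm_le_l1_cart[of "vector [x, y, z] :: real^3"] by (simp add: sum_3)

text \<open>Bounds for the first two derivatives of such a helix. An angle of at most 4 times
  plateau derivatives of at most 4 M^2 gives 16 M^2; the radius 5 and two horizontal components give
  the factor 10; the vertical component has speed 1.\<close>

definition spd :: "real => real" where "spd M = 160 * M^2 + 1"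
definition crv :: "real => real" where "crv M = 10 * ((16 * M^2)^2 + 16 * M^2)"

lemma spd_ge_1: "1 <= spd M" and crv_ge_0: "0 <= crv M" by (auto simp: spd_def crv_def)

lemma helix_bounds:
  assumes M: "M >= 1" "!!x. \<bar>st' x\<bar> <= M" "!!x. \<bar>st'' x\<bar> <= M" and A: "\<bar>A\<bar> <= pi" and rho: "\<bar>rho\<bar> <= 5"
  obtains a' a'' where "!!z. (helix N j c A rho has_vector_derivative a' z) (at z)" "!!z. (a' has_vector_derivative a'' z) (at z)"
    "!!z. norm (a' z) <= spd M" "!!z. norm (a'' z) <= crv M" "!!z. a' z $ 3 = 1"
proof
  let ?p = "plt N j" and ?p1 = "plt1 N j" and ?p2 = "plt2 N j"
  let ?a1 = "%z. vector [- sin (A * ?p z) * (A * ?p1 z) * rho, cos (A * ?p z) * (A * ?p1 z) * rho, 1] :: real^3"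
  let ?a2 = "%z. vector [(- cos (A * ?p z) * (A * ?p1 z)^2 - sin (A * ?p z) * (A * ?p2 z)) * rho,
     (- sin (A * ?p z) * (A * ?p1 z)^2 + cos (A * ?p z) * (A * ?p2 z)) * rho, 0] :: real^3"
  show "(helix N j c A rho has_vector_derivative ?a1 z) (at z)" for z
    unfolding helix_def[abs_def] by (rule vector3_has_vector_derivative) (auto intro!: derivative_eq_intros plt_deriv)
  show "(?a1 has_vector_derivative ?a2 z) (at z)" for z
    by (rule vector3_has_vector_derivative)
      (auto intro!: derivative_eq_intros plt_deriv plt1_deriv simp: algebra_simps power2_eq_square)
  have b: "\<bar>A * ?p1 z\<bar> <= 16 * M^2" "\<bar>A * ?p2 z\<bar> <= 16 * M^2" for z
  proof -
    have "\<bar>A\<bar> <= 4" using A pi_less_4 by linarith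
    thus "\<bar>A * ?p1 z\<bar> <= 16 * M^2" "\<bar>A * ?p2 z\<bar> <= 16 * M^2"
      using mult_mono[OF \<open>\<bar>A\<bar> <= 4\<close> plt_bounds(1)[OF M, of N j z]] mult_mono[OF \<open>\<bar>A\<bar> <= 4\<close> plt_bounds(2)[OF M, of N j z]]
      by (auto simp: abs_mult)
  qed
  have sc: "\<bar>s * y * rho\<bar> <= Y * 5" if "\<bar>s\<bar> <= 1" "\<bar>y\<bar> <= Y" for s y Y
  proof -
    have "\<bar>s\<bar> * \<bar>y\<bar> <= 1 * Y" using that by (intro mult_mono) auto
    moreover have "0 <= Y" using that(2) by linarith
    ultimately have "(\<bar>s\<bar> * \<bar>y\<bar>) * \<bar>rho\<bar> <= (1 * Y) * 5" using rho by (rule_tac mult_mono) auto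
    thus ?thesis by (simp add: abs_mult)
  qed
  show "norm (?a1 z) <= spd M" for z
  proof -
    have "\<bar>- sin (A * ?p z) * (A * ?p1 z) * rho\<bar> <= 16 * M^2 * 5" "\<bar>cos (A * ?p z) * (A * ?p1 z) * rho\<bar> <= 16 * M^2 * 5"
      by (rule sc[OF _ b(1)], simp)+
    moreover have "norm (vector [P, R, 1] :: real^3) <= spd M" if "\<bar>P\<bar> <= 16 * M^2 * 5" "\<bar>R\<bar> <= 16 * M^2 * 5" for P R
      using norm_vector3_le[of P R 1] that by (simp add: spd_def)
    ultimately show ?thesis by blast
  qed
  show "norm (?a2 z) <= crv M" for z
  proof -
    let ?B = "(16 * M^2)^2" and ?C = "16 * M^2"
    have q: "\<bar>(A * ?p1 z)^2\<bar> <= ?B" using power_mono[OF b(1)[of z], of 2] by simp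
    have 1: "\<bar>- cos (A * ?p z) * (A * ?p1 z)^2 * rho\<bar> <= ?B * 5" "\<bar>- sin (A * ?p z) * (A * ?p1 z)^2 * rho\<bar> <= ?B * 5"
      by (rule sc[OF _ q], simp)+
    have 2: "\<bar>sin (A * ?p z) * (A * ?p2 z) * rho\<bar> <= ?C * 5" "\<bar>cos (A * ?p z) * (A * ?p2 z) * rho\<bar> <= ?C * 5"
      by (rule sc[OF _ b(2)], simp)+
    have "\<bar>(- cos (A * ?p z) * (A * ?p1 z)^2 - sin (A * ?p z) * (A * ?p2 z)) * rho\<bar> <= ?B * 5 + ?C * 5"
      "\<bar>(- sin (A * ?p z) * (A * ?p1 z)^2 + cos (A * ?p z) * (A * ?p2 z)) * rho\<bar> <= ?B * 5 + ?C * 5"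
      unfolding left_diff_distrib distrib_right using 1 2 by linarith+
    moreover have "norm (vector [P, R, 0] :: real^3) <= crv M" if "\<bar>P\<bar> <= ?B * 5 + ?C * 5" "\<bar>R\<bar> <= ?B * 5 + ?C * 5" for P R
      using norm_vector3_le[of P R 0] that by (simp add: crv_def)
    ultimately show ?thesis by blast
  qed
  show "?a1 z $ 3 = 1" for z by simp
qed

definition strand1 :: "nat => real => real => real^3" where "strand1 N v z = vector_derivative (strand N v) (at z)"
definition strand2 :: "nat => real => real => real^3" where "strand2 N v z = vector_derivative (strand1 N v) (at z)"

lemma smooth_strand: "smooth_on UNIV (strand N v)"
  unfolding strand_def[abs_def] by (intro smooth_on_tws smooth_intros open_UNIV)

lemma strand_deriv: "(strand N v has_vector_derivative strand1 N v z) (at z)"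
  and strand1_deriv: "(strand1 N v has_vector_derivative strand2 N v z) (at z)"
proof -
  show "(strand N v has_vector_derivative strand1 N v z) (at z)"
    unfolding strand1_def by (rule smooth_on_has_vector_derivative[OF smooth_strand])
  have "smooth_on UNIV (strand1 N v)" unfolding strand1_def[abs_def] by (rule smooth_on_vector_derivative[OF smooth_strand])
  thus "(strand1 N v has_vector_derivative strand2 N v z) (at z)"
    unfolding strand2_def by (rule smooth_on_has_vector_derivative)
qed

lemma strand_bounds:
  assumes M: "M >= 1" "!!x. \<bar>st' x\<bar> <= M" "!!x. \<bar>st'' x\<bar> <= M" and v: "v \<in> V4"
  shows "norm (strand1 N v z) <= spd M" "norm (strand2 N v z) <= crv M" "1 <= norm (strand1 N v z)"
proof -
  obtain U c A rho j where U: "open U" "z \<in> U" "\<bar>A\<bar> <= pi" "\<bar>rho\<bar> <= 5" "!!z'. z' \<in> U ==> strand N v z' = helix N j c A rho z'"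
    by (rule strand_local[OF v, where z = z and N = N]) (rule that; assumption)
  obtain a' a'' where a: "!!z. (helix N j c A rho has_vector_derivative a' z) (at z)" "!!z. (a' has_vector_derivative a'' z) (at z)"
    "!!z. norm (a' z) <= spd M" "!!z. norm (a'' z) <= crv M" "!!z. a' z $ 3 = 1"
    by (rule helix_bounds[OF M U(3,4), where N = N and j = j and c = c]) (rule that; assumption)
  have 1: "strand1 N v z' = a' z'" if "z' \<in> U" for z'
    unfolding strand1_def
    by (rule vector_derivative_at[OF has_vector_derivative_transform_within_open[OF a(1) U(1) that]]) (simp add: U(5))
  have 2: "strand2 N v z = a'' z"
    unfolding strand2_def
    by (rule vector_derivative_at[OF has_vector_derivative_transform_within_open[OF a(2) U(1,2)]]) (simp add: 1)
  show "norm (strand1 N v z) <= spd M" "norm (strand2 N v z) <= crv M"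
    using 1[OF U(2)] 2 a(3,4) by auto
  show "1 <= norm (strand1 N v z)" using 1[OF U(2)] a(5)[of z] component_le_norm_cart[of "a' z" 3] by simp
qed

lemma cmod_cplx_le: "cmod (cplx p) <= norm p"
proof -
  have "sqrt ((p$1)^2 + (p$2)^2) <= sqrt ((p$1)^2 + (p$2)^2 + (p$3)^2)" by (intro real_sqrt_le_mono) simp
  thus ?thesis by (simp add: cplx_def cmod_def norm_vec_def L2_set_def sum_3)
qed

lemma cplx_diff: "cplx (p - q) = cplx p - cplx q" by (simp add: cplx_def complex_eq_iff)

text \<open>Twisting preserves the distance to the centre. Two strands in the core of the twist turn
  rigidly together, two strands outside do not move, and a strand at distance 1 and one at distance
  at least 3 are kept apart by the triangle inequality.\<close>

lemma strand_sep:
  assumes v: "v \<in> V4" "v' \<in> V4" "v ~= v'"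
  shows "2 <= norm (strand N v z - strand N v' z)"
proof -
  have fl: "2 <= norm (vector [u, 0, z] - vector [u', 0, z] :: real^3)" if "u \<in> V4" "u' \<in> V4" "u ~= u'" for u u'
    using V4_dist[OF that] component_le_norm_cart[of "vector [u, 0, z] - vector [u', 0, z] :: real^3" 1] by simp
  show ?thesis
  proof (rule zone_cases[where z = z and N = N])
    assume "\<bar>z\<bar> < 2"
    thus ?thesis using fl[OF perm_V4[OF v(1)] perm_V4[OF v(2)] perm_inj[OF v]] by (simp add: strand_inner v)
  next
    assume "2 * real N + 1 < \<bar>z\<bar>"
    thus ?thesis using fl[OF v] by (simp add: strand_def tws_outer)
  next
    fix j assume j: "j < N" "2 * (real N - real j) - 1 < \<bar>z\<bar>" "\<bar>z\<bar> < 2 * (real N - real j) + 2"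
    define u u' c where "u = perm j v" and "u' = perm j v'" and "c = cen j"
    have u: "u \<in> V4" "u' \<in> V4" "u ~= u'" using perm_V4 perm_inj v by (auto simp: u_def u'_def)
    have c: "c = - 2 | c = 0" using cen_cases by (simp add: c_def)
    define T where "T u = tw (of_real c) (sg j) (plt N j z) (of_real u)" for u :: real
    have T: "cplx (strand N v z) = T u" "cplx (strand N v' z) = T u'"
      using strand_zone[OF v(1) j(1), of z] strand_zone[OF v(2) j(1), of z] j
      by (simp_all add: cplx_twr T_def u_def u'_def c_def) (simp_all add: cplx_def complex_of_real_def)
    have n: "cmod (T u - of_real c) = \<bar>u - c\<bar>" for u
      unfolding T_def tw_norm of_real_diff[symmetric] by (simp only: norm_of_real)
    have e: "T u = of_real c + cis (sg j * pi * plt N j z * eta ((u - c)^2)) * of_real (u - c)" for u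
      unfolding T_def tw_def of_real_diff[symmetric] norm_of_real power2_abs ..
    have "2 <= cmod (T u - T u')"
    proof -
      have tri: "2 <= cmod (T u1 - T u2)" if "\<bar>u1 - c\<bar> = 1" "3 <= \<bar>u2 - c\<bar>" for u1 u2
        using norm_triangle_ineq4[of "T u1 - of_real c" "T u1 - T u2"] n[of u1] n[of u2] that by simp
      consider "\<bar>u - c\<bar> = 1" "\<bar>u' - c\<bar> = 1" | "\<bar>u - c\<bar> = 1" "3 <= \<bar>u' - c\<bar>" | "3 <= \<bar>u - c\<bar>" "\<bar>u' - c\<bar> = 1" | "3 <= \<bar>u - c\<bar>" "3 <= \<bar>u' - c\<bar>"
        using V4_cen[OF c u(1)] V4_cen[OF c u(2)] by blast
      thus ?thesis
      proof cases
        case 1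
        have "T u - T u' = cis (sg j * pi * plt N j z) * of_real (u - u')"
          unfolding e using eta_near[OF 1(1)] eta_near[OF 1(2)] by (simp add: algebra_simps)
        hence "cmod (T u - T u') = \<bar>u - u'\<bar>" by (simp only: norm_mult norm_cis norm_of_real mult_1)
        thus ?thesis using V4_dist[OF u] by simp
      next
        case 2 thus ?thesis by (rule tri)
      next
        case 3 thus ?thesis using tri[of u' u] by (simp add: norm_minus_commute)
      next
        case 4
        have "T u - T u' = of_real (u - u')" unfolding e using eta_far[OF 4(1)] eta_far[OF 4(2)] by simp
        hence "cmod (T u - T u') = \<bar>u - u'\<bar>" by (simp only: norm_of_real)
        thus ?thesis using V4_dist[OF u] by simp
      qed
    qed
    thus ?thesis using cmod_cplx_le[of "strand N v z - strand N v' z"] unfolding cplx_diff T by linarith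
  qed
qed

lemma strand_lipschitz:
  assumes M: "M >= 1" "!!x. \<bar>st' x\<bar> <= M" "!!x. \<bar>st'' x\<bar> <= M" and v: "v \<in> V4"
  shows "norm (strand N v z - strand N v z') <= spd M * \<bar>z - z'\<bar>"
proof -
  have "norm (strand N v z - strand N v z') <= spd M * norm (z - z')"
  proof (rule differentiable_bound[where S = UNIV and f' = "%t h. h *\<^sub>R strand1 N v t"])
    show "(strand N v has_derivative (%h. h *\<^sub>R strand1 N v u)) (at u within UNIV)" for u
      using strand_deriv unfolding has_vector_derivative_def by simp
    show "onorm (%h. h *\<^sub>R strand1 N v u) <= spd M" for u
      by (rule onorm_le) (use mult_left_mono[OF strand_bounds(1)[OF M v, of N u] abs_ge_zero] in \<open>simp add: mult.commute\<close>)
  qed auto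
  thus ?thesis by simp
qed

text \<open>The third coordinate of a strand is its parameter, so a common point of two normal disks
  bounds the difference of heights by 2 r. Different strands are then too far apart, and on one
  strand \<open>no_common_normal\<close> applies.\<close>

lemma strand_pair:
  assumes M: "M >= 1" "!!x. \<bar>st' x\<bar> <= M" "!!x. \<bar>st'' x\<bar> <= M" and v: "v \<in> V4" "v' \<in> V4"
    and r: "(r + spd M * (2 * r)) * crv M < 1" "spd M * (2 * r) + 2 * r < 2" "r > 0"
    and x: "norm (x - strand N v z) <= r" "norm (x - strand N v' z') <= r"
    and n: "(x - strand N v z) \<bullet> strand1 N v z = 0" "(x - strand N v' z') \<bullet> strand1 N v' z' = 0"
  shows "v = v' & z = z'"
proof -
  have d: "norm (strand N v z - strand N v' z') <= 2 * r"
    using norm_triangle_ineq4[of "x - strand N v' z'" "x - strand N v z"] x by simp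
  have zz: "\<bar>z - z'\<bar> <= 2 * r" using component_le_norm_cart[of "strand N v z - strand N v' z'" 3] d by simp
  have eq: "v = v'"
  proof (rule ccontr)
    assume ne: "v ~= v'"
    have "norm (strand N v z - strand N v' z) <= norm (strand N v z - strand N v' z') + norm (strand N v' z - strand N v' z')"
      using norm_triangle_ineq4[of "strand N v z - strand N v' z'" "strand N v' z - strand N v' z'"] by simp
    moreover have "norm (strand N v' z - strand N v' z') <= spd M * (2 * r)"
      using strand_lipschitz[OF M v(2), of N z z'] mult_left_mono[OF zz, of "spd M"] spd_ge_1[of M] by linarith
    ultimately show False using strand_sep[OF v ne, of N z] d r(2) by linarith
  qed
  have no: False if "a < b" "b - a <= 2 * r" "norm (x - strand N v a) <= r" "(x - strand N v a) \<bullet> strand1 N v a = 0" "(x - strand N v b) \<bullet> strand1 N v b = 0" for a b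
  proof (rule no_common_normal[where c = "strand N v" and c' = "strand1 N v" and c'' = "strand2 N v" and m = 1 and r = r
        and V = "spd M" and k = "crv M", OF that(1) _ _ _ _ _ _ _ that(3,4,5)])
    show "(strand N v has_vector_derivative strand1 N v t) (at t)" "(strand1 N v has_vector_derivative strand2 N v t) (at t)" for t
      by (rule strand_deriv strand1_deriv)+
    show "norm (strand1 N v t) <= spd M" "norm (strand2 N v t) <= crv M" "1 <= norm (strand1 N v t)" for t
      by (rule strand_bounds[OF M v(1)])+
    have "(r + spd M * (b - a)) * crv M <= (r + spd M * (2 * r)) * crv M"
      using that(2) spd_ge_1[of M] crv_ge_0[of M] by (intro mult_right_mono add_left_mono mult_left_mono) auto
    thus "(r + spd M * (b - a)) * crv M < 1^2" using r(1) by simp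
  qed simp
  have "z = z'"
  proof (cases z z' rule: linorder_cases)
    case less thus ?thesis using no[of z z'] x n zz eq by simp
  next
    case greater thus ?thesis using no[of z' z] x n zz eq by simp
  qed
  thus ?thesis using eq by simp
qed

section \<open>The closed curves, their admissible radius and their length\<close>

definition pxt :: "real => real" where "pxt t = px (cos (2 * pi * t)) (sin (2 * pi * t))"
definition pzt :: "real => real" where "pzt t = pz (cos (2 * pi * t)) (sin (2 * pi * t))"
text \<open>Heights of modulus 1 are moved to 2 N + 3, beyond the outermost twist, which ends at 2 N
  + 1. From there on the curve is a translate of \<open>core\<close>.\<close>

definition stretch :: "nat => real" where "stretch N = 2 * real N + 2"
definition plat :: "nat => real => real^3" where "plat N = rim (FR (stretch N) N)"
definition core :: "real => real^3" where "core = rim (FR 0 0)"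

lemma plat_eq: "plat N t = tws N N (vector [pxt t, 0, sK (stretch N) (pzt t)])"
  by (simp add: plat_def rim_def FR_def pxt_def pzt_def)

lemma core_eq: "core t = vector [pxt t, 0, pzt t]"
  by (simp add: core_def rim_def FR_def pxt_def pzt_def sK_def)

lemma plat_3 [simp]: "plat N t $ 3 = sK (stretch N) (pzt t)" by (simp add: plat_eq)

lemma stretch_nonneg: "stretch N >= 0" by (simp add: stretch_def)

lemma plat_curve: "smooth_closed_embedded_curve (plat N)" and core_curve: "smooth_closed_embedded_curve core"
  unfolding plat_def core_def by (intro disk_emb_curve disk_emb_FR stretch_nonneg order_refl)+

lemma curve_smooth: "smooth_closed_embedded_curve c ==> smooth_on UNIV c"
  by (simp add: smooth_closed_embedded_curve_def)

lemma pzt_deriv: "(pzt has_real_derivative vector_derivative core (at t) $ 3) (at t)"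
proof -
  have "((%t. core t $ 3) has_vector_derivative vector_derivative core (at t) $ 3) (at t)"
    by (rule bounded_linear.has_vector_derivative[OF bounded_linear_vec_nth smooth_on_has_vector_derivative[OF curve_smooth[OF core_curve]]])
  thus ?thesis by (simp add: core_eq has_real_derivative_iff_has_vector_derivative)
qed

lemma continuous_pzt: "continuous_on UNIV pzt"
  by (intro continuous_at_imp_continuous_on ballI DERIV_isCont[OF pzt_deriv])

lemma sK_out: "1 <= \<bar>z\<bar> ==> sK K z = z + K * sgn z" by (simp add: sK_def X_abs)

lemma plat_cap:
  assumes "1 <= \<bar>pzt t\<bar>"
  shows "plat N t = core t + vector [0, 0, stretch N * sgn (pzt t)]"
proof -
  have s: "sK (stretch N) (pzt t) = pzt t + stretch N * sgn (pzt t)" using sK_out[OF assms] .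
  have "\<bar>pzt t + stretch N * sgn (pzt t)\<bar> = \<bar>pzt t\<bar> + stretch N"
    using assms stretch_nonneg[of N] by (cases "pzt t > 0") (auto simp: sgn_if)
  hence "2 * real N + 1 <= \<bar>pzt t + stretch N * sgn (pzt t)\<bar>" using assms by (simp add: stretch_def)
  thus ?thesis unfolding plat_eq core_eq s by (subst tws_outer) (simp_all add: vec_eq_iff forall_3)
qed

lemma plat_cap_deriv:
  assumes "1 < \<bar>pzt t\<bar>"
  shows "vector_derivative (plat N) (at t) = vector_derivative core (at t)"
proof -
  define s where "s = sgn (pzt t)"
  have s: "s = 1 | s = - 1" using assms by (auto simp: s_def sgn_if)
  define U where "U = {u. 1 < s * pzt u}"
  have U: "open U" unfolding U_def by (intro open_Collect_less continuous_intros continuous_pzt)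
  have tU: "t \<in> U" using assms by (simp add: U_def s_def sgn_mult_abs mult.commute[of "sgn _"] abs_sgn[symmetric])
  have "((%u. core u + vector [0, 0, stretch N * s]) has_vector_derivative vector_derivative core (at t) + 0) (at t)"
    by (intro has_vector_derivative_add has_vector_derivative_const smooth_on_has_vector_derivative[OF curve_smooth[OF core_curve]])
  hence "(plat N has_vector_derivative vector_derivative core (at t) + 0) (at t)"
  proof (rule has_vector_derivative_transform_within_open[OF _ U tU])
    fix u assume "u \<in> U"
    hence "1 <= \<bar>pzt u\<bar>" "sgn (pzt u) = s" using s by (auto simp: U_def)
    thus "core u + vector [0, 0, stretch N * s] = plat N u" using plat_cap[of u N] by simp
  qed
  thus ?thesis by (simp add: vector_derivative_at)
qed

text \<open>The signs of cosine and sine select the strand; they do not vanish at these heights, so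
  the selection is locally constant and derivatives can be compared.\<close>

lemma plat_strand:
  assumes z: "\<bar>pzt t\<bar> < 2"
  obtains v where "v \<in> V4" "plat N t = strand N v (sK (stretch N) (pzt t))"
    "vector_derivative (plat N) (at t) =
       ((1 + stretch N * st' ((pzt t + 1) / 2)) * vector_derivative core (at t) $ 3) *\<^sub>R strand1 N v (sK (stretch N) (pzt t))"
proof -
  let ?a = "%t. cos (2 * pi * t)" and ?b = "%t. sin (2 * pi * t)"
  define v where "v = sgn (?a t) * (2 + sgn (?b t))"
  have px: "pxt s = sgn (?a s) * (2 + sgn (?b s))" "?a s ~= 0" "?b s ~= 0" if "\<bar>pzt s\<bar> < 2" for s
  proof -
    have 1: "(?a s)^2 + (?b s)^2 = 1" by simp
    have 2: "pz (?a s) (?b s) <= 2" "pz (?a s) (?b s) >= - 2" using that unfolding pzt_def by linarith+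
    show "pxt s = sgn (?a s) * (2 + sgn (?b s))" "?a s ~= 0" "?b s ~= 0"
      using planar_low[OF eq_refl[OF 1] 2(1)] planar_circle[OF 1 2(2)] unfolding pxt_def by auto
  qed
  have v4: "v \<in> V4" using px(2,3)[OF z] unfolding v_def V4_def by (auto simp: sgn_if)
  define U where "U = {s. \<bar>pzt s\<bar> < 2} Int ({s. 0 < ?a s * ?a t} Int {s. 0 < ?b s * ?b t})"
  have U: "open U" unfolding U_def by (intro open_Int open_Collect_less continuous_intros continuous_pzt)
  have tU: "t \<in> U" using z px(2,3)[OF z] by (simp add: U_def zero_less_mult_iff) linarith
  have pU: "plat N s = strand N v (sK (stretch N) (pzt s))" if "s \<in> U" for s
  proof -
    have "sgn (?a s) = sgn (?a t)" "sgn (?b s) = sgn (?b t)" using that by (auto simp: U_def zero_less_mult_iff)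
    hence "pxt s = v" using px(1)[of s] that by (simp add: v_def U_def)
    thus ?thesis by (simp add: plat_eq strand_def)
  qed
  have sd: "(sK (stretch N) has_real_derivative 1 + stretch N * st' ((z + 1) / 2)) (at z)" for z
    unfolding sK_def[abs_def] by (auto intro!: derivative_eq_intros X_deriv)
  have "((%s. sK (stretch N) (pzt s)) has_real_derivative (1 + stretch N * st' ((pzt t + 1) / 2)) * vector_derivative core (at t) $ 3) (at t)"
    by (rule DERIV_chain2[OF sd pzt_deriv])
  hence "((strand N v \<circ> (%s. sK (stretch N) (pzt s))) has_vector_derivative
      ((1 + stretch N * st' ((pzt t + 1) / 2)) * vector_derivative core (at t) $ 3) *\<^sub>R strand1 N v (sK (stretch N) (pzt t))) (at t)"
    unfolding has_real_derivative_iff_has_vector_derivative by (rule vector_diff_chain_at) (rule strand_deriv)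
  hence "(plat N has_vector_derivative
      ((1 + stretch N * st' ((pzt t + 1) / 2)) * vector_derivative core (at t) $ 3) *\<^sub>R strand1 N v (sK (stretch N) (pzt t))) (at t)"
    by (rule has_vector_derivative_transform_within_open[OF _ U tU]) (simp add: pU)
  thus thesis using that[OF v4 pU[OF tU]] vector_derivative_at by blast
qed

text \<open>Strand pieces (|pzt| < 2) and cap pieces (|pzt| > 1) overlap, so two points at almost
  the same height can always be treated within the same kind of piece, and for caps at the same
  end.\<close>

lemma cap_pair:
  assumes t: "2 <= \<bar>pzt t\<bar>" and d: "\<bar>sK (stretch N) (pzt s) - sK (stretch N) (pzt t)\<bar> < 1"
  shows "1 < \<bar>pzt s\<bar>" "sgn (pzt s) = sgn (pzt t)"
proof -
  let ?K = "stretch N"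
  have K: "?K >= 2" by (simp add: stretch_def)
  have st: "sK ?K (pzt t) = pzt t + ?K * sgn (pzt t)" using sK_out[of "pzt t" ?K] t by simp
  have at: "\<bar>sK ?K (pzt t)\<bar> >= 2 + ?K" unfolding st using t K by (cases "pzt t > 0") (auto simp: sgn_if)
  show 1: "1 < \<bar>pzt s\<bar>"
  proof (rule ccontr)
    assume "\<not> 1 < \<bar>pzt s\<bar>"
    moreover have "\<bar>?K * X (pzt s)\<bar> <= ?K * 1" unfolding abs_mult using X_range[of "pzt s"] K by (intro mult_mono) auto
    ultimately have "\<bar>sK ?K (pzt s)\<bar> <= 1 + ?K" unfolding sK_def by linarith
    thus False using at d by linarith
  qed
  hence ss: "sK ?K (pzt s) = pzt s + ?K * sgn (pzt s)" using sK_out[of "pzt s" ?K] by simp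
  show "sgn (pzt s) = sgn (pzt t)" using d 1 t K unfolding st ss by (cases "pzt s > 0"; cases "pzt t > 0") (auto simp: sgn_if)
qed

text \<open>Two centres whose disks meet are less than 1 apart. Hence both lie on strands, where
  \<open>strand_pair\<close> is uniform in N, or both lie on one translate of \<open>core\<close>,
  where its own admissible radius is used.\<close>

lemma plat_adm:
  assumes M: "M >= 1" "!!x. \<bar>st' x\<bar> <= M" "!!x. \<bar>st'' x\<bar> <= M"
    and r: "(r + spd M * (2 * r)) * crv M < 1" "spd M * (2 * r) + 2 * r < 2"
      "r < 1/2" and core: "adm core r"
  shows "adm (plat N) r"
proof (rule admI)
  show r0: "r > 0" using core by (simp add: adm_def)
  fix s t x assume h: "0 <= s" "s < t" "t < 1" "norm (x - plat N s) <= r" "norm (x - plat N t) <= r"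
    "(x - plat N s) \<bullet> vector_derivative (plat N) (at s) = 0" "(x - plat N t) \<bullet> vector_derivative (plat N) (at t) = 0"
  have "norm (plat N s - plat N t) <= 2 * r" using norm_triangle_ineq4[of "x - plat N t" "x - plat N s"] h(4,5) by simp
  hence d: "\<bar>sK (stretch N) (pzt s) - sK (stretch N) (pzt t)\<bar> < 1"
    using component_le_norm_cart[of "plat N s - plat N t" 3] r(3) by simp
  have nz: "vector_derivative (plat N) (at u) ~= 0" for u using plat_curve unfolding smooth_closed_embedded_curve_def by blast
  have ne: "plat N s ~= plat N t"
    using plat_curve[of N] h(1-3) unfolding smooth_closed_embedded_curve_def inj_on_def by fastforce
  show False
  proof (cases "\<bar>pzt s\<bar> < 2 & \<bar>pzt t\<bar> < 2")
    case True
    obtain v where v: "v \<in> V4" "plat N s = strand N v (sK (stretch N) (pzt s))" "vector_derivative (plat N) (at s) =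
       ((1 + stretch N * st' ((pzt s + 1) / 2)) * vector_derivative core (at s) $ 3) *\<^sub>R strand1 N v (sK (stretch N) (pzt s))"
      using plat_strand[of s N] True by blast
    obtain v' where v': "v' \<in> V4" "plat N t = strand N v' (sK (stretch N) (pzt t))" "vector_derivative (plat N) (at t) =
       ((1 + stretch N * st' ((pzt t + 1) / 2)) * vector_derivative core (at t) $ 3) *\<^sub>R strand1 N v' (sK (stretch N) (pzt t))"
      using plat_strand[of t N] True by blast
    have n: "(x - strand N v (sK (stretch N) (pzt s))) \<bullet> strand1 N v (sK (stretch N) (pzt s)) = 0"
      using h(6) nz[of s] unfolding v(2,3) inner_scaleR_right by auto
    have n': "(x - strand N v' (sK (stretch N) (pzt t))) \<bullet> strand1 N v' (sK (stretch N) (pzt t)) = 0"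
      using h(7) nz[of t] unfolding v'(2,3) inner_scaleR_right by auto
    have "v = v' & sK (stretch N) (pzt s) = sK (stretch N) (pzt t)"
      using strand_pair[OF M v(1) v'(1) r(1,2) r0 h(4)[unfolded v(2)] h(5)[unfolded v'(2)] n n'] .
    thus False using ne v(2) v'(2) by simp
  next
    case False
    have c: "1 < \<bar>pzt s\<bar> & 1 < \<bar>pzt t\<bar> & sgn (pzt s) = sgn (pzt t)"
    proof (cases "2 <= \<bar>pzt t\<bar>")
      case True thus ?thesis using cap_pair[OF True d] by linarith
    next
      case F: False
      hence "2 <= \<bar>pzt s\<bar>" using False by linarith
      thus ?thesis using cap_pair[of s N t] d by (simp add: abs_minus_commute)
    qed
    let ?e = "vector [0, 0, stretch N * sgn (pzt t)] :: real^3"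
    have ps: "plat N s = core s + ?e" and pt: "plat N t = core t + ?e" using plat_cap[of s N] plat_cap[of t N] c by auto
    have ds: "vector_derivative (plat N) (at s) = vector_derivative core (at s)" "vector_derivative (plat N) (at t) = vector_derivative core (at t)"
      using plat_cap_deriv c by blast+
    have e: "x - (y + ?e) = (x - ?e) - y" for y by simp
    show False
      by (rule admD[OF core, of s t "x - ?e"]) (use h[unfolded ps pt ds e] in auto)
  qed
qed

lemma curve_length_pos:
  assumes "smooth_closed_embedded_curve c"
  shows "curve_length c > 0"
proof -
  have cont: "continuous_on {0..1} (%t. norm (vector_derivative c (at t)))"
    by (intro continuous_intros continuous_on_subset[OF smooth_on_continuous[OF smooth_on_vector_derivative[OF curve_smooth[OF assms]]]]) simp
  have "curve_length c >= 0" unfolding curve_length_def by (intro integral_nonneg integrable_continuous_interval cont) auto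
  moreover have "curve_length c ~= 0"
  proof
    assume "curve_length c = 0"
    hence "\<forall>t\<in>{0..1}. norm (vector_derivative c (at t)) = 0"
      using integral_eq_0_iff[OF cont] unfolding curve_length_def by auto
    thus False using assms unfolding smooth_closed_embedded_curve_def by auto
  qed
  ultimately show ?thesis by linarith
qed

text \<open>N enters the speed only through the stretching factor 1 + (2 N + 2) st', at most 3 M (1
  + N); the strands themselves have bounded speed.\<close>

lemma plat_length:
  assumes M: "M >= 1" "!!x. \<bar>st' x\<bar> <= M" "!!x. \<bar>st'' x\<bar> <= M" and V0: "!!t. t \<in> {0..1} ==> norm (vector_derivative core (at t)) <= V0"
  shows "curve_length (plat N) <= 3 * M * V0 * spd M * (1 + real N)"
proof -
  let ?B = "3 * M * V0 * spd M * (1 + real N)"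
  have V0': "V0 >= 0" by (rule order_trans[OF norm_ge_zero V0[of 0]]) simp
  have bound: "norm (vector_derivative (plat N) (at t)) <= ?B" if t: "t \<in> {0..1}" for t
  proof (cases "\<bar>pzt t\<bar> < 2")
    case True
    obtain v where v: "v \<in> V4" "vector_derivative (plat N) (at t) =
       ((1 + stretch N * st' ((pzt t + 1) / 2)) * vector_derivative core (at t) $ 3) *\<^sub>R strand1 N v (sK (stretch N) (pzt t))"
      using plat_strand[OF True, of N] by blast
    have "stretch N * st' ((pzt t + 1) / 2) <= stretch N * M"
      using M(2)[of "(pzt t + 1) / 2"] stretch_nonneg[of N] by (intro mult_left_mono) auto
    moreover have "0 <= stretch N * st' ((pzt t + 1) / 2)" using stretch_nonneg st'_nonneg by simp
    moreover have "1 <= M * (1 + real N)" using mult_mono[of 1 M 1 "1 + real N"] M(1) by simp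
    ultimately have 1: "\<bar>1 + stretch N * st' ((pzt t + 1) / 2)\<bar> <= 3 * M * (1 + real N)"
      unfolding stretch_def by (simp add: algebra_simps)
    have 2: "\<bar>vector_derivative core (at t) $ 3\<bar> <= V0" using V0[OF t] component_le_norm_cart order_trans by blast
    have "norm (vector_derivative (plat N) (at t)) <= (3 * M * (1 + real N)) * V0 * spd M"
      unfolding v(2) norm_scaleR abs_mult
      by (intro mult_mono 1 2 strand_bounds(1)[OF M v(1)]) (use M(1) V0' in auto)
    also have "\<dots> = ?B" by (simp add: algebra_simps)
    finally show ?thesis .
  next
    case False
    hence "norm (vector_derivative (plat N) (at t)) <= V0" using plat_cap_deriv[of t N] V0[OF t] by simp
    also have "V0 = 1 * V0 * 1 * 1" by simp
    also have "\<dots> <= (3 * M) * V0 * spd M * (1 + real N)"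
      using M(1) V0' spd_ge_1[of M] by (intro mult_mono mult_nonneg_nonneg) auto
    finally show ?thesis by simp
  qed
  have cont: "continuous_on {0..1} (%t. norm (vector_derivative (plat N) (at t)))"
    by (intro continuous_intros continuous_on_subset[OF smooth_on_continuous[OF smooth_on_vector_derivative[OF curve_smooth[OF plat_curve]]]]) simp
  have "curve_length (plat N) <= integral {0..1::real} (%t. ?B)"
    unfolding curve_length_def by (intro integral_le integrable_continuous_interval cont continuous_on_const bound)
  thus ?thesis by simp
qed

theorem plat_family:
  obtains r C where "r > 0" "C > 0" "!!N. adm (plat N) r" "!!N. curve_length (plat N) <= C * (1 + real N)"
proof -
  obtain M where M: "M >= 1" "!!x. \<bar>st' x\<bar> <= M" "!!x. \<bar>st'' x\<bar> <= M" by (rule st_bounds) (rule that; assumption)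
  obtain r1 where r1: "adm core r1" by (rule adm_exists[OF core_curve])
  define V k where "V = spd M" and "k = crv M"
  have V: "V >= 1" "k >= 0" by (auto simp: V_def k_def spd_ge_1 crv_ge_0)
  \<comment> \<open>Chosen so that e (1 + 2 V) (1 + k) = 1/2, which covers both the curvature
    condition and the separation condition for strands.\<close>
  define e where "e = 1 / (2 * (1 + 2 * V) * (1 + k))"
  define r where "r = min r1 e"
  have e0: "e > 0" using V by (simp add: e_def)
  have r0: "r > 0" "r <= r1" "r <= e" using e0 r1 by (auto simp: r_def adm_def)
  have "1 / (2 * a * b) * a * b = 1/2" if "a ~= 0" "b ~= 0" for a b :: real using that by simp
  hence e1: "e * (1 + 2 * V) * (1 + k) = 1/2" unfolding e_def using V by auto
  have e2: "e * (1 + 2 * V) <= 1/2"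
    using mult_left_mono[of 1 "1 + k" "e * (1 + 2 * V)"] V e0 e1 by simp
  have rV: "r * (1 + 2 * V) <= e * (1 + 2 * V)" using r0 V by (intro mult_right_mono) auto
  have "r * (1 + 2 * V) * k <= e * (1 + 2 * V) * (1 + k)" using rV V e0 by (intro mult_mono) auto
  hence k1: "(r + V * (2 * r)) * k < 1" using e1 by (simp add: algebra_simps)
  have rr: "r <= r * V" using mult_left_mono[OF V(1), of r] r0 by simp
  have "r * (1 + 2 * V) = r + 2 * (r * V)" "V * (2 * r) = 2 * (r * V)" by (simp_all add: algebra_simps)
  hence k2: "V * (2 * r) + 2 * r < 2" and k3: "r < 1/2" using rV e2 rr r0(1) by linarith+
  have cb: "continuous_on {0..1} (%t. vector_derivative core (at t))"
    by (rule continuous_on_subset[OF smooth_on_continuous[OF smooth_on_vector_derivative[OF curve_smooth[OF core_curve]]]]) simp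
  hence "bounded ((%t. vector_derivative core (at t)) ` {0..1})" by (intro compact_imp_bounded compact_continuous_image compact_Icc)
  then obtain V0 where V0: "V0 > 0" "!!t. t \<in> {0..1} ==> norm (vector_derivative core (at t)) <= V0" unfolding bounded_pos by blast
  show thesis
  proof (rule that[OF r0(1)])
    show "3 * M * V0 * spd M > 0" using M(1) V0(1) spd_ge_1[of M] by simp
    show "adm (plat N) r" for N
      using plat_adm[OF M k1[unfolded V_def k_def] k2[unfolded V_def] k3 adm_mono[OF r1 r0(1,2)]] .
    show "curve_length (plat N) <= 3 * M * V0 * spd M * (1 + real N)" for N
      using plat_length[OF M V0(2)] .
  qed
qed

section \<open>Round circles and rescaling\<close>

text \<open>Its rim is the round unit circle. Rescaled to length 1, round circles fill the finitely
  many places n > 2 pi at which n is too small for the twisted curves.\<close>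

definition flatF :: "real => real => real^3" where "flatF a b = vector [a, b, 0]"

lemma disk_emb_flat: "disk_emb flatF"
  unfolding disk_emb_def
proof (intro conjI allI impI)
  show "smooth_on UNIV (%t::real. flatF (a t) (b t))" if "smooth_on UNIV a" "smooth_on UNIV b" for a b
    unfolding flatF_def by (intro smooth_intros that open_UNIV)
  show "smooth_on U (%q::real^2. flatF (a q) (b q))" if "open U" "smooth_on U a" "smooth_on U b" for U a b
    unfolding flatF_def by (intro smooth_intros that)
  show "a = a'" "b = b'" if "flatF a b = flatF a' b'" for a b a' b'
    using that by (auto simp: flatF_def vec_eq_iff forall_3)
  have "((%p. flatF (fst p) (snd p)) has_derivative (%h. flatF (fst h) (snd h))) (at (a, b))" for a b
    unfolding flatF_def vector3_axis by (auto intro!: derivative_eq_intros)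
  moreover have "inj (%h. flatF (fst h) (snd h))" by (auto simp: inj_on_def flatF_def vec_eq_iff forall_3)
  ultimately show "immersed (%p. flatF (fst p) (snd p)) (a, b)" for a b unfolding immersed_def by blast
qed

lemma circle_derivative: "vector_derivative (rim flatF) (at t) = vector [- (2 * pi) * sin (2 * pi * t), 2 * pi * cos (2 * pi * t), 0]"
  unfolding rim_def[abs_def] flatF_def
  by (rule vector_derivative_at, rule vector3_has_vector_derivative) (auto intro!: derivative_eq_intros)

lemma circle_length: "curve_length (rim flatF) = 2 * pi"
proof -
  have "norm (vector_derivative (rim flatF) (at t)) = 2 * pi" for t
  proof -
    define S C where "S = sin (2 * pi * t)" and "C = cos (2 * pi * t)"
    have "(norm (vector_derivative (rim flatF) (at t)))^2 = (2 * pi)^2 * (S^2 + C^2)"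
      unfolding circle_derivative power2_norm_eq_inner S_def[symmetric] C_def[symmetric]
      by (simp add: inner_vec_def sum_3 power2_eq_square algebra_simps)
    hence "(norm (vector_derivative (rim flatF) (at t)))^2 = (2 * pi)^2" by (simp add: S_def C_def)
    thus ?thesis by (rule power2_eq_imp_eq) auto
  qed
  thus ?thesis unfolding curve_length_def by simp
qed

text \<open>For r < 1 a point of the normal disk at parameter u projects to a positive multiple of
  the direction of angle 2 pi u, and the direction determines u.\<close>

lemma circle_adm:
  assumes "0 < r" "r < 1"
  shows "adm (rim flatF) r"
proof (rule admI[OF assms(1)])
  fix s t x assume h: "0 <= s" "s < t" "t < 1" "norm (x - rim flatF s) <= r" "norm (x - rim flatF t) <= r"
    "(x - rim flatF s) \<bullet> vector_derivative (rim flatF) (at s) = 0" "(x - rim flatF t) \<bullet> vector_derivative (rim flatF) (at t) = 0"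
  define H where "H = sqrt ((x$1)^2 + (x$2)^2)"
  have key: "x$1 = H * cos (2 * pi * u) & x$2 = H * sin (2 * pi * u) & H > 0"
    if n: "norm (x - rim flatF u) <= r" and o: "(x - rim flatF u) \<bullet> vector_derivative (rim flatF) (at u) = 0" for u
  proof -
    define C S where "C = cos (2 * pi * u)" and "S = sin (2 * pi * u)"
    have CS: "C * C + S * S = 1" using sin_cos_squared_add3[of "2 * pi * u"] by (simp add: C_def S_def)
    have c: "rim flatF u = vector [C, S, 0]" by (simp add: rim_def flatF_def C_def S_def)
    have "2 * pi * (x$2 * C - x$1 * S) = 0"
      using o unfolding circle_derivative c C_def[symmetric] S_def[symmetric] by (simp add: inner_vec_def sum_3 algebra_simps)
    hence perp: "x$2 * C = x$1 * S" by simp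
    define h where "h = x$1 * C + x$2 * S"
    have x1: "x$1 = h * C"
    proof -
      have "h * C = x$1 * (C * C) + (x$2 * C) * S" by (simp add: h_def algebra_simps)
      also have "\<dots> = x$1 * (C * C + S * S)" unfolding perp by (simp add: algebra_simps)
      finally show ?thesis using CS by simp
    qed
    have x2: "x$2 = h * S"
    proof -
      have "h * S = (x$1 * S) * C + x$2 * (S * S)" by (simp add: h_def algebra_simps)
      also have "\<dots> = x$2 * (C * C + S * S)" unfolding perp[symmetric] by (simp add: algebra_simps)
      finally show ?thesis using CS by simp
    qed
    have nc: "norm (rim flatF u) = 1"
    proof -
      have "(norm (rim flatF u))^2 = 1^2" unfolding c power2_norm_eq_inner using CS by (simp add: inner_vec_def sum_3)
      thus ?thesis by (rule power2_eq_imp_eq) auto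
    qed
    have "\<bar>(x - rim flatF u) \<bullet> rim flatF u\<bar> <= r" using Cauchy_Schwarz_ineq2[of "x - rim flatF u" "rim flatF u"] n nc by simp
    moreover have "(x - rim flatF u) \<bullet> rim flatF u = h - 1" unfolding c h_def using CS by (simp add: inner_vec_def sum_3 algebra_simps)
    ultimately have "h > 0" using assms(2) by linarith
    moreover have "H = h"
    proof -
      have "(x$1)^2 + (x$2)^2 = h^2 * (C * C + S * S)" unfolding x1 x2 by (simp add: power2_eq_square algebra_simps)
      thus ?thesis unfolding H_def using CS \<open>h > 0\<close> by simp
    qed
    ultimately show ?thesis using x1 x2 by (simp add: C_def S_def)
  qed
  have "cos (2 * pi * s) = cos (2 * pi * t)" "sin (2 * pi * s) = sin (2 * pi * t)"
    using key[OF h(4,6)] key[OF h(5,7)] by auto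
  hence "s = t" using circle_eq[of s t] h(1-3) by simp
  thus False using h(2) by simp
qed

lemma ps_embedded_disk_scale:
  assumes D: "ps_embedded_disk D" and L: "L ~= 0"
  shows "ps_embedded_disk (%q. L *\<^sub>R D q)"
proof -
  obtain \<T> where T: "triangulation \<T>" "\<Union>\<T> = unit_square" "\<forall>T\<in>\<T>. \<exists>U g. open U & T \<subseteq> U & smooth_on U g &
           (\<forall>x\<in>T. g x = D x & inj (frechet_derivative g (at x)))" and c: "continuous_on unit_square D" "inj_on D unit_square"
    using D unfolding ps_embedded_disk_def by blast
  have "\<exists>U g. open U & T \<subseteq> U & smooth_on U g & (\<forall>x\<in>T. g x = L *\<^sub>R D x & inj (frechet_derivative g (at x)))" if "T \<in> \<T>" for T
  proof -
    obtain U g where g: "open U" "T \<subseteq> U" "smooth_on U g" "\<forall>x\<in>T. g x = D x & inj (frechet_derivative g (at x))" using T(3) \<open>T \<in> \<T>\<close> by blast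
    have "inj (frechet_derivative (%x. L *\<^sub>R g x) (at x))" if x: "x \<in> T" for x
    proof -
      have "g differentiable (at x)" using smooth_on_differentiable[OF g(3)] g(2) x by blast
      hence "(g has_derivative frechet_derivative g (at x)) (at x)" by (simp add: frechet_derivative_works)
      hence "((%x. L *\<^sub>R g x) has_derivative (%h. L *\<^sub>R frechet_derivative g (at x) h)) (at x)" by (rule has_derivative_scaleR_right)
      hence "frechet_derivative (%x. L *\<^sub>R g x) (at x) = (%h. L *\<^sub>R frechet_derivative g (at x) h)" by (rule frechet_derivative_at[symmetric])
      thus ?thesis using g(4) x L by (simp add: inj_on_def)
    qed
    thus ?thesis using g by (intro exI[of _ U] exI[of _ "%x. L *\<^sub>R g x"]) (auto intro!: smooth_on_scaleR smooth_on_const)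
  qed
  moreover have "continuous_on unit_square (%q. L *\<^sub>R D q)" by (intro continuous_intros c)
  moreover have "inj_on (%q. L *\<^sub>R D q) unit_square" using c(2) L by (simp add: inj_on_def)
  ultimately show ?thesis unfolding ps_embedded_disk_def using T(1,2) by blast
qed

lemma disk_area_scale:
  assumes D: "ps_embedded_disk D"
  shows "disk_area (%q. L *\<^sub>R D q) = L^2 * disk_area D"
proof -
  obtain B Z where "B-lipschitz_on unit_square D" and Z: "negligible Z" "!!q. q \<in> unit_square - Z ==> q \<in> interior unit_square & D differentiable (at q)"
    using ps_embedded_disk_regular[OF D] by blast
  have "disk_area (%q. L *\<^sub>R D q) = integral unit_square (%x. L^2 * norm (cross3 (frechet_derivative D (at x) (axis 1 1))
                       (frechet_derivative D (at x) (axis 2 1))))"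
    unfolding disk_area_def
  proof (rule integral_spike[OF Z(1)])
    fix x :: "real^2" assume "x \<in> unit_square - Z"
    hence "(D has_derivative frechet_derivative D (at x)) (at x)" using Z(2) by (simp add: frechet_derivative_works)
    hence "((%q. L *\<^sub>R D q) has_derivative (%h. L *\<^sub>R frechet_derivative D (at x) h)) (at x)" by (rule has_derivative_scaleR_right)
    hence e: "frechet_derivative (%q. L *\<^sub>R D q) (at x) = (%h. L *\<^sub>R frechet_derivative D (at x) h)" by (rule frechet_derivative_at[symmetric])
    show "L^2 * norm (cross3 (frechet_derivative D (at x) (axis 1 1)) (frechet_derivative D (at x) (axis 2 1))) =
      norm (cross3 (frechet_derivative (%q. L *\<^sub>R D q) (at x) (axis 1 1)) (frechet_derivative (%q. L *\<^sub>R D q) (at x) (axis 2 1)))"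
      unfolding e cross_mult_left cross_mult_right by (simp add: power2_eq_square abs_mult[symmetric])
  qed
  thus ?thesis unfolding disk_area_def by simp
qed

lemma rim_scale: "rim (%a b. s *\<^sub>R F a b) = (%t. s *\<^sub>R rim F t)" by (simp add: rim_def fun_eq_iff)

lemma scaled_rim:
  assumes "disk_emb F" "s > 0"
  shows "smooth_closed_embedded_curve (%t. s *\<^sub>R rim F t)" "unknotted (%t. s *\<^sub>R rim F t)"
    "curve_length (%t. s *\<^sub>R rim F t) = s * curve_length (rim F)"
    "adm (rim F) r ==> s * r <= thickness (%t. s *\<^sub>R rim F t)"
proof -
  have e: "disk_emb (%a b. s *\<^sub>R F a b)" using disk_emb_scale assms by simp
  show c: "smooth_closed_embedded_curve (%t. s *\<^sub>R rim F t)" using disk_emb_curve[OF e] by (simp add: rim_scale)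
  show "unknotted (%t. s *\<^sub>R rim F t)" using disk_emb_unknotted[OF e] by (simp add: rim_scale)
  show "curve_length (%t. s *\<^sub>R rim F t) = s * curve_length (rim F)"
    using curve_length_scale[OF curve_smooth[OF disk_emb_curve[OF assms(1)]] assms(2)] .
  show "adm (rim F) r ==> s * r <= thickness (%t. s *\<^sub>R rim F t)"
    using thickness_ge[OF c adm_scale[OF curve_smooth[OF disk_emb_curve[OF assms(1)]] _ assms(2)]] .
qed

lemma plat_area:
  assumes M: "!!x. \<bar>st' x\<bar> <= M" and L: "L > 0" and D: "ps_embedded_disk D" "spans D (%t. (1 / L) *\<^sub>R plat (2 * k) t)"
  shows "(golden^2) ^ k <= 48 * M^2 * (L^2 * disk_area D)"
proof -
  have "spans (%q. L *\<^sub>R D q) (plat (2 * k))"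
    unfolding spans_def
  proof -
    have "(%q. L *\<^sub>R D q) ` frontier unit_square = (%p. L *\<^sub>R p) ` (D ` frontier unit_square)" by (simp add: image_image)
    also have "\<dots> = path_image (plat (2 * k))" using D(2) L unfolding spans_def path_image_def by (simp add: image_image)
    finally show "(%q. L *\<^sub>R D q) ` frontier unit_square = path_image (plat (2 * k))" .
  qed
  hence "1/2 <= 24 * M^2 * (1 / (golden^2) ^ k) * disk_area (%q. L *\<^sub>R D q)"
    using FR_area[OF M stretch_nonneg refl ps_embedded_disk_scale[OF D(1)]] L unfolding plat_def by simp
  moreover have "(golden^2) ^ k > 0" using golden_gt_1 by simp
  moreover have "G <= 48 * m * a" if "1/2 <= 24 * m * (1 / G) * a" "G > 0" for G m a :: real
    using that by (simp add: field_simps)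
  ultimately show ?thesis unfolding disk_area_scale[OF D(1)] by blast
qed

text \<open>Thickness r at length 1 requires 2 pi r <= 1 by the inequality of Fenchel, so a
  thickness above 1/n is possible only for n > 2 pi, which is how the second clause is phrased. The
  estimate with L/r in the exponent follows since the length is 1 and the reciprocal of the
  thickness is at most n.\<close>

theorem theorem1p2:
  shows "\<exists>C\<^sub>1::real. C\<^sub>1 > 1 \<and> (\<exists>\<Delta> :: nat \<Rightarrow> real \<Rightarrow> real^3.
    (\<forall>n\<ge>1. smooth_closed_embedded_curve (\<Delta> n) \<and> unknotted (\<Delta> n) \<and> curve_length (\<Delta> n) = 1) \<and>
    (\<forall>n. real n > 2 * pi \<longrightarrow> thickness (\<Delta> n) > 1 / real n) \<and>
    (\<forall>\<^sub>F n in sequentially. \<forall>D. ps_embedded_disk D \<and> spans D (\<Delta> n) \<longrightarrow>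
       disk_area D \<ge> C\<^sub>1 ^ n \<and>
       C\<^sub>1 ^ n \<ge> C\<^sub>1 powr (curve_length (\<Delta> n) / thickness (\<Delta> n)) * (curve_length (\<Delta> n))\<^sup>2))"
proof -
  obtain M where M: "M >= 1" "!!x. \<bar>st' x\<bar> <= M" "!!x. \<bar>st'' x\<bar> <= M" by (rule st_bounds) (rule that; assumption)
  obtain r C where rC: "r > 0" "C > 0" "!!N. adm (plat N) r" "!!N. curve_length (plat N) <= C * (1 + real N)"
    by (rule plat_family) (rule that; assumption)
  \<comment> \<open>With 2 k(n) twists, k(n) <= th n, the length is at most C + r n / 2, which is
    below r n once n > 2 C / r. Rescaling to length 1 then gives thickness above 1/n.\<close>
  define th where "th = r / (4 * C)"
  define k where "k n = nat \<lfloor>th * real n\<rfloor>" for n :: nat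
  define L where "L n = curve_length (plat (2 * k n))" for n
  \<comment> \<open>Below the threshold 2 C / r round circles are substituted; they are thick enough
    for every n > 2 pi.\<close>
  define Delta where "Delta n = (if real n > 2 * C / r then (%t. (1 / L n) *\<^sub>R plat (2 * k n) t) else (%t. (1 / (2 * pi)) *\<^sub>R rim flatF t))" for n
  have th: "th > 0" using rC by (simp add: th_def)
  have Lpos: "L n > 0" for n unfolding L_def by (rule curve_length_pos[OF plat_curve])
  have k: "real (k n) <= th * real n" "th * real n - 1 <= real (k n)" for n
    using th unfolding k_def by (simp_all add: of_nat_nat)
  have Llt: "L n < r * real n" if "real n > 2 * C / r" for n
  proof -
    have "L n <= C * (1 + 2 * real (k n))" using rC(4)[of "2 * k n"] by (simp add: L_def)
    also have "\<dots> <= C * (1 + 2 * (th * real n))" using k(1)[of n] rC by (intro mult_left_mono) auto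
    also have "\<dots> = C + r * real n / 2" using rC by (simp add: th_def field_simps)
    also have "\<dots> < r * real n" using that rC by (simp add: field_simps)
    finally show ?thesis .
  qed
  have fam: "smooth_closed_embedded_curve (Delta n)" "unknotted (Delta n)" "curve_length (Delta n) = 1" for n
  proof -
    have "smooth_closed_embedded_curve (Delta n) & unknotted (Delta n) & curve_length (Delta n) = 1"
    proof (cases "real n > 2 * C / r")
      case True
      thus ?thesis
        using scaled_rim(1,2,3)[OF disk_emb_FR[OF stretch_nonneg[of "2 * k n"], of "2 * k n"], of "1 / L n"] Lpos[of n]
        unfolding Delta_def plat_def[symmetric] by (simp add: L_def[symmetric])
    next
      case False
      thus ?thesis using scaled_rim(1,2,3)[OF disk_emb_flat, of "1 / (2 * pi)"]
        unfolding Delta_def circle_length by simp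
    qed
    thus "smooth_closed_embedded_curve (Delta n)" "unknotted (Delta n)" "curve_length (Delta n) = 1" by auto
  qed
  have thick: "thickness (Delta n) > 1 / real n" if n: "real n > 2 * pi" for n
  proof (cases "real n > 2 * C / r")
    case True
    have n0: "real n > 0" using n pi_gt_zero by linarith
    have "1 / real n < 1 / L n * r" using Llt[OF True] Lpos[of n] n0 by (simp add: field_simps)
    also have "\<dots> <= thickness (Delta n)"
      using scaled_rim(4)[OF disk_emb_FR[OF stretch_nonneg[of "2 * k n"], of "2 * k n"], of "1 / L n" r] Lpos[of n] rC(3) True
      unfolding Delta_def plat_def[symmetric] by simp
    finally show ?thesis .
  next
    case False
    have n0: "real n > 0" using n pi_gt_zero by linarith
    define q where "q = (1 + 2 * pi / real n) / 2"
    have "2 * pi / real n < 1" "2 * pi / real n > 0" using n n0 by (auto simp: field_simps)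
    hence q: "0 < q" "q < 1" "2 * pi / real n < q" by (auto simp: q_def)
    have "1 / real n = 1 / (2 * pi) * (2 * pi / real n)" by simp
    also have "\<dots> < 1 / (2 * pi) * q" using q(3) by (intro mult_strict_left_mono) auto
    also have "\<dots> <= thickness (Delta n)"
      using scaled_rim(4)[OF disk_emb_flat _ circle_adm[OF q(1,2)], of "1 / (2 * pi)"] False unfolding Delta_def by simp
    finally show ?thesis .
  qed
  \<comment> \<open>Then s^(4n) is golden^(2k) up to a bounded factor. The constant of the theorem
    is s^2, half of the available exponent; the other half has to beat the factor of order n^2 from
    the rescaling of area.\<close>
  define s where "s = (golden^2) powr (th / 4)"
  have g2: "golden^2 > 1" using golden_gt_1 by (simp add: one_less_power)
  have s1: "s > 1" unfolding s_def using g2 th by (intro gr_one_powr) auto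
  \<comment> \<open>Collects the constants: 48 M^2 from the area estimate, r^2 from the bound r n on
    the length, and golden^2 for rounding th n down to an integer.\<close>
  define A where "A = 48 * M^2 * r^2 * golden^2"
  have g0: "golden^2 > 0" using g2 by linarith
  have "(%n. real n / s ^ n) \<longlonglongrightarrow> 0" using lim_n_over_pown[of s] s1 by simp
  hence "(%n. A * (real n / s ^ n)^2) \<longlonglongrightarrow> A * 0^2" by (intro tendsto_intros)
  hence "\<forall>\<^sub>F n in sequentially. A * (real n / s ^ n)^2 < 1" by (rule order_tendstoD) simp
  moreover have "\<forall>\<^sub>F n in sequentially. real n > max (2 * C / r) (2 * pi)"
    using filterlim_real_sequentially unfolding filterlim_at_top_dense by blast
  ultimately have ev: "\<forall>\<^sub>F n in sequentially. \<forall>D. ps_embedded_disk D & spans D (Delta n) -->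
       disk_area D >= (s^2) ^ n &
       (s^2) ^ n >= (s^2) powr (curve_length (Delta n) / thickness (Delta n)) * (curve_length (Delta n))^2"
  proof eventually_elim
    case (elim n)
    hence n: "real n > 2 * C / r" "real n > 2 * pi" by auto
    have sn: "(s ^ n)^2 > 0" using s1 by (intro zero_less_power) simp
    have n0: "real n > 0" using n(2) pi_gt_zero by linarith
    show ?case
    proof (intro allI impI conjI)
      fix D assume D: "ps_embedded_disk D & spans D (Delta n)"
      have "s ^ (4 * n) = (golden^2) powr (th * real n)"
      proof -
        have "s ^ (4 * n) = s powr real (4 * n)" using powr_realpow[of s "4 * n"] s1 by simp
        also have "\<dots> = (golden^2) powr (th * real n)" unfolding s_def powr_powr by simp
        finally show ?thesis .
      qed
      also have "\<dots> <= (golden^2) powr (real (k n) + 1)" using k(2)[of n] g2 by (intro powr_mono) auto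
      also have "\<dots> = (golden^2) ^ k n * golden^2" by (simp only: powr_add powr_realpow[OF g0] powr_one[OF less_imp_le[OF g0]])
      also have "\<dots> <= 48 * M^2 * ((L n)^2 * disk_area D) * golden^2"
        using plat_area[OF M(2) Lpos[of n], of D "k n"] D n(1) by (intro mult_right_mono) (simp_all add: Delta_def)
      finally have 1: "s ^ (4 * n) <= 48 * M^2 * ((L n)^2 * disk_area D) * golden^2" .
      \<comment> \<open>Read off the estimate itself: a negative area would make a power of s
        nonpositive.\<close>
      have a0: "disk_area D >= 0"
      proof (rule ccontr)
        assume "\<not> disk_area D >= 0"
        hence neg: "(L n)^2 * disk_area D <= 0" by (intro mult_nonneg_nonpos) auto
        have "48 * M^2 * ((L n)^2 * disk_area D) * golden^2 <= 0"
          by (rule mult_nonpos_nonneg[OF mult_nonneg_nonpos[OF _ neg]]) auto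
        moreover have "s ^ (4 * n) > 0" using s1 by (intro zero_less_power) simp
        ultimately show False using 1 by linarith
      qed
      have "(L n)^2 <= (r * real n)^2" using Llt[OF n(1)] Lpos[of n] by (intro power_mono) auto
      hence LA: "(L n)^2 * disk_area D <= (r * real n)^2 * disk_area D" using a0 by (intro mult_right_mono)
      have "48 * M^2 * ((L n)^2 * disk_area D) * golden^2 <= 48 * M^2 * ((r * real n)^2 * disk_area D) * golden^2"
        by (rule mult_right_mono[OF mult_left_mono[OF LA]]) auto
      also have "\<dots> = A * (real n)^2 * disk_area D" by (simp add: A_def power_mult_distrib)
      finally have 2: "s ^ (4 * n) <= A * (real n)^2 * disk_area D" using 1 by linarith
      have "A * (real n)^2 / (s ^ n)^2 < 1" using elim(1) by (simp only: power_divide times_divide_eq_right)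
      hence "A * (real n)^2 < (s ^ n)^2" unfolding pos_divide_less_eq[OF sn] by simp
      hence "A * (real n)^2 * disk_area D <= (s ^ n)^2 * disk_area D" using a0 by (intro mult_right_mono) auto
      moreover have "s ^ (4 * n) = (s ^ n)^2 * (s ^ n)^2" by (simp add: power_mult[symmetric] power_add[symmetric] mult.commute)
      ultimately have "(s ^ n)^2 * (s ^ n)^2 <= (s ^ n)^2 * disk_area D" using 2 by linarith
      hence "(s ^ n)^2 <= disk_area D" using mult_le_cancel_left_pos[OF sn] by blast
      thus "disk_area D >= (s^2) ^ n" by (simp add: power_mult[symmetric] mult.commute)
      have "0 < 1 / real n" using n0 by simp
      hence "thickness (Delta n) > 0" using thick[OF n(2)] by linarith
      hence "1 / thickness (Delta n) <= real n" using thick[OF n(2)] n0 by (simp add: field_simps)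
      hence "(s^2) powr (1 / thickness (Delta n)) <= (s^2) powr (real n)" using s1 by (intro powr_mono) (auto simp: one_le_power)
      also have "\<dots> = (s^2) ^ n" using s1 by (simp add: powr_realpow)
      finally show "(s^2) ^ n >= (s^2) powr (curve_length (Delta n) / thickness (Delta n)) * (curve_length (Delta n))^2"
        by (simp add: fam(3))
    qed
  qed
  show ?thesis
  proof (intro exI conjI)
    show "s^2 > 1" using s1 by (simp add: one_less_power)
    show "\<forall>n\<ge>1. smooth_closed_embedded_curve (Delta n) & unknotted (Delta n) & curve_length (Delta n) = 1" using fam by blast
    show "\<forall>n. real n > 2 * pi --> thickness (Delta n) > 1 / real n" using thick by blast
  qed (rule ev)
qed

end
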